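(* Let $E$ be a Courant algebroid over a compact manifold $M$ whose complexification admits a decomposition $E\otimes\mathbb{C}=L\oplus\overline L$ as the direct sum of a pair of complex conjugate Lie algebroids (that is, complex conjugate isotropic subbundles whose spaces of sections are closed under the bracket). Let $t\in[0,1]\mapsto H_t\in\Gamma(\wedge^2L^* )$ be a smooth family of Hamiltonian operators such that the bundle map $\overline{H_t}'\circ H_t'-1:L\to L$ is invertible for all $t$. Assume that there exists a smooth family $Y_t\in\Gamma(L^* )$ solving the equation $$\frac{dH_t}{dt}=d_LY_t+[H_t,Y_t]_{L^*}.$$ Then the generalized complex structures associated to $H_0$ and $H_1$ are isomorphic.
   Context: A Courant algebroid is a vector bundle $E\to M$ with a non-degenerate symmetric bilinear form $\langle\cdot,\cdot\rangle$, a skew-symmetric bracket $[\![\cdot,\cdot]\!]$ on $\Gamma(E)$ and a smooth bundle map $\rho:E\to TM$ (the anchor), such that, with $\mathcal{D}:C^\infty(M)\to\Gamma(E)$ defined by $\langle\mathcal{D}f,a\rangle=\frac12\rho(a)f$, one has for all $a,b,c\in\Gamma(E)$, $f,g\in C^\infty(M)$: (i) $\rho([\![a,b]\!])=[\rho(a),\rho(b)]$; (ii) $[\![[\![a,b]\!],c]\!]+[\![[\![b,c]\!],a]\!]+[\![[\![c,a]\!],b]\!]=\frac13\mathcal{D}\big(\langle[\![a,b]\!],c\rangle+\langle[\![b,c]\!],a\rangle+\langle[\![c,a]\!],b\rangle\big)$; (iii) $[\![a,fb]\!]=f[\![a,b]\!]+(\rho(a)f)b-\langle a,b\rangle\mathcal{D}f$;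 (iv) $\rho\circ\mathcal{D}=0$, i.e. $\langle\mathcal{D}f,\mathcal{D}g\rangle=0$; (v) $\rho(a)\langle b,c\rangle=\langle[\![a,b]\!]+\mathcal{D}\langle a,b\rangle,c\rangle+\langle b,[\![a,c]\!]+\mathcal{D}\langle a,c\rangle\rangle$. A generalized complex structure on $E$ is a vector bundle map $J:E\to E$ over $\mathrm{id}_M$ with $J^2=-\mathrm{id}$, orthogonal for $\langle\cdot,\cdot\rangle$, and integrable: $[\![Jx,Jy]\!]-[\![x,y]\!]-J([\![Jx,y]\!]+[\![x,Jy]\!])=0$ for all $x,y\in\Gamma(E)$. The structure of $E$ is extended $\mathbb{C}$-linearly to $E\otimes\mathbb{C}$. Isotropic subbundles of $E\otimes\mathbb{C}$ with sections closed under $[\![\cdot,\cdot]\!]$ are complex Lie algebroids, with anchor the restriction of $\rho$. The isomorphism $e\mapsto\langle e,\cdot\rangle$ identifies $\overline L$ with $L^*$ and $L$ with $\overline L^*$. Thus $L^*$ inherits the Lie algebroid structure of $\overline L$, whose Schouten bracket is $[\cdot,\cdot]_{L^*}:\Gamma(\wedge^kL^* )\otimes\Gamma(\wedge^lL^* )\to\Gamma(\wedge^{k+l-1}L^* )$; and $d_L:\Gamma(\wedge^\bullet L^* )\to\Gamma(\wedge^{\bullet+1}L^* )$ is the Lie algebroid differential of $L$. A section $H\in\Gamma(\wedge^2L^* )$ defines a map $H':L\to L^*\simeq\overline L$, $v\mapsto H(v,\cdot)$, and its conjugate $\overline H\in\Gamma(\wedge^2\overline L^* )$ defines $\overline H':\overline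 L\to L$. $H$ is a Hamiltonian operator if the Maurer–Cartan equation $d_LH+\frac12[H,H]_{L^*}=0$ holds; equivalently, the graph $L_H=\{v+H'v: v\in L\}\subset L\oplus\overline L$ is a Dirac structure (maximal isotropic, sections closed under the bracket). When moreover $\overline H'\circ H'-1$ is invertible, the generalized complex structure associated to $H$ is the one on $E$ whose $+i$-eigenbundle is $L_H$ (and $-i$-eigenbundle is $\overline{L_H}$). An automorphism of the Courant algebroid $E$ is a vector bundle automorphism, covering a diffeomorphism of $M$, that preserves pairing, bracket and anchor. Two generalized complex structures $J,J'$ on $E$ are isomorphic if there is a Courant algebroid automorphism $\phi$ with $\phi^{-1}\circ J'\circ\phi=J$. *)

theory Defs
  imports "HOL-Analysis.Analysis" "HOL-Combinatorics.Permutations"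
begin

section \<open>Smooth functions on open subsets of normed spaces\<close>

text \<open>Differentiability classes by iterated directional derivatives. These are the usual
  classes when the domain is finite-dimensional, the only case used below.\<close>

primrec Ck_on :: "nat \<Rightarrow> 'a::real_normed_vector set \<Rightarrow> ('a \<Rightarrow> 'b::real_normed_vector) \<Rightarrow> bool" where
  "Ck_on 0 S f \<longleftrightarrow> continuous_on S f"
| "Ck_on (Suc k) S f \<longleftrightarrow>
     (\<exists>f'. (\<forall>x\<in>S. (f has_derivative f' x) (at x)) \<and> (\<forall>v. Ck_on k S (\<lambda>x. f' x v)))"

definition smooth_on :: "'a::real_normed_vector set \<Rightarrow> ('a \<Rightarrow> 'b::real_normed_vector) \<Rightarrow> bool" where
  "smooth_on S f \<longleftrightarrow> (\<forall>k. Ck_on k S f)"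

definition finite_dim :: "'a::real_vector itself \<Rightarrow> bool" where
  "finite_dim _ \<longleftrightarrow> (\<exists>B::'a set. finite B \<and> span B = UNIV)"


section \<open>Manifolds\<close>

text \<open>The points of the manifold are all the elements of a Hausdorff, second countable type
  \<open>'m\<close>. The model space \<open>'e\<close> is any finite-dimensional inner product space (every such space is
  complete and has the Heine-Borel property). It is not required to be of class
  \<open>euclidean_space\<close>, since that class excludes dimension 0.\<close>

record ('m, 'e) manifold =
  charts :: "('m set \<times> ('m \<Rightarrow> 'e)) set"

definition smooth_manifold ::
  "('m::{t2_space,second_countable_topology}, 'e::{real_inner,banach,heine_borel}, 'z) manifold_scheme \<Rightarrow> bool"
where
  "smooth_manifold M \<longleftrightarrow>
     finite_dim TYPE('e) \<and>
     \<Union>(fst ` charts M) = UNIV \<and>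
     (\<forall>(U, c) \<in> charts M. open U \<and> open (c ` U) \<and> homeomorphism U (c ` U) c (inv_into U c)) \<and>
     (\<forall>(U, c) \<in> charts M. \<forall>(V, d) \<in> charts M. smooth_on (c ` (U \<inter> V)) (d \<circ> inv_into U c))"

definition smooth_fun_on ::
  "('m::topological_space, 'e::real_normed_vector, 'z) manifold_scheme \<Rightarrow> 'm set
    \<Rightarrow> ('m \<Rightarrow> 'b::real_normed_vector) \<Rightarrow> bool"
where
  "smooth_fun_on M W g \<longleftrightarrow> (\<forall>(U, c) \<in> charts M. smooth_on (c ` (U \<inter> W)) (g \<circ> inv_into U c))"

abbreviation smooth_fun where "smooth_fun M \<equiv> smooth_fun_on M UNIV"

text \<open>Joint smoothness of \<open>(t, x) \<mapsto> g t x\<close> on the manifold with boundary \<open>[0,1] \<times> M\<close>: in charts,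
  the function extends smoothly to a neighbourhood of every point.\<close>

definition smooth_family ::
  "('m::topological_space, 'e::real_normed_vector, 'z) manifold_scheme
    \<Rightarrow> (real \<Rightarrow> 'm \<Rightarrow> 'b::real_normed_vector) \<Rightarrow> bool"
where
  "smooth_family M g \<longleftrightarrow>
     (\<forall>(U, c) \<in> charts M. \<forall>p \<in> {0..1} \<times> c ` U.
        \<exists>W G. open W \<and> p \<in> W \<and> smooth_on W G \<and>
          (\<forall>(t, y) \<in> W \<inter> ({0..1} \<times> c ` U). G (t, y) = g t (inv_into U c y)))"

definition smooth_map ::
  "('m::topological_space, 'e::real_normed_vector, 'z) manifold_scheme \<Rightarrow> ('m \<Rightarrow> 'm) \<Rightarrow> bool"
where
  "smooth_map M h \<longleftrightarrow> continuous_on UNIV h \<and>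
     (\<forall>(U, c) \<in> charts M. \<forall>(V, d) \<in> charts M.
        smooth_on (c ` (U \<inter> h -` V)) (d \<circ> h \<circ> inv_into U c))"

definition diffeomorphism ::
  "('m::topological_space, 'e::real_normed_vector, 'z) manifold_scheme \<Rightarrow> ('m \<Rightarrow> 'm) \<Rightarrow> bool"
where
  "diffeomorphism M h \<longleftrightarrow> bij h \<and> smooth_map M h \<and> smooth_map M (inv h)"

text \<open>Tangent vectors at \<open>x\<close> are derivations at \<open>x\<close> of the algebra of smooth functions; only
  their values on smooth functions matter.\<close>

definition tangent_vector ::
  "('m::topological_space, 'e::real_normed_vector, 'z) manifold_scheme \<Rightarrow> 'm
    \<Rightarrow> (('m \<Rightarrow> real) \<Rightarrow> real) \<Rightarrow> bool"
where
  "tangent_vector M x X \<longleftrightarrow>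
     (\<forall>f g r. smooth_fun M f \<and> smooth_fun M g \<longrightarrow>
        X (\<lambda>y. r * f y + g y) = r * X f + X g \<and>
        X (\<lambda>y. f y * g y) = f x * X g + g x * X f)"


section \<open>Vector bundles\<close>

text \<open>The fibre over \<open>x\<close> is a linear subspace of an ambient real vector space \<open>'v\<close> which has no
  topology and is used only for its algebraic operations: nothing is assumed about how
  \<open>fibre E x\<close> varies inside \<open>'v\<close> (so, for instance, all fibres may be the whole of \<open>'v\<close> without the
  bundle being trivial). The bundle topology and smooth structure come exclusively from the
  local trivialisations \<open>(U, \<phi>)\<close>, given by linear isomorphisms from \<open>fibre E x\<close> to the
  finite-dimensional model fibre \<open>'f\<close>, for \<open>x\<close> in \<open>U\<close>, with smooth transition functions.\<close>

record ('m, 'e, 'v, 'f) vector_bundle = "('m, 'e) manifold" +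
  fibre :: "'m \<Rightarrow> 'v set"
  trivs :: "('m set \<times> ('m \<Rightarrow> 'v \<Rightarrow> 'f)) set"

definition smooth_vector_bundle ::
  "('m::{t2_space,second_countable_topology}, 'e::{real_inner,banach,heine_borel}, 'v::real_vector,
    'f::{real_inner,banach,heine_borel}, 'z) vector_bundle_scheme \<Rightarrow> bool"
where
  "smooth_vector_bundle E \<longleftrightarrow>
     smooth_manifold E \<and>
     finite_dim TYPE('f) \<and>
     (\<forall>x. subspace (fibre E x)) \<and>
     \<Union>(fst ` trivs E) = UNIV \<and>
     (\<forall>(U, \<phi>) \<in> trivs E. open U \<and>
        (\<forall>x\<in>U. bij_betw (\<phi> x) (fibre E x) UNIV \<and>
           (\<forall>v\<in>fibre E x. \<forall>w\<in>fibre E x. \<forall>r. \<phi> x (r *\<^sub>R v + w) = r *\<^sub>R \<phi> x v + \<phi> x w))) \<and>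
     (\<forall>(U, \<phi>) \<in> trivs E. \<forall>(V, \<psi>) \<in> trivs E. \<forall>w.
        smooth_fun_on E (U \<inter> V) (\<lambda>x. \<psi> x (inv_into (fibre E x) (\<phi> x) w)))"

definition sections_on ::
  "('m::topological_space, 'e::real_normed_vector, 'v, 'f::real_normed_vector, 'z) vector_bundle_scheme
    \<Rightarrow> 'm set \<Rightarrow> ('m \<Rightarrow> 'v) set"
where
  "sections_on E W =
     {s. (\<forall>x\<in>W. s x \<in> fibre E x) \<and>
         (\<forall>(U, \<phi>) \<in> trivs E. smooth_fun_on E (U \<inter> W) (\<lambda>x. \<phi> x (s x)))}"

abbreviation sections where "sections E \<equiv> sections_on E UNIV"

text \<open>Smoothness of a bundle map over the identity is expressed by its action on smooth sections.\<close>

definition bundle_endomorphism ::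
  "('m::topological_space, 'e::real_normed_vector, 'v::real_vector, 'f::real_normed_vector, 'z)
     vector_bundle_scheme \<Rightarrow> ('m \<Rightarrow> 'v \<Rightarrow> 'v) \<Rightarrow> bool"
where
  "bundle_endomorphism E J \<longleftrightarrow>
     (\<forall>x. \<forall>v\<in>fibre E x. J x v \<in> fibre E x) \<and>
     (\<forall>x. \<forall>v\<in>fibre E x. \<forall>w\<in>fibre E x. \<forall>r. J x (r *\<^sub>R v + w) = r *\<^sub>R J x v + J x w) \<and>
     (\<forall>s\<in>sections E. (\<lambda>x. J x (s x)) \<in> sections E)"

definition pushforward :: "('m \<Rightarrow> 'm) \<Rightarrow> ('m \<Rightarrow> 'v \<Rightarrow> 'v) \<Rightarrow> ('m \<Rightarrow> 'v) \<Rightarrow> 'm \<Rightarrow> 'v" where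
  "pushforward h \<Phi> s = (\<lambda>y. \<Phi> (inv h y) (s (inv h y)))"

text \<open>The family \<open>\<Phi> x\<close>, from the fibre over \<open>x\<close> to the fibre over \<open>h x\<close>, is an automorphism covering
  \<open>h\<close>; the equivalence in the last clause is smoothness of \<open>\<Phi>\<close> and of its inverse.\<close>

definition bundle_automorphism ::
  "('m::topological_space, 'e::real_normed_vector, 'v::real_vector, 'f::real_normed_vector, 'z)
     vector_bundle_scheme \<Rightarrow> ('m \<Rightarrow> 'm) \<Rightarrow> ('m \<Rightarrow> 'v \<Rightarrow> 'v) \<Rightarrow> bool"
where
  "bundle_automorphism E h \<Phi> \<longleftrightarrow>
     diffeomorphism E h \<and>
     (\<forall>x. bij_betw (\<Phi> x) (fibre E x) (fibre E (h x))) \<and>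
     (\<forall>x. \<forall>v\<in>fibre E x. \<forall>w\<in>fibre E x. \<forall>r. \<Phi> x (r *\<^sub>R v + w) = r *\<^sub>R \<Phi> x v + \<Phi> x w) \<and>
     (\<forall>s. (\<forall>x. s x \<in> fibre E x) \<longrightarrow> (s \<in> sections E \<longleftrightarrow> pushforward h \<Phi> s \<in> sections E))"


section \<open>Courant algebroids\<close>

text \<open>\<open>anchor C x v\<close> is the tangent vector \<open>\<rho>(v)\<close> at \<open>x\<close>, as a derivation.\<close>

record ('m, 'e, 'v, 'f) courant = "('m, 'e, 'v, 'f) vector_bundle" +
  pairing :: "'m \<Rightarrow> 'v \<Rightarrow> 'v \<Rightarrow> real"
  bracket :: "('m \<Rightarrow> 'v) \<Rightarrow> ('m \<Rightarrow> 'v) \<Rightarrow> ('m \<Rightarrow> 'v)"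
  anchor :: "'m \<Rightarrow> 'v \<Rightarrow> ('m \<Rightarrow> real) \<Rightarrow> real"

definition pair_sec :: "('m, 'e, 'v, 'f) courant \<Rightarrow> ('m \<Rightarrow> 'v) \<Rightarrow> ('m \<Rightarrow> 'v) \<Rightarrow> 'm \<Rightarrow> real" where
  "pair_sec C a b = (\<lambda>x. pairing C x (a x) (b x))"

definition anchor_sec :: "('m, 'e, 'v, 'f) courant \<Rightarrow> ('m \<Rightarrow> 'v) \<Rightarrow> ('m \<Rightarrow> real) \<Rightarrow> 'm \<Rightarrow> real" where
  "anchor_sec C a f = (\<lambda>x. anchor C x (a x) f)"

definition courant_D :: "('m, 'e, 'v, 'f) courant \<Rightarrow> ('m \<Rightarrow> real) \<Rightarrow> 'm \<Rightarrow> 'v" where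
  "courant_D C f =
     (\<lambda>x. THE w. w \<in> fibre C x \<and> (\<forall>v\<in>fibre C x. pairing C x w v = (1/2) * anchor C x v f))"

definition courant_algebroid ::
  "('m::{t2_space,second_countable_topology}, 'e::{real_inner,banach,heine_borel}, 'v::real_vector,
    'f::{real_inner,banach,heine_borel}) courant \<Rightarrow> bool"
where
  "courant_algebroid C \<longleftrightarrow>
     smooth_vector_bundle C \<and>
     \<comment> \<open>non-degenerate symmetric bilinear form\<close>
     (\<forall>x. \<forall>u\<in>fibre C x. \<forall>v\<in>fibre C x. \<forall>w\<in>fibre C x. \<forall>r.
        pairing C x (r *\<^sub>R u + v) w = r * pairing C x u w + pairing C x v w) \<and>
     (\<forall>x. \<forall>u\<in>fibre C x. \<forall>v\<in>fibre C x. pairing C x u v = pairing C x v u) \<and>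
     (\<forall>x. \<forall>u\<in>fibre C x. (\<forall>v\<in>fibre C x. pairing C x u v = 0) \<longrightarrow> u = 0) \<and>
     (\<forall>a\<in>sections C. \<forall>b\<in>sections C. smooth_fun C (pair_sec C a b)) \<and>
     \<comment> \<open>smooth bundle map to the tangent bundle\<close>
     (\<forall>x. \<forall>v\<in>fibre C x. tangent_vector C x (anchor C x v)) \<and>
     (\<forall>x. \<forall>u\<in>fibre C x. \<forall>v\<in>fibre C x. \<forall>r f. smooth_fun C f \<longrightarrow>
        anchor C x (r *\<^sub>R u + v) f = r * anchor C x u f + anchor C x v f) \<and>
     (\<forall>a\<in>sections C. \<forall>f. smooth_fun C f \<longrightarrow> smooth_fun C (anchor_sec C a f)) \<and>
     \<comment> \<open>skew-symmetric (real-bilinear) bracket\<close>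
     (\<forall>a\<in>sections C. \<forall>b\<in>sections C. bracket C a b \<in> sections C) \<and>
     (\<forall>a\<in>sections C. \<forall>b\<in>sections C. \<forall>x. bracket C a b x = - bracket C b a x) \<and>
     (\<forall>a\<in>sections C. \<forall>b\<in>sections C. \<forall>c\<in>sections C. \<forall>r x.
        bracket C (\<lambda>y. r *\<^sub>R a y + b y) c x = r *\<^sub>R bracket C a c x + bracket C b c x) \<and>
     \<comment> \<open>(i)\<close>
     (\<forall>a\<in>sections C. \<forall>b\<in>sections C. \<forall>f x. smooth_fun C f \<longrightarrow>
        anchor_sec C (bracket C a b) f x =
          anchor_sec C a (anchor_sec C b f) x - anchor_sec C b (anchor_sec C a f) x) \<and>
     \<comment> \<open>(ii)\<close>
     (\<forall>a\<in>sections C. \<forall>b\<in>sections C. \<forall>c\<in>sections C. \<forall>x.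
        bracket C (bracket C a b) c x + bracket C (bracket C b c) a x + bracket C (bracket C c a) b x =
          (1/3) *\<^sub>R courant_D C (\<lambda>y. pair_sec C (bracket C a b) c y
                                 + pair_sec C (bracket C b c) a y
                                 + pair_sec C (bracket C c a) b y) x) \<and>
     \<comment> \<open>(iii)\<close>
     (\<forall>a\<in>sections C. \<forall>b\<in>sections C. \<forall>f x. smooth_fun C f \<longrightarrow>
        bracket C a (\<lambda>y. f y *\<^sub>R b y) x =
          f x *\<^sub>R bracket C a b x + anchor_sec C a f x *\<^sub>R b x - pair_sec C a b x *\<^sub>R courant_D C f x) \<and>
     \<comment> \<open>(iv)\<close>
     (\<forall>f g x. smooth_fun C f \<and> smooth_fun C g \<longrightarrow> anchor_sec C (courant_D C f) g x = 0) \<and>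
     \<comment> \<open>(v)\<close>
     (\<forall>a\<in>sections C. \<forall>b\<in>sections C. \<forall>c\<in>sections C. \<forall>x.
        anchor_sec C a (pair_sec C b c) x =
          pairing C x (bracket C a b x + courant_D C (pair_sec C a b) x) (c x) +
          pairing C x (b x) (bracket C a c x + courant_D C (pair_sec C a c) x))"

definition courant_automorphism ::
  "('m::{t2_space,second_countable_topology}, 'e::{real_inner,banach,heine_borel}, 'v::real_vector,
    'f::{real_inner,banach,heine_borel}) courant \<Rightarrow> ('m \<Rightarrow> 'm) \<Rightarrow> ('m \<Rightarrow> 'v \<Rightarrow> 'v) \<Rightarrow> bool"
where
  "courant_automorphism C h \<Phi> \<longleftrightarrow>
     bundle_automorphism C h \<Phi> \<and>
     (\<forall>x. \<forall>u\<in>fibre C x. \<forall>v\<in>fibre C x. pairing C (h x) (\<Phi> x u) (\<Phi> x v) = pairing C x u v) \<and>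
     (\<forall>a\<in>sections C. \<forall>b\<in>sections C. \<forall>x.
        bracket C (pushforward h \<Phi> a) (pushforward h \<Phi> b) x = pushforward h \<Phi> (bracket C a b) x) \<and>
     (\<forall>x. \<forall>v\<in>fibre C x. \<forall>f. smooth_fun C f \<longrightarrow> anchor C (h x) (\<Phi> x v) f = anchor C x v (f \<circ> h))"


section \<open>Generalized complex structures\<close>

definition generalized_complex_structure ::
  "('m::{t2_space,second_countable_topology}, 'e::{real_inner,banach,heine_borel}, 'v::real_vector,
    'f::{real_inner,banach,heine_borel}) courant \<Rightarrow> ('m \<Rightarrow> 'v \<Rightarrow> 'v) \<Rightarrow> bool"
where
  "generalized_complex_structure C J \<longleftrightarrow>
     bundle_endomorphism C J \<and>
     (\<forall>x. \<forall>v\<in>fibre C x. J x (J x v) = - v) \<and>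
     (\<forall>x. \<forall>u\<in>fibre C x. \<forall>v\<in>fibre C x. pairing C x (J x u) (J x v) = pairing C x u v) \<and>
     (\<forall>a\<in>sections C. \<forall>b\<in>sections C. \<forall>x.
        bracket C (\<lambda>y. J y (a y)) (\<lambda>y. J y (b y)) x - bracket C a b x
          - J x (bracket C (\<lambda>y. J y (a y)) b x + bracket C a (\<lambda>y. J y (b y)) x) = 0)"

definition isomorphic_gcs ::
  "('m::{t2_space,second_countable_topology}, 'e::{real_inner,banach,heine_borel}, 'v::real_vector,
    'f::{real_inner,banach,heine_borel}) courant \<Rightarrow> ('m \<Rightarrow> 'v \<Rightarrow> 'v) \<Rightarrow> ('m \<Rightarrow> 'v \<Rightarrow> 'v) \<Rightarrow> bool"
where
  "isomorphic_gcs C J J' \<longleftrightarrow>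
     (\<exists>h \<Phi>. courant_automorphism C h \<Phi> \<and>
        (\<forall>x. \<forall>v\<in>fibre C x. inv_into (fibre C x) (\<Phi> x) (J' (h x) (\<Phi> x v)) = J x v))"


section \<open>Complexification\<close>

text \<open>The complexification of a real vector space is rendered by pairs, \<open>(a, b)\<close> standing for
  \<open>a + i b\<close>. All real structure is extended complex-linearly.\<close>

definition cscale :: "complex \<Rightarrow> 'v \<times> 'v \<Rightarrow> 'v::real_vector \<times> 'v" where
  "cscale z u = (Re z *\<^sub>R fst u - Im z *\<^sub>R snd u, Re z *\<^sub>R snd u + Im z *\<^sub>R fst u)"

definition cconj :: "'v \<times> 'v \<Rightarrow> 'v::real_vector \<times> 'v" where
  "cconj u = (fst u, - snd u)"

definition cpairing :: "('m, 'e, 'v, 'f) courant \<Rightarrow> 'm \<Rightarrow> 'v \<times> 'v \<Rightarrow> 'v \<times> 'v \<Rightarrow> complex" where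
  "cpairing C x u w =
     Complex (pairing C x (fst u) (fst w) - pairing C x (snd u) (snd w))
             (pairing C x (fst u) (snd w) + pairing C x (snd u) (fst w))"

definition cbracket ::
  "('m, 'e, 'v::real_vector, 'f) courant \<Rightarrow> ('m \<Rightarrow> 'v \<times> 'v) \<Rightarrow> ('m \<Rightarrow> 'v \<times> 'v) \<Rightarrow> 'm \<Rightarrow> 'v \<times> 'v"
where
  "cbracket C s t = (\<lambda>x.
     (bracket C (fst \<circ> s) (fst \<circ> t) x - bracket C (snd \<circ> s) (snd \<circ> t) x,
      bracket C (fst \<circ> s) (snd \<circ> t) x + bracket C (snd \<circ> s) (fst \<circ> t) x))"

definition canchor ::
  "('m, 'e, 'v, 'f) courant \<Rightarrow> ('m \<Rightarrow> 'v \<times> 'v) \<Rightarrow> ('m \<Rightarrow> complex) \<Rightarrow> 'm \<Rightarrow> complex"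
where
  "canchor C s f = (\<lambda>x.
     Complex (anchor_sec C (fst \<circ> s) (Re \<circ> f) x - anchor_sec C (snd \<circ> s) (Im \<circ> f) x)
             (anchor_sec C (fst \<circ> s) (Im \<circ> f) x + anchor_sec C (snd \<circ> s) (Re \<circ> f) x))"

definition csections_on ::
  "('m::topological_space, 'e::real_normed_vector, 'v, 'f::real_normed_vector) courant
    \<Rightarrow> ('m \<Rightarrow> ('v \<times> 'v) set) \<Rightarrow> 'm set \<Rightarrow> ('m \<Rightarrow> 'v \<times> 'v) set"
where
  "csections_on C N W =
     {s. fst \<circ> s \<in> sections_on C W \<and> snd \<circ> s \<in> sections_on C W \<and> (\<forall>x\<in>W. s x \<in> N x)}"

abbreviation csections where "csections C N \<equiv> csections_on C N UNIV"

definition conj_bundle :: "('m \<Rightarrow> ('v \<times> 'v) set) \<Rightarrow> 'm \<Rightarrow> ('v::real_vector \<times> 'v) set" where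
  "conj_bundle N = (\<lambda>x. cconj ` N x)"

text \<open>Smoothness of a complex subbundle of the complexification: near every point there are
  smooth local sections whose values form a complex basis of the fibre.\<close>

definition complex_subbundle ::
  "('m::topological_space, 'e::real_normed_vector, 'v::real_vector, 'f::real_normed_vector) courant
    \<Rightarrow> ('m \<Rightarrow> ('v \<times> 'v) set) \<Rightarrow> bool"
where
  "complex_subbundle C N \<longleftrightarrow>
     (\<forall>x. N x \<subseteq> fibre C x \<times> fibre C x \<and> 0 \<in> N x \<and>
        (\<forall>u\<in>N x. \<forall>w\<in>N x. \<forall>z. cscale z u + w \<in> N x)) \<and>
     (\<forall>x. \<exists>U n. \<exists>s::nat \<Rightarrow> 'm \<Rightarrow> 'v \<times> 'v. open U \<and> x \<in> U \<and>
        (\<forall>i<n. s i \<in> csections_on C N U) \<and>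
        (\<forall>y\<in>U. bij_betw (\<lambda>z. \<Sum>i<n. cscale (z i) (s i y)) ({..<n} \<rightarrow>\<^sub>E UNIV) (N y)))"

definition isotropic_lie_subbundle ::
  "('m::topological_space, 'e::real_normed_vector, 'v::real_vector, 'f::real_normed_vector) courant
    \<Rightarrow> ('m \<Rightarrow> ('v \<times> 'v) set) \<Rightarrow> bool"
where
  "isotropic_lie_subbundle C N \<longleftrightarrow>
     complex_subbundle C N \<and>
     (\<forall>x. \<forall>u\<in>N x. \<forall>w\<in>N x. cpairing C x u w = 0) \<and>
     (\<forall>s\<in>csections C N. \<forall>t\<in>csections C N. cbracket C s t \<in> csections C N)"

definition conjugate_decomposition ::
  "('m::topological_space, 'e::real_normed_vector, 'v::real_vector, 'f::real_normed_vector) courant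
    \<Rightarrow> ('m \<Rightarrow> ('v \<times> 'v) set) \<Rightarrow> bool"
where
  "conjugate_decomposition C L \<longleftrightarrow>
     isotropic_lie_subbundle C L \<and>
     isotropic_lie_subbundle C (conj_bundle L) \<and>
     (\<forall>x. L x \<inter> conj_bundle L x = {0} \<and>
          {u + w |u w. u \<in> L x \<and> w \<in> conj_bundle L x} = fibre C x \<times> fibre C x)"


section \<open>Forms on L, the differential of L and the Schouten bracket of its dual\<close>

text \<open>A \<open>k\<close>-form is evaluated on lists of \<open>k\<close> vectors of \<open>L x\<close>; values on other lists are irrelevant.\<close>

type_synonym ('m, 'v) lform = "'m \<Rightarrow> ('v \<times> 'v) list \<Rightarrow> complex"

definition eval_form ::
  "('m, 'v) lform \<Rightarrow> ('m \<Rightarrow> 'v \<times> 'v) list \<Rightarrow> 'm \<Rightarrow> complex"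
where
  "eval_form \<omega> ss = (\<lambda>x. \<omega> x (map (\<lambda>s. s x) ss))"

definition alternating_form ::
  "('m \<Rightarrow> ('v::real_vector \<times> 'v) set) \<Rightarrow> nat \<Rightarrow> ('m, 'v) lform \<Rightarrow> bool"
where
  "alternating_form L k \<omega> \<longleftrightarrow>
     (\<forall>x vs. length vs = k \<and> set vs \<subseteq> L x \<longrightarrow>
        (\<forall>i<k. \<forall>u\<in>L x. \<forall>w\<in>L x. \<forall>z.
           \<omega> x (vs[i := cscale z u + w]) = z * \<omega> x (vs[i := u]) + \<omega> x (vs[i := w])) \<and>
        (\<forall>i j. i < j \<and> j < k \<and> vs ! i = vs ! j \<longrightarrow> \<omega> x vs = 0))"

text \<open>Smooth sections of the \<open>k\<close>-th exterior power of the dual of \<open>L\<close>, and smooth families of such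
  sections parametrised by \<open>[0,1]\<close>.\<close>

definition form_sections ::
  "('m::topological_space, 'e::real_normed_vector, 'v::real_vector, 'f::real_normed_vector) courant
    \<Rightarrow> ('m \<Rightarrow> ('v \<times> 'v) set) \<Rightarrow> nat \<Rightarrow> ('m, 'v) lform set"
where
  "form_sections C L k =
     {\<omega>. alternating_form L k \<omega> \<and>
         (\<forall>ss. length ss = k \<and> set ss \<subseteq> csections C L \<longrightarrow> smooth_fun C (eval_form \<omega> ss))}"

definition smooth_form_family ::
  "('m::topological_space, 'e::real_normed_vector, 'v::real_vector, 'f::real_normed_vector) courant
    \<Rightarrow> ('m \<Rightarrow> ('v \<times> 'v) set) \<Rightarrow> nat \<Rightarrow> (real \<Rightarrow> ('m, 'v) lform) \<Rightarrow> bool"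
where
  "smooth_form_family C L k \<Omega> \<longleftrightarrow>
     (\<forall>t\<in>{0..1}. \<Omega> t \<in> form_sections C L k) \<and>
     (\<forall>ss. length ss = k \<and> set ss \<subseteq> csections C L \<longrightarrow> smooth_family C (\<lambda>t. eval_form (\<Omega> t) ss))"

definition del_nth :: "nat \<Rightarrow> 'a list \<Rightarrow> 'a list" where
  "del_nth i xs = take i xs @ drop (Suc i) xs"

text \<open>The Lie algebroid differential, evaluated on a list of \<open>k + 1\<close> sections of \<open>L\<close>.\<close>

definition d_L ::
  "('m, 'e, 'v::real_vector, 'f) courant \<Rightarrow> ('m, 'v) lform \<Rightarrow> ('m \<Rightarrow> 'v \<times> 'v) list \<Rightarrow> 'm \<Rightarrow> complex"
where
  "d_L C \<omega> ss = (\<lambda>x.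
     (\<Sum>i<length ss. (-1) ^ i * canchor C (ss ! i) (eval_form \<omega> (del_nth i ss)) x) +
     (\<Sum>j<length ss. \<Sum>i<j. (-1) ^ (i + j) *
        eval_form \<omega> (cbracket C (ss ! i) (ss ! j) # del_nth i (del_nth j ss)) x))"

text \<open>The wedge product of a list of covectors, with the determinant convention
  \<open>(\<alpha> \<and> \<beta>)(u, v) = \<alpha>(u) \<beta>(v) - \<alpha>(v) \<beta>(u)\<close>.\<close>

definition wedge :: "('w \<Rightarrow> complex) list \<Rightarrow> 'w list \<Rightarrow> complex" where
  "wedge \<alpha>s vs =
     (\<Sum>p | p permutes {..<length \<alpha>s}. of_int (sign p) * (\<Prod>i<length \<alpha>s. (\<alpha>s ! i) (vs ! p i)))"

text \<open>A section \<open>e\<close> of the conjugate of \<open>L\<close> is identified with the covector field \<open>\<langle>e, \<cdot>\<rangle>\<close> on \<open>L\<close>.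
  \<open>decomposable C es\<close> is the wedge product of the covector fields of the sections \<open>es\<close>.\<close>

definition decomposable :: "('m, 'e, 'v, 'f) courant \<Rightarrow> ('m \<Rightarrow> 'v \<times> 'v) list \<Rightarrow> ('m, 'v) lform" where
  "decomposable C es = (\<lambda>x vs. wedge (map (\<lambda>e. cpairing C x (e x)) es) vs)"

text \<open>The Schouten bracket of decomposable multivectors,
  \<open>[X\<^sub>1 \<and> \<dots> \<and> X\<^sub>k, Y\<^sub>1 \<and> \<dots> \<and> Y\<^sub>l] = \<Sum>\<^bsub>i,j\<^esub> (-1)\<^bsup>i+j\<^esup> [X\<^sub>i, Y\<^sub>j] \<and> X\<^sub>1 \<and> \<dots> \<and> X\<^sub>k \<and> Y\<^sub>1 \<and> \<dots> \<and> Y\<^sub>l\<close>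
  with \<open>X\<^sub>i\<close> and \<open>Y\<^sub>j\<close> omitted after the bracket.\<close>

definition schouten_decomposable ::
  "('m, 'e, 'v::real_vector, 'f) courant \<Rightarrow> ('m \<Rightarrow> 'v \<times> 'v) list \<Rightarrow> ('m \<Rightarrow> 'v \<times> 'v) list
    \<Rightarrow> ('m, 'v) lform"
where
  "schouten_decomposable C es fs = (\<lambda>x vs.
     \<Sum>i<length es. \<Sum>j<length fs. (-1) ^ (i + j) *
       decomposable C (cbracket C (es ! i) (fs ! j) # del_nth i es @ del_nth j fs) x vs)"

definition represents ::
  "('m::topological_space, 'e::real_normed_vector, 'v::real_vector, 'f::real_normed_vector) courant
    \<Rightarrow> ('m \<Rightarrow> ('v \<times> 'v) set) \<Rightarrow> nat \<Rightarrow> ('m \<Rightarrow> 'v \<times> 'v) list list \<Rightarrow> ('m, 'v) lform \<Rightarrow> bool"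
where
  "represents C L k ess P \<longleftrightarrow>
     (\<forall>es\<in>set ess. length es = k \<and> set es \<subseteq> csections C (conj_bundle L)) \<and>
     (\<forall>x vs. length vs = k \<and> set vs \<subseteq> L x \<longrightarrow> P x vs = (\<Sum>es\<leftarrow>ess. decomposable C es x vs))"

text \<open>The Schouten bracket of the dual of \<open>L\<close> in degrees \<open>k, l \<ge> 1\<close>, with the Lie algebroid structure
  inherited from the conjugate of \<open>L\<close>. Over a compact base every section of an exterior power
  is a finite sum of decomposable ones, and the value of the bracket does not depend on the
  decomposition.\<close>

definition schouten ::
  "('m::topological_space, 'e::real_normed_vector, 'v::real_vector, 'f::real_normed_vector) courant
    \<Rightarrow> ('m \<Rightarrow> ('v \<times> 'v) set) \<Rightarrow> nat \<Rightarrow> nat \<Rightarrow> ('m, 'v) lform \<Rightarrow> ('m, 'v) lform \<Rightarrow> ('m, 'v) lform"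
where
  "schouten C L k l P Q = (\<lambda>x vs. THE r. \<exists>ess fss.
     represents C L k ess P \<and> represents C L l fss Q \<and>
     r = (\<Sum>es\<leftarrow>ess. \<Sum>fs\<leftarrow>fss. schouten_decomposable C es fs x vs))"


section \<open>Hamiltonian operators\<close>

text \<open>The equation is between sections of an exterior power, tested on all sections of \<open>L\<close>.\<close>

definition hamiltonian_operator ::
  "('m::topological_space, 'e::real_normed_vector, 'v::real_vector, 'f::real_normed_vector) courant
    \<Rightarrow> ('m \<Rightarrow> ('v \<times> 'v) set) \<Rightarrow> ('m, 'v) lform \<Rightarrow> bool"
where
  "hamiltonian_operator C L H \<longleftrightarrow>
     H \<in> form_sections C L 2 \<and>
     (\<forall>ss x. length ss = 3 \<and> set ss \<subseteq> csections C L \<longrightarrow>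
        d_L C H ss x + (1/2) * eval_form (schouten C L 2 2 H H) ss x = 0)"

text \<open>For a 2-form \<open>H\<close> on \<open>N\<close>, with \<open>K\<close> the complementary bundle identified with the dual of \<open>N\<close>,
  this is the map from \<open>N\<close> to \<open>K\<close> sending \<open>v\<close> to \<open>H(v, \<cdot>)\<close>.\<close>

definition form_map ::
  "('m, 'e, 'v, 'f) courant \<Rightarrow> ('m \<Rightarrow> ('v \<times> 'v) set) \<Rightarrow> ('m \<Rightarrow> ('v \<times> 'v) set) \<Rightarrow> ('m, 'v) lform
    \<Rightarrow> 'm \<Rightarrow> 'v \<times> 'v \<Rightarrow> 'v \<times> 'v"
where
  "form_map C N K H x v = (THE e. e \<in> K x \<and> (\<forall>w\<in>N x. cpairing C x e w = H x [v, w]))"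

definition conj_form :: "('m, 'v::real_vector) lform \<Rightarrow> ('m, 'v) lform" where
  "conj_form H = (\<lambda>x vs. cnj (H x (map cconj vs)))"

abbreviation H_map where "H_map C L H \<equiv> form_map C L (conj_bundle L) H"

abbreviation Hbar_map where "Hbar_map C L H \<equiv> form_map C (conj_bundle L) L (conj_form H)"

definition graph ::
  "('m, 'e, 'v::real_vector, 'f) courant \<Rightarrow> ('m \<Rightarrow> ('v \<times> 'v) set) \<Rightarrow> ('m, 'v) lform
    \<Rightarrow> 'm \<Rightarrow> ('v \<times> 'v) set"
where
  "graph C L H = (\<lambda>x. (\<lambda>v. v + H_map C L H x v) ` L x)"

definition plus_i_eigenbundle ::
  "('m, 'e, 'v::real_vector, 'f) courant \<Rightarrow> ('m \<Rightarrow> 'v \<Rightarrow> 'v) \<Rightarrow> 'm \<Rightarrow> ('v \<times> 'v) set"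
where
  "plus_i_eigenbundle C J =
     (\<lambda>x. {u \<in> fibre C x \<times> fibre C x. (J x (fst u), J x (snd u)) = cscale \<i> u})"

text \<open>The \<open>-i\<close>-eigenbundle of a real \<open>J\<close> is automatically the conjugate of the \<open>+i\<close>-eigenbundle, so
  \<open>J\<close> is determined (on the fibres) by this predicate.\<close>

definition associated_gcs ::
  "('m::{t2_space,second_countable_topology}, 'e::{real_inner,banach,heine_borel}, 'v::real_vector,
    'f::{real_inner,banach,heine_borel}) courant \<Rightarrow> ('m \<Rightarrow> ('v \<times> 'v) set) \<Rightarrow> ('m, 'v) lform
    \<Rightarrow> ('m \<Rightarrow> 'v \<Rightarrow> 'v) \<Rightarrow> bool"
where
  "associated_gcs C L H J \<longleftrightarrow>
     generalized_complex_structure C J \<and> plus_i_eigenbundle C J = graph C L H"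

end

theory Submission imports Defs begin

text \<open>For each time \<open>t\<close>, the graph of \<open>H t\<close> is the \<open>+i\<close>-eigenbundle of an orthogonal complex structure
 \<open>J t\<close>. Regard \<open>Y t\<close> as a section \<open>a t + i b t\<close> of the conjugate of \<open>L\<close> and put \<open>e t = a t - J t (b t)\<close>.
 Since the graph of \<open>H t\<close> is involutive, the deformation equation says exactly that the derivative of \<open>J t\<close>
 is its Lie derivative along \<open>e t\<close> for the Dorfman bracket, up to sign. Compactness of the base gives the flow of \<open>e t\<close>,
 on the base and on the fibres, for short times starting anywhere in \<open>[0,1]\<close>. It preserves the pairing, the anchor and
 the bracket because the corresponding expressions are constant along integral curves, which uses smooth
 dependence on the starting time, and for the same reason it intertwines the structures \<open>J t\<close>. Finitely many such
 flows are composed.\<close>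

text \<open>Why e has this form: Y is complex and has no flow, but it may be changed by sections of
  the graph. With \<open>U H s\<close> for s + H's, the right-hand side of the deformation equation
  is minus the pairing of the Dorfman bracket of Y and \<open>U H s1\<close> with
  \<open>U H s2\<close>, and a graph section added to Y contributes nothing to it. Each class modulo
  the graph has exactly one real representative, for a + i b it is a - J b. The Dorfman bracket is
  used because it acts by derivations, so every invariance becomes the vanishing of one derivative.
  The obstacle is analytic: fibres lie in a type without topology, M is seen only through charts,
  and time runs in a closed interval. So smoothness is a matter of germs, families of sections and
  integral curves are tested by pairing with fixed smooth sections, and compactness supplies a
  finite family \<open>ga\<close>, \<open>ga'\<close> resolving the identity of every fibre, which
  turns these tests into finite sums of functions. The starting time of a flow is a parameter of its
  ODE, so smoothness in it comes from the same theorem as smoothness in the initial point.\<close>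

notation (input) HOL.eq (infixr "<->" 25)
notation (input) scaleR (infixr "*R" 75)
notation (input) inner (infixl "*." 70)
notation (input) has_derivative (infix "hfd" 50)
notation (input) has_real_derivative (infix "hrd" 50)
notation (input) has_vector_derivative (infix "hvd" 50)
abbreviation (input) Times_infix (infixr "><" 80) where "A >< B == A \<times> B"
abbreviation (input) "cyl d == {-d<..<d::real} >< UNIV"
abbreviation (input) "iv == inv_into"
abbreviation (input) "con == continuous_on"
abbreviation (input) "son == smooth_on"
lemmas hrd_hvd = has_real_derivative_iff_has_vector_derivative

section \<open>Calculus on finite-dimensional inner product spaces\<close>

subsection \<open>Orthonormal bases\<close>

text \<open>A substitute for \<open>Basis\<close>: the model spaces are only inner product spaces,
  so that dimension 0 is allowed. The last clause is spanning, in the form in which it is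
  used.\<close>

definition onb :: "'a::real_inner set => bool" where
 "onb B <-> finite B & (ALL b:B. ALL c:B. b *. c = (if b = c then 1 else 0)) &
   (ALL v. (SUM b:B. (v *. b) *R b) = v)"

lemma onbD:
 assumes "onb B"
 shows "finite B" "!!b c. b : B ==> c : B ==> b *. c = (if b = c then 1 else 0)"
  "!!v. (SUM b:B. (v *. b) *R b) = v"
 using assms unfolding onb_def by auto

lemma onb_exists:
 assumes "finite_dim TYPE('a::real_inner)"
 obtains B :: "'a::real_inner set" where "onb B"
proof -
 from assms obtain A :: "'a set" where A: "finite A" "span A = UNIV"
  unfolding finite_dim_def by auto
 from basis_orthogonal[OF A(1)] obtain C0 :: "'a set" where C0: "finite C0" "span C0 = UNIV" "pairwise orthogonal C0"
  using A(2) by auto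
 define C where "C = C0 - {0}"
 have C: "finite C" "span C = UNIV" "pairwise orthogonal C" "0 ~: C"
  using C0 unfolding C_def by(auto simp: pairwise_def)
 define n where "n = (%c::'a. c /\<^sub>R norm c)"
 define B where "B = n ` C"
 have fB: "finite B" using C by(simp add: B_def)
 have nn: "norm c ~= 0" if "c : C" for c using that C(4) by auto
 have on: "b *. c = (if b = c then 1 else 0)" if bc: "b : B" "c : B" for b c
 proof -
  obtain b' c' where b': "b' : C" "b = n b'" and c': "c' : C" "c = n c'" using bc B_def by auto
  show ?thesis
  proof(cases "b' = c'")
   case True
   thus ?thesis using b' c' nn[OF b'(1)]
    by(simp add: n_def power2_norm_eq_inner[symmetric] power2_eq_square field_simps)
  next
   case False
   hence "b' *. c' = 0" using C(3) b' c' by(auto simp: pairwise_def orthogonal_def)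
   hence z: "b *. c = 0" using b' c' by(simp add: n_def)
   have "b ~= 0" using b' nn by(auto simp: n_def)
   hence "b ~= c" using z by auto
   thus ?thesis using z by simp
  qed
 qed
 have "span B = UNIV"
 proof -
  have "c : span B" if "c : C" for c
  proof -
   have "c = norm c *R n c" using nn[OF that] by(simp add: n_def)
   thus ?thesis using that B_def by(metis imageI span_base span_scale)
  qed
  hence "span C <= span B" by(intro span_minimal) auto
  thus ?thesis using C(2) by auto
 qed
 hence ex: "(SUM b:B. (v *. b) *R b) = v" for v
 proof -
  have "v : span B" using \<open>span B = UNIV\<close> by auto
  then obtain u where u: "v = (SUM b:B. u b *R b)" using span_finite[OF fB] by auto
  have "v *. c = u c" if "c : B" for c
  proof -
   have "v *. c = (SUM b:B. u b * (b *. c))" unfolding u by(simp add: inner_sum_left)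
   also have "... = (SUM b:B. if b = c then u b else 0)"
    using on that by(intro sum.cong) auto
   also have "... = u c" using fB that by(simp add: sum.delta)
   finally show ?thesis .
  qed
  thus ?thesis using u by simp
 qed
 have "onb B" using fB on ex unfolding onb_def by blast
 thus ?thesis using that by blast
qed

lemma onb_finite_dim: "onb (B::'a::real_inner set) ==> finite_dim TYPE('a)"
 unfolding finite_dim_def
proof(intro exI conjI)
 assume B: "onb B"
 show "finite B" by(rule onbD(1)[OF B])
 have "(SUM b:B. (v *. b) *R b) : span B" for v
  by(intro span_sum span_scale span_base)
 thus "span B = UNIV" using onbD(3)[OF B] by auto
qed

lemma onb_norm_le:
 assumes "onb B" "b : B" shows "norm b = 1"
 using onbD(2)[OF assms(1) assms(2) assms(2)] by(simp add: norm_eq_1)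

lemma fd_real: "finite_dim TYPE(real)"
proof -
 have "onb {1::real}" by(simp add: onb_def)
 thus ?thesis by(rule onb_finite_dim)
qed

lemma fd_prod:
 assumes "finite_dim TYPE('a::real_vector)" "finite_dim TYPE('b::real_vector)"
 shows "finite_dim TYPE('a * 'b)"
proof -
 obtain A :: "'a set" and B :: "'b set" where AB: "finite A" "span A = UNIV" "finite B" "span B = UNIV"
  using assms unfolding finite_dim_def by auto
 let ?C = "(%a. (a,0::'b)) ` A Un (%b. (0::'a,b)) ` B"
 have "(a,0) : span ?C" for a
 proof -
  have "linear (%a. (a,0::'b))" by(rule linearI) auto
  hence "(%a. (a,0::'b)) ` span A = span ((%a. (a,0)) ` A)" using linear_span_image by metis
  thus ?thesis using AB by(metis (no_types,lifting) UNIV_I image_eqI in_mono span_mono sup_ge1)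
 qed
 moreover have "(0,b) : span ?C" for b
 proof -
  have "linear (%b. (0::'a,b))" by(rule linearI) auto
  hence "(%b. (0::'a,b)) ` span B = span ((%b. (0,b)) ` B)" using linear_span_image by metis
  thus ?thesis using AB by(metis (no_types,lifting) UNIV_I image_eqI in_mono span_mono sup_ge2)
 qed
 ultimately have "(a,b) : span ?C" for a b
  using span_add[of "(a,0)" ?C "(0,b)"] by simp
 hence "span ?C = UNIV" by auto
 thus ?thesis using AB unfolding finite_dim_def by(intro exI[of _ ?C]) auto
qed

lemma linear_onb_expand:
 assumes "onb B" "linear f"
 shows "f v = (SUM b:B. (v *. b) *R f b)"
proof -
 have "f (SUM b:B. (v *. b) *R b) = (SUM b:B. (v *. b) *R f b)"
  by(simp add: linear_sum[OF assms(2)] linear_scale[OF assms(2)])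
 thus ?thesis by(simp only: onbD(3)[OF assms(1)])
qed

lemma linear_bounded_fd:
 fixes f :: "'a::real_inner => 'b::real_normed_vector"
 assumes "finite_dim TYPE('a)" "linear f"
 shows "bounded_linear f"
proof -
 obtain B :: "'a set" where B: "onb B" using onb_exists[OF assms(1)] .
 have "f v = (SUM b:B. (v *. b) *R f b)" for v
  by(rule linear_onb_expand[OF B assms(2)])
 hence "f = (%v. SUM b:B. (v *. b) *R f b)" by(rule ext)
 moreover have "bounded_linear (%v. SUM b:B. (v *. b) *R f b)"
  by(intro bounded_linear_sum bounded_linear_scaleR_left[THEN bounded_linear_compose] bounded_linear_inner_left)
 ultimately show ?thesis by metis
qed

subsection \<open>Functions of class C^k\<close>

lemma Ck_on_cong:
 assumes "open S" "!!x. x : S ==> f x = g x" "Ck_on k S f"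
 shows "Ck_on k S g"
proof(cases k)
 case 0
 thus ?thesis using assms continuous_on_cong[of S S f g] by auto
next
 case (Suc n)
 then obtain f' where f': "ALL x:S. (f hfd f' x) (at x)" "ALL v. Ck_on n S (%x. f' x v)"
  using assms(3) by auto
 have "ALL x:S. (g hfd f' x) (at x)"
  using f' assms(1,2) by(metis has_derivative_transform_within_open)
 thus ?thesis using f' Suc by auto
qed

lemma Ck_on_subset: "Ck_on k S f ==> S' <= S ==> Ck_on k S' f"
proof(induction k arbitrary: f)
 case 0 thus ?case using continuous_on_subset by auto
next
 case (Suc k)
 then obtain f' where "ALL x:S. (f hfd f' x) (at x)" "ALL v. Ck_on k S (%x. f' x v)" by auto
 hence "(ALL x:S'. (f hfd f' x) (at x)) & (ALL v. Ck_on k S' (%x. f' x v))"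
  using Suc by blast
 thus ?case by auto
qed

lemma Ck_on_imp_continuous: "Ck_on k S f ==> con S f"
 by(cases k) (auto intro!: continuous_at_imp_continuous_on intro: has_derivative_continuous)

lemma Ck_on_SucD: "Ck_on (Suc k) S f ==> Ck_on k S f"
proof(induction k arbitrary: f)
 case 0 thus ?case using Ck_on_imp_continuous[of "Suc 0" S f] by auto
next
 case (Suc k)
 then obtain f' where "ALL x:S. (f hfd f' x) (at x)" "ALL v. Ck_on (Suc k) S (%x. f' x v)"
  by(subst (asm) (2) Ck_on.simps(2)) blast
 hence "(ALL x:S. (f hfd f' x) (at x)) & (ALL v. Ck_on k S (%x. f' x v))"
  using Suc.IH by blast
 thus ?case by auto
qed

lemma Ck_on_SucI:
 assumes "!!x. x : S ==> (f hfd f' x) (at x)" "!!v. Ck_on k S (%x. f' x v)"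
 shows "Ck_on (Suc k) S f"
 using assms by auto

lemma Ck_on_SucE:
 assumes "Ck_on (Suc k) S f"
 obtains f' where "!!x. x : S ==> (f hfd f' x) (at x)" "!!v. Ck_on k S (%x. f' x v)"
 using assms by auto

lemma Ck_on_local:
 assumes "open S" "!!x. x : S ==> EX N. open N & x : N & Ck_on k N f"
 shows "Ck_on k S f"
 using assms(2)
proof(induction k arbitrary: f)
 case 0
 hence "ALL x:S. isCont f x" using continuous_on_eq_continuous_at by(metis Ck_on.simps(1))
 thus ?case using continuous_at_imp_continuous_on by auto
next
 case (Suc k)
 \<comment> \<open>The derivatives found on different neighbourhoods have to be values of one
   function; uniqueness of the Frechet derivative makes it a consistent choice.\<close>
 define f' where "f' x = frechet_derivative f (at x)" for x
 have 1: "(f hfd f' x) (at x) & (EX N. open N & x : N & (ALL v. Ck_on k N (%x. f' x v)))"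
  if x: "x : S" for x
 proof -
  obtain N where N: "open N" "x : N" "Ck_on (Suc k) N f" using Suc.prems x by blast
  obtain g where g: "!!x. x : N ==> (f hfd g x) (at x)" "!!v. Ck_on k N (%x. g x v)"
   using Ck_on_SucE[OF N(3)] by blast
  have eq: "f' y = g y" if "y : N" for y
   using g(1)[OF that] unfolding f'_def by(metis frechet_derivative_at)
  have "ALL v. Ck_on k N (%x. f' x v)"
   using Ck_on_cong[OF N(1) _ g(2)] eq by simp
  thus ?thesis using g(1)[OF N(2)] eq N by metis
 qed
 have "Ck_on k S (%x. f' x v)" for v by(rule Suc.IH) (use 1 in blast)
 thus ?case using 1 by(intro Ck_on_SucI) auto
qed

lemma Ck_on_const[simp]: "Ck_on k S (%x. c)"
proof(induction k arbitrary: c)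
 case (Suc k) thus ?case by(intro Ck_on_SucI[of _ _ "%x v. 0"]) auto
qed simp

lemma Ck_on_bounded_linear:
 assumes "bounded_linear f" shows "Ck_on k S f"
proof(cases k)
 case 0 thus ?thesis using assms by(simp add: linear_continuous_on)
next
 case (Suc n)
 thus ?thesis using assms by(auto intro!: exI[of _ "%x. f"] bounded_linear_imp_has_derivative)
qed

lemma Ck_on_linear_comp:
 assumes "bounded_linear h" "Ck_on k S f" shows "Ck_on k S (%x. h (f x))"
 using assms(2)
proof(induction k arbitrary: f)
 case 0 thus ?case using assms(1) by(simp add: bounded_linear.continuous_on)
next
 case (Suc k)
 then obtain f' where f': "!!x. x : S ==> (f hfd f' x) (at x)" "!!v. Ck_on k S (%x. f' x v)"
  using Ck_on_SucE by blast
 show ?case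
  by(rule Ck_on_SucI[of _ _ "%x v. h (f' x v)"])
   (use f' Suc.IH in "auto intro: bounded_linear.has_derivative[OF assms(1)]")
qed

lemma Ck_on_add:
 assumes "Ck_on k S f" "Ck_on k S g" shows "Ck_on k S (%x. f x + g x)"
 using assms
proof(induction k arbitrary: f g)
 case 0 thus ?case by(simp add: continuous_on_add)
next
 case (Suc k)
 obtain f' where f': "!!x. x : S ==> (f hfd f' x) (at x)" "!!v. Ck_on k S (%x. f' x v)"
  using Ck_on_SucE Suc.prems(1) by blast
 obtain g' where g': "!!x. x : S ==> (g hfd g' x) (at x)" "!!v. Ck_on k S (%x. g' x v)"
  using Ck_on_SucE Suc.prems(2) by blast
 show ?case
  by(rule Ck_on_SucI[of _ _ "%x v. f' x v + g' x v"]) (use f' g' Suc.IH in "auto intro: has_derivative_add")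
qed

lemma Ck_on_sum:
 "(!!i. i : I ==> Ck_on k S (f i)) ==> Ck_on k S (%x. SUM i:I. f i x)"
 by(induction I rule: infinite_finite_induct) (auto intro: Ck_on_add)

lemma Ck_on_bilinear:
 assumes bl: "bounded_bilinear bop"
  and "Ck_on k S f" "Ck_on k S g" shows "Ck_on k S (%x. bop (f x) (g x))"
 using assms(2,3)
proof(induction k arbitrary: f g)
 case 0 thus ?case by(simp add: bounded_bilinear.continuous_on[OF bl])
next
 case (Suc k)
 obtain f' where f': "!!x. x : S ==> (f hfd f' x) (at x)" "!!v. Ck_on k S (%x. f' x v)"
  using Ck_on_SucE Suc.prems(1) by blast
 obtain g' where g': "!!x. x : S ==> (g hfd g' x) (at x)" "!!v. Ck_on k S (%x. g' x v)"
  using Ck_on_SucE Suc.prems(2) by blast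
 have fg: "Ck_on k S f" "Ck_on k S g" using Suc.prems Ck_on_SucD by auto
 show ?case
  by(rule Ck_on_SucI[of _ _ "%x v. bop (f x) (g' x v) + bop (f' x v) (g x)"])
   (use f' g' fg Suc.IH in "auto intro!: bounded_bilinear.FDERIV[OF bl] Ck_on_add")
qed

lemma Ck_on_Pair:
 assumes "Ck_on k S f" "Ck_on k S g" shows "Ck_on k S (%x. (f x,g x))"
 using assms
proof(induction k arbitrary: f g)
 case 0 thus ?case by(simp add: continuous_on_Pair)
next
 case (Suc k)
 obtain f' where f': "!!x. x : S ==> (f hfd f' x) (at x)" "!!v. Ck_on k S (%x. f' x v)"
  using Ck_on_SucE Suc.prems(1) by blast
 obtain g' where g': "!!x. x : S ==> (g hfd g' x) (at x)" "!!v. Ck_on k S (%x. g' x v)"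
  using Ck_on_SucE Suc.prems(2) by blast
 show ?case
  by(rule Ck_on_SucI[of _ _ "%x v. (f' x v,g' x v)"]) (use f' g' Suc.IH in "auto intro: has_derivative_Pair")
qed

lemmas Ck_on_scaleR = Ck_on_bilinear[OF bounded_bilinear_scaleR]
lemmas Ck_on_mult = Ck_on_bilinear[OF bounded_bilinear_mult]
lemmas Ck_on_inner = Ck_on_bilinear[OF bounded_bilinear_inner]

text \<open>\<open>Ck_on\<close> controls the derivative of g in fixed directions only, while the
  chain rule evaluates it in the direction \<open>f' x v\<close>, which varies with x. Expanding
  this direction in an orthonormal basis separates the two dependences.\<close>

lemma Ck_on_compose:
 fixes f :: "'a::real_normed_vector => 'b::real_inner"
 assumes fd: "finite_dim TYPE('b)"
 assumes "Ck_on k T g" "Ck_on k S f" "f ` S <= T"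
 shows "Ck_on k S (%x. g (f x))"
 using assms(2,3)
proof(induction k arbitrary: g)
 case 0 thus ?case using assms(4) continuous_on_compose2 by auto
next
 case (Suc k)
 obtain B :: "'b set" where B: "onb B" using onb_exists[OF fd] .
 obtain f' where f': "!!x. x : S ==> (f hfd f' x) (at x)" "!!v. Ck_on k S (%x. f' x v)"
  using Ck_on_SucE Suc.prems(2) by blast
 obtain g' where g': "!!x. x : T ==> (g hfd g' x) (at x)" "!!v. Ck_on k T (%x. g' x v)"
  using Ck_on_SucE Suc.prems(1) by blast
 have fk: "Ck_on k S f" using Suc.prems Ck_on_SucD by auto
 show ?case
 proof(rule Ck_on_SucI[of _ _ "%x v. SUM b:B. (f' x v *. b) *R g' (f x) b"])
  fix x assume x: "x : S"
  hence fx: "f x : T" using assms(4) by auto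
  have "linear (g' (f x))" using g'(1)[OF fx] by(rule has_derivative_linear)
  hence "(%v. SUM b:B. (f' x v *. b) *R g' (f x) b) = (%v. g' (f x) (f' x v))"
   using linear_onb_expand[OF B] by metis
  thus "((%x. g (f x)) hfd (%v. SUM b:B. (f' x v *. b) *R g' (f x) b)) (at x)"
   using has_derivative_compose[OF f'(1)[OF x] g'(1)[OF fx]] by simp
 next
  fix v
  show "Ck_on k S (%x. SUM b:B. (f' x v *. b) *R g' (f x) b)"
   by(intro Ck_on_sum Ck_on_scaleR Ck_on_inner f' Ck_on_const Suc.IH g' fk)
 qed
qed

lemma Ck_on_inverse: "Ck_on k {x. x ~= 0} (inverse :: real => real)"
proof(induction k)
 case 0 show ?case by(auto intro!: continuous_intros)
next
 case (Suc k)
 show ?case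
 proof(rule Ck_on_SucI[of _ _ "%x v. - (inverse x * v * inverse x)"])
  fix x :: real assume "x : {x. x ~= 0}"
  thus "(inverse hfd (%v. - (inverse x * v * inverse x))) (at x)"
   using has_derivative_inverse'[of x UNIV] by auto
 next
  fix v :: real
  have "Ck_on k {x::real. x ~= 0} (%x. (-v) * (inverse x * inverse x))"
   by(intro Ck_on_mult Suc Ck_on_const)
  thus "Ck_on k {x::real. x ~= 0} (%x. - (inverse x * v * inverse x))"
   by(simp add: mult.assoc mult.left_commute)
 qed
qed

lemma smooth_onD: "son S f ==> Ck_on k S f" by(simp add: smooth_on_def)

lemma son_cong: "open S ==> (!!x. x : S ==> f x = g x) ==> son S f ==> son S g"
 unfolding smooth_on_def using Ck_on_cong by blast
lemma son_subset: "son S f ==> S' <= S ==> son S' f"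
 unfolding smooth_on_def using Ck_on_subset by blast
lemma son_continuous: "son S f ==> con S f"
 unfolding smooth_on_def using Ck_on_imp_continuous by blast
lemma son_local:
 assumes "open S" "!!x. x : S ==> EX N. open N & x : N & son N f"
 shows "son S f"
 unfolding smooth_on_def
proof
 fix k show "Ck_on k S f" by(rule Ck_on_local[OF assms(1)]) (use assms(2) smooth_onD in metis)
qed
lemma son_const[simp]: "son S (%x. c)" by(simp add: smooth_on_def)
lemma son_bounded_linear: "bounded_linear f ==> son S f"
 by(simp add: smooth_on_def Ck_on_bounded_linear)
lemma son_id[simp]: "son S (%x. x)" by(rule son_bounded_linear) (rule bounded_linear_ident)
lemma son_linear_comp: "bounded_linear h ==> son S f ==> son S (%x. h (f x))"
 by(simp add: smooth_on_def Ck_on_linear_comp)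
lemma son_fst: "son S f ==> son S (%x. fst (f x))"
 by(rule son_linear_comp[OF bounded_linear_fst])
lemma son_snd: "son S f ==> son S (%x. snd (f x))"
 by(rule son_linear_comp[OF bounded_linear_snd])
lemma son_add: "son S f ==> son S g ==> son S (%x. f x + g x)"
 by(simp add: smooth_on_def Ck_on_add)
lemma son_minus: "son S f ==> son S (%x. - f x)"
 by(rule son_linear_comp) (rule bounded_linear_minus[OF bounded_linear_ident])
lemma son_diff: "son S f ==> son S g ==> son S (%x. f x - g x)"
 using son_add[of S f "%x. - g x"] son_minus by auto
lemma son_sum: "(!!i. i : I ==> son S (f i)) ==> son S (%x. SUM i:I. f i x)"
 unfolding smooth_on_def by(auto intro: Ck_on_sum)
lemma son_bilinear:
 "bounded_bilinear bop ==> son S f ==> son S g ==> son S (%x. bop (f x) (g x))"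
 unfolding smooth_on_def by(auto intro: Ck_on_bilinear)
lemmas son_scaleR = son_bilinear[OF bounded_bilinear_scaleR]
lemmas son_mult = son_bilinear[OF bounded_bilinear_mult]
lemmas son_inner = son_bilinear[OF bounded_bilinear_inner]
lemma son_Pair: "son S f ==> son S g ==> son S (%x. (f x,g x))"
 by(simp add: smooth_on_def Ck_on_Pair)
lemma son_compose:
 fixes f :: "'a::real_normed_vector => 'b::real_inner"
 assumes "finite_dim TYPE('b)" "son T g" "son S f" "f ` S <= T"
 shows "son S (%x. g (f x))"
 using assms Ck_on_compose unfolding smooth_on_def by blast
lemma son_inverse: "son S f ==> (!!x. x : S ==> f x ~= (0::real)) ==> son S (%x. inverse (f x))"
 by(rule son_compose[OF fd_real,of "{x. x ~= 0}"]) (auto simp: smooth_on_def Ck_on_inverse)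

lemma son_derivative:
 assumes "son S f" "open S"
 obtains f' where "!!x. x : S ==> (f hfd f' x) (at x)" "!!v. son S (%x. f' x v)"
proof -
 define f' where "f' x = frechet_derivative f (at x)" for x
 have 1: "(f hfd f' x) (at x)" if "x : S" for x
  using smooth_onD[OF assms(1),of "Suc 0"] that unfolding f'_def
  by(metis Ck_on_SucE frechet_derivative_at)
 have "Ck_on k S (%x. f' x v)" for k v
 proof -
  obtain g where g: "!!x. x : S ==> (f hfd g x) (at x)" "!!v. Ck_on k S (%x. g x v)"
   using Ck_on_SucE[OF smooth_onD[OF assms(1),of "Suc k"]] by blast
  have "f' x = g x" if "x : S" for x using 1 g that has_derivative_unique by blast
  thus ?thesis using Ck_on_cong[OF assms(2) _ g(2)] by simp
 qed
 hence "son S (%x. f' x v)" for v by(simp add: smooth_on_def)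
 thus ?thesis using that 1 by blast
qed

section \<open>Linear maps of the model fibre\<close>

lemma fd_linear_inj_imp_surj:
 fixes f :: "'f::real_inner => 'f"
 assumes "finite_dim TYPE('f)" "linear f" "inj f"
 shows "surj f"
proof -
 obtain B :: "'f set" where B: "onb B" using onb_exists[OF assms(1)] .
 have "independent B"
 proof(rule pairwise_orthogonal_independent)
  show "pairwise orthogonal B" using onbD(2)[OF B] by(auto simp: pairwise_def orthogonal_def)
  show "0 ~: B" using onb_norm_le[OF B] by fastforce
 qed
 moreover have "span B = UNIV"
 proof -
  have "(SUM b:B. (v *. b) *R b) : span B" for v by(intro span_sum span_scale span_base)
  thus ?thesis using onbD(3)[OF B] by auto
 qed
 ultimately interpret fv: finite_dimensional_vector_space "(*R) :: real => 'f => 'f" B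
  using onbD(1)[OF B]
  by unfold_locales (auto simp: algebra_simps dependent_raw_def span_raw_def)
 have "Vector_Spaces.linear (*R) (*R) f" using assms(2) unfolding linear_def .
 thus ?thesis using fv.linear_inj_imp_surj assms(3) by blast
qed

lemma bij_linear_inv:
 assumes "linear f" "bij f" shows "linear (inv f)"
proof(rule linearI)
 fix x y r
 have f: "f (inv f x) = x" for x using assms(2) by(simp add: bij_is_surj surj_f_inv_f)
 have g: "inv f (f x) = x" for x using assms(2) by(simp add: bij_is_inj)
 show "inv f (x + y) = inv f x + inv f y" using g[of "inv f x + inv f y"] by(simp add: linear_add[OF assms(1)] f)
 show "inv f (r *R x) = r *R inv f x" using g[of "r *R inv f x"] by(simp add: linear_scale[OF assms(1)] f)
qed

subsection \<open>Gronwall-type uniqueness\<close>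

lemma is_interval_Icc_subset:
 assumes "is_interval S" "a : S" "b : S" shows "{a..b::real} <= S"
proof
 fix x assume "x : {a..b}"
 hence "a <= x" "x <= b" by auto
 moreover have *: "ALL a:S. ALL b:S. ALL x. a <= x & x <= b --> x : S"
  using assms(1) by(simp only: is_interval_1)
 note bspec[OF bspec[OF * assms(2)] assms(3),rule_format,of x]
 ultimately show "x : S" by simp
qed

text \<open>Integrating factors: \<open>exp (- C * x) * q x\<close> decreases and
  \<open>exp (C * x) * q x\<close> increases. The former forces \<open>q t <= 0\<close> for t after
  s, the latter for t before s.\<close>

lemma gronwall_real:
 fixes q q' :: "real => real"
 assumes S: "is_interval S" "s : S" "t : S"
  and d: "!!ta. ta : S ==> (q hrd q' ta) (at ta within S)"
  and b: "!!ta. ta : S ==> \<bar>q' ta\<bar> <= C * q ta"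
  and "q s = 0" "q t >= 0"
 shows "q t = 0"
proof -
 \<comment> \<open>Both monotonicities at once: \<open>si\<close> is the sign and \<open>k\<close>
   the exponent; the pairs (-1, -C) and (1, C) are used.\<close>
 have mono: "si * (exp (k * x) * q x) <= si * (exp (k * y) * q y)"
  if xy: "x : S" "y : S" "x < y" and sgn: "!!ta. ta : S ==> 0 <= si * (q' ta + k * q ta)" for si k x y
 proof -
  have sub: "{x..y} <= S" using is_interval_Icc_subset S(1) xy by blast
  define m where "m ta = si * (exp (k * ta) * q ta)" for ta
  have m': "(m hrd exp (k * ta) * (si * (q' ta + k * q ta))) (at ta within {x..y})" if "ta : {x..y}" for ta
   unfolding m_def
   by(rule derivative_eq_intros DERIV_subset[OF d sub] subsetD[OF sub that] refl | simp add: algebra_simps)+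
  obtain ta where ta: "ta : {x<..<y}" "m y - m x = (exp (k * ta) * (si * (q' ta + k * q ta))) * (y - x)"
   using mvt_simple[OF xy(3),of m "%ta. (*) (exp (k * ta) * (si * (q' ta + k * q ta)))"] m'
   unfolding has_field_derivative_def by auto
  have "0 <= m y - m x" unfolding ta(2) by(intro mult_nonneg_nonneg[OF mult_nonneg_nonneg[OF _ sgn]]) (use ta(1) sub xy(3) in auto)
  thus ?thesis by(simp add: m_def)
 qed
 have "0 <= - 1 * (q' ta + - C * q ta)" "0 <= 1 * (q' ta + C * q ta)" if "ta : S" for ta using b[OF that] by auto
 from mono[OF S(2,3) _ this(1)] mono[OF S(3,2) _ this(2)] have "q t <= 0" if "s ~= t"
  using assms(6) that by(cases s t rule: linorder_cases) (auto simp: mult_le_0_iff)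
 thus ?thesis using assms(6,7) by fastforce
qed

lemma gronwall_vec:
 fixes u u' :: "real => 'a::real_inner"
 assumes S: "is_interval S" "s : S" "t : S"
  and d: "!!ta. ta : S ==> (u hvd u' ta) (at ta within S)"
  and b: "!!ta. ta : S ==> norm (u' ta) <= C * norm (u ta)"
  and "u s = 0"
 shows "u t = 0"
proof -
 have "u t *. u t = 0"
 proof(rule gronwall_real[OF S,of "%ta. u ta *. u ta" "%ta. 2 * (u ta *. u' ta)" "2 * C"])
  fix ta assume ta: "ta : S"
  show "((%ta. u ta *. u ta) hrd 2 * (u ta *. u' ta)) (at ta within S)"
   using bounded_bilinear.has_vector_derivative[OF bounded_bilinear_inner d[OF ta] d[OF ta]]
   by(simp add: hrd_hvd inner_commute)
  have "\<bar>u ta *. u' ta\<bar> <= norm (u ta) * norm (u' ta)" by(rule Cauchy_Schwarz_ineq2)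
  also have "... <= norm (u ta) * (C * norm (u ta))" using b[OF ta] by(simp add: mult_left_mono)
  finally show "\<bar>2 * (u ta *. u' ta)\<bar> <= 2 * C * (u ta *. u ta)"
   by(simp add: power2_norm_eq_inner[symmetric] power2_eq_square ac_simps)
 qed (use assms in auto)
 thus ?thesis by simp
qed

subsection \<open>Bump functions\<close>

text \<open>The extra power of 1/x makes the family closed under differentiation up to linear
  combinations, so smoothness follows by induction on the order, for all n at once.\<close>

definition flat_exp :: "nat => real => real" where
 "flat_exp n x = (if x <= 0 then 0 else exp (- inverse x) * inverse x ^ n)"

text \<open>With y = 1/x, the single term of degree n + 2 of the exponential series is at most exp
  y. The spare factor x^2 gives derivative 0 at the origin.\<close>

lemma flat_exp_bound: "\<bar>flat_exp n x\<bar> <= fact (n + 2) * x\<^sup>2"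
proof(cases "x <= 0")
 case False
 define y where "y = inverse x"
 have y: "y > 0" using False by(simp add: y_def)
 have "y ^ (n + 2) / fact (n + 2) <= exp y"
 proof -
  have s: "(%k. y ^ k /\<^sub>R fact k) sums exp y" by(rule exp_converges)
  have "(SUM k:{n+2}. y ^ k /\<^sub>R fact k) <= (\<Sum>k. y ^ k /\<^sub>R fact k)"
   by(rule sum_le_suminf) (use s y in "auto simp: sums_iff")
  thus ?thesis using s by(simp add: sums_iff divide_inverse mult.commute)
 qed
 hence "y ^ (n + 2) <= exp y * fact (n + 2)"
  by(subst (asm) pos_divide_le_eq) simp_all
 hence "exp (- y) * y ^ n * (y ^ 2) <= fact (n + 2)"
  by(simp add: exp_minus divide_simps power_add power2_eq_square mult_ac del: fact_Suc)
 hence "exp (- y) * y ^ n <= fact (n + 2) * x\<^sup>2"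
  using y False by(simp add: y_def field_simps)
 thus ?thesis using False y by(simp add: flat_exp_def y_def)
qed (simp add: flat_exp_def)

lemma flat_exp_deriv:
 "(flat_exp n hrd flat_exp (n + 2) x - real n * flat_exp (n + 1) x) (at x)"
proof -
 consider "x < 0" | "x = 0" | "x > 0" by linarith
 thus ?thesis
 proof cases
  case 1
  have "((%x. 0) hrd 0) (at x)" by simp
  hence "(flat_exp n hrd 0) (at x)"
   by(rule has_field_derivative_transform_within_open[of _ _ _ "{..<0}"]) (use 1 in "auto simp: flat_exp_def")
  thus ?thesis using 1 by(simp add: flat_exp_def)
 next
  case 2
  have "(flat_exp n hrd 0) (at 0)"
   unfolding has_field_derivative_def has_derivative_at_alt
  proof(intro conjI allI impI)
   fix e :: real assume e: "e > 0"
   define K :: real where "K = fact (n + 2)"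
   have K: "K > 0" by(simp add: K_def)
   show "EX d>0. ALL y. norm (y - 0) < d --> norm (flat_exp n y - flat_exp n 0 - 0 * (y - 0)) <= e * norm (y - 0)"
   proof(intro exI[of _ "e / K"] conjI allI impI)
    fix y :: real assume y: "norm (y - 0) < e / K"
    have "norm (flat_exp n y - flat_exp n 0 - 0 * (y - 0)) <= K * y\<^sup>2"
     using flat_exp_bound[of n y] by(simp add: K_def flat_exp_def)
    also have "... = (K * (abs y)) * (abs y)" by(simp add: power2_eq_square)
    also have "... <= e * (abs y)" using y K by(intro mult_right_mono) (auto simp: field_simps)
    finally show "norm (flat_exp n y - flat_exp n 0 - 0 * (y - 0)) <= e * norm (y - 0)" by simp
   qed (use e K in auto)
  qed (simp add: bounded_linear_mult_right)
  thus ?thesis using 2 by(simp add: flat_exp_def)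
 next
  case 3
  have pw: "((%x. inverse x ^ n) hrd - (real n * inverse x ^ (n + 1))) (at x)"
   using DERIV_power[OF DERIV_inverse[of x UNIV],of n] 3
   by(cases n) (simp_all add: algebra_simps)
  have "((%x. exp (- inverse x)) hrd exp (- inverse x) * inverse x ^ 2) (at x)"
   using 3 by(auto intro!: derivative_eq_intros simp: power2_eq_square)
  from DERIV_mult[OF this pw]
  have "((%x. exp (- inverse x) * inverse x ^ n) hrd
    (exp (- inverse x) * inverse x ^ (n + 2) - real n * (exp (- inverse x) * inverse x ^ (n + 1)))) (at x)"
   by(simp add: algebra_simps power2_eq_square)
  hence "(flat_exp n hrd
    (exp (- inverse x) * inverse x ^ (n + 2) - real n * (exp (- inverse x) * inverse x ^ (n + 1)))) (at x)"
   by(rule has_field_derivative_transform_within_open[of _ _ _ "{0<..}"]) (use 3 in "auto simp: flat_exp_def")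
  thus ?thesis using 3 by(simp add: flat_exp_def)
 qed
qed

lemma smooth_flat_exp: "son UNIV (flat_exp n)"
 unfolding smooth_on_def
proof
 fix k show "Ck_on k UNIV (flat_exp n)"
 proof(induction k arbitrary: n)
  case 0
  show ?case using DERIV_isCont[OF flat_exp_deriv] by(simp add: continuous_at_imp_continuous_on)
 next
  case (Suc k)
  show ?case
  proof(rule Ck_on_SucI)
   show "(flat_exp n hfd (%v. (flat_exp (n + 2) x - real n * flat_exp (n + 1) x) * v)) (at x)" for x
    using flat_exp_deriv[of n x] by(simp add: has_field_derivative_def)
   have "Ck_on k UNIV (%x. (flat_exp (n + 2) x + (- real n) * flat_exp (n + 1) x) * v)" for v
    by(intro Ck_on_mult Ck_on_add Suc Ck_on_const)
   thus "Ck_on k UNIV (%x. (flat_exp (n + 2) x - real n * flat_exp (n + 1) x) * v)" for v by simp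
  qed
 qed
qed

lemma smooth_bump:
 fixes y0 :: "'a::real_inner"
 assumes "r > 0"
 obtains be :: "'a => real" where "son UNIV be" "!!y. 0 <= be y" "!!y. be y <= 1"
  "!!y. dist y0 y <= r ==> be y = 1" "!!y. dist y0 y >= 2 * r ==> be y = 0"
proof -
 define E where "E = flat_exp 0"
 have E: "E x >= 0" "x > 0 ==> E x > 0" "x <= 0 ==> E x = 0" for x
  by(auto simp: E_def flat_exp_def)
 have pos: "E x + E (1 - x) > 0" for x
 proof(cases "x > 0")
  case True thus ?thesis using E(1)[of "1-x"] E(2)[of x] by linarith
 next
  case False thus ?thesis using E(2)[of "1-x"] E(1)[of x] by simp
 qed
 define si where "si x = E x * inverse (E x + E (1 - x))" for x
 have sE: "son UNIV E" by(simp add: E_def smooth_flat_exp)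
 have "son UNIV (%x. E (1 - x))"
  by(rule son_compose[OF fd_real sE]) (auto intro: son_diff)
 hence ssi: "son UNIV si" unfolding si_def
  using pos by(intro son_mult sE son_inverse son_add) (auto simp: less_le)
 \<comment> \<open>The argument of the smooth step \<open>si\<close> is at least 1 within distance r
   and at most -2 beyond 2 r; \<open>si\<close> is 0 on the negative axis and 1 from 1 on.\<close>
 define be where "be y = si (2 - ((y - y0) *. (y - y0)) * inverse (r * r))" for y
 have "son UNIV be" unfolding be_def
  by(rule son_compose[OF fd_real ssi])
   (auto intro!: son_diff son_mult son_inner)
 moreover have s0: "0 <= si x" for x using E(1) pos by(simp add: si_def less_imp_le)
 moreover have "si x <= 1" for x using E(1) pos[of x] by(simp add: si_def field_simps)
 moreover have "be y = 1" if "dist y0 y <= r" for y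
 proof -
  have "(y - y0) *. (y - y0) <= r * r"
   using that assms by(simp add: dist_norm norm_minus_commute power2_norm_eq_inner[symmetric] power2_eq_square mult_mono)
  hence "2 - ((y - y0) *. (y - y0)) * inverse (r * r) >= 1" using assms by(simp add: field_simps)
  hence "E (1 - (2 - ((y - y0) *. (y - y0)) * inverse (r * r))) = 0" by(intro E(3)) simp
  thus ?thesis using pos[of "2 - ((y - y0) *. (y - y0)) * inverse (r * r)"]
   unfolding be_def si_def by simp
 qed
 moreover have "be y = 0" if "dist y0 y >= 2 * r" for y
 proof -
  have "2 * r * (2 * r) <= (y - y0) *. (y - y0)"
   using mult_mono[OF that that] assms
   by(simp add: dist_norm norm_minus_commute power2_norm_eq_inner[symmetric] power2_eq_square)
  moreover have "r * r > 0" using assms by simp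
  ultimately have "2 * (r * r) <= (y - y0) *. (y - y0)" by linarith
  hence "2 - ((y - y0) *. (y - y0)) * inverse (r * r) <= 0" using assms by(simp add: field_simps)
  thus ?thesis using E(3) unfolding be_def si_def by simp
 qed
 ultimately show ?thesis by(intro that[of be]) (auto simp: be_def)
qed

subsection \<open>Inverses of smooth families of linear maps\<close>

text \<open>Product rule at a zero of f, with g merely continuous. It differentiates a family of
  inverse maps before these are known to be differentiable.\<close>

lemma has_derivative_scaleR_vanish:
 fixes f :: "'a::real_normed_vector => real" and g :: "'a => 'b::real_normed_vector"
 assumes "(f hfd f') (at x)" "f x = 0" "isCont g x"
 shows "((%y. f y *R g y) hfd (%v. f' v *R g x)) (at x)"
proof -
 have 1: "((%y. f y *R g x) hfd (%v. f' v *R g x)) (at x)"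
  using assms(1) by(rule has_derivative_scaleR_left)
 have bl: "bounded_linear f'" using assms(1) by(rule has_derivative_bounded_linear)
 obtain K0 where K0: "K0 > 0" "!!v. norm (f' v) <= norm v * K0"
  using bounded_linear.pos_bounded[OF bl] by auto
 have 2: "((%y. f y *R (g y - g x)) hfd (%v. 0)) (at x)"
  unfolding has_derivative_at_alt
 proof(intro conjI allI impI)
  fix e :: real assume e: "e > 0"
  define K where "K = K0 + 1"
  have K: "K > 0" using K0 by(simp add: K_def)
  obtain d1 where d1: "d1 > 0" "!!y. norm (y - x) < d1 ==> norm (f y - f x - f' (y - x)) <= 1 * norm (y - x)"
   using assms(1) unfolding has_derivative_at_alt using zero_less_one by blast
  obtain d2 where d2: "d2 > 0" "!!y. dist y x < d2 ==> dist (g y) (g x) < e / K"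
   using assms(3) e K unfolding continuous_at_eps_delta by(metis divide_pos_pos)
  show "EX d>0. ALL y. norm (y - x) < d -->
    norm (f y *R (g y - g x) - f x *R (g x - g x) - 0) <= e * norm (y - x)"
  proof(intro exI[of _ "min d1 d2"] conjI allI impI)
   fix y assume y: "norm (y - x) < min d1 d2"
   have "norm (f y) <= norm (f y - f x - f' (y - x)) + norm (f' (y - x))"
    using assms(2) norm_triangle_ineq[of "f y - f x - f' (y - x)" "f' (y - x)"] by simp
   also have "... <= K * norm (y - x)" using d1(2)[of y] K0(2)[of "y - x"] y by(simp add: K_def algebra_simps)
   finally have a: "norm (f y) <= K * norm (y - x)" .
   have b: "norm (g y - g x) <= e / K" using d2(2)[of y] y by(simp add: dist_norm)
   have "norm (f y) * norm (g y - g x) <= (K * norm (y - x)) * (e / K)"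
    using a b K by(intro mult_mono) auto
   also have "... = e * norm (y - x)" using K by simp
   finally show "norm (f y *R (g y - g x) - f x *R (g x - g x) - 0) <= e * norm (y - x)" by simp
  qed (use d1 d2 in auto)
 qed simp
 have "((%y. f y *R g x + f y *R (g y - g x)) hfd (%v. f' v *R g x + 0)) (at x)"
  by(rule has_derivative_add[OF 1 2])
 thus ?thesis by(simp add: algebra_simps)
qed

text \<open>The resolvent identity \<open>R q - R p = - R q (A q - A p) R p\<close> gives continuity
  of the inverses and then their derivative. The formula for the derivative involves only R and the
  derivatives of A, so regularity bootstraps. Being the identity at q0 is a normalisation.\<close>

lemma inverse_family:
 fixes A :: "'q::real_normed_vector => 'f::{real_inner,banach} => 'f"
 assumes fd: "finite_dim TYPE('f)" and Q: "open Q" "q0 : Q"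
  and lin: "!!q. q : Q ==> linear (A q)"
  and sm: "!!u. son Q (%q. A q u)"
  and id: "!!u. A q0 u = u"
 obtains N where "open N" "q0 : N" "N <= Q" "!!q. q : N ==> bij (A q)"
  "!!w. son N (%q. inv (A q) w)"
proof -
 obtain B :: "'f set" where B: "onb B" using onb_exists[OF fd] .
 define s where "s q = (SUM b:B. norm (A q b - b))" for q
 have cs: "con Q s" unfolding s_def
  by(intro continuous_intros son_continuous sm)
 \<comment> \<open>The threshold 1/2 bounds the distance of \<open>A q u\<close> from u by half the
   norm of u, hence \<open>A q\<close> is injective and its inverse has norm at most 2.\<close>
 define N where "N = {q : Q. s q < 1/2}"
 have oN: "open N" unfolding N_def
  using continuous_open_preimage[OF cs Q(1),of "{..<1/2}"] by(simp add: vimage_def Int_def)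
 have N: "q0 : N" "N <= Q" using Q id by(auto simp: N_def s_def)
 have small: "norm (A q u - u) <= (1/2) * norm u" if q: "q : N" for q u
 proof -
  have "A q u - u = (SUM b:B. (u *. b) *R (A q b - b))"
   using linear_onb_expand[OF B lin,of q u] q N onbD(3)[OF B,of u]
   by(auto simp: scaleR_diff_right sum_subtractf)
  also have "norm ... <= (SUM b:B. norm u * norm (A q b - b))"
  proof(rule order_trans[OF norm_sum],rule sum_mono)
   fix b assume b: "b : B"
   have "\<bar>u *. b\<bar> <= norm u" using Cauchy_Schwarz_ineq2[of u b] onb_norm_le[OF B b] by simp
   thus "norm ((u *. b) *R (A q b - b)) <= norm u * norm (A q b - b)"
    by(simp add: mult_right_mono)
  qed
  also have "... = norm u * s q" by(simp add: s_def sum_distrib_left)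
  also have "... <= norm u * (1/2)" using q by(intro mult_left_mono) (auto simp: N_def)
  finally show ?thesis by simp
 qed
 have bij: "bij (A q)" if q: "q : N" for q
 proof -
  have l: "linear (A q)" using lin q N by auto
  have "u = 0" if "A q u = 0" for u using small[OF q,of u] that by simp
  hence "inj (A q)" unfolding linear_injective_0[OF l] by blast
  thus ?thesis using fd_linear_inj_imp_surj[OF fd l] by(simp add: bij_def)
 qed
 define R where "R q = inv (A q)" for q
 have RA: "R q (A q u) = u" "A q (R q w) = w" if "q : N" for q u w
  using bij[OF that] by(auto simp: R_def bij_is_inj bij_is_surj surj_f_inv_f)
 have linR: "linear (R q)" if q: "q : N" for q
  unfolding R_def by(rule bij_linear_inv[OF lin bij[OF q]]) (use q N in auto)
 have Rb: "norm (R q w) <= 2 * norm w" if q: "q : N" for q w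
  using small[OF q,of "R q w"] RA(2)[OF q,of w] norm_triangle_ineq2[of "R q w" w]
  by(simp add: norm_minus_commute)
 have diff: "R q w - R p w = - R q (A q (R p w) - A p (R p w))" if "q : N" "p : N" for q p w
  using RA[OF that(1)] RA[OF that(2)] by(simp add: linear_diff[OF linR[OF that(1)]])
 have contR: "isCont (%q. R q w) p" if p: "p : N" for p w
 proof -
  define z where "z = R p w"
  have "isCont (%q. A q z) p"
   using son_continuous[OF sm[of z]] Q p N by(metis continuous_on_eq_continuous_at subsetD)
  hence "(%q. A q z - A p z) \<midarrow>p\<rightarrow> 0" by(simp add: LIM_zero isCont_def)
  hence t: "(%q. 2 * norm (A q z - A p z)) \<midarrow>p\<rightarrow> 0"
   using tendsto_mult_right_zero tendsto_norm_zero by blast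
  have "\<forall>\<^sub>F q in at p. q : N" using oN p by(rule eventually_at_in_open')
  hence "\<forall>\<^sub>F q in at p. norm (R q w - R p w) <= 2 * norm (A q z - A p z)"
  proof eventually_elim
   case (elim q) thus ?case using diff[OF elim p,of w] Rb[OF elim] by(simp add: z_def)
  qed
  hence "(%q. R q w - R p w) \<midarrow>p\<rightarrow> 0" by(rule Lim_null_comparison[OF _ t])
  thus ?thesis by(simp add: isCont_def LIM_zero_iff)
 qed
 have "EX A'. ALL b. (ALL x:Q. ((%q. A q b) hfd A' b x) (at x)) & (ALL v. son Q (%x. A' b x v))"
  by(rule choice) (use son_derivative[OF sm Q(1)] in metis)
 then obtain A' where A': "!!b x. x : Q ==> ((%q. A q b) hfd A' b x) (at x)"
  "!!b v. son Q (%x. A' b x v)" by blast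
 \<comment> \<open>This is - R A' R, with the vectors expanded in B so that the derivative of A
   occurs only at fixed basis vectors.\<close>
 define R' where "R' w p v = - (SUM c:B. SUM b:B. ((R p w *. b) * (A' b p v *. c)) *R R p c)" for w p v
 have dR: "((%q. R q w) hfd R' w p) (at p)" if p: "p : N" for p w
 proof -
  define z where "z = R p w"
  have pQ: "p : Q" using p N by auto
  define k where "k q = (SUM b:B. (z *. b) *R (A q b - A p b))" for q
  have k': "(k hfd (%v. SUM b:B. (z *. b) *R A' b p v)) (at p)" unfolding k_def
   by(intro has_derivative_sum has_derivative_scaleR_right has_derivative_diff[of _ _ _ "%_. _" "%_. 0", simplified] A'(1) pQ has_derivative_const)
  have "((%q. (k q *. c) *R R q c) hfd (%v. ((SUM b:B. (z *. b) *R A' b p v) *. c) *R R p c)) (at p)" for c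
   by(rule has_derivative_scaleR_vanish[OF has_derivative_inner_left[OF k'] _ contR[OF p]])
    (simp add: k_def)
  hence "((%q. R p w - (SUM c:B. (k q *. c) *R R q c)) hfd
    (%v. 0 - (SUM c:B. ((SUM b:B. (z *. b) *R A' b p v) *. c) *R R p c))) (at p)"
   by(intro has_derivative_diff has_derivative_const has_derivative_sum)
  moreover have "(%v. 0 - (SUM c:B. ((SUM b:B. (z *. b) *R A' b p v) *. c) *R R p c)) = R' w p"
   by(auto simp: R'_def z_def inner_sum_left scaleR_sum_left)
  moreover have "R p w - (SUM c:B. (k q *. c) *R R q c) = R q w" if q: "q : N" for q
  proof -
   have "(SUM c:B. (k q *. c) *R R q c) = R q (k q)"
    using linear_onb_expand[OF B linR[OF q]] by metis
   moreover have "k q = A q z - A p z"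
    using linear_onb_expand[OF B lin[OF subsetD[OF N(2) q]],of z]
     linear_onb_expand[OF B lin[OF pQ],of z]
    by(simp add: k_def scaleR_diff_right sum_subtractf)
   ultimately have "(SUM c:B. (k q *. c) *R R q c) = R q (A q z - A p z)" by simp
   moreover have "R q w = R p w - R q (A q z - A p z)"
    using diff[OF q p,of w] unfolding z_def by(metis add_diff_cancel_left' diff_add_cancel minus_diff_eq uminus_add_conv_diff)
   ultimately show ?thesis by simp
  qed
  ultimately show ?thesis
   using has_derivative_transform_within_open[OF _ oN p] by(metis (no_types,lifting))
 qed
 have "Ck_on k N (%q. R q w)" for k w
 proof(induction k arbitrary: w)
  case 0 show ?case using contR by(simp add: continuous_at_imp_continuous_on)
 next
  case (Suc k)
  have Ak: "Ck_on k N (%x. A' b x v)" for b v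
   using smooth_onD[OF son_subset[OF A'(2) N(2)]] .
  have "Ck_on k N (%p. (-1) *R (SUM c:B. SUM b:B. ((R p w *. b) * (A' b p v *. c)) *R R p c))" for v
   by(intro Ck_on_scaleR Ck_on_sum Ck_on_mult Ck_on_inner Suc Ak Ck_on_const)
  thus ?case by(intro Ck_on_SucI[OF dR]) (auto simp: R'_def)
 qed
 thus ?thesis using that[OF oN N(1,2) bij] by(simp add: smooth_on_def R_def)
qed

subsection \<open>Symmetry of mixed partial derivatives\<close>

lemma line_derivative:
 assumes "(f hfd f') (at (z + a *R v))"
 shows "((%a. f (z + a *R v)) hrd f' v) (at a)"
proof -
 have "((%a. z + a *R v) hfd (%t. t *R v)) (at a)" by(auto intro!: derivative_eq_intros)
 from has_derivative_compose[OF this assms] show ?thesis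
  using linear_scale[OF has_derivative_linear[OF assms]] by(simp add: has_field_derivative_def mult_commute_abs)
qed

text \<open>Mean value theorem for the second difference, first in direction v, then in direction w.
  With v and w exchanged it expresses the same second difference by the other mixed derivative; on a
  small parallelogram both are close to their values at x, which is Schwarz's theorem.\<close>

lemma mixed_partials_aux:
 fixes f :: "'a::real_normed_vector => real"
 assumes d1: "!!y. y : ball x r ==> (f hfd f' y) (at y)"
  and d2: "!!y. y : ball x r ==> ((%y. f' y v) hfd g y) (at y)"
  and h: "h > 0" "h * (norm v + norm w) < r"
 obtains p where "p : ball x r" "f (x + h *R v + h *R w) - f (x + h *R v) - f (x + h *R w) + f x = h * h * g p w"
proof -
 have inb: "x + a *R v + b *R w : ball x r" if "0 <= a" "a <= h" "0 <= b" "b <= h" for a b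
 proof -
  have "dist (x + a *R v + b *R w) x = norm (a *R v + b *R w)" by(simp add: dist_norm)
  also have "... <= a * norm v + b * norm w"
   using norm_triangle_ineq[of "a *R v" "b *R w"] that by simp
  also have "... <= h * norm v + h * norm w" using that by(intro add_mono mult_right_mono) auto
  finally show ?thesis using h by(simp add: dist_commute algebra_simps)
 qed
 define K where "K a = f (x + h *R w + a *R v) - f (x + a *R v)" for a
 have "(K hrd f' (x + h *R w + a *R v) v - f' (x + a *R v) v) (at a)" if "0 <= a" "a <= h" for a
  unfolding K_def using inb[of a h] inb[of a 0] that h(1)
  by(intro DERIV_diff line_derivative d1) (simp_all add: add_ac)
 from MVT2[OF h(1) this] obtain a where a: "0 < a" "a < h"
  "K h - K 0 = h * (f' (x + h *R w + a *R v) v - f' (x + a *R v) v)" by auto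
 have "((%b. f' (x + a *R v + b *R w) v) hrd g (x + a *R v + b *R w) w) (at b)" if "0 <= b" "b <= h" for b
  by(rule line_derivative[OF d2[OF inb]]) (use a that in auto)
 from MVT2[OF h(1) this] obtain b where b: "0 < b" "b < h"
  "f' (x + a *R v + h *R w) v - f' (x + a *R v + 0 *R w) v = h * g (x + a *R v + b *R w) w" by auto
 show ?thesis
  by(rule that[OF inb[of a b]]) (use a b in "auto simp: K_def add_ac")
qed

lemma mixed_partials:
 fixes f :: "'a::real_normed_vector => real"
 assumes S: "open S" "x : S"
  and d1: "!!y. y : S ==> (f hfd f' y) (at y)"
  and dv: "!!y. y : S ==> ((%y. f' y v) hfd gv y) (at y)"
  and dw: "!!y. y : S ==> ((%y. f' y w) hfd gw y) (at y)"
  and c: "con S (%y. gv y w)" "con S (%y. gw y v)"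
 shows "gv x w = gw x v"
proof(rule ccontr)
 define ep where "ep = \<bar>gv x w - gw x v\<bar> / 2"
 assume "gv x w ~= gw x v"
 hence ep: "ep > 0" by(simp add: ep_def)
 have "open (S Int (%y. gv y w) -` ball (gv x w) ep Int (S Int (%y. gw y v) -` ball (gw x v) ep))"
  using c S(1) by(intro open_Int continuous_open_preimage) auto
 then obtain r where r: "r > 0" "ball x r <= S Int (%y. gv y w) -` ball (gv x w) ep Int (S Int (%y. gw y v) -` ball (gw x v) ep)"
  using S(2) ep by(auto elim!: openE)
 define h where "h = r / (norm v + norm w + 1)"
 have n: "norm v + norm w + 1 > 0" by(simp add: add_nonneg_pos)
 have h: "h > 0" "h * (norm v + norm w) < r" using r(1) n by(simp_all add: h_def field_simps)
 have S': "y : S" if "y : ball x r" for y using r(2) that by blast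
 obtain p where p: "p : ball x r" "f (x + h *R v + h *R w) - f (x + h *R v) - f (x + h *R w) + f x = h * h * gv p w"
  using mixed_partials_aux[OF d1[OF S'] dv[OF S'] h] by blast
 have h': "h * (norm w + norm v) < r" using h(2) by(simp add: add.commute)
 obtain q where q: "q : ball x r" "f (x + h *R w + h *R v) - f (x + h *R w) - f (x + h *R v) + f x = h * h * gw q v"
  using mixed_partials_aux[OF d1[OF S'] dw[OF S'] h(1) h'] by blast
 have "h * h * gv p w = h * h * gw q v" using p(2) q(2) by(simp add: algebra_simps)
 hence "gv p w = gw q v" using h(1) by simp
 moreover have "dist (gv x w) (gv p w) < ep" "dist (gw x v) (gw q v) < ep" using r(2) p(1) q(1) by auto
 ultimately show False by(auto simp: ep_def dist_real_def abs_if split: if_splits)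
qed

section \<open>Ordinary differential equations with parameters\<close>

definition time_primitive :: "(real * 'p => 'z::real_normed_vector) => real * 'p => 'z" where
 "time_primitive f = (%(t,p). integral {0..1} (%s. t *R f (s * t,p)))"

lemma scaled_time_mem: "t : {-d<..<d} ==> s : {0..1} ==> s * t : {-d<..<d::real}"
proof -
 assume a: "t : {-d<..<d}" "s : {0..1}"
 have "\<bar>s * t\<bar> <= 1 * (abs t)" unfolding abs_mult using a by(intro mult_right_mono) auto
 thus ?thesis using a by auto
qed

lemma scaled_time_le: "s : {0..1} ==> \<bar>s * t\<bar> <= \<bar>t::real\<bar>"
 using mult_right_mono[of "(abs s)" 1 "(abs t)"] by(auto simp: abs_mult)

lemma time_primitive_cont_line:
 fixes f :: "real * 'p::topological_space => 'z::banach"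
 assumes "con (cyl d) f" "t : {-d<..<d}"
 shows "con {0..1} (%s. t *R f (s * t,p))"
proof -
 have "con {0..1} (%s. f (s * t,p))"
  by(rule continuous_on_compose2[OF assms(1)])
   (use scaled_time_mem[OF assms(2)] in "auto intro!: continuous_intros")
 thus ?thesis by(intro continuous_intros)
qed

lemma time_primitive_continuous:
 fixes f :: "real * 'p::real_normed_vector => 'z::banach"
 assumes "con (cyl d) f"
 shows "con (cyl d) (time_primitive f)"
proof -
 have "con ((cyl d) >< cbox 0 1) (%x. f (snd x * fst (fst x),snd (fst x)))"
  by(rule continuous_on_compose2[OF assms])
   (use scaled_time_mem[of _ d] in "auto intro!: continuous_intros")
 hence "con (({-d<..<d} >< (UNIV::'p set)) >< cbox (0::real) 1)
   (%(x,s). fst x *R f (s * fst x,snd x))"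
  unfolding split_beta by(intro continuous_intros)
 from integral_continuous_on_param[OF this]
 show ?thesis by(simp add: time_primitive_def split_beta cbox_interval)
qed

lemma time_primitive_deriv:
 fixes f :: "real * 'p::real_normed_vector => 'z::banach"
 assumes c: "con (cyl d) f" and t: "t : {-d<..<d}"
 shows "((%t. time_primitive f (t,p)) hvd f (t,p)) (at t)"
proof -
 obtain r where r: "(abs t) < r" "r < d" using dense[of "(abs t)" d] t by(auto simp: abs_less_iff)
 have "con {-r..r} (%s. f (s,p))"
  by(rule continuous_on_compose2[OF c]) (use r in "auto intro!: continuous_intros")
 then obtain g where g: "!!x. x : {-r..r} ==> (g hvd f (x,p)) (at x within {-r..r})"
  using antiderivative_continuous by blast
 have J: "time_primitive f (ta,p) = g ta - g 0" if ta: "ta : {-r..r}" for ta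
 proof -
  have img: "(%s. s * ta) ` {0..1} <= {-r..r}"
  proof
   fix y assume "y : (%s. s * ta) ` {0..1}"
   hence "(abs y) <= (abs ta)" using scaled_time_le[of _ ta] by blast
   thus "y : {-r..r}" using ta by auto
  qed
  have "((%s. g (s * ta)) hvd ta *R f (s * ta,p)) (at s within {0..1})" if s: "s : {0..1}" for s
  proof -
   have 1: "((%s. s * ta) hvd ta) (at s within {0..1})"
    by(auto intro!: derivative_eq_intros simp: hrd_hvd[symmetric])
   have "s * ta : {-r..r}" using img s by blast
   hence "(g hvd f (s * ta,p)) (at (s * ta) within (%s. s * ta) ` {0..1})"
    using has_vector_derivative_within_subset[OF g img] by simp
   from vector_diff_chain_within[OF 1 this] show ?thesis by(simp add: o_def)
  qed
  from fundamental_theorem_of_calculus[OF zero_le_one this]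
  have "((%s. ta *R f (s * ta,p)) has_integral (g (1 * ta) - g (0 * ta))) {0..1}" .
  from integral_unique[OF this] show ?thesis by(simp only: time_primitive_def prod.case mult_1 mult_zero_left)
 qed
 have "(g hvd f (t,p)) (at t)"
  using g[of t] r at_within_Icc_at[of "-r" t r] by(simp add: abs_less_iff)
 hence "((%ta. g ta - g 0) hvd f (t,p)) (at t)"
  by(auto intro!: derivative_eq_intros)
 thus ?thesis
  by(rule has_vector_derivative_transform_within_open[of _ _ _ "{-r<..<r}"]) (use r J in auto)
qed

lemma time_primitive_diff_bound:
 fixes f g :: "real * 'p::real_normed_vector => 'z::banach"
 assumes "con (cyl d) f" "con (cyl d) g" "t : {-d<..<d}"
  and b: "!!s. (abs s) <= (abs t) ==> norm (f (s,p) - g (s,p)) <= M"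
 shows "norm (time_primitive f (t,p) - time_primitive g (t,p)) <= (abs t) * M"
proof -
 have cf: "con {0..1} (%s. t *R f (s * t,p))" "con {0..1} (%s. t *R g (s * t,p))"
  using time_primitive_cont_line assms by blast+
 have "time_primitive f (t,p) - time_primitive g (t,p)
   = integral {0..1} (%s. t *R f (s * t,p) - t *R g (s * t,p))"
  unfolding time_primitive_def prod.case using cf
  by(subst integral_diff) (auto intro: integrable_continuous_interval)
 also have "norm ... <= ((abs t) * M) * (1 - 0)"
 proof(rule integral_bound)
  fix s :: real assume "s : {0..1}"
  hence "norm (f (s * t,p) - g (s * t,p)) <= M" using b scaled_time_le by blast
  thus "norm (t *R f (s * t,p) - t *R g (s * t,p)) <= (abs t) * M"
   by(simp add: scaleR_diff_right[symmetric] mult_left_mono)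
 qed (use cf in "auto intro: continuous_intros")
 finally show ?thesis by simp
qed

lemma time_primitive_0: "time_primitive f (0,p) = 0"
 by(simp add: time_primitive_def)

lemma ode_unique:
 fixes u1 u2 :: "real => 'z::real_inner"
 assumes S: "is_interval S" "s : S" "t : S"
  and Lip: "!!t z z'. t : S ==> norm (G t z - G t z') <= K * norm (z - z')"
  and d1: "!!t. t : S ==> (u1 hvd G t (u1 t)) (at t within S)"
  and d2: "!!t. t : S ==> (u2 hvd G t (u2 t)) (at t within S)"
  and "u1 s = u2 s"
 shows "u1 t = u2 t"
proof -
 have "u1 t - u2 t = 0"
  by(rule gronwall_vec[OF S,of "%t. u1 t - u2 t" "%t. G t (u1 t) - G t (u2 t)" K])
   (use assms in "auto intro!: has_vector_derivative_diff")
 thus ?thesis by simp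
qed

text \<open>Picard iteration with a parameter: \<open>K * d <= 1/2\<close> makes \<open>P\<close>
  contract by 1/2. The parameter space is not compact, so uniform convergence is shown on products
  with closed unit balls, which are compact by the Heine-Borel property.\<close>

lemma ode_exists:
 fixes G :: "real * 'p::{real_normed_vector,heine_borel} * 'z::banach => 'z"
 assumes dK: "d > 0" "K >= 0" "K * d <= 1/2"
  and cG: "con (cyl d) G"
  and Lip: "!!t p z z'. t : {-d<..<d} ==> norm (G (t,p,z) - G (t,p,z')) <= K * norm (z - z')"
  and cu0: "con UNIV u0"
 obtains u where "con (cyl d) u" "!!p. u (0,p) = u0 p"
  "!!t p. t : {-d<..<d} ==> ((%t. u (t,p)) hvd G (t,p,u (t,p))) (at t)"
proof -
 define I where "I = {-d<..<d}"
 define X where "X = I >< (UNIV :: 'p set)"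
 define S where "S u = (%x::real * 'p. G (fst x,snd x,u x))" for u
 define P where "P u = (%x. u0 (snd x) + time_primitive (S u) x)" for u
 define U where "U n = (P ^^ n) (%x. u0 (snd x))" for n
 have U0: "U 0 = (%x. u0 (snd x))" and US: "U (Suc n) = P (U n)" for n by(simp_all add: U_def)
 have cS: "con X (S u)" if "con X u" for u
  unfolding S_def by(rule continuous_on_compose2[OF cG])
   (use that in "auto intro!: continuous_intros simp: X_def I_def")
 have cu0': "con X (%x. u0 (snd x))"
  by(rule continuous_on_compose2[OF cu0]) (auto intro!: continuous_intros)
 have cP: "con X (P u)" if "con X u" for u
  unfolding P_def using time_primitive_continuous[of d] cS[OF that] cu0'
  by(intro continuous_on_add) (auto simp: X_def I_def)
 have cU: "con X (U n)" for n
  by(induction n) (simp_all add: U0 US cP cu0')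
 \<comment> \<open>The estimate at (t,p) uses only the same p and times s with |s| at most |t|, so
   it can be iterated inside each compact box.\<close>
 have PP: "norm (P u (t,p) - P v (t,p)) <= (1/2) * M"
  if t: "t : I" and cuv: "con X u" "con X v"
   and b: "!!s. (abs s) <= (abs t) ==> norm (u (s,p) - v (s,p)) <= M" for u v t p M
 proof -
  have M0: "M >= 0" using b[of t] norm_ge_zero order_trans by blast
  have "norm (time_primitive (S u) (t,p) - time_primitive (S v) (t,p)) <= (abs t) * (K * M)"
  proof(rule time_primitive_diff_bound[of d])
   fix s assume s: "(abs s) <= (abs t)"
   hence "s : {-d<..<d}" using t by(auto simp: I_def)
   hence "norm (S u (s,p) - S v (s,p)) <= K * norm (u (s,p) - v (s,p))"
    using Lip by(simp add: S_def)
   also have "... <= K * M" using b[OF s] dK by(intro mult_left_mono)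
   finally show "norm (S u (s,p) - S v (s,p)) <= K * M" .
  qed (use cS cuv t in "auto simp: X_def I_def")
  also have "... <= d * (K * M)" using t dK M0 by(intro mult_right_mono) (auto simp: I_def)
  also have "... = (K * d) * M" by simp
  also have "... <= (1/2) * M" using dK M0 by(intro mult_right_mono)
  finally show ?thesis by(simp add: P_def)
 qed
 define f where "f n x = U (Suc n) x - U n x" for n x
 define u where "u x = U 0 x + (\<Sum>n. f n x)" for x
 have sumf: "U n x = U 0 x + (SUM i<n. f i x)" for n x
  by(induction n) (auto simp: f_def)
 have unif: "uniform_limit ({-r..r} >< cball p 1) U u sequentially" if r: "0 < r" "r < d" for r p
 proof -
  let ?A = "{-r..r} >< cball p 1"
  have sub: "?A <= X" using r by(auto simp: X_def I_def)
  have "compact ?A" by(intro compact_Times) auto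
  moreover have "con ?A (f 0)" unfolding f_def
   using cU continuous_on_subset[OF _ sub] by(intro continuous_on_diff) auto
  ultimately have "compact (f 0 ` ?A)" by(rule compact_continuous_image[rotated])
  hence "bounded (f 0 ` ?A)" by(rule compact_imp_bounded)
  then obtain M where M: "!!x. x : ?A ==> norm (f 0 x) <= M"
   unfolding bounded_iff by blast
  have fn: "norm (f n x) <= M * (1/2) ^ n" if "x : ?A" for n x
   using that
  proof(induction n arbitrary: x)
   case 0 thus ?case using M by simp
  next
   case (Suc n)
   obtain t q where x: "x = (t,q)" by fastforce
   have "norm (P (U (Suc n)) (t,q) - P (U n) (t,q)) <= (1/2) * (M * (1/2) ^ n)"
   proof(rule PP)
    show "t : I" using Suc.prems x r by(auto simp: I_def)
    fix s assume "(abs s) <= (abs t)"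
    hence "(s,q) : ?A" using Suc.prems x by auto
    from Suc.IH[OF this] show "norm (U (Suc n) (s,q) - U n (s,q)) <= M * (1/2) ^ n"
     by(simp add: f_def)
   qed (rule cU)+
   thus ?case by(simp add: f_def US x)
  qed
  have "uniform_limit ?A (%n x. SUM i<n. f i x) (%x. \<Sum>i. f i x) sequentially"
   by(rule Weierstrass_m_test[OF fn]) (assumption,rule summable_mult,rule summable_geometric,simp)
  hence "uniform_limit ?A (%n x. U 0 x + (SUM i<n. f i x)) u sequentially"
   unfolding u_def by(intro uniform_limit_add uniform_limit_const)
  moreover have "(%n x. U 0 x + (SUM i<n. f i x)) = U" by(intro ext) (rule sumf[symmetric])
  ultimately show ?thesis by(simp only:)
 qed
 have cu: "con X u"
 proof(rule continuous_at_imp_continuous_on,safe)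
  fix t p assume "(t,p) : X"
  then obtain r where r: "(abs t) < r" "r < d" using dense[of "(abs t)" d] by(auto simp: X_def I_def abs_less_iff)
  have "con ({-r..r} >< cball p 1) u"
  proof(rule uniform_limit_theorem[OF _ unif])
   have "{-r..r} >< cball p 1 <= X" using r by(auto simp: X_def I_def)
   thus "\<forall>\<^sub>F n in sequentially. con ({-r..r} >< cball p 1) (U n)"
    by(intro always_eventually allI continuous_on_subset[OF cU])
  qed (use r in simp_all)
  hence "con ({-r<..<r} >< ball p 1) u"
   by(rule continuous_on_subset) auto
  moreover have "open ({-r<..<r} >< ball p 1)" by(intro open_Times) auto
  moreover have "(t,p) : {-r<..<r} >< ball p 1" using r by auto
  ultimately show "isCont u (t,p)" using continuous_on_eq_continuous_at by blast
 qed
 have fix_pt: "u (t,p) = P u (t,p)" if t: "t : I" for t p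
 proof -
  obtain r where r: "(abs t) < r" "r < d" using dense[of "(abs t)" d] t by(auto simp: I_def abs_less_iff)
  have r0: "0 < r" using r by linarith
  have ul: "uniform_limit ({-r..r} >< cball p 1) U u sequentially" by(rule unif[OF r0 r(2)])
  have "(%n. U (Suc n) (t,p)) \<longlonglongrightarrow> u (t,p)"
   using tendsto_uniform_limitI[OF ul,of "(t,p)"] r by(intro LIMSEQ_Suc) (simp add: abs_less_iff)
  moreover have "(%n. U (Suc n) (t,p)) \<longlonglongrightarrow> P u (t,p)"
  proof(rule metric_LIMSEQ_I)
   fix e :: real assume e: "e > 0"
   from uniform_limitD[OF ul e] obtain N where
    N: "!!n x. n >= N ==> x : {-r..r} >< cball p 1 ==> dist (U n x) (u x) < e"
    unfolding eventually_sequentially by blast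
   have "dist (U (Suc n) (t,p)) (P u (t,p)) < e" if n: "n >= N" for n
   proof -
    have "norm (P (U n) (t,p) - P u (t,p)) <= (1/2) * e"
     by(rule PP[OF t cU cu]) (use N[OF n] r in "auto simp: dist_norm less_imp_le")
    thus ?thesis using e by(simp add: US dist_norm)
   qed
   thus "EX N. ALL n>=N. dist (U (Suc n) (t,p)) (P u (t,p)) < e" by blast
  qed
  ultimately show ?thesis using LIMSEQ_unique by blast
 qed
 have der: "((%t. u (t,p)) hvd G (t,p,u (t,p))) (at t)" if t: "t : I" for t p
 proof -
  have "((%t. time_primitive (S u) (t,p)) hvd S u (t,p)) (at t)"
   using time_primitive_deriv[of d "S u" t p] cS[OF cu] t by(auto simp: X_def I_def)
  hence "((%t. P u (t,p)) hvd G (t,p,u (t,p))) (at t)"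
   unfolding P_def by(auto intro!: derivative_eq_intros simp: S_def)
  thus ?thesis
   by(rule has_vector_derivative_transform_within_open[of _ _ _ I]) (use t fix_pt in "auto simp: I_def")
 qed
 show ?thesis
 proof(rule that)
  show "u (0,p) = u0 p" for p using fix_pt[of 0 p] dK by(simp add: I_def P_def time_primitive_0)
 qed (use cu der in "auto simp: X_def I_def")
qed

text \<open>The Lipschitz bound is asked along w only: the right-hand sides below are Lipschitz in
  the unknown, while no such bound is assumed in the parameter.\<close>

lemma directional_lipschitz:
 fixes G :: "'a::real_normed_vector => 'b::real_normed_vector"
 assumes d: "(G hfd G') (at x)"
  and L: "!!h. norm (G (x + h *R w) - G x) <= (abs h) * M"
 shows "norm (G' w) <= M"
proof(cases "w = 0")
 case True
 have "0 <= M" using order_trans[OF norm_ge_zero L[of 1]] by simp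
 thus ?thesis using True linear_0[OF has_derivative_linear[OF d]] by simp
next
 case False
 show ?thesis
 proof(rule field_le_epsilon)
  fix e :: real assume e: "e > 0"
  define e' where "e' = e / norm w"
  have e': "e' > 0" using e False by(simp add: e'_def)
  obtain r where r: "r > 0" "!!y. norm (y - x) < r ==> norm (G y - G x - G' (y - x)) <= e' * norm (y - x)"
   using d e' unfolding has_derivative_at_alt by blast
  define h where "h = r / (2 * norm w)"
  have h: "h > 0" "norm (h *R w) < r" using r False by(auto simp: h_def)
  have "norm (G (x + h *R w) - G x - G' (h *R w)) <= e' * norm (h *R w)"
   using r(2)[of "x + h *R w"] h by simp
  moreover have "norm (G' (h *R w)) <= norm (G (x + h *R w) - G x) + norm (G (x + h *R w) - G x - G' (h *R w))"
   by(metis norm_minus_commute norm_triangle_sub)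
  ultimately have "norm (G' (h *R w)) <= h * M + e' * (h * norm w)" using L[of h] h by simp
  moreover have "G' (h *R w) = h *R G' w" using has_derivative_linear[OF d] by(simp add: linear_scale)
  ultimately have "h * norm (G' w) <= h * (M + e' * norm w)" using h by(simp add: algebra_simps)
  hence "norm (G' w) <= M + e' * norm w" using h by simp
  thus "norm (G' w) <= M + e" using False by(simp add: e'_def)
 qed
qed

lemma continuous_on_derivative_joint:
 fixes G' :: "'a::topological_space => 'b::real_inner => 'c::real_normed_vector"
 assumes fd: "finite_dim TYPE('b)"
  and c: "!!v. con S (%x. G' x v)" and l: "!!x. x : S ==> linear (G' x)"
  and f: "con T f" "f ` T <= S" "con T g"
 shows "con T (%y. G' (f y) (g y))"
proof -
 obtain B :: "'b set" where B: "onb B" using onb_exists[OF fd] .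
 have "con T (%y. G' (f y) b)" for b
  using continuous_on_compose2[OF c f(1,2)] .
 hence "con T (%y. SUM b:B. (g y *. b) *R G' (f y) b)"
  by(intro continuous_intros f)
 moreover have "(SUM b:B. (g y *. b) *R G' (f y) b) = G' (f y) (g y)" if "y : T" for y
 proof -
  have "f y : S" using f(2) that by auto
  from linear_onb_expand[OF B l[OF this],of "g y"] show ?thesis by(rule sym)
 qed
 ultimately show ?thesis
  using continuous_on_cong[OF refl,of T "%y. SUM b:B. (g y *. b) *R G' (f y) b" "%y. G' (f y) (g y)"]
  by blast
qed

lemma has_vector_derivative_swap_diff_quot:
 fixes u :: "real => 'z::real_normed_vector"
 assumes "(u hvd a) F" "(v hvd b) F"
 shows "((%t. (u t - v t) /\<^sub>R h) hvd (a - b) /\<^sub>R h) F"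
 using has_vector_derivative_scaleR[of "%_. inverse h" 0 _ UNIV] bounded_linear.has_vector_derivative[OF bounded_linear_scaleR_right
  has_vector_derivative_diff[OF assms]] by simp

text \<open>Difference quotients of u in the parameter solve an ODE of their own. Its right-hand
  side \<open>R\<close> averages G' along a segment and stays continuous at h = 0, where it is the
  variational equation. So continuous dependence, with h among the parameters, yields the
  derivative. The equation for W has the same shape as the one for u, and the affine initial values
  \<open>l p + c\<close> cover both.\<close>

lemma ode_C1:
 fixes G :: "real * 'p::{real_inner,heine_borel} * 'z::{real_inner,banach} => 'z"
 assumes fd: "finite_dim TYPE('p)" "finite_dim TYPE('z)"
  and dK: "d > 0" "K >= 0" "K * d <= 1/2"
  and dG: "!!x. x : cyl d ==> (G hfd G' x) (at x)"
  and cG': "!!v. con (cyl d) (%x. G' x v)"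
  and Lip: "!!t p z z'. t : {-d<..<d} ==> norm (G (t,p,z) - G (t,p,z')) <= K * norm (z - z')"
  and cu: "con (cyl d) u" and l: "bounded_linear l" and u0: "!!p. u (0,p) = l p + c"
  and du: "!!t p. t : {-d<..<d} ==> ((%t. u (t,p)) hvd G (t,p,u (t,p))) (at t)"
 obtains W where
  "!!v. con (cyl d) (W v)" "!!v p. W v (0,p) = l v"
  "!!v t p. t : {-d<..<d} ==>
    ((%t. W v (t,p)) hvd G' (t,p,u (t,p)) (0,v,W v (t,p))) (at t)"
  "!!t p. t : {-d<..<d} ==>
    (u hfd (%(ta,v). ta *R G (t,p,u (t,p)) + W v (t,p))) (at (t,p))"
  "!!t p z. t : {-d<..<d} ==> norm (G' (t,p,u (t,p)) (0,0,z)) <= K * norm z"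
proof -
 define I where "I = {-d<..<d}"
 have oI: "open I" by(simp add: I_def)
 have fd3: "finite_dim TYPE(real * 'p * 'z)"
  by(intro fd_prod fd_real fd)
 have lG': "linear (G' x)" if "x : I >< UNIV" for x
  by(rule has_derivative_linear[OF dG]) (use that in "auto simp: I_def")
 have cGG: "con T (%y. G' (f y) (g y))"
  if "con T f" "f ` T <= I >< UNIV" "con T g" for T :: "'w::topological_space set" and f g
  by(rule continuous_on_derivative_joint[OF fd3 _ lG' that]) (use cG' in "simp add: I_def")
 have KG': "norm (G' (t,p,z) (0,0,w)) <= K * norm w" if t: "t : I" for t p z w
 proof(rule directional_lipschitz[OF dG])
  show "(t,p,z) : cyl d" using t by(simp add: I_def)
  fix h show "norm (G ((t,p,z) + h *R (0,0,w)) - G (t,p,z)) <= (abs h) * (K * norm w)"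
   using Lip[of t p "z + h *R w" z] t by(simp add: I_def mult.left_commute)
 qed
 have cuI: "con (I >< UNIV) u" using cu by(simp add: I_def)
 have cuc: "con T (%y. u (f y))"
  if "con T f" "f ` T <= I >< UNIV" for T :: "'w::topological_space set" and f
  by(rule continuous_on_compose2[OF cuI that])
 \<comment> \<open>The segment from the solution point over p to the one over p + h v. When z is the
   difference quotient of u, the average of G' along it is that of G.\<close>
 define base where "base t p h v th = (t,p + (th * h) *R v,u (t,p) + th *R (u (t,p + h *R v) - u (t,p)))"
  for t :: real and p :: 'p and h :: real and v :: 'p and th :: real
 define R where "R x = (case x of (t,(p,h,v),z) =>
   integral {0..1} (%th. G' (base t p h v th) (0,v,z)))" for x :: "real * ('p * real * 'p) * 'z"
 have cR: "con (I >< UNIV) R"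
 proof -
  have "con ((I >< UNIV) >< cbox 0 1)
    (%(x,th). G' (base (fst x) (fst (fst (snd x))) (fst (snd (fst (snd x)))) (snd (snd (fst (snd x)))) th)
     (0,snd (snd (fst (snd x))),snd (snd x)) :: 'z)"
   unfolding split_beta base_def
   by(rule cGG) (auto intro!: continuous_intros cuc)
  from integral_continuous_on_param[OF this]
  show ?thesis by(simp add: R_def split_beta cbox_interval)
 qed
 have cl: "con {0..1} (%th. G' (base t p h v th) (0,v,z))" if "t : I" for t p h v z
  unfolding base_def by(rule cGG) (use that in "auto intro!: continuous_intros")
 have LipR: "norm (R (t,q,z) - R (t,q,z')) <= K * norm (z - z')" if t: "t : {-d<..<d}" for t q z z'
 proof -
  obtain p h v where q: "q = (p,h,v)" by(cases q) auto
  have tI: "t : I" using t by(simp add: I_def)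
  have "R (t,q,z) - R (t,q,z') = integral {0..1} (%th. G' (base t p h v th) (0,v,z) - G' (base t p h v th) (0,v,z'))"
   unfolding R_def q prod.case using cl[OF tI]
   by(subst integral_diff) (auto intro: integrable_continuous_interval)
  also have "norm ... <= K * norm (z - z') * (1 - 0)"
  proof(rule integral_bound)
   fix th :: real
   have m: "base t p h v th : I >< UNIV" using tI by(simp add: base_def)
   have "G' (base t p h v th) (0,v,z) - G' (base t p h v th) (0,v,z') = G' (base t p h v th) (0,0,z - z')"
    using linear_diff[OF lG'[OF m],of "(0,v,z)" "(0,v,z')"] by simp
   thus "norm (G' (base t p h v th) (0,v,z) - G' (base t p h v th) (0,v,z')) <= K * norm (z - z')"
    using KG'[OF tI] by(simp add: base_def)
  qed (use cl[OF tI] in "auto intro: continuous_intros")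
  finally show ?thesis by simp
 qed
 have cl0: "con UNIV (%q::'p * real * 'p. l (snd (snd q)))"
  by(intro bounded_linear.continuous_on[OF l] continuous_intros)
 obtain V where V: "con (I >< UNIV) V" "!!q. V (0,q) = l (snd (snd q))"
  "!!t q. t : I ==> ((%t. V (t,q)) hvd R (t,q,V (t,q))) (at t)"
  using ode_exists[OF dK cR[unfolded I_def] LipR cl0] unfolding I_def by blast
 have I0: "0 : I" "is_interval I" using dK by(auto simp: I_def)
 \<comment> \<open>For h nonzero the difference quotient and V solve the same initial value
   problem.\<close>
 have quot: "u (t,p + h *R v) - u (t,p) = h *R V (t,p,h,v)" if t: "t : I" for t p h v
 proof(cases "h = 0")
  case False
  define D where "D t = (u (t,p + h *R v) - u (t,p)) /\<^sub>R h" for t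
  have "D t = V (t,p,h,v)"
  proof(rule ode_unique[OF I0(2,1) t,of "%t z. R (t,(p,h,v),z)" K])
   fix ta assume ta: "ta : I"
   have ta': "ta : {-d<..<d}" using ta by(simp add: I_def)
   have "((%th. G (base ta p h v th)) hvd
     G' (base ta p h v th) (h *R (0,v,D ta))) (at th within {0..1})" for th
   proof -
    have b: "(base ta p h v hfd (%r. r *R (h *R (0,v,D ta)))) (at th within {0..1})"
     unfolding base_def using False
     by(auto intro!: derivative_eq_intros has_derivative_Pair simp: D_def mult.commute)
    have m: "base ta p h v th : cyl d" using ta' by(simp add: base_def)
    have "((%th. G (base ta p h v th)) hfd (%r. G' (base ta p h v th) (r *R (h *R (0,v,D ta))))) (at th within {0..1})"
     by(rule has_derivative_compose[OF b dG[OF m]])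
    thus ?thesis
     by(simp only: has_vector_derivative_def linear_scale[OF has_derivative_linear[OF dG[OF m]],symmetric])
   qed
   from fundamental_theorem_of_calculus[OF zero_le_one this]
   have "((%th. G' (base ta p h v th) (h *R (0,v,D ta))) has_integral
     G (base ta p h v 1) - G (base ta p h v 0)) {0..1}" .
   moreover have "G' (base ta p h v th) (h *R (0,v,D ta)) = h *R G' (base ta p h v th) (0,v,D ta)" for th
    by(rule linear_scale[OF lG']) (use ta in "simp add: base_def")
   ultimately have HI: "((%th. h *R G' (base ta p h v th) (0,v,D ta)) has_integral
     G (base ta p h v 1) - G (base ta p h v 0)) {0..1}" by(simp only:)
   have "integral {0..1} (%th. h *R G' (base ta p h v th) (0,v,D ta)) =
     G (base ta p h v 1) - G (base ta p h v 0)" by(rule integral_unique[OF HI])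
   hence "h *R R (ta,(p,h,v),D ta) = G (ta,p + h *R v,u (ta,p + h *R v)) - G (ta,p,u (ta,p))"
    by(simp add: R_def base_def)
   hence "R (ta,(p,h,v),D ta) = (G (ta,p + h *R v,u (ta,p + h *R v)) - G (ta,p,u (ta,p))) /\<^sub>R h"
    using False by(metis scaleR_scaleR left_inverse scaleR_one)
   moreover have "(D hvd (G (ta,p + h *R v,u (ta,p + h *R v)) - G (ta,p,u (ta,p))) /\<^sub>R h) (at ta within I)"
    unfolding D_def
    by(intro has_vector_derivative_swap_diff_quot has_vector_derivative_at_within[OF du] ta')
   ultimately show "(D hvd R (ta,(p,h,v),D ta)) (at ta within I)" by simp
   show "((%t. V (t,p,h,v)) hvd R (ta,(p,h,v),V (ta,p,h,v))) (at ta within I)"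
    using V(3)[OF ta,of "(p,h,v)"] by(rule has_vector_derivative_at_within)
   show "norm (R (ta,(p,h,v),z) - R (ta,(p,h,v),z')) <= K * norm (z - z')" for z z'
    by(rule LipR[OF ta'])
  next
   show "D 0 = V (0,p,h,v)"
    using False linear_add[OF bounded_linear.linear[OF l]] linear_scale[OF bounded_linear.linear[OF l]]
    by(simp add: D_def u0 V(2))
  qed
  hence "h *R V (t,p,h,v) = h *R D t" by simp
  thus ?thesis using False by(simp add: D_def)
 qed simp
 define W where "W v x = V (fst x,snd x,0,v)" for v and x :: "real * 'p"
 have W1: "con (I >< UNIV) (W v)" for v
  unfolding W_def by(rule continuous_on_compose2[OF V(1)]) (auto intro!: continuous_intros)
 have W2: "W v (0,p) = l v" for v p by(simp add: W_def V(2))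
 have W3: "((%t. W v (t,p)) hvd G' (t,p,u (t,p)) (0,v,W v (t,p))) (at t)" if "t : I" for v t p
  using V(3)[OF that,of "(p,0,v)"] by(simp add: W_def R_def base_def)
 have linW: "linear (%v. W v (t,p))" if t: "t : I" for t p
 proof -
  have lin: "W (r *R v + v') (t,p) = r *R W v (t,p) + W v' (t,p)" for r v v'
  proof -
   define E where "E t = W (r *R v + v') (t,p) - (r *R W v (t,p) + W v' (t,p))" for t
   have "E t = 0"
   proof(rule gronwall_vec[OF I0(2,1) t,of E "%t. G' (t,p,u (t,p)) (0,0,E t)" K])
    fix ta assume ta: "ta : I"
    have lg: "linear (G' (ta,p,u (ta,p)))" using lG' ta by simp
    let ?g = "G' (ta,p,u (ta,p))"
    have "(E hvd (?g (0,r *R v + v',W (r *R v + v') (ta,p))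
      - (r *R ?g (0,v,W v (ta,p)) + ?g (0,v',W v' (ta,p))))) (at ta within I)"
     unfolding E_def
     by(intro has_vector_derivative_diff has_vector_derivative_add
       bounded_linear.has_vector_derivative[OF bounded_linear_scaleR_right]
       has_vector_derivative_at_within[OF W3] ta)
    moreover have "?g (0,r *R v + v',W (r *R v + v') (ta,p))
      - (r *R ?g (0,v,W v (ta,p)) + ?g (0,v',W v' (ta,p))) = ?g (0,0,E ta)"
     unfolding linear_scale[OF lg,symmetric] linear_add[OF lg,symmetric] linear_diff[OF lg,symmetric]
     by(simp add: E_def)
    ultimately show "(E hvd ?g (0,0,E ta)) (at ta within I)" by simp
    show "norm (?g (0,0,E ta)) <= K * norm (E ta)" by(rule KG'[OF ta])
   next
    show "E 0 = 0"
     using linear_add[OF bounded_linear.linear[OF l]] linear_scale[OF bounded_linear.linear[OF l]]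
     by(simp add: E_def W2)
   qed
   thus ?thesis by(simp add: E_def)
  qed
  have lin0: "W 0 (t,p) = 0" using lin[of 1 0 0] by simp
  show ?thesis
  proof(rule linearI)
   show "W (a + b) (t,p) = W a (t,p) + W b (t,p)" for a b using lin[of 1 a b] by simp
   show "W (r *R a) (t,p) = r *R W a (t,p)" for r a using lin[of r a 0] lin0 by simp
  qed
 qed
 have dp: "((%p. u (t,p)) hfd (%v. W v (t,p))) (at p)" if t: "t : I" for t p
  unfolding has_derivative_at_alt
 proof(intro conjI allI impI)
  show "bounded_linear (%v. W v (t,p))" by(rule linear_bounded_fd[OF fd(1) linW[OF t]])
  fix e :: real assume e: "e > 0"
  \<comment> \<open>Uniform continuity on this compact set makes the convergence of the quotients
    uniform in the unit direction v, hence gives a Frechet derivative.\<close>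
  let ?C = "{-1..1::real} >< cball (0::'p) 1"
  have "con ?C (%x. V (t,p,fst x,snd x))"
   by(rule continuous_on_compose2[OF V(1)]) (use t in "auto intro!: continuous_intros")
  moreover have "compact ?C" by(intro compact_Times) auto
  ultimately have "uniformly_continuous_on ?C (%x. V (t,p,fst x,snd x))"
   by(rule compact_uniformly_continuous)
  then obtain r where r: "r > 0" "!!x y. x : ?C ==> y : ?C ==> dist y x < r ==>
    dist (V (t,p,fst y,snd y)) (V (t,p,fst x,snd x)) < e"
   using e unfolding uniformly_continuous_on_def by metis
  show "EX d>0. ALL y. norm (y - p) < d --> norm (u (t,y) - u (t,p) - W (y - p) (t,p)) <= e * norm (y - p)"
  proof(intro exI[of _ "min r 1"] conjI allI impI)
   fix y assume y: "norm (y - p) < min r 1"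
   show "norm (u (t,y) - u (t,p) - W (y - p) (t,p)) <= e * norm (y - p)"
   proof(cases "y = p")
    case True thus ?thesis using linear_0[OF linW[OF t]] by simp
   next
    case False
    define h where "h = norm (y - p)"
    define v where "v = (y - p) /\<^sub>R h"
    have h: "h > 0" "h < r" "h < 1" using False y by(auto simp: h_def)
    have v: "norm v = 1" "y - p = h *R v" using h by(auto simp: v_def h_def)
    hence yp: "y = p + h *R v" by(metis add.commute diff_add_cancel)
    have "u (t,y) - u (t,p) - W (y - p) (t,p) = h *R (V (t,p,h,v) - V (t,p,0,v))"
     unfolding v(2) linear_scale[OF linW[OF t]] unfolding yp quot[OF t]
     by(simp add: W_def scaleR_diff_right)
    moreover have "dist (V (t,p,h,v)) (V (t,p,0,v)) < e"
     using r(2)[of "(0,v)" "(h,v)"] h v by(simp add: dist_prod_def)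
    ultimately show ?thesis using h by(simp add: dist_norm h_def[symmetric])
   qed
  qed (use r in auto)
 qed
 have djoint: "(u hfd (%(ta,v). ta *R G (t,p,u (t,p)) + W v (t,p))) (at (t,p))" if t: "t : I" for t p
 proof -
  have cG: "con (cyl d) G"
   by(rule continuous_at_imp_continuous_on) (use dG has_derivative_continuous in blast)
  \<comment> \<open>Continuity of the time derivative joins the two partial derivatives into a total
    one.\<close>
  have cGu: "con (UNIV >< I) (%x. G (snd x,fst x,u (snd x,fst x)))"
   by(rule continuous_on_compose2[OF cG])
    (auto simp: I_def intro!: continuous_intros cuc[unfolded I_def])
  have "((%(p,t). u (t,p)) hfd (%(v,ta). W v (t,p) + blinfun_scaleR_left (G (t,p,u (t,p))) ta))
    (at (p,t) within UNIV >< I)"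
  proof(rule has_derivative_partialsI[where fx = "%v. W v (t,p)"
     and fy = "%p t. blinfun_scaleR_left (G (t,p,u (t,p)))"])
   show "((%x. u (t,x)) hfd (%v. W v (t,p))) (at p)"
    by(rule dp[OF t])
   show "((%t. u (t,p)) hfd blinfun_apply (blinfun_scaleR_left (G (t,p,u (t,p))))) (at t within I)"
    if "t : I" for p t
    using du[of t p] that unfolding has_vector_derivative_def I_def
    by(auto simp: has_derivative_at_withinI)
   have "con (UNIV >< I) (%(x,y). blinfun_scaleR_left (G (y,x,u (y,x))))"
    unfolding split_beta
    by(intro bounded_linear.continuous_on[OF bounded_linear_blinfun_scaleR_left] cGu)
   thus "continuous (at (p,t) within UNIV >< I) (%(x,y). blinfun_scaleR_left (G (y,x,u (y,x))))"
    using t by(auto simp: continuous_on_eq_continuous_within)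
   show "convex I" by(simp add: I_def)
  qed (use t in auto)
  hence "((%(p,t). u (t,p)) hfd (%(v,ta). W v (t,p) + ta *R G (t,p,u (t,p)))) (at (p,t))"
   using at_within_open[of "(p,t)" "UNIV >< I"] t oI by(simp add: open_Times)
  hence D1: "((%x. u (snd x,fst x)) hfd (%w. W (fst w) (t,p) + snd w *R G (t,p,u (t,p)))) (at (p,t))"
   by(simp add: case_prod_beta')
  have D2: "((%x. (snd x,fst x)) hfd (%x. (snd x,fst x))) (at (t,p))"
   by(intro has_derivative_Pair has_derivative_snd has_derivative_fst has_derivative_ident)
  have "((%x. u (snd (snd x,fst x),fst (snd x,fst x))) hfd
    (%x. W (fst (snd x,fst x)) (t,p) + snd (snd x,fst x) *R G (t,p,u (t,p)))) (at (t,p))"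
   by(rule has_derivative_compose[OF D2]) (use D1 in simp)
  thus ?thesis by(simp add: case_prod_beta' add.commute)
 qed
 show ?thesis
  by(rule that[of W]) (use W1 W2 W3 djoint KG' in "auto simp: I_def")
qed

text \<open>Induction over all G and u at once: if u is C^k, so is the right-hand side of the
  linearised equation, hence W is C^k by the induction hypothesis, and the derivative of u is built
  from W and from G along u.\<close>

lemma ode_Ck:
 fixes G :: "real * 'p::{real_inner,heine_borel} * 'z::{real_inner,banach} => 'z"
 assumes fd: "finite_dim TYPE('p)" "finite_dim TYPE('z)"
  and dK: "d > 0" "K >= 0" "K * d <= 1/2"
  and "Ck_on k (cyl d) G"
  and "!!t p z z'. t : {-d<..<d} ==> norm (G (t,p,z) - G (t,p,z')) <= K * norm (z - z')"
  and "con (cyl d) u" and "bounded_linear l" and "!!p. u (0,p) = l p + c"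
  and "!!t p. t : {-d<..<d} ==> ((%t. u (t,p)) hvd G (t,p,u (t,p))) (at t)"
 shows "Ck_on k (cyl d) u"
 using assms(6-)
proof(induction k arbitrary: G u l c)
 case 0 thus ?case by simp
next
 case (Suc k)
 define X where "X = {-d<..<d} >< (UNIV :: 'p set)"
 obtain G' where G': "!!x. x : cyl d ==> (G hfd G' x) (at x)"
  "!!v. Ck_on k (cyl d) (%x. G' x v)"
  using Ck_on_SucE[OF Suc.prems(1)] by blast
 obtain W where W:
  "!!v. con (cyl d) (W v)" "!!v p. W v (0,p) = l v"
  "!!v t p. t : {-d<..<d} ==>
    ((%t. W v (t,p)) hvd G' (t,p,u (t,p)) (0,v,W v (t,p))) (at t)"
  "!!t p. t : {-d<..<d} ==>
    (u hfd (%(ta,v). ta *R G (t,p,u (t,p)) + W v (t,p))) (at (t,p))"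
  "!!t p z. t : {-d<..<d} ==> norm (G' (t,p,u (t,p)) (0,0,z)) <= K * norm z"
  using ode_C1[OF fd dK G'(1) Ck_on_imp_continuous[OF G'(2)] Suc.prems(2-6)] by blast
 have Gk: "Ck_on k (cyl d) G" using Suc.prems(1) by(rule Ck_on_SucD)
 have uk: "Ck_on k X u" unfolding X_def by(rule Suc.IH[OF Gk Suc.prems(2-6)])
 have fd3: "finite_dim TYPE(real * 'p * 'z)"
  by(intro fd_prod fd_real fd)
 obtain B :: "(real * 'p * 'z) set" where B: "onb B" using onb_exists[OF fd3] .
 have Wk: "Ck_on k X (W v)" for v
 proof -
  define G2 where "G2 x = (case x of (t,p,z) => G' (t,p,u (t,p)) (0,v,z))" for x
  have "Ck_on k (cyl d) (%x. SUM b:B. ((0,v,snd (snd x)) *. b) *R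
    G' (fst x,fst (snd x),u (fst x,fst (snd x))) b)"
  proof(intro Ck_on_sum Ck_on_scaleR Ck_on_inner Ck_on_const Ck_on_Pair)
   have ls: "Ck_on k S (%x. snd (snd x))" "Ck_on k S (%x. fst x)" "Ck_on k S (%x. fst (snd x))"
    for S :: "(real * 'p * 'z) set"
    by(auto intro!: Ck_on_bounded_linear bounded_linear_intros)
   show "Ck_on k ({-d<..<d} >< (UNIV::('p * 'z) set)) (%x. snd (snd x))" by(rule ls)
   fix b
   have "Ck_on k ({-d<..<d} >< (UNIV::('p * 'z) set)) (%x. u (fst x,fst (snd x)))"
    by(rule Ck_on_compose[OF fd_prod[OF fd_real fd(1)] uk])
     (auto intro!: Ck_on_Pair ls simp: X_def)
   thus "Ck_on k ({-d<..<d} >< (UNIV::('p * 'z) set)) (%x. G' (fst x,fst (snd x),u (fst x,fst (snd x))) b)"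
    by(intro Ck_on_compose[OF fd3 G'(2)] Ck_on_Pair ls) auto
  qed
  hence "Ck_on k (cyl d) G2"
  proof(rule Ck_on_cong[rotated 2])
   fix x :: "real * 'p * 'z" assume x: "x : cyl d"
   have "linear (G' (fst x,fst (snd x),u (fst x,fst (snd x))))"
    by(rule has_derivative_linear[OF G'(1)]) (use x in auto)
   from linear_onb_expand[OF B this,of "(0,v,snd (snd x))", symmetric]
   show "(SUM b:B. ((0,v,snd (snd x)) *. b) *R G' (fst x,fst (snd x),u (fst x,fst (snd x))) b) = G2 x"
    by(simp add: G2_def split_beta)
  qed (auto intro: open_Times)
  moreover have "norm (G2 (t,p,z) - G2 (t,p,z')) <= K * norm (z - z')" if t: "t : {-d<..<d}" for t p z z'
  proof -
   have lg: "linear (G' (t,p,u (t,p)))" by(rule has_derivative_linear[OF G'(1)]) (use t in auto)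
   show ?thesis using W(5)[OF t,of p "z - z'"] linear_diff[OF lg,of "(0,v,z)" "(0,v,z')"]
    by(simp add: G2_def)
  qed
  moreover have "((%t. W v (t,p)) hvd G2 (t,p,W v (t,p))) (at t)" if "t : {-d<..<d}" for t p
   using W(3)[OF that] by(simp add: G2_def)
  moreover have "W v (0,p) = (%_. 0) p + l v" for p using W(2) by simp
  ultimately show ?thesis unfolding X_def
   using Suc.IH[of G2 "W v" "%_. 0" "l v"] W(1) bounded_linear_zero by blast
 qed
 have "Ck_on (Suc k) X u"
 proof(rule Ck_on_SucI)
  fix x assume "x : X"
  thus "(u hfd (%w. fst w *R G (fst x,snd x,u x) + W (snd w) x)) (at x)"
   using W(4)[of "fst x" "snd x"] unfolding split_beta by(auto simp: X_def)
 next
  fix w :: "real * 'p"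
  have "Ck_on k X fst" "Ck_on k X snd"
   by(rule Ck_on_bounded_linear,rule bounded_linear_fst,rule Ck_on_bounded_linear,rule bounded_linear_snd)
  hence "Ck_on k X (%x. (fst x,snd x,u x))" by(intro Ck_on_Pair uk)
  hence "Ck_on k X (%x. G (fst x,snd x,u x))"
   by(rule Ck_on_compose[OF fd3 Gk]) (auto simp: X_def)
  thus "Ck_on k X (%x. fst w *R G (fst x,snd x,u x) + W (snd w) x)"
   by(intro Ck_on_add Ck_on_scaleR Ck_on_const Wk)
 qed
 thus ?case by(simp add: X_def)
qed

lemma ode_smooth:
 fixes G :: "real * 'p::{real_inner,heine_borel} * 'z::{real_inner,banach} => 'z"
 assumes fd: "finite_dim TYPE('p)" "finite_dim TYPE('z)"
  and dK: "d > 0" "K >= 0" "K * d <= 1/2"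
  and sG: "son (cyl d) G"
  and Lip: "!!t p z z'. t : {-d<..<d} ==> norm (G (t,p,z) - G (t,p,z')) <= K * norm (z - z')"
  and l: "bounded_linear l"
 obtains u where "son (cyl d) u" "!!p. u (0,p) = l p"
  "!!t p. t : {-d<..<d} ==> ((%t. u (t,p)) hvd G (t,p,u (t,p))) (at t)"
proof -
 obtain u where u: "con (cyl d) u" "!!p. u (0,p) = l p"
  "!!t p. t : {-d<..<d} ==> ((%t. u (t,p)) hvd G (t,p,u (t,p))) (at t)"
  using ode_exists[OF dK son_continuous[OF sG] Lip linear_continuous_on[OF l]] by blast
 have "son (cyl d) u"
  unfolding smooth_on_def
  using ode_Ck[OF fd dK smooth_onD[OF sG] Lip u(1) l _ u(3),of 0] u(2) by simp
 thus ?thesis using that u by blast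
qed

section \<open>Smooth functions on manifolds\<close>

text \<open>The coefficients are the integrals over t in [0,1] of the b-th partial derivative of f
  at x0 + t (y - x0). Each is obtained as the value at time 1 of an ODE solution, so smooth
  dependence on parameters replaces differentiation under the integral.\<close>

lemma hadamard:
 fixes f :: "'a::{real_inner,heine_borel} => real"
 assumes fd: "finite_dim TYPE('a)" and B: "onb B" and f: "son UNIV f" "(f hfd D) (at x0)"
 obtains g where "!!b. son UNIV (g b)" "!!y. f y = f x0 + (SUM b:B. ((y - x0) *. b) * g b y)"
  "!!b. g b x0 = D b"
proof -
 obtain f' where f': "!!x. (f hfd f' x) (at x)" "!!v. son UNIV (%x. f' x v)"
  using son_derivative[OF f(1)] by auto
 have D: "f' x0 = D" using f'(1) f(2) has_derivative_unique by blast
 define I where "I = {-2<..<2::real}"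
 have "EX u. son (I >< UNIV) u & (ALL p. u (0,p) = 0) &
   (ALL t:I. ALL p. ((%t. u (t,p)) hvd f' (x0 + t *R (p - x0)) b) (at t))" for b
 proof -
  have s: "son S (%x::real * 'a * real. f' (x0 + fst x *R (fst (snd x) - x0)) b)" for S
   by(rule son_compose[OF fd f'(2)])
    (auto intro!: son_add son_scaleR son_diff son_fst son_snd)
  \<comment> \<open>The right-hand side is independent of the unknown, so K = 0 is allowed and the
    interval may be as long as desired; d = 2 reaches beyond time 1.\<close>
  obtain u where "son (I >< UNIV) u" "!!p. u (0,p) = 0"
   "!!t p. t : I ==> ((%t. u (t,p)) hvd f' (x0 + t *R (p - x0)) b) (at t)"
   unfolding I_def
   using ode_smooth[OF fd fd_real _ _ _ s _ bounded_linear_zero,of 2 0] by auto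
  thus ?thesis by blast
 qed
 then obtain u where u: "!!b. son (I >< UNIV) (u b)" "!!b p. u b (0,p) = 0"
   "!!b t p. t : I ==> ((%t. u b (t,p)) hvd f' (x0 + t *R (p - x0)) b) (at t)"
  by metis
 have lf': "linear (f' x)" for x using f'(1) has_derivative_linear by blast
 show ?thesis
 proof(rule that[of "%b y. u b (1,y)"])
  show "son UNIV (%y. u b (1,y))" for b
   by(rule son_compose[OF fd_prod[OF fd_real fd] u(1)])
    (auto intro!: son_Pair simp: I_def)
  show "f y = f x0 + (SUM b:B. ((y - x0) *. b) * u b (1,y))" for y
  proof -
   define ph where "ph t = f (x0 + t *R (y - x0)) - (SUM b:B. ((y - x0) *. b) * u b (t,y))" for t
   have "(ph hfd (%t. 0)) (at t within {0..1})" if t: "t : {0..1}" for t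
   proof -
    have 1: "((%t. x0 + t *R (y - x0)) hfd (%t. t *R (y - x0))) (at t within {0..1})"
     by(auto intro!: derivative_eq_intros)
    have 2: "((%t. f (x0 + t *R (y - x0))) hfd (%r. f' (x0 + t *R (y - x0)) (r *R (y - x0)))) (at t within {0..1})"
     by(rule has_derivative_compose[OF 1 f'(1)])
    have tI: "t : I" using t by(simp add: I_def)
    have 3: "((%t. u b (t,y)) hfd (%r. r *R f' (x0 + t *R (y - x0)) b)) (at t within {0..1})" for b
     using u(3)[OF tI,of b y] has_derivative_at_withinI unfolding has_vector_derivative_def by blast
    have "(ph hfd (%r. f' (x0 + t *R (y - x0)) (r *R (y - x0)) -
      (SUM b:B. ((y - x0) *. b) * (r *R f' (x0 + t *R (y - x0)) b)))) (at t within {0..1})"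
     unfolding ph_def
     by(intro has_derivative_diff 2 has_derivative_sum has_derivative_mult_right 3)
    moreover have "f' (x0 + t *R (y - x0)) (r *R (y - x0)) -
      (SUM b:B. ((y - x0) *. b) * (r *R f' (x0 + t *R (y - x0)) b)) = 0" for r
     using linear_onb_expand[OF B lf',of "x0 + t *R (y - x0)" "y - x0"]
     by(simp add: linear_scale[OF lf'] sum_distrib_left mult.left_commute)
    ultimately show ?thesis by simp
   qed
   then obtain k where "!!t. t : {0..1} ==> ph t = k"
    using has_derivative_zero_constant[of "{0..1::real}" ph] by auto
   hence "ph 1 = ph 0" by simp
   thus ?thesis by(simp add: ph_def u(2))
  qed
  show "u b (1,x0) = D b" for b
  proof -
   have "u b (1,x0) = 1 *R D b"
   proof(rule ode_unique[of "{0..1}" 0 1 "%_ _. D b" 0])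
    fix t :: real assume "t : {0..1}"
    hence "t : I" by(simp add: I_def)
    from u(3)[OF this,of b x0]
    show "((%t. u b (t,x0)) hvd D b) (at t within {0..1})"
     by(simp add: D has_vector_derivative_at_within)
    show "((%t. t *R D b) hvd D b) (at t within {0..1})"
     unfolding has_vector_derivative_def by(auto intro!: derivative_eq_intros)
   qed (use u(2) in auto)
   thus ?thesis by simp
  qed
 qed
qed

section \<open>Germs of time-dependent smooth functions\<close>

lemma open_slice:
 fixes t :: "'a::metric_space" and y :: "'b::metric_space"
 assumes "open N" "(t,y) : N"
 obtains e where "e > 0" "!!ta. dist ta t < e ==> (ta,y) : N"
proof -
 obtain e where e: "e > 0" "ball (t,y) e <= N" using assms open_contains_ball by blast
 have "(ta,y) : N" if "dist ta t < e" for ta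
 proof -
  have "(ta,y) : ball (t,y) e" using that by(simp add: dist_Pair_Pair dist_commute)
  thus ?thesis using e(2) by blast
 qed
 thus ?thesis using that e(1) by blast
qed

lemma has_derivative_time_slice:
 assumes F: "(F hfd F') (at (t,y))"
 shows "((%ta. F (ta,y)) hvd F' (1,0)) (at t within T)"
proof -
 have "((%ta. (ta,y)) hfd (%r. (r,0))) (at t within T)" by(auto intro!: derivative_eq_intros)
 from has_derivative_compose[OF this F]
 have "((%ta. F (ta,y)) hfd (%r. F' (r,0))) (at t within T)" .
 moreover have "(%r. F' (r,0)) = (%r. r *R F' (1,0))"
 proof
  fix r :: real
  have "F' (r *R (1,0)) = r *R F' (1,0)" by(rule linear_scale[OF has_derivative_linear[OF F]])
  thus "F' (r,0) = r *R F' (1,0)" by simp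
 qed
 ultimately show ?thesis by(simp only: has_vector_derivative_def)
qed

text \<open>Germwise smoothness at \<open>(t,x)\<close> of a family \<open>g\<close> of functions with time set \<open>T\<close>; constant
 families with \<open>T = {0}\<close> give smooth functions, and \<open>T = {0..1}\<close> gives smooth families.\<close>

definition smooth_at ::
 "('m::topological_space,'e::real_normed_vector,'z) manifold_scheme => real set
  => (real => 'm => 'b::real_normed_vector) => real => 'm => bool"
where
 "smooth_at M T g t x <-> (EX U c N G. (U,c) : charts M & x : U & open N & (t,c x) : N &
   son N G & (ALL ta y. (ta,y) : N & ta : T & y : c ` U --> G (ta,y) = g ta (iv U c y)))"

locale mfd =
 fixes M :: "('m::{t2_space,second_countable_topology},'e::{real_inner,banach,heine_borel},'z) manifold_scheme"
 assumes mfd: "smooth_manifold M"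
begin

abbreviation (input) "sfun == smooth_fun M"
abbreviation (input) "sat == smooth_at M"

lemma fdE: "finite_dim TYPE('e)" using mfd unfolding smooth_manifold_def by blast

lemma fdRE: "finite_dim TYPE(real * 'e)" by(intro fd_prod fd_real fdE)

lemma ex_chart: obtains U c where "(U,c) : charts M" "x : U"
proof -
 have "x : \<Union>(fst ` charts M)" using mfd unfolding smooth_manifold_def by auto
 thus ?thesis using that by auto
qed

lemma chart:
 assumes "(U,c) : charts M"
 shows "open U" "open (c ` U)" "con U c" "con (c ` U) (iv U c)"
  "x : U ==> iv U c (c x) = x" "y : c ` U ==> c (iv U c y) = y"
  "y : c ` U ==> iv U c y : U"
proof -
 have *: "open U & open (c ` U) & homeomorphism U (c ` U) c (iv U c)"
  using assms mfd unfolding smooth_manifold_def by blast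
 thus "open U" "open (c ` U)" by auto
 from * have h: "homeomorphism U (c ` U) c (iv U c)" by auto
 show "con U c" "con (c ` U) (iv U c)"
  using h homeomorphism_def by blast+
 show "x : U ==> iv U c (c x) = x" using h unfolding homeomorphism_def by auto
 show "y : c ` U ==> c (iv U c y) = y" using h unfolding homeomorphism_def by auto
 show "y : c ` U ==> iv U c y : U" by(rule inv_into_into)
qed

lemma chart_image_eq:
 assumes "(U,c) : charts M"
 shows "c ` (U Int V) = {y : c ` U. iv U c y : V}"
 using chart(5,7)[OF assms] by force

lemma chart_image_open:
 assumes "(U,c) : charts M" "open V"
 shows "open (c ` (U Int V))"
proof -
 have "c ` (U Int V) = c ` U Int iv U c -` V" using chart_image_eq[OF assms(1)] by auto
 thus ?thesis
  using continuous_open_preimage[OF chart(4,2)[OF assms(1)] assms(2)] by simp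
qed

lemma chart_preimage_open:
 assumes "(U,c) : charts M" "open A"
 shows "open {x : U. c x : A}"
 using continuous_open_preimage[OF chart(3,1)[OF assms(1)] assms(2)] by(simp add: vimage_def Int_def)

lemma transition:
 assumes "(U,c) : charts M" "(V,d) : charts M"
 shows "son (c ` (U Int V)) (%y. d (iv U c y))"
 using assms mfd unfolding smooth_manifold_def o_def by fast

lemma satI:
 assumes "(U,c) : charts M" "x : U" "open N" "(t,c x) : N" "son N G"
  "!!ta y. (ta,y) : N ==> ta : T ==> y : c ` U ==> G (ta,y) = g ta (iv U c y)"
 shows "sat T g t x"
 unfolding smooth_at_def using assms by(intro exI[of _ U] exI[of _ c] exI[of _ N] exI[of _ G]) blast

text \<open>A transition map moves the representative to a prescribed chart, so that two germs can
  be combined in one chart.\<close>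

lemma sat_chartE:
 assumes "sat T g t x" and c: "(V,d) : charts M" "x : V"
 obtains N G where "open N" "(t,d x) : N" "N <= UNIV >< d ` V" "son N G"
  "!!ta y. (ta,y) : N ==> ta : T ==> G (ta,y) = g ta (iv V d y)"
proof -
 obtain U c N0 G where U: "(U,c) : charts M" "x : U" and N0: "open N0" "(t,c x) : N0" "son N0 G"
  and G: "!!ta y. (ta,y) : N0 ==> ta : T ==> y : c ` U ==> G (ta,y) = g ta (iv U c y)"
  using assms(1) unfolding smooth_at_def by blast
 define W where "W = d ` (V Int U)"
 have oW: "open W" unfolding W_def using chart_image_open[OF c(1)] chart(1)[OF U(1)] by blast
 define h where "h z = (fst z,c (iv V d (snd z)))" for z :: "real * 'e"
 have "son (UNIV >< W) (%z. c (iv V d (snd z)))"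
  by(rule son_compose[OF fdE transition[OF c(1) U(1)]])
   (auto intro!: son_snd simp: W_def)
 hence sh: "son (UNIV >< W) h"
  unfolding h_def by(intro son_Pair son_fst) auto
 define N where "N = (UNIV >< W) Int h -` N0"
 show ?thesis
 proof(rule that[of N "%z. G (h z)"])
  show "open N" unfolding N_def
   by(rule continuous_open_preimage[OF son_continuous[OF sh] _ N0(1)]) (intro open_Times open_UNIV oW)
  show "(t,d x) : N" using c U N0 chart(5)[OF c(1,2)] by(auto simp: N_def W_def h_def)
  show "N <= UNIV >< d ` V" by(auto simp: N_def W_def)
  show "son N (%z. G (h z))"
   by(rule son_compose[OF fdRE N0(3) son_subset[OF sh]]) (auto simp: N_def)
  fix ta y assume y: "(ta,y) : N" "ta : T"
  then obtain z where z: "z : V" "z : U" "y = d z" by(auto simp: N_def W_def)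
  have "iv V d y = z" using chart(5)[OF c(1)] z by simp
  thus "G (h (ta,y)) = g ta (iv V d y)"
   using y G[of ta "c z"] z chart(5)[OF U(1)] by(auto simp: N_def h_def)
 qed
qed

definition rep where
 "rep T g t x U c N F <-> (U,c) : charts M & x : U & open N & (t,c x) : N & N <= UNIV >< c ` U & son N F &
  (ALL ta y. (ta,y) : N --> ta : T --> F (ta,y) = g ta (iv U c y))"

lemma repD:
 assumes "rep T g t x U c N F"
 shows "(U,c) : charts M" "x : U" "open N" "(t,c x) : N" "N <= UNIV >< c ` U" "son N F"
  "!!ta y. (ta,y) : N ==> ta : T ==> F (ta,y) = g ta (iv U c y)"
 using assms unfolding rep_def by blast+

lemma sat_rep_chart: "sat T g t x ==> (U,c) : charts M ==> x : U ==> EX N F. rep T g t x U c N F"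
 unfolding rep_def by(rule sat_chartE) blast+

lemma sat_rep: "sat T g t x ==> EX U c N F. rep T g t x U c N F"
 using sat_rep_chart ex_chart by metis

lemma sat_binop:
 assumes "sat T f t x" "sat T g t x"
  and op: "!!(N :: (real * 'e) set) F G. son N F ==> son N G ==> son N (%z. h (F z) (G z))"
 shows "sat T (%t x. h (f t x) (g t x)) t x"
proof -
 obtain U c N F where "rep T f t x U c N F" using sat_rep[OF assms(1)] by blast
 note U = repD(1,2)[OF this] and N = repD(3-7)[OF this]
 obtain N' G where "rep T g t x U c N' G" using sat_rep_chart[OF assms(2) U] by blast
 note N' = repD(3-7)[OF this]
 have "son (N Int N') (%z. h (F z) (G z))"
  by(rule op) (use N(4) N'(4) son_subset in blast)+
 thus ?thesis
  by(rule satI[OF U,of "N Int N'", rotated 2]) (use N N' in auto)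
qed

lemma sat_unop:
 assumes "sat T f t x"
  and op: "!!(N :: (real * 'e) set) F. son N F ==> son N (%z. h (F z))"
 shows "sat T (%t x. h (f t x)) t x"
 by(rule sat_binop[OF assms(1,1)]) (rule op)

lemma sat_const [simp,intro]: "sat T (%t x. k) t x"
proof -
 obtain U c where U: "(U,c) : charts M" "x : U" using ex_chart by blast
 show ?thesis by(rule satI[OF U,of UNIV]) auto
qed

lemma sat_add: "sat T f t x ==> sat T g t x ==> sat T (%t x. f t x + g t x) t x"
 by(rule sat_binop[of T f t x g "%a b. a + b"]) (auto intro: son_add)
lemma sat_diff: "sat T f t x ==> sat T g t x ==> sat T (%t x. f t x - g t x) t x"
 by(rule sat_binop[of T f t x g "%a b. a - b"]) (auto intro: son_diff)
lemma sat_minus: "sat T f t x ==> sat T (%t x. - f t x) t x"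
 by(rule sat_unop[of T f t x uminus]) (auto intro: son_minus)
lemma sat_mult: "sat T f t x ==> sat T g t x ==>
  sat T (%t x. f t x * g t x :: 'b::real_normed_algebra) t x"
 by(rule sat_binop[of T f t x g "%a b. a * b"]) (auto intro: son_mult)
lemma sat_scaleR: "sat T f t x ==> sat T g t x ==> sat T (%t x. f t x *R g t x) t x"
 by(rule sat_binop[of T f t x g "%a b. a *R b"]) (auto intro: son_scaleR)
lemma sat_inner: "sat T f t x ==> sat T g t x ==> sat T (%t x. f t x *. g t x) t x"
 by(rule sat_binop[of T f t x g "%a b. a *. b"]) (auto intro: son_inner)
lemma sat_sum: "(!!i. i : I ==> sat T (f i) t x) ==> sat T (%t x. SUM i:I. f i t x) t x"
 by(induction I rule: infinite_finite_induct) (auto intro: sat_add)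
lemma sat_linear: "bounded_linear h ==> sat T f t x ==> sat T (%t x. h (f t x)) t x"
 by(rule sat_unop[of T f t x h]) (auto intro: son_linear_comp)

lemma sat_compose:
 fixes f :: "real => 'm => 'b::real_inner"
 assumes "finite_dim TYPE('b)" "sat T f t x" "t : T" "open A" "son A h" "f t x : A"
 shows "sat T (%t x. h (f t x)) t x"
proof -
 obtain U c N F where "rep T f t x U c N F" using sat_rep[OF assms(2)] by blast
 note U = repD(1,2)[OF this] and N = repD(3-7)[OF this]
 define N' where "N' = N Int F -` A"
 have oN': "open N'" unfolding N'_def by(rule continuous_open_preimage[OF son_continuous[OF N(4)] N(1) assms(4)])
 have m: "(t,c x) : N'" using N assms U chart(5)[OF U(1)] by(auto simp: N'_def)
 have "son N' (%z. h (F z))"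
  by(rule son_compose[OF assms(1,5) son_subset[OF N(4)]]) (auto simp: N'_def)
 thus ?thesis by(rule satI[OF U oN' m]) (use N(5) in "auto simp: N'_def")
qed

lemma sat_inverse:
 assumes "sat T f t x" "t : T" "f t x ~= (0::real)"
 shows "sat T (%t x. inverse (f t x)) t x"
 by(rule sat_compose[OF fd_real assms(1,2),of "{x. x ~= 0}"])
  (use assms Ck_on_inverse in "auto simp: smooth_on_def open_Collect_neq")

lemma sat_cong:
 assumes "sat T f t x" "open J" "t : J" "open V" "x : V"
  and "!!ta y. ta : T ==> ta : J ==> y : V ==> f ta y = g ta y"
 shows "sat T g t x"
proof -
 obtain U c N F where "rep T f t x U c N F" using sat_rep[OF assms(1)] by blast
 note U = repD(1,2)[OF this] and N = repD(3-7)[OF this]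
 define N' where "N' = N Int (J >< c ` (U Int V))"
 have "open N'" unfolding N'_def using N(1) assms chart_image_open[OF U(1)] by(intro open_Int open_Times)
 thus ?thesis
  by(rule satI[OF U,of N'])
   (use N assms U son_subset[OF N(4),of N'] chart(5)[OF U(1)] in "auto simp: N'_def")
qed

lemma sat_cong':
 assumes "sat T f t x" "open V" "x : V" "!!ta y. ta : T ==> y : V ==> f ta y = g ta y"
 shows "sat T g t x"
 by(rule sat_cong[OF assms(1) open_UNIV _ assms(2,3)]) (use assms(4) in auto)

lemma sat_mono: "sat T f t x ==> T' <= T ==> sat T' f t x"
 unfolding smooth_at_def by(meson subsetD)

lemma sat_slice:
 assumes "sat T f t x" "t : T" shows "sat T' (%_. f t) t' x"
proof -
 obtain U c N F where "rep T f t x U c N F" using sat_rep[OF assms(1)] by blast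
 note U = repD(1,2)[OF this] and N = repD(3-7)[OF this]
 define h where "h z = (t,snd z)" for z :: "real * 'e"
 have sh: "son UNIV h" unfolding h_def by(intro son_Pair son_snd) auto
 have o: "open (h -` N)"
  using continuous_open_preimage[OF son_continuous[OF sh] open_UNIV N(1)] by simp
 have "son (h -` N) (%z. F (h z))"
  by(rule son_compose[OF fdRE N(4) son_subset[OF sh]]) auto
 thus ?thesis
  by(rule satI[OF U o,rotated]) (use N assms(2) in "auto simp: h_def")
qed

lemma sat_fun_onI:
 assumes "open W" "!!x. x : W ==> sat T (%_. f) (t x) x" "!!x. x : W ==> t x : T"
 shows "smooth_fun_on M W f"
 unfolding smooth_fun_on_def
proof(safe,rule son_local)
 fix U c assume U: "(U,c) : charts M"
 show "open (c ` (U Int W))" by(rule chart_image_open[OF U assms(1)])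
 fix y assume "y : c ` (U Int W)"
 then obtain x where x: "x : U" "x : W" "y = c x" by auto
 obtain N F where N: "open N" "(t x,c x) : N" "N <= UNIV >< c ` U" "son N F"
  "!!ta y. (ta,y) : N ==> ta : T ==> F (ta,y) = f (iv U c y)"
  using sat_chartE[OF assms(2)[OF x(2)] U x(1)] by metis
 define h where "h z = (t x,z)" for z :: 'e
 have sh: "son UNIV h" unfolding h_def by(intro son_Pair) auto
 have o: "open (h -` N)"
  using continuous_open_preimage[OF son_continuous[OF sh] open_UNIV N(1)] by simp
 have "son (h -` N) (%z. F (h z))"
  by(rule son_compose[OF fdRE N(4) son_subset[OF sh]]) auto
 hence "son (h -` N) (f o iv U c)"
  by(rule son_cong[OF o,rotated]) (use N(5) assms(3)[OF x(2)] in "auto simp: h_def")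
 thus "EX N. open N & y : N & son N (f o iv U c)"
  using o N(2) x by(intro exI[of _ "h -` N"]) (auto simp: h_def)
qed

lemma sat_fun_on:
 assumes "smooth_fun_on M W f" "open W" "x : W"
 shows "sat T (%_. f) t x"
proof -
 obtain U c where U: "(U,c) : charts M" "x : U" using ex_chart by blast
 have s: "son (c ` (U Int W)) (f o iv U c)" using assms(1) U unfolding smooth_fun_on_def by blast
 have "son (UNIV >< c ` (U Int W)) (%z::real * 'e. (f o iv U c) (snd z))"
  by(rule son_compose[OF fdE s]) (auto intro: son_snd)
 thus ?thesis
  by(rule satI[OF U,rotated 2]) (use chart_image_open[OF U(1) assms(2)] U assms(3) in "auto intro: open_Times")
qed

lemma sfun_iff: "sfun f <-> (ALL x. sat {0} (%_. f) 0 x)"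
proof
 show "sfun f ==> ALL x. sat {0} (%_. f) 0 x"
  using sat_fun_on[OF _ open_UNIV] by blast
 show "ALL x. sat {0} (%_. f) 0 x ==> sfun f"
  by(rule sat_fun_onI[OF open_UNIV,of "{0}" f "%_. 0"]) auto
qed

lemma sat_fun: "sfun f ==> sat T (%_. f) t x"
 by(rule sat_fun_on[OF _ open_UNIV]) auto

lemma sat_slice_fun:
 assumes "!!x. sat T f t x" "t : T" shows "sfun (f t)"
 unfolding sfun_iff using sat_slice[OF assms] by blast

lemma smooth_family_iff: "smooth_family M g <-> (ALL t:{0..1}. ALL x. sat {0..1} g t x)"
proof
 assume L: "smooth_family M g"
 show "ALL t:{0..1}. ALL x. sat {0..1} g t x"
 proof(intro ballI allI)
  fix t :: real and x assume t: "t : {0..1}"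
  obtain U c where U: "(U,c) : charts M" "x : U" using ex_chart by blast
  hence m: "(t,c x) : {0..1} >< c ` U" using t by auto
  from bspec[OF L[unfolded smooth_family_def] U(1)]
  have "ALL p:{0..1} >< c ` U. EX N G. open N & p : N & son N G &
   (ALL (t,y) : N Int ({0..1} >< c ` U). G (t,y) = g t (iv U c y))" by simp
  from bspec[OF this m] obtain N G where "open N" "(t,c x) : N" "son N G"
   "ALL (t,y) : N Int ({0..1} >< c ` U). G (t,y) = g t (iv U c y)"
   by auto
  thus "sat {0..1} g t x"
   by(intro satI[OF U,of N t G]) auto
 qed
next
 assume R: "ALL t:{0..1}. ALL x. sat {0..1} g t x"
 show "smooth_family M g"
  unfolding smooth_family_def
 proof(safe)
  fix U c and t :: real and x assume U: "(U,c) : charts M" "x : U" and t: "t : {0..1}"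
  have "sat {0..1} g t x" using R t by blast
  from sat_chartE[OF this U] obtain N G where N: "open N" "(t,c x) : N" "N <= UNIV >< c ` U" "son N G"
   "!!ta y. (ta,y) : N ==> ta : {0..1} ==> G (ta,y) = g ta (iv U c y)" by metis
  show "EX W G. open W & (t,c x) : W & son W G & (ALL (t,y):W Int {0..1} >< c ` U. G (t,y) = g t (iv U c y))"
   by(intro exI[of _ N] exI[of _ G]) (use N in auto)
 qed
qed

lemma sat_time_derivative:
 assumes "sat T g t x" "t : T"
 obtains D where "((%ta. g ta x) hvd D) (at t within T)"
proof -
 obtain U c N F where "rep T g t x U c N F" using sat_rep[OF assms(1)] by blast
 note U = repD(1,2)[OF this] and N = repD(3-7)[OF this]
 obtain F' where F': "!!x. x : N ==> (F hfd F' x) (at x)"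
  using son_derivative[OF N(4,1)] by metis
 have 2: "((%ta. F (ta,c x)) hvd F' (t,c x) (1,0)) (at t within T)"
  by(rule has_derivative_time_slice[OF F'[OF N(2)]])
 obtain e where e: "e > 0" "!!ta. dist ta t < e ==> (ta,c x) : N"
  using open_slice[OF N(1,2)] by blast
 have "((%ta. g ta x) hvd F' (t,c x) (1,0)) (at t within T)"
  by(rule has_vector_derivative_transform_within[OF 2 e(1) assms(2)])
   (use e N(5) chart(5)[OF U] in auto)
 thus ?thesis by(rule that)
qed

lemma sat_isCont:
 assumes "sat T g t x" "t : T" shows "isCont (g t) x"
proof -
 obtain U c N F where "rep T g t x U c N F" using sat_rep[OF assms(1)] by blast
 note U = repD(1,2)[OF this] and N = repD(3-7)[OF this]
 have cc: "con U (%y. (t,c y))" by(intro continuous_intros chart(3)[OF U(1)])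
 define V where "V = U Int (%y. (t,c y)) -` N"
 have oV: "open V" unfolding V_def by(rule continuous_open_preimage[OF cc chart(1)[OF U(1)] N(1)])
 have "con V (%y. F (t,c y))"
  by(rule continuous_on_compose2[OF son_continuous[OF N(4)] continuous_on_subset[OF cc]]) (auto simp: V_def)
 moreover have "F (t,c y) = g t y" if "y : V" for y
  using N(5)[of t "c y"] that assms(2) chart(5)[OF U(1),of y] by(auto simp: V_def)
 ultimately have "con V (g t)" by(metis (no_types,lifting) continuous_on_cong)
 thus ?thesis using oV U N(2) continuous_on_eq_continuous_at by(auto simp: V_def)
qed

lemma sfun_continuous: "sfun f ==> con UNIV f"
 by(intro continuous_at_imp_continuous_on ballI sat_isCont[of "{0}" "%_. f" 0] sat_fun) auto

lemma sfun_const [simp]: "sfun (%_. k)" unfolding sfun_iff by(intro allI sat_const)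
lemma sfun_add: "sfun f ==> sfun g ==> sfun (%x. f x + g x)"
 unfolding sfun_iff using sat_add[of "{0}" "%_. f" 0 _ "%_. g"] by blast
lemma sfun_diff: "sfun f ==> sfun g ==> sfun (%x. f x - g x)"
 unfolding sfun_iff using sat_diff[of "{0}" "%_. f" 0 _ "%_. g"] by blast
lemma sfun_mult: "sfun f ==> sfun g ==> sfun (%x. f x * g x :: 'b::real_normed_algebra)"
 unfolding sfun_iff using sat_mult[of "{0}" "%_. f" 0 _ "%_. g"] by blast
lemma sfun_sum: "(!!i. i : I ==> sfun (f i)) ==> sfun (%x. SUM i:I. f i x)"
 unfolding sfun_iff using sat_sum[of I "{0}" "%i _. f i"] by blast
lemma sfun_linear: "bounded_linear h ==> sfun f ==> sfun (%x. h (f x))"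
 unfolding sfun_iff using sat_linear[of h "{0}" "%_. f"] by blast
lemma sfun_cmult: "sfun f ==> sfun (%x. r * f x :: 'b::real_normed_algebra)"
 using sfun_mult[OF sfun_const] .

text \<open>Extension by zero is smooth because the preimage of the closed ball is compact, hence
  closed in the Hausdorff space M, and the function vanishes on its open complement.\<close>

lemma sfun_chart_lift:
 assumes U: "(U,c) : charts M" and p: "p : U" and r: "r > 0" "cball (c p) (2 * r) <= c ` U"
  and G: "son UNIV G" "!!y. dist (c p) y >= 2 * r ==> G y = 0"
 shows "sfun (%x. if x : U then G (c x) else 0)"
 unfolding sfun_iff
proof
 fix x
 define S where "S = iv U c ` cball (c p) (2 * r)"
 have "compact S" unfolding S_def
  by(rule compact_continuous_image[OF continuous_on_subset[OF chart(4)[OF U] r(2)]]) simp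
 hence cS: "closed S" by(rule compact_imp_closed)
 show "sat {0} (%_ x. if x : U then G (c x) else 0) 0 x"
 proof(cases "x : U")
  case True
  have "son UNIV (%z::real * 'e. G (snd z))"
   by(rule son_compose[OF fdE G(1)]) (auto intro: son_snd)
  thus ?thesis
   by(rule satI[OF U True open_UNIV UNIV_I]) (use chart(6,7)[OF U] in auto)
 next
  case False
  have S: "S <= U" unfolding S_def using chart(7)[OF U] r(2) by auto
  have z: "(if y : U then G (c y) else 0) = 0" if "y : - S" for y
  proof(cases "y : U")
   case True
   have "c y ~: cball (c p) (2 * r)"
    using that chart(5)[OF U True] unfolding S_def by(metis ComplD imageI)
   thus ?thesis using G(2) by simp
  qed simp
  show ?thesis
   by(rule sat_cong'[of "{0}" "%_ _. 0" 0 x "- S"]) (use z False S cS in auto)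
 qed
qed

lemma bump:
 assumes "open W" "p : W"
 obtains ze V S where "sfun ze" "open V" "p : V" "V <= W" "!!x. x : V ==> ze x = (1::real)"
  "!!x. 0 <= ze x" "closed S" "S <= W" "!!x. x ~: S ==> ze x = 0"
proof -
 obtain U c where U: "(U,c) : charts M" "p : U" using ex_chart by blast
 have "open (c ` (U Int W))" "c p : c ` (U Int W)" using chart_image_open[OF U(1) assms(1)] U assms by auto
 then obtain r0 where r0: "r0 > 0" "cball (c p) r0 <= c ` (U Int W)" using open_contains_cball by blast
 define r where "r = r0 / 2"
 have r: "r > 0" "cball (c p) (2 * r) <= c ` (U Int W)" using r0 by(auto simp: r_def)
 obtain be :: "'e => real" where be: "son UNIV be" "!!y. 0 <= be y" "!!y. be y <= 1"
  "!!y. dist (c p) y <= r ==> be y = 1" "!!y. dist (c p) y >= 2 * r ==> be y = 0"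
  using smooth_bump[OF r(1)] by metis
 define ze where "ze x = (if x : U then be (c x) else 0)" for x
 define S where "S = iv U c ` cball (c p) (2 * r)"
 have rU: "cball (c p) (2 * r) <= c ` U" using r(2) by auto
 have "compact S" unfolding S_def
  by(rule compact_continuous_image[OF continuous_on_subset[OF chart(4)[OF U(1)] rU]]) simp
 hence cS: "closed S" by(rule compact_imp_closed)
 show ?thesis
 proof(rule that[of ze "{x : U. c x : ball (c p) r}" S])
  show "sfun ze" unfolding ze_def
   by(rule sfun_chart_lift[OF U r(1) rU be(1,5)])
  show "open {x : U. c x : ball (c p) r}" by(rule chart_preimage_open[OF U(1)]) simp
  show "{x : U. c x : ball (c p) r} <= W"
  proof safe
   fix x assume x: "x : U" "c x : ball (c p) r"
   hence "c x : c ` (U Int W)" using r by auto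
   hence "iv U c (c x) : W" using chart_image_eq[OF U(1)] by blast
   thus "x : W" using chart(5)[OF U(1) x(1)] by simp
  qed
  show "S <= W" unfolding S_def using r(2) chart_image_eq[OF U(1),of W] by auto
  fix x
  show "x : {x : U. c x : ball (c p) r} ==> ze x = 1" by(auto simp: ze_def intro!: be(4))
  show "0 <= ze x" by(simp add: ze_def be(2))
  show "ze x = 0" if "x ~: S"
  proof(cases "x : U")
   case True
   have "c x ~: cball (c p) (2 * r)"
    using that chart(5)[OF U(1) True] unfolding S_def by(metis imageI)
   thus ?thesis using be(5) by(simp add: ze_def)
  qed (simp add: ze_def)
 qed (use U r cS in auto)
qed

lemma cutoff_smooth:
 assumes "sfun ze" "closed S" "S <= W" "!!x. x ~: S ==> ze x = (0::real)"
  and "open W" "x : W ==> sat T g t x"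
 shows "sat T (%t x. ze x *R g t x) t x"
proof(cases "x : W")
 case True
 thus ?thesis by(intro sat_scaleR assms sat_fun)
next
 case False
 show ?thesis
  by(rule sat_cong'[of T "%_ _. 0" t x "- S"]) (use False assms in auto)
qed

text \<open>Tangent vectors act on globally defined functions only, so coordinates have to be cut
  off before they can be differentiated.\<close>

lemma coordinate_functions:
 assumes "(U,c) : charts M" "p : U"
 obtains V ey where "open V" "p : V" "V <= U" "!!b::'e. sfun (ey b)"
  "!!b x. x : V ==> ey b x = c x *. b"
proof -
 obtain ze V S where ze: "sfun ze" "open V" "p : V" "V <= U" "!!x. x : V ==> ze x = (1::real)"
  "!!x. 0 <= ze x" "closed S" "S <= U" "!!x. x ~: S ==> ze x = 0"
  using bump[OF chart(1)[OF assms(1)] assms(2)] by metis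
 show ?thesis
 proof(rule that[of V "%b x. ze x *R (c x *. b)"])
  fix b :: 'e
  have "sat {0} (%t x. c x *. b) 0 x" if "x : U" for x
  proof -
   have "son UNIV (%z::real * 'e. snd z *. b)" by(intro son_inner son_snd) auto
   thus ?thesis by(rule satI[OF assms(1) that open_UNIV UNIV_I]) (use chart(6)[OF assms(1)] in auto)
  qed
  thus "sfun (%x. ze x *R (c x *. b))"
   unfolding sfun_iff using cutoff_smooth[OF ze(1,7,8,9) chart(1)[OF assms(1)],of _ "{0}" "%_ x. c x *. b" 0] by blast
 qed (use ze in auto)
qed

section \<open>Tangent vectors in coordinates\<close>

lemma tangent_vectorD:
 assumes "tangent_vector M x X" "sfun f" "sfun g"
 shows "X (%y. r * f y + g y) = r * X f + X g" "X (%y. f y * g y) = f x * X g + g x * X f"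
 using assms unfolding tangent_vector_def by blast+

lemma tv_const:
 assumes "tangent_vector M x X" shows "X (%_. k) = 0"
proof -
 have 1: "X (%_. 1) = 0" using tangent_vectorD(2)[OF assms,of "%_. 1" "%_. 1"] by simp
 have 0: "X (%_. 0) = 0" using tangent_vectorD(2)[OF assms,of "%_. 0" "%_. 0"] by simp
 show ?thesis using tangent_vectorD(1)[OF assms,of "%_. 1" "%_. 0" k] 1 0 by simp
qed

lemma tv_linear:
 assumes "tangent_vector M x X" "sfun f" "sfun g"
 shows "X (%y. f y + g y) = X f + X g" "X (%y. f y - g y) = X f - X g" "X (%y. r * f y) = r * X f"
  "X (%y. - f y) = - X f"
 using tangent_vectorD(1)[OF assms,of 1] tangent_vectorD(1)[OF assms(1,3,2),of "-1"]
  tangent_vectorD(1)[OF assms(1,2) sfun_const,of r 0] tangent_vectorD(1)[OF assms(1,2) sfun_const,of "-1" 0]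
  tv_const[OF assms(1)] by simp_all

lemma tv_sum:
 assumes "tangent_vector M x X" "!!i. i : I ==> sfun (f i)"
 shows "X (%y. SUM i:I. f i y) = (SUM i:I. X (f i))"
 using assms(2)
proof(induction I rule: infinite_finite_induct)
 case (insert i I)
 have "sfun (%y. SUM i:I. f i y)" by(rule sfun_sum) (use insert in simp)
 thus ?case using tv_linear(1)[OF assms(1),of "f i" "%y. SUM i:I. f i y"] insert by simp
qed (simp_all add: tv_const[OF assms(1)])

text \<open>Hadamard's lemma in the chart, made global. A derivation can be applied only to
  functions on all of M, so the expansion of f - f x is multiplied by the square of a cutoff equal
  to 1 near x; the Leibniz rule at x then removes the cutoff.\<close>

lemma tv_coords:
 assumes X: "tangent_vector M x X" and U: "(U,c) : charts M" and V: "open V" "V <= U" "x : V"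
  and ey: "!!b. sfun (ey b)" "!!b y. y : V ==> ey b y = c y *. b"
  and B: "onb B" and f: "sfun f" and D: "((%y. f (iv U c y)) hfd D) (at (c x))"
 shows "X f = (SUM b:B. D b * X (ey b))"
proof -
 have xU: "x : U" using V by auto
 have "open (c ` (U Int V))" "c x : c ` (U Int V)" using chart_image_open[OF U V(1)] V by auto
 then obtain r0 where r0: "r0 > 0" "cball (c x) r0 <= c ` (U Int V)" using open_contains_cball by blast
 \<comment> \<open>The cutoff lives on radius 2 r, and the closed ball of radius 4 r still lies in
   the image of V, where the functions \<open>ey\<close> are the coordinates.\<close>
 define r where "r = r0 / 4"
 have r: "r > 0" "cball (c x) (2 * (2 * r)) <= c ` (U Int V)" using r0 by(auto simp: r_def)
 have rU: "cball (c x) (2 * r) <= c ` U" "cball (c x) (2 * (2 * r)) <= c ` U"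
  using r subset_cball[of "2 * r" "2 * (2 * r)" "c x"] by auto
 obtain be :: "'e => real" where be: "son UNIV be" "!!y. 0 <= be y" "!!y. be y <= 1"
  "!!y. dist (c x) y <= r ==> be y = 1" "!!y. dist (c x) y >= 2 * r ==> be y = 0"
  using smooth_bump[OF r(1)] by metis
 define F where "F y = be y * (f (iv U c y) - f x)" for y
 have sF: "son UNIV F"
 proof(rule son_local[OF open_UNIV])
  fix y
  show "EX N. open N & y : N & son N F"
  proof(cases "y : c ` U")
   case True
   have "son (c ` (U Int UNIV)) (f o iv U c)"
    using f U unfolding smooth_fun_on_def by blast
   hence "son (c ` U) F" unfolding F_def
    by(intro son_mult son_diff son_subset[OF be(1)]) (auto simp: o_def)
   thus ?thesis using True chart(2)[OF U] by blast
  next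
   case False
   have "son (- cball (c x) (2 * r)) F"
    by(rule son_cong[of _ "%_. 0"]) (use be(5) in "auto simp: F_def open_Compl")
   thus ?thesis using False rU by(intro exI[of _ "- cball (c x) (2 * r)"]) (auto simp: open_Compl)
  qed
 qed
 have dF: "(F hfd D) (at (c x))"
 proof -
  have "((%y. f (iv U c y) - f x) hfd D) (at (c x))"
   using has_derivative_diff[OF D has_derivative_const[of "f x"]] by simp
  thus ?thesis
   by(rule has_derivative_transform_within_open[of _ _ _ UNIV "ball (c x) r"]) (use r be(4) in "auto simp: F_def")
 qed
 obtain g where g: "!!b. son UNIV (g b)" "!!y. F y = F (c x) + (SUM b:B. ((y - c x) *. b) * g b y)"
  "!!b. g b (c x) = D b" using hadamard[OF fdE B sF dF] by metis
 have F0: "F (c x) = 0" using chart(5)[OF U xU] by(simp add: F_def)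
 define ze where "ze y = (if y : U then be (c y) else 0)" for y
 have sze: "sfun ze" unfolding ze_def by(rule sfun_chart_lift[OF U xU r(1) rU(1) be(1,5)])
 define h where "h b y = (if y : U then be (c y) * g b (c y) else 0)" for b y
 have sh: "sfun (h b)" for b unfolding h_def
  by(rule sfun_chart_lift[OF U xU r(1) rU(1)]) (auto intro!: son_mult be g)
 \<comment> \<open>One factor \<open>ze\<close> makes F smooth on the whole model space, where
   Hadamard's lemma applies; the other turns its coefficients into the global functions
   \<open>h b\<close>.\<close>
 have eq: "(ze y * ze y) * (f y - f x) = (SUM b:B. (ey b y - ey b x) * h b y)" for y
 proof(cases "y : U & dist (c x) (c y) < 2 * r")
  case True
  hence "c y : cball (c x) (2 * (2 * r))" using r(1) by simp
  hence "c y : c ` (U Int V)" using r(2) by blast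
  hence yV: "y : V" using chart_image_eq[OF U] chart(5)[OF U] True by auto
  have "ze y * (f y - f x) = F (c y)" using True chart(5)[OF U] by(simp add: ze_def F_def)
  also have "... = (SUM b:B. (ey b y - ey b x) * g b (c y))"
   using g(2)[of "c y"] F0 ey(2)[OF yV] ey(2)[OF V(3)] by(simp add: inner_diff_left)
  finally have "ze y * (ze y * (f y - f x)) = (SUM b:B. (ey b y - ey b x) * (ze y * g b (c y)))"
   by(simp add: sum_distrib_left mult.left_commute)
  thus ?thesis using True by(simp add: h_def ze_def mult.assoc)
 next
  case False
  hence "ze y = 0" "h b y = 0" for b using be(5)[of "c y"] by(auto simp: ze_def h_def)
  thus ?thesis by simp
 qed
 have zex: "ze x = 1" using xU be(4)[of "c x"] r by(simp add: ze_def)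
 have sf: "sfun (%y. f y - f x)" "sfun (%y. ze y * ze y)" "sfun (%y. ey b y - ey b x)" for b
  by(intro sfun_diff f sfun_const sfun_mult sze ey)+
 have "X (%y. (ze y * ze y) * (f y - f x)) = X f"
  using tangent_vectorD(2)[OF X sf(2,1)] tv_linear(2)[OF X f sfun_const]
   tv_const[OF X] by(simp add: zex)
 moreover have "X (%y. (ey b y - ey b x) * h b y) = D b * X (ey b)" for b
  using tangent_vectorD(2)[OF X sf(3) sh] tv_linear(2)[OF X ey(1) sfun_const]
   tv_const[OF X] g(3) xU be(4)[of "c x"] r by(simp add: h_def)
 moreover have "X (%y. SUM b:B. (ey b y - ey b x) * h b y) = (SUM b:B. X (%y. (ey b y - ey b x) * h b y))"
  by(rule tv_sum[OF X]) (intro sfun_mult sf sh)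
 ultimately show ?thesis by(simp add: eq)
qed

lemma tv_local:
 assumes X: "tangent_vector M x X" and "sfun f" "sfun g" "open W" "x : W"
  "!!y. y : W ==> f y = g y"
 shows "X f = X g"
proof -
 obtain U c where U: "(U,c) : charts M" "x : U" using ex_chart by blast
 obtain B :: "'e set" where B: "onb B" using onb_exists[OF fdE] .
 obtain V ey where V: "open V" "x : V" "V <= U" "!!b::'e. sfun (ey b)"
  "!!b x. x : V ==> ey b x = c x *. b" using coordinate_functions[OF U] by metis
 have sf: "son (c ` (U Int UNIV)) (f o iv U c)"
  using assms(2) U unfolding smooth_fun_on_def by blast
 have "open (c ` (U Int UNIV))" "c x : c ` (U Int UNIV)" using chart(2)[OF U(1)] U(2) by simp_all
 with son_derivative[OF sf]
 obtain D where D: "((%y. f (iv U c y)) hfd D) (at (c x))"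
  unfolding o_def by metis
 have Dg: "((%y. g (iv U c y)) hfd D) (at (c x))"
  by(rule has_derivative_transform_within_open[OF D chart_image_open[OF U(1) assms(4)]])
   (use U assms(5,6) chart_image_eq[OF U(1)] in auto)
 show ?thesis
  using tv_coords[OF X U(1) V(1,3,2,4,5) B assms(2) D]
   tv_coords[OF X U(1) V(1,3,2,4,5) B assms(3) Dg] by simp
qed

lemma smooth_family_slice_derivative:
 assumes U: "(U,c) : charts M" and N: "open N" "N <= UNIV >< c ` U"
  and F: "!!x. x : N ==> (F hfd F' x) (at x)"
  and eq: "!!ta y. (ta,y) : N ==> ta : T ==> F (ta,y) = g ta (iv U c y)"
  and t: "(t,y0) : N" "t : T"
 shows "((%y. g t (iv U c y)) hfd (%v. F' (t,y0) (0,v))) (at y0)"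
proof -
 have "((%y. (t,y)) hfd (%v. (0,v))) (at y0)" by(auto intro!: derivative_eq_intros)
 from has_derivative_compose[OF this F[OF t(1)]]
 have "((%y. F (t,y)) hfd (%v. F' (t,y0) (0,v))) (at y0)" .
 moreover have "open ((%y. (t,y)) -` N)"
  using continuous_open_preimage[OF _ open_UNIV N(1),of "%y. (t,y)"] by(simp add: continuous_intros)
 ultimately show ?thesis
  by(rule has_derivative_transform_within_open) (use t eq in auto)
qed

text \<open>The smoothness assumed of X concerns a fixed function. For a family,
  \<open>tv_coords\<close> writes \<open>X x (g t)\<close> through the spatial partial derivatives
  of a joint local representative and the fixed functions \<open>X x (ey b)\<close>.\<close>

lemma sat_tangent:
 assumes X: "!!x. tangent_vector M x (X x)" "!!f. sfun f ==> sfun (%x. X x f)"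
  and g: "!!ta. ta : T ==> sfun (g ta)" "sat T g t p"
 shows "sat T (%t x. X x (g t)) t p"
proof -
 obtain U c where U: "(U,c) : charts M" "p : U" using ex_chart by blast
 obtain B :: "'e set" where B: "onb B" using onb_exists[OF fdE] .
 obtain V ey where V: "open V" "p : V" "V <= U" "!!b::'e. sfun (ey b)"
  "!!b x. x : V ==> ey b x = c x *. b" using coordinate_functions[OF U] by metis
 obtain N F where N: "open N" "(t,c p) : N" "N <= UNIV >< c ` U" "son N F"
  "!!ta y. (ta,y) : N ==> ta : T ==> F (ta,y) = g ta (iv U c y)"
  using sat_chartE[OF g(2) U] by metis
 obtain F' where F': "!!x. x : N ==> (F hfd F' x) (at x)" "!!v. son N (%x. F' x v)"
  using son_derivative[OF N(4,1)] by metis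
 define k where "k b ta x = F' (ta,c x) (0,b)" for b :: 'e and ta x
 have "sat T (k b) t p" for b
  by(rule satI[OF U N(1,2) F'(2)[of "(0,b)"]]) (use chart(6)[OF U(1)] in "auto simp: k_def")
 hence s: "sat T (%t x. SUM b:B. k b t x * X x (ey b)) t p"
  by(intro sat_sum sat_mult sat_fun X V)
 have cN: "con (UNIV >< U) (%(ta,x). (ta::real,c x))"
  unfolding split_beta
  by(intro continuous_intros continuous_on_compose2[OF chart(3)[OF U(1)]]) auto
 have "open ((UNIV >< U) Int (%(ta,x). (ta,c x)) -` N)"
  by(rule continuous_open_preimage[OF cN _ N(1)]) (intro open_Times open_UNIV chart(1)[OF U(1)])
 moreover have "(t,p) : (UNIV >< U) Int (%(ta,x). (ta,c x)) -` N" using N U by auto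
 ultimately obtain J W where JW: "open J" "open W" "t : J" "p : W" "J >< W <= (UNIV >< U) Int (%(ta,x). (ta,c x)) -` N"
  by(rule open_prod_elim) auto
 show ?thesis
 proof(rule sat_cong[OF s JW(1,3),of "W Int V"])
  fix ta y assume y: "ta : T" "ta : J" "y : W Int V"
  hence m: "(ta,c y) : N" using JW(5) by auto
  have "X y (g ta) = (SUM b:B. F' (ta,c y) (0,b) * X y (ey b))"
   by(rule tv_coords[OF X(1) U(1) V(1,3) _ V(4,5) B g(1)[OF y(1)]
      smooth_family_slice_derivative[OF U(1) N(1,3) F'(1) N(5) m y(1)]]) (use y in auto)
  thus "(SUM b:B. k b ta y * X y (ey b)) = X y (g ta)" by(simp add: k_def)
 qed (use JW V in auto)
qed

text \<open>Symmetry of second derivatives of a local representative, one in time and one in space.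
  That t is a limit point of T identifies \<open>g'\<close> with the time derivative of the
  representative.\<close>

lemma tangent_time_derivative:
 assumes X: "tangent_vector M x X"
  and g: "!!ta. ta : T ==> sfun (g ta)" "sat T g t x"
  and t: "t : T" "t islimpt T"
  and g': "!!y. ((%ta. g ta y) hvd g' y) (at t within T)" "sfun g'"
 shows "((%ta. X (g ta)) hvd X g') (at t within T)"
proof -
 obtain U c where U: "(U,c) : charts M" "x : U" using ex_chart by blast
 obtain B :: "'e set" where B: "onb B" using onb_exists[OF fdE] .
 obtain V ey where V: "open V" "x : V" "V <= U" "!!b::'e. sfun (ey b)"
  "!!b x. x : V ==> ey b x = c x *. b" using coordinate_functions[OF U] by metis
 obtain N F where N: "open N" "(t,c x) : N" "N <= UNIV >< c ` U" "son N F"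
  "!!ta y. (ta,y) : N ==> ta : T ==> F (ta,y) = g ta (iv U c y)"
  using sat_chartE[OF g(2) U] by metis
 obtain F' where F': "!!x. x : N ==> (F hfd F' x) (at x)" "!!v. son N (%x. F' x v)"
  using son_derivative[OF N(4,1)] by metis
 have "EX H. ALL v. (ALL x:N. ((%x. F' x v) hfd H v x) (at x)) & (ALL w. son N (%x. H v x w))"
  by(rule choice) (use son_derivative[OF F'(2) N(1)] in metis)
 then obtain H where H: "!!v x. x : N ==> ((%x. F' x v) hfd H v x) (at x)"
  "!!v w. son N (%x. H v x w)" by blast
 have ntriv: "at t within T ~= bot" using t(2) by(simp add: trivial_limit_within)
 have g'F: "g' (iv U c y) = F' (t,y) (1,0)" if m: "(t,y) : N" for y
 proof -
  obtain e where e: "e > 0" "!!ta. dist ta t < e ==> (ta,y) : N" using open_slice[OF N(1) m] by blast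
  have "((%ta. g ta (iv U c y)) hvd F' (t,y) (1,0)) (at t within T)"
   by(rule has_vector_derivative_transform_within[OF has_derivative_time_slice[OF F'(1)[OF m]] e(1) t(1)]) (use e N(5) in auto)
  thus ?thesis using g'(1) vector_derivative_unique_within[OF ntriv] by blast
 qed
 have "((%y. (t,y)) hfd (%v. (0,v))) (at (c x))" by(auto intro!: derivative_eq_intros)
 from has_derivative_compose[OF this H(1)[OF N(2),of "(1,0)"]]
 have "((%y. F' (t,y) (1,0)) hfd (%v. H (1,0) (t,c x) (0,v))) (at (c x))" .
 moreover have "open ((%y. (t,y)) -` N)"
  using continuous_open_preimage[OF _ open_UNIV N(1),of "%y. (t,y)"] by(simp add: continuous_intros)
 ultimately have "((%y. g' (iv U c y)) hfd (%v. H (1,0) (t,c x) (0,v))) (at (c x))"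
  by(rule has_derivative_transform_within_open) (use N(2) g'F in auto)
 from tv_coords[OF X U(1) V(1,3,2,4,5) B g'(2) this]
 have Xg': "X g' = (SUM b:B. H (1,0) (t,c x) (0,b) * X (ey b))" .
 have mixed: "H (1,0) (t,c x) (0,b) = H (0,b) (t,c x) (1,0)" for b
  by(rule mixed_partials[OF N(1,2) F'(1) H(1) H(1)]) (auto intro: son_continuous[OF H(2)])
 obtain e where e: "e > 0" "!!ta. dist ta t < e ==> (ta,c x) : N" using open_slice[OF N(1,2)] by blast
 have "((%ta. SUM b:B. F' (ta,c x) (0,b) * X (ey b)) hvd
   (SUM b:B. H (0,b) (t,c x) (1,0) * X (ey b))) (at t within T)"
  by(intro has_vector_derivative_sum has_vector_derivative_mult_left has_derivative_time_slice H(1) N(2))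
 hence "((%ta. X (g ta)) hvd
   (SUM b:B. H (0,b) (t,c x) (1,0) * X (ey b))) (at t within T)"
 proof(rule has_vector_derivative_transform_within[OF _ e(1) t(1)])
  fix ta assume ta: "ta : T" "dist ta t < e"
  show "(SUM b:B. F' (ta,c x) (0,b) * X (ey b)) = X (g ta)"
   by(rule tv_coords[OF X U(1) V(1,3,2,4,5) B g(1)[OF ta(1)]
      smooth_family_slice_derivative[OF U(1) N(1,3) F'(1) N(5) e(2)[OF ta(2)] ta(1)],symmetric])
 qed
 thus ?thesis using Xg' mixed by simp
qed

end

section \<open>Sections of the bundle\<close>

context mfd
begin

text \<open>Composition with the inverse of \<open>A t p\<close> reduces this to
  \<open>inverse_family\<close>.\<close>

lemma sat_inverse_family:
 fixes A :: "real => 'm => 'f::{real_inner,banach} => 'f"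
 assumes fd: "finite_dim TYPE('f)" and sm: "!!u. sat T (%ta x. A ta x u) t p"
  and t: "t : T" and W: "open W" "p : W"
  and lin: "!!ta x. ta : T ==> x : W ==> linear (A ta x)"
  and bij: "bij (A t p)"
 obtains J V where "open J" "t : J" "open V" "p : V" "V <= W"
  "!!ta x. ta : T ==> ta : J ==> x : V ==> bij (A ta x)"
  "!!w. sat T (%ta x. inv (A ta x) w) t p"
proof -
 obtain U c where U: "(U,c) : charts M" "p : U" using ex_chart by blast
 obtain B :: "'f set" where B: "onb B" using onb_exists[OF fd] .
 have "EX N G. open N & (t,c p) : N & N <= UNIV >< c ` U & son N G &
   (ALL ta y. (ta,y) : N & ta : T --> G (ta,y) = A ta (iv U c y) b)" for b
  using sat_chartE[OF sm[of b] U] by metis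
 then obtain N G where N: "!!b. open (N b)" "!!b. (t,c p) : N b" "!!b. N b <= UNIV >< c ` U"
  "!!b. son (N b) (G b)"
  "!!b ta y. (ta,y) : N b ==> ta : T ==> G b (ta,y) = A ta (iv U c y) b"
  by metis
 define Q where "Q = (INT b:B. N b) Int (UNIV >< c ` (U Int W))"
 have oQ: "open Q" unfolding Q_def using onbD(1)[OF B] N(1)
  by(intro open_Int open_INT open_Times open_UNIV chart_image_open[OF U(1) W(1)]) auto
 have q0: "(t,c p) : Q" using N(2) U W by(auto simp: Q_def)
 define A0 where "A0 = A t p"
 have l0: "linear A0" and b0: "bij A0" using lin bij t W by(auto simp: A0_def)
 have AI: "A0 (inv A0 u) = u" "inv A0 (A0 u) = u" for u
  using b0 by(simp_all add: bij_is_surj surj_f_inv_f bij_is_inj)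
 have li: "linear (inv A0)"
 proof(rule linearI)
  fix x y r
  have "A0 (inv A0 x + inv A0 y) = x + y" "A0 (r *R inv A0 x) = r *R x"
   using AI l0 by(simp_all add: linear_add linear_scale)
  thus "inv A0 (x + y) = inv A0 x + inv A0 y" "inv A0 (r *R x) = r *R inv A0 x"
   using AI(2) by metis+
 qed
 \<comment> \<open>Built from smooth representatives of the values on basis vectors, so that it is
   linear for every q, also at times outside T, where nothing is known of A.\<close>
 define A' where "A' q u = (SUM b:B. (u *. b) *R inv A0 (G b q))" for q u
 have A'_eq: "A' (ta,y) u = inv A0 (A ta (iv U c y) u)" if "(ta,y) : Q" "ta : T" for ta y u
 proof -
  have "iv U c y : W" using that chart_image_eq[OF U(1)] by(auto simp: Q_def)
  hence l: "linear (A ta (iv U c y))" using lin that by blast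
  have "A' (ta,y) u = (SUM b:B. (u *. b) *R inv A0 (A ta (iv U c y) b))"
   unfolding A'_def using that N(5) by(intro sum.cong) (auto simp: Q_def)
  also have "... = inv A0 (SUM b:B. (u *. b) *R A ta (iv U c y) b)"
   by(simp add: linear_sum[OF li] linear_scale[OF li])
  also have "(SUM b:B. (u *. b) *R A ta (iv U c y) b) = A ta (iv U c y) u"
   by(rule linear_onb_expand[OF B l,symmetric])
  finally show ?thesis .
 qed
 have linA': "linear (A' q)" for q unfolding A'_def
  by(rule linearI) (simp_all add: inner_add_left scaleR_add_left sum.distrib scaleR_sum_right)
 have sA': "son Q (%q. A' q u)" for u
  unfolding A'_def
 proof(intro son_sum son_scaleR son_const son_linear_comp[OF linear_bounded_fd[OF fd li]])
  fix b assume "b : B"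
  thus "son Q (G b)" by(intro son_subset[OF N(4)]) (auto simp: Q_def)
 qed
 have id: "A' (t,c p) u = u" for u
  using A'_eq[OF q0 t] chart(5)[OF U] AI by(simp add: A0_def)
 obtain Q' where Q': "open Q'" "(t,c p) : Q'" "Q' <= Q" "!!q. q : Q' ==> bij (A' q)"
  "!!w. son Q' (%q. inv (A' q) w)"
  using inverse_family[OF fd oQ q0 linA' sA' id] by metis
 have bA: "bij (A ta (iv U c y))" if a: "(ta,y) : Q'" "ta : T" for ta y
 proof -
  have Q: "(ta,y) : Q" using a Q'(3) by auto
  have "A ta (iv U c y) = A0 o A' (ta,y)" using A'_eq[OF Q a(2)] AI by auto
  thus ?thesis using bij_comp[OF Q'(4)[OF a(1)] b0] by simp
 qed
 have smI: "sat T (%ta x. inv (A ta x) w) t p" for w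
 proof(rule satI[OF U Q'(1,2) Q'(5)[of "inv A0 w"]])
  fix ta y assume a: "(ta,y) : Q'" "ta : T" "y : c ` U"
  have Q: "(ta,y) : Q" using a Q'(3) by auto
  let ?A = "A ta (iv U c y)"
  have "A' (ta,y) (inv ?A w) = inv A0 w"
   using A'_eq[OF Q a(2)] bA[OF a(1,2)] by(simp add: bij_is_surj surj_f_inv_f)
  thus "inv (A' (ta,y)) (inv A0 w) = inv ?A w"
   using Q'(4)[OF a(1)] by(metis bij_is_inj inv_f_f)
 qed
 obtain J D where JD: "open J" "open D" "t : J" "c p : D" "J >< D <= Q'"
  using open_prod_elim[OF Q'(1,2)] by(metis mem_Sigma_iff)
 show ?thesis
 proof(rule that[OF JD(1,3) _ _ _ _ smI])
  show "open ({x : U. c x : D} Int W)" using chart_preimage_open[OF U(1) JD(2)] W by auto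
  show "p : {x : U. c x : D} Int W" using U JD W by auto
  fix ta x assume a: "ta : T" "ta : J" "x : {x : U. c x : D} Int W"
  thus "bij (A ta x)" using bA[of ta "c x"] JD(5) chart(5)[OF U(1),of x] by auto
 qed auto
qed

end

text \<open>Numbers the clauses that follow the bundle condition: in \<open>courant_axioms\<close>,
  1 to 4 concern the pairing, 5 to 7 the anchor, 8 to 10 the bracket, and 11 to 15 are (i) to
  (v).\<close>

lemma conjunct_list:
 assumes "A & B1 & B2 & B3 & B4 & B5 & B6 & B7 & B8 & B9 & B10 & B11 & B12 & B13 & B14 & B15"
 shows B1 B2 B3 B4 B5 B6 B7 B8 B9 B10 B11 B12 B13 B14 B15
 using assms by simp_all

locale courant =
 fixes C :: "('m::{t2_space,second_countable_topology},'e::{real_inner,banach,heine_borel},'v::real_vector,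
  'f::{real_inner,banach,heine_borel}) courant"
 assumes ca: "courant_algebroid C"

sublocale courant \<subseteq> mfd C
 by unfold_locales (rule ca[unfolded courant_algebroid_def,THEN conjunct1,
  unfolded smooth_vector_bundle_def,THEN conjunct1])

context courant
begin

abbreviation (input) "cS == csections C"
abbreviation (input) "an == anchor C"
abbreviation (input) "br == bracket C"
abbreviation (input) "can == canchor C"
abbreviation F where "F == fibre C"
abbreviation Gam where "Gam == sections C"
abbreviation pair where "pair == pairing C"

lemma svb: "smooth_vector_bundle C" by(rule ca[unfolded courant_algebroid_def,THEN conjunct1])

lemma fdF: "finite_dim TYPE('f)" using svb unfolding smooth_vector_bundle_def by(elim conjE)

lemma F_subspace: "subspace (F x)" using svb unfolding smooth_vector_bundle_def by(elim conjE allE)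

lemma F_closed [simp,intro]:
 "0 : F x" "u : F x ==> v : F x ==> u + v : F x" "u : F x ==> r *R u : F x"
 "u : F x ==> v : F x ==> u - v : F x" "u : F x ==> - u : F x"
 "(!!i. i : I ==> g i : F x) ==> sum g I : F x"
 using F_subspace[of x]
 by(auto simp: subspace_0 subspace_add subspace_scale subspace_diff subspace_neg intro: subspace_sum)

lemma triv:
 assumes "(U,ph) : trivs C"
 shows "open U" "x : U ==> bij_betw (ph x) (F x) UNIV"
  "x : U ==> v : F x ==> w : F x ==> ph x (r *R v + w) = r *R ph x v + ph x w"
proof -
 have "ALL (U,ph) : trivs C. open U &
    (ALL x:U. bij_betw (ph x) (fibre C x) UNIV &
      (ALL v:fibre C x. ALL w:fibre C x. ALL r. ph x (r *R v + w) = r *R ph x v + ph x w))"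
  using svb unfolding smooth_vector_bundle_def by(elim conjE)
 from bspec[OF this assms]
 have *: "open U & (ALL x:U. bij_betw (ph x) (fibre C x) UNIV &
      (ALL v:fibre C x. ALL w:fibre C x. ALL r. ph x (r *R v + w) = r *R ph x v + ph x w))" by simp
 show "open U" using * by blast
 show "x : U ==> bij_betw (ph x) (F x) UNIV" using * by blast
 show "x : U ==> v : F x ==> w : F x ==> ph x (r *R v + w) = r *R ph x v + ph x w" using * by blast
qed

lemma ex_triv: obtains U ph where "(U,ph) : trivs C" "x : U"
proof -
 have "\<Union>(fst ` trivs C) = UNIV" using svb unfolding smooth_vector_bundle_def by(elim conjE)
 hence "x : \<Union>(fst ` trivs C)" by simp
 thus ?thesis using that by auto
qed

definition tinv :: "('m => 'v => 'f) => 'm => 'f => 'v" where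
 "tinv ph x w = inv_into (F x) (ph x) w"

lemma tinv:
 assumes "(U,ph) : trivs C" "x : U"
 shows "tinv ph x w : F x" "ph x (tinv ph x w) = w" "v : F x ==> tinv ph x (ph x v) = v"
  "tinv ph x (r *R w + w') = r *R tinv ph x w + tinv ph x w'" "tinv ph x 0 = 0"
proof -
 have b: "bij_betw (ph x) (F x) UNIV" by(rule triv(2)[OF assms])
 show 1: "tinv ph x w : F x" for w using b unfolding tinv_def bij_betw_def by(metis UNIV_I inv_into_into)
 show 2: "ph x (tinv ph x w) = w" for w using b unfolding tinv_def bij_betw_def by(metis UNIV_I f_inv_into_f)
 show 3: "v : F x ==> tinv ph x (ph x v) = v" for v using b unfolding tinv_def bij_betw_def by(metis inv_into_f_f)
 have "ph x (r *R tinv ph x w + tinv ph x w') = r *R w + w'"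
  using triv(3)[OF assms 1 1] 2 by simp
 thus 4: "tinv ph x (r *R w + w') = r *R tinv ph x w + tinv ph x w'" for r w w'
  by(metis "1" "2" "3" F_closed(2) F_closed(3) assms triv(3))
 show "tinv ph x 0 = 0" using 4[of "-1" 0 0] by simp
qed

lemma tinv_sum:
 assumes "(U,ph) : trivs C" "x : U"
 shows "tinv ph x (SUM i:I. r i *R g i) = (SUM i:I. r i *R tinv ph x (g i))"
 by(induction I rule: infinite_finite_induct) (auto simp: tinv(4,5)[OF assms])

lemma triv_sum:
 assumes "(U,ph) : trivs C" "x : U" "!!i. i : I ==> g i : F x"
 shows "ph x (SUM i:I. r i *R g i) = (SUM i:I. r i *R ph x (g i))"
proof -
 have z: "ph x 0 = 0" using tinv(2,5)[OF assms(1,2)] by metis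
 show ?thesis using assms(3)
  by(induction I rule: infinite_finite_induct) (auto simp: z triv(3)[OF assms(1,2)])
qed

lemma triv_transition:
 assumes "(U,ph) : trivs C" "(V,py) : trivs C"
 shows "smooth_fun_on C (U Int V) (%x. py x (tinv ph x w))"
proof -
 have "ALL (U,ph) : trivs C. ALL (V,py) : trivs C. ALL w.
    smooth_fun_on C (U Int V) (%x. py x (inv_into (fibre C x) (ph x) w))"
  using svb unfolding smooth_vector_bundle_def by(elim conjE)
 from bspec[OF this assms(1)] show ?thesis using assms(2) unfolding tinv_def by auto
qed

text \<open>Asks for a single trivialisation; \<open>sect_at_triv\<close> passes to any
  other.\<close>

definition sect_at :: "real set => (real => 'm => 'v) => real => 'm => bool" where
 "sect_at T s t x <-> (EX U ph. (U,ph) : trivs C & x : U & sat T (%ta y. ph y (s ta y)) t x)"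

lemma sect_at_triv:
 assumes "sect_at T s t x" "open W" "x : W" "!!ta y. ta : T ==> y : W ==> s ta y : F y"
  and V: "(V,py) : trivs C" "x : V"
 shows "sat T (%ta y. py y (s ta y)) t x"
proof -
 obtain U ph where U: "(U,ph) : trivs C" "x : U" "sat T (%ta y. ph y (s ta y)) t x"
  using assms(1) unfolding sect_at_def by blast
 obtain B :: "'f set" where B: "onb B" using onb_exists[OF fdF] .
 have oUV: "open (U Int V)" using triv(1) U V by blast
 have "sat T (%ta y. SUM b:B. (ph y (s ta y) *. b) *R py y (tinv ph y b)) t x"
  by(intro sat_sum sat_scaleR sat_inner U(3) sat_const
    sat_fun_on[OF triv_transition[OF U(1) V(1)] oUV]) (use U V in auto)
 thus ?thesis
 proof(rule sat_cong'[of _ _ _ _ "W Int (U Int V)"])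
  fix ta y assume y: "ta : T" "y : W Int (U Int V)"
  hence "s ta y = tinv ph y (SUM b:B. (ph y (s ta y) *. b) *R b)"
   using onbD(3)[OF B] tinv(3)[OF U(1)] assms(4) by simp
  also have "... = (SUM b:B. (ph y (s ta y) *. b) *R tinv ph y b)"
   using tinv_sum[OF U(1)] y by auto
  finally have "py y (s ta y) = py y (SUM b:B. (ph y (s ta y) *. b) *R tinv ph y b)" by simp
  also have "... = (SUM b:B. (ph y (s ta y) *. b) *R py y (tinv ph y b))"
   by(rule triv_sum[OF V(1)]) (use y tinv(1)[OF U(1)] in auto)
  finally show "(SUM b:B. (ph y (s ta y) *. b) *R py y (tinv ph y b)) = py y (s ta y)" by simp
 qed (use U V assms oUV in auto)
qed

lemma sec_on_iff:
 assumes "open W"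
 shows "s : sections_on C W <-> (ALL x:W. s x : F x & sect_at {0} (%_. s) 0 x)"
proof
 assume s: "s : sections_on C W"
 show "ALL x:W. s x : F x & sect_at {0} (%_. s) 0 x"
 proof
  fix x assume x: "x : W"
  obtain U ph where U: "(U,ph) : trivs C" "x : U" using ex_triv by blast
  have "smooth_fun_on C (U Int W) (%x. ph x (s x))" using s U unfolding sections_on_def by blast
  hence "sat {0} (%_ x. ph x (s x)) 0 x"
   by(rule sat_fun_on) (use triv(1)[OF U(1)] assms x U in auto)
  thus "s x : F x & sect_at {0} (%_. s) 0 x"
   using U s x unfolding sect_at_def sections_on_def by blast
 qed
next
 assume R: "ALL x:W. s x : F x & sect_at {0} (%_. s) 0 x"
 have "smooth_fun_on C (U Int W) (%x. ph x (s x))" if U: "(U,ph) : trivs C" for U ph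
 proof(rule sat_fun_onI[of _ "{0}" _ "%_. 0"])
  fix x assume x: "x : U Int W"
  show "sat {0} (%_ x. ph x (s x)) 0 x"
   by(rule sect_at_triv[of "{0}" "%_. s" 0 x W]) (use R x U assms in auto)
 qed (use triv(1)[OF U] assms in auto)
 thus "s : sections_on C W" using R unfolding sections_on_def by auto
qed

lemma sec_iff: "s : Gam <-> (ALL x. s x : F x & sect_at {0} (%_. s) 0 x)"
 using sec_on_iff[OF open_UNIV] by auto

lemma sectionsD [simp]: "s : Gam ==> s x : F x" unfolding sec_iff by blast

lemma sect_at_lincomb:
 assumes s: "!!i. i : I ==> sect_at T (s i) t x" and W: "open W" "x : W"
  and F: "!!i ta y. i : I ==> ta : T ==> y : W ==> s i ta y : F y"
  and r: "!!i. i : I ==> sat T (r i) t x"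
 shows "sect_at T (%ta y. SUM i:I. r i ta y *R s i ta y) t x"
proof -
 obtain U ph where U: "(U,ph) : trivs C" "x : U" using ex_triv by blast
 have "sat T (%ta y. SUM i:I. r i ta y *R ph y (s i ta y)) t x"
  by(intro sat_sum sat_scaleR r sect_at_triv[OF s W F U])
 hence "sat T (%ta y. ph y (SUM i:I. r i ta y *R s i ta y)) t x"
  by(rule sat_cong'[of _ _ _ _ "W Int U"])
   (use F W U triv(1)[OF U(1)] in "auto intro!: triv_sum[OF U(1),symmetric]")
 thus ?thesis using U unfolding sect_at_def by blast
qed

lemma sec_lincomb:
 assumes "!!i. i : I ==> s i : Gam" "!!i. i : I ==> sfun (r i)"
 shows "(%y. SUM i:I. r i y *R s i y) : Gam"
 unfolding sec_iff
proof
 fix x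
 have "sect_at {0} (%_ y. SUM i:I. r i y *R s i y) 0 x"
  by(rule sect_at_lincomb[OF _ open_UNIV]) (use assms(1) sec_iff in "auto intro!: sat_fun[OF assms(2)]")
 thus "(SUM i:I. r i x *R s i x) : F x & sect_at {0} (%_ y. SUM i:I. r i y *R s i y) 0 x"
  using assms by auto
qed

lemma sec_zero [simp]: "(%_. 0) : Gam" using sec_lincomb[of "{}"] by simp

lemma sec_scale: "s : Gam ==> sfun r ==> (%y. r y *R s y) : Gam"
 using sec_lincomb[of "{()}" "%_. s" "%_. r"] by simp

lemma sec_add: "s : Gam ==> s' : Gam ==> (%y. s y + s' y) : Gam"
 using sec_lincomb[of "UNIV::bool set" "%b. if b then s else s'" "%_ _. 1"] by(simp add: UNIV_bool add.commute)

lemma sec_minus: "s : Gam ==> (%y. - s y) : Gam"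
 using sec_scale[of s "%_. -1"] by simp

lemma sec_diff: "s : Gam ==> s' : Gam ==> (%y. s y - s' y) : Gam"
 using sec_add[OF _ sec_minus] by simp

lemma sec_cscale: "s : Gam ==> (%y. k *R s y) : Gam"
 using sec_scale[of s "%_. k"] by simp

lemma sec_sum: "(!!i. i : I ==> s i : Gam) ==> (%y. SUM i:I. s i y) : Gam"
 using sec_lincomb[of I s "%_ _. 1"] by simp

lemma section_extend:
 assumes "open W" "p : W" "!!x. x : W ==> s x : F x" "!!x. x : W ==> sect_at {0} (%_. s) 0 x"
 obtains s' V where "s' : Gam" "open V" "p : V" "V <= W" "!!x. x : V ==> s' x = s x"
proof -
 obtain ze V S where ze: "sfun ze" "open V" "p : V" "V <= W" "!!x. x : V ==> ze x = (1::real)"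
  "!!x. 0 <= ze x" "closed S" "S <= W" "!!x. x ~: S ==> ze x = 0"
  using bump[OF assms(1,2)] by metis
 define s' where "s' x = ze x *R s x" for x
 have "s' : Gam"
  unfolding sec_iff
 proof
  fix x
  show "s' x : F x & sect_at {0} (%_. s') 0 x"
  proof(cases "x : W")
   case True
   have "sect_at {0} (%ta y. SUM i:{()}. ze y *R s y) 0 x"
    by(rule sect_at_lincomb[where W = W]) (use assms True sat_fun[OF ze(1)] in auto)
   thus ?thesis using assms(3) True by(simp add: s'_def[abs_def])
  next
   case False
   have "s' y = 0" if "y : - S" for y using that ze(9) by(simp add: s'_def)
   obtain U ph where U: "(U,ph) : trivs C" "x : U" using ex_triv by blast
   have z: "ph y 0 = 0" if "y : U" for y using tinv(2,5)[OF U(1) that] by metis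
   have "sat {0} (%_ y. ph y (s' y)) 0 x"
    by(rule sat_cong'[of _ "%_ _. 0" _ _ "- S Int U"])
     (use \<open>!!y. y : - S ==> s' y = 0\<close> z False ze U triv(1)[OF U(1)] in auto)
   moreover have "s' x = 0" using \<open>!!y. y : - S ==> s' y = 0\<close> False ze(8) by blast
   ultimately show ?thesis using U unfolding sect_at_def by auto
  qed
 qed
 thus ?thesis using that[of s' V] ze by(auto simp: s'_def)
qed

lemma section_extend':
 assumes "s : sections_on C W" "open W" "p : W"
 obtains s' V where "s' : Gam" "open V" "p : V" "V <= W" "!!x. x : V ==> s' x = s x"
 using section_extend[OF assms(2,3),of s] sec_on_iff[OF assms(2),of s] assms(1) by metis

section \<open>The pairing and dual frames\<close>

lemmas courant_axioms = conjunct_list[OF ca[unfolded courant_algebroid_def]]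

lemma pair_lin: "u : F x ==> v : F x ==> w : F x ==> pair x (r *R u + v) w = r * pair x u w + pair x v w"
 using courant_axioms(1) by blast
lemma pair_sym: "u : F x ==> v : F x ==> pair x u v = pair x v u"
 using courant_axioms(2) by blast
lemma pair_nondeg: "u : F x ==> (!!v. v : F x ==> pair x u v = 0) ==> u = 0"
 using courant_axioms(3) by blast
lemma pair_smooth: "a : Gam ==> b : Gam ==> sfun (%x. pair x (a x) (b x))"
 using courant_axioms(4) unfolding pair_sec_def by blast

lemma pair_add_left [simp]: "u : F x ==> v : F x ==> w : F x ==> pair x (u + v) w = pair x u w + pair x v w"
 using pair_lin[of u x v w 1] by simp
lemma pair_zero_left [simp]: "w : F x ==> pair x 0 w = 0"
 using pair_lin[of 0 x 0 w 1] by simp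
lemma pair_scale_left [simp]: "u : F x ==> w : F x ==> pair x (r *R u) w = r * pair x u w"
 using pair_lin[of u x 0 w r] by simp
lemma pair_minus_left [simp]: "u : F x ==> w : F x ==> pair x (- u) w = - pair x u w"
 using pair_scale_left[of u x w "-1"] by simp
lemma pair_diff_left [simp]: "u : F x ==> v : F x ==> w : F x ==> pair x (u - v) w = pair x u w - pair x v w"
 using pair_add_left[of u x "- v" w] by simp
lemma pair_add_right [simp]: "u : F x ==> v : F x ==> w : F x ==> pair x w (u + v) = pair x w u + pair x w v"
 using pair_sym[of w x] by simp
lemma pair_zero_right [simp]: "w : F x ==> pair x w 0 = 0"
 using pair_sym[of w x 0] by simp
lemma pair_scale_right [simp]: "u : F x ==> w : F x ==> pair x w (r *R u) = r * pair x w u"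
 using pair_sym[of w x] by simp
lemma pair_minus_right [simp]: "u : F x ==> w : F x ==> pair x w (- u) = - pair x w u"
 using pair_sym[of w x] by simp
lemma pair_diff_right [simp]: "u : F x ==> v : F x ==> w : F x ==> pair x w (u - v) = pair x w u - pair x w v"
 using pair_sym[of w x] by simp

lemma pair_sum:
 assumes "!!i. i : I ==> g i : F x" "w : F x"
 shows "pair x (SUM i:I. g i) w = (SUM i:I. pair x (g i) w)" "pair x w (SUM i:I. g i) = (SUM i:I. pair x w (g i))"
 using assms by(induction I rule: infinite_finite_induct) auto

lemma pair_eqI:
 assumes "u : F x" "v : F x" "!!w. w : F x ==> pair x u w = pair x v w"
 shows "u = v"
 using pair_nondeg[of "u - v" x] assms by auto

lemma sat_pair_fixed:
 "a : Gam ==> b : Gam ==> sat T (%_ x. pair x (a x) (b x)) t x"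
 by(rule sat_fun) (rule pair_smooth)

text \<open>The pairing may be indefinite, so orthonormal frames are replaced by a frame and its
  dual for the pairing, both made of global sections and indexed by an orthonormal basis of the
  model fibre.\<close>

definition dual_frame :: "'f set => 'm set => ('f => 'm => 'v) => ('f => 'm => 'v) => bool" where
 "dual_frame B V al al' <-> (ALL b. al b : Gam & al' b : Gam) & (ALL x:V.
   (ALL b:B. ALL c:B. pair x (al b x) (al' c x) = (if b = c then 1 else 0)) &
   (ALL v:F x. (SUM b:B. pair x (al' b x) v *R al b x) = v & (SUM b:B. pair x (al b x) v *R al' b x) = v))"

lemma dual_frameD:
 assumes "dual_frame B V al al'"
 shows "!!b. al b : Gam" "!!b. al' b : Gam"
  "!!x b c. x : V ==> b : B ==> c : B ==> pair x (al b x) (al' c x) = (if b = c then 1 else 0)"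
  "!!x v. x : V ==> v : F x ==> (SUM b:B. pair x (al' b x) v *R al b x) = v"
  "!!x v. x : V ==> v : F x ==> (SUM b:B. pair x (al b x) v *R al' b x) = v"
 using assms unfolding dual_frame_def by blast+

text \<open>\<open>al\<close> comes from a trivialisation, cut off to global sections.
  \<open>A\<close> is the Gram operator of the pairing on the model fibre, invertible by
  non-degeneracy, and its smooth inverse gives the dual frame.\<close>

lemma local_frame:
 assumes B: "onb (B :: 'f set)"
 obtains V al al' where "open V" "p : V" "dual_frame B V al al'"
proof -
 obtain U ph where U: "(U,ph) : trivs C" "p : U" using ex_triv by blast
 have oU: "open U" by(rule triv(1)[OF U(1)])
 have "EX s' V. s' : Gam & open V & p : V & V <= U & (ALL x:V. s' x = tinv ph x b)" for b
 proof -
  have "sect_at {0} (%_ x. tinv ph x b) 0 x" if x: "x : U" for x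
  proof -
   have "sat {0} (%_ y. ph y (tinv ph y b)) 0 x"
    by(rule sat_cong'[of _ "%_ _. b" _ _ U]) (use x oU tinv(2)[OF U(1)] in auto)
   thus ?thesis using U(1) x unfolding sect_at_def by blast
  qed
  from section_extend[OF oU U(2),of "%x. tinv ph x b"] this tinv(1)[OF U(1)] show ?thesis by metis
 qed
 then obtain al V0 where al: "!!b. al b : Gam" "!!b. open (V0 b)" "!!b. p : V0 b" "!!b. V0 b <= U"
  "!!b x. x : V0 b ==> al b x = tinv ph x b" by metis
 define V1 where "V1 = (INT b:B. V0 b) Int U"
 have V1: "open V1" "p : V1" "V1 <= U" using al onbD(1)[OF B] oU U by(auto simp: V1_def)
 have alV: "al b x = tinv ph x b" if "x : V1" "b : B" for b x using al(5) that by(auto simp: V1_def)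
 define A where "A x u = (SUM c:B. SUM b:B. ((u *. b) * pair x (al b x) (al c x)) *R c)" for x and u :: 'f
 have tk: "tinv ph x u = (SUM b:B. (u *. b) *R al b x)" if "x : V1" for x u
 proof -
  have x: "x : U" using that V1 by auto
  have "tinv ph x u = tinv ph x (SUM b:B. (u *. b) *R b)" by(simp add: onbD(3)[OF B])
  also have "... = (SUM b:B. (u *. b) *R tinv ph x b)" by(rule tinv_sum[OF U(1) x])
  finally show ?thesis using alV[OF that] by simp
 qed
 have A_inner: "A x u *. u' = pair x (tinv ph x u) (tinv ph x u')" if x: "x : V1" for x u u'
 proof -
  have "A x u = (SUM c:B. pair x (tinv ph x u) (al c x) *R c)"
   unfolding A_def tk[OF x] using al(1) by(simp add: pair_sum scaleR_sum_left)
  hence "A x u *. u' = (SUM c:B. (u' *. c) * pair x (tinv ph x u) (al c x))"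
   by(simp add: inner_sum_left inner_commute[of u'] mult.commute)
  also have "... = pair x (tinv ph x u) (SUM c:B. (u' *. c) *R al c x)"
   using al(1) tinv(1)[OF U(1)] V1 x by(subst pair_sum) auto
  finally show ?thesis by(simp add: tk[OF x,of u'])
 qed
 have linA: "linear (A x)" for x unfolding A_def
  by(rule linearI) (simp_all add: inner_add_left distrib_right scaleR_add_left sum.distrib scaleR_sum_right mult.assoc)
 have bijA: "bij (A x)" if x: "x : V1" for x
 proof -
  have xU: "x : U" using x V1 by auto
  have "inj (A x)"
   unfolding linear_injective_0[OF linA]
  proof(intro allI impI)
   fix u assume "A x u = 0"
   hence "pair x (tinv ph x u) (tinv ph x u') = 0" for u' using A_inner[OF x,of u u'] by simp
   hence "pair x (tinv ph x u) v = 0" if "v : F x" for v using tinv(3)[OF U(1) xU that] by metis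
   hence "tinv ph x u = 0" using pair_nondeg tinv(1)[OF U(1) xU] by blast
   thus "u = 0" using tinv(2)[OF U(1) xU] tinv(5)[OF U(1) xU] by metis
  qed
  thus ?thesis using fd_linear_inj_imp_surj[OF fdF linA] by(simp add: bij_def)
 qed
 have sA: "sat {0} (%_ x. inv (A x) w) 0 q" if "q : V1" for w q
 proof -
  have "sat {0} (%_ x. A x u) 0 q" for u
   unfolding A_def
   by(intro sat_sum sat_scaleR sat_mult sat_const sat_pair_fixed al)
  from sat_inverse_family[OF fdF this singletonI V1(1) that linA bijA[OF that]]
  show ?thesis by metis
 qed
 define s where "s b x = tinv ph x (inv (A x) b)" for b x
 have "EX s' V. s' : Gam & open V & p : V & V <= V1 & (ALL x:V. s' x = s b x)" for b
 proof -
  have "sect_at {0} (%_. s b) 0 x" if x: "x : V1" for x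
  proof -
   have "sat {0} (%_ y. ph y (s b y)) 0 x"
    by(rule sat_cong'[OF sA[OF x,of b] V1(1) x]) (use tinv(2)[OF U(1)] V1 in "auto simp: s_def")
   thus ?thesis using U(1) x V1 unfolding sect_at_def by blast
  qed
  moreover have "s b x : F x" if "x : V1" for x
   unfolding s_def by(rule tinv(1)[OF U(1)]) (use that V1 in auto)
  ultimately show ?thesis using section_extend[OF V1(1,2),of "s b"] by metis
 qed
 then obtain al' V2 where al': "!!b. al' b : Gam" "!!b. open (V2 b)" "!!b. p : V2 b" "!!b. V2 b <= V1"
  "!!b x. x : V2 b ==> al' b x = s b x" by metis
 define V where "V = (INT b:B. V2 b) Int V1"
 have V: "open V" "p : V" "V <= V1" using al' onbD(1)[OF B] V1 by(auto simp: V_def)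
 have p': "pair x (tinv ph x u) (al' b x) = u *. b" if x: "x : V" "b : B" for x u b
 proof -
  have x1: "x : V1" "x : U" using x V V1 by auto
  have "pair x (tinv ph x u) (al' b x) = pair x (s b x) (tinv ph x u)"
   using al'(5)[of x b] x pair_sym[OF tinv(1)[OF U(1) x1(2)] tinv(1)[OF U(1) x1(2)]] by(auto simp: V_def s_def)
  also have "... = A x (inv (A x) b) *. u" unfolding s_def by(rule A_inner[OF x1(1),symmetric])
  also have "... = b *. u" using bijA[OF x1(1)] by(simp add: bij_is_surj surj_f_inv_f)
  finally show ?thesis by(simp add: inner_commute)
 qed
 have delta: "pair x (al b x) (al' c x) = (if b = c then 1 else 0)" if "x : V" "b : B" "c : B" for x b c
  using p'[OF that(1,3),of b] alV[of x b] that V onbD(2)[OF B that(2,3)] by auto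
 have ex: "(SUM b:B. pair x (al' b x) v *R al b x) = v" if x: "x : V" and v: "v : F x" for x v
 proof -
  have x1: "x : V1" "x : U" using x V V1 by auto
  have "v = tinv ph x (ph x v)" using tinv(3)[OF U(1) x1(2) v] by simp
  also have "... = (SUM b:B. (ph x v *. b) *R al b x)" by(rule tk[OF x1(1)])
  also have "... = (SUM b:B. pair x (al' b x) v *R al b x)"
  proof(rule sum.cong)
   fix b assume "b : B"
   hence "ph x v *. b = pair x v (al' b x)" using p'[OF x,of b "ph x v"] tinv(3)[OF U(1) x1(2) v] by simp
   thus "(ph x v *. b) *R al b x = pair x (al' b x) v *R al b x"
    using pair_sym[OF v sectionsD[OF al'(1)]] by simp
  qed simp
  finally show ?thesis by(rule sym)
 qed
 have ex': "(SUM b:B. pair x (al b x) v *R al' b x) = v" if x: "x : V" and v: "v : F x" for x v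
 proof(rule pair_eqI[OF _ v])
  show "(SUM b:B. pair x (al b x) v *R al' b x) : F x" using al' by auto
  fix w assume w: "w : F x"
  have "pair x (SUM b:B. pair x (al b x) v *R al' b x) w = (SUM b:B. pair x (al' b x) w * pair x (al b x) v)"
   using al' w by(subst pair_sum) (auto simp: mult.commute)
  also have "... = pair x (SUM b:B. pair x (al' b x) w *R al b x) v"
   using al v by(subst pair_sum) auto
  also have "... = pair x w v" using ex[OF x w] by simp
  finally show "pair x (SUM b:B. pair x (al b x) v *R al' b x) w = pair x v w"
   using pair_sym[OF v w] by simp
 qed
 have "dual_frame B V al al'"
  unfolding dual_frame_def using al(1) al'(1) delta ex ex' by(intro conjI ballI allI) simp_all
 thus ?thesis by(rule that[OF V(1,2)])
qed

text \<open>Local dual frames weighted by a partition of unity. The family is in general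
  overcomplete; only the resolution of the identity survives, and expansions rest on that
  alone.\<close>

lemma global_frame_exists:
 assumes compact_M: "compact (UNIV :: 'm set)"
 shows "EX (n::nat) a a'. (ALL i<n. a i : Gam & a' i : Gam) &
   (ALL x. ALL v:F x. (SUM i<n. pair x (a' i x) v *R a i x) = v)"
proof -
 obtain B :: "'f set" where B: "onb B" using onb_exists[OF fdF] .
 have "ALL p. EX V al al'. open V & p : V & dual_frame B V al al'"
  using local_frame[OF B] by metis
 then obtain V al al' where V: "!!p. open (V p)" "!!p. p : V p" "!!p. dual_frame B (V p) (al p) (al' p)"
  by metis
 have "ALL p. EX ze V' S. sfun ze & open V' & p : V' & (ALL x:V'. ze x = (1::real)) &
   (ALL x. 0 <= ze x) & S <= V p & (ALL x. x ~: S --> ze x = 0)"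
 proof
  fix p
  obtain ze V' S where "sfun ze" "open V'" "p : V'" "V' <= V p" "!!x. x : V' ==> ze x = (1::real)"
   "!!x. 0 <= ze x" "closed S" "S <= V p" "!!x. x ~: S ==> ze x = 0"
   using bump[OF V(1,2)] by metis
  thus "EX ze V' S. sfun ze & open V' & p : V' & (ALL x:V'. ze x = (1::real)) &
   (ALL x. 0 <= ze x) & S <= V p & (ALL x. x ~: S --> ze x = 0)"
   by(intro exI[of _ ze] exI[of _ V'] exI[of _ S]) simp
 qed
 from choice[OF this] obtain ze where "ALL p. EX V' S. sfun (ze p) & open V' & p : V' &
   (ALL x:V'. ze p x = (1::real)) & (ALL x. 0 <= ze p x) & S <= V p & (ALL x. x ~: S --> ze p x = 0)" by(elim exE)
 from choice[OF this] obtain V' where "ALL p. EX S. sfun (ze p) & open (V' p) & p : V' p &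
   (ALL x:V' p. ze p x = (1::real)) & (ALL x. 0 <= ze p x) & S <= V p & (ALL x. x ~: S --> ze p x = 0)" by(elim exE)
 from choice[OF this] obtain S where S: "ALL p. sfun (ze p) & open (V' p) & p : V' p &
   (ALL x:V' p. ze p x = (1::real)) & (ALL x. 0 <= ze p x) & S p <= V p & (ALL x. x ~: S p --> ze p x = 0)" by(elim exE)
 have ze: "!!p. sfun (ze p)"
  "!!p. open (V' p)" "!!p. p : V' p" "!!p x. x : V' p ==> ze p x = (1::real)" "!!p x. 0 <= ze p x"
  "!!p. S p <= V p" "!!p x. x ~: S p ==> ze p x = 0"
  using S by blast+
 note * = dual_frameD(1,2)[OF V(3)] ze dual_frameD(4)[OF V(3)]
 obtain P where P: "finite P" "UNIV <= (UN p:P. V' p)"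
 proof -
  have "UNIV <= (UN p:UNIV. V' p)" using *(5) by auto
  from compactE_image[OF compact_M *(4) this] show ?thesis using that by metis
 qed
 define th where "th x = (SUM p:P. ze p x)" for x
 have thpos: "th x > 0" for x
 proof -
  obtain p where p: "p : P" "x : V' p" using P(2) by blast
  have "ze p x <= th x" unfolding th_def by(rule member_le_sum) (use p P *(7) in auto)
  thus ?thesis using *(6)[OF p(2)] by linarith
 qed
 have sth: "sfun (%x. inverse (th x))"
  unfolding sfun_iff
 proof
  fix x
  have "sfun th" unfolding th_def using *(3) by(intro sfun_sum)
  thus "sat {0} (%_ x. inverse (th x)) 0 x"
   using thpos[of x] by(intro sat_inverse sat_fun) auto
 qed
 define I where "I = P >< B"
 have fI: "finite I" using P onbD(1)[OF B] by(simp add: I_def)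
 define A where "A i x = (ze (fst i) x * inverse (th x)) *R al (fst i) (snd i) x" for i x
 have AG: "A i : Gam" for i unfolding A_def by(intro sec_scale sfun_mult sth *)
 have resol: "(SUM i:I. pair x (al' (fst i) (snd i) x) v *R A i x) = v" if v: "v : F x" for x v
 proof -
  have "(SUM i:I. pair x (al' (fst i) (snd i) x) v *R A i x)
    = (SUM p:P. SUM b:B. pair x (al' p b x) v *R ((ze p x * inverse (th x)) *R al p b x))"
   unfolding I_def A_def by(subst sum.cartesian_product) (simp add: split_beta)
  also have "... = (SUM p:P. (ze p x * inverse (th x)) *R v)"
  proof(rule sum.cong)
   fix p assume "p : P"
   show "(SUM b:B. pair x (al' p b x) v *R ((ze p x * inverse (th x)) *R al p b x)) = (ze p x * inverse (th x)) *R v"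
   proof(cases "x : V p")
    case True
    have "(ze p x * inverse (th x)) *R (SUM b:B. pair x (al' p b x) v *R al p b x) = (ze p x * inverse (th x)) *R v"
     using *(10)[OF True v] by simp
    thus ?thesis by(simp add: scaleR_sum_right mult.commute)
   next
    case False
    hence "ze p x = 0" using *(8,9) by blast
    thus ?thesis by simp
   qed
  qed simp
  also have "... = (th x * inverse (th x)) *R v"
   by(simp add: th_def sum_distrib_right scaleR_sum_left)
  also have "... = v" using thpos[of x] by simp
  finally show ?thesis .
 qed
 obtain h where h: "bij_betw h {0..<card I} I" using ex_bij_betw_nat_finite[OF fI] by blast
 have "(SUM k<card I. pair x (al' (fst (h k)) (snd (h k)) x) v *R A (h k) x) = v" if v: "v : F x" for x v
 proof -
  have "(SUM k:{0..<card I}. pair x (al' (fst (h k)) (snd (h k)) x) v *R A (h k) x) = (SUM i:I. pair x (al' (fst i) (snd i) x) v *R A i x)"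
   by(rule sum.reindex_bij_betw[OF h])
  thus ?thesis using resol[OF v] by(simp only: atLeast0LessThan)
 qed
 moreover have "A (h k) : Gam" "al' (fst (h k)) (snd (h k)) : Gam" for k using AG * by auto
 ultimately have "(ALL i<card I. A (h i) : Gam & al' (fst (h i)) (snd (h i)) : Gam) &
   (ALL x. ALL v:F x. (SUM i<card I. pair x (al' (fst (h i)) (snd (h i)) x) v *R A (h i) x) = v)" by simp
 thus ?thesis
  by(intro exI[of _ "card I"] exI[of _ "%k. A (h k)"] exI[of _ "%k. al' (fst (h k)) (snd (h k))"])
qed

end

section \<open>Global frames and smoothness tested by pairing\<close>

locale framed_courant = courant C
 for C :: "('m::{t2_space,second_countable_topology},'e::{real_inner,banach,heine_borel},'v::real_vector,
  'f::{real_inner,banach,heine_borel}) courant" +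
 fixes gn :: nat and ga ga' :: "nat => 'm => 'v"
 assumes compact_M: "compact (UNIV :: 'm set)"
  and ga: "!!i. i < gn ==> ga i : sections C" "!!i. i < gn ==> ga' i : sections C"
  and frame: "!!x v. v : fibre C x ==> (SUM i<gn. pairing C x (ga' i x) v *R ga i x) = v"
begin

lemma frame':
 assumes v: "v : F x" shows "(SUM i<gn. pair x (ga i x) v *R ga' i x) = v"
proof(rule pair_eqI[OF _ v])
 show "(SUM i<gn. pair x (ga i x) v *R ga' i x) : F x" using ga by auto
 fix w assume w: "w : F x"
 have "pair x (SUM i<gn. pair x (ga i x) v *R ga' i x) w = (SUM i<gn. pair x (ga' i x) w * pair x (ga i x) v)"
  using ga w by(subst pair_sum) (auto simp: mult.commute)
 also have "... = pair x (SUM i<gn. pair x (ga' i x) w *R ga i x) v"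
  using ga v by(subst pair_sum) auto
 also have "... = pair x w v" using frame[OF w] by simp
 finally show "pair x (SUM i<gn. pair x (ga i x) v *R ga' i x) w = pair x v w"
  using pair_sym[OF v w] by simp
qed

lemma section_through:
 assumes "v : F x" obtains s where "s : Gam" "s x = v"
proof -
 have "(%y. SUM i<gn. pair x (ga' i x) v *R ga i y) : Gam"
  by(rule sec_lincomb) (use ga in auto)
 thus ?thesis by(rule that) (rule frame[OF assms])
qed

lemma pair_expand:
 assumes "u : F x" "v : F x"
 shows "pair x u v = (SUM i<gn. pair x (ga' i x) u * pair x (ga i x) v)"
proof -
 have "pair x u v = pair x (SUM i<gn. pair x (ga' i x) u *R ga i x) v" using frame[OF assms(1)] by simp
 also have "... = (SUM i<gn. pair x (ga' i x) u * pair x (ga i x) v)"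
  using ga assms by(subst pair_sum) auto
 finally show ?thesis .
qed

text \<open>Smoothness of a family of sections in the weak sense. Through the resolution of the
  identity it controls the pairing of two families as well, without trivialisations.\<close>

definition sfam :: "real set => (real => 'm => 'v) => real => 'm => bool" where
 "sfam T s t x <-> (ALL a:Gam. sat T (%ta y. pair y (s ta y) (a y)) t x)"

lemma sfamD: "sfam T s t x ==> a : Gam ==> sat T (%ta y. pair y (s ta y) (a y)) t x"
 unfolding sfam_def by blast

lemma sectionI:
 assumes "!!x. s x : F x" "!!a. a : Gam ==> sfun (%x. pair x (s x) (a x))"
 shows "s : Gam"
proof -
 have "(%x. SUM i<gn. pair x (s x) (ga' i x) *R ga i x) : Gam"
  using ga assms by(intro sec_lincomb) auto
 moreover have "(%x. SUM i<gn. pair x (s x) (ga' i x) *R ga i x) = s"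
 proof
  fix x
  have "(SUM i<gn. pair x (s x) (ga' i x) *R ga i x) = (SUM i<gn. pair x (ga' i x) (s x) *R ga i x)"
   using pair_sym[OF assms(1)] ga by(intro sum.cong) auto
  also have "... = s x" by(rule frame[OF assms(1)])
  finally show "(SUM i<gn. pair x (s x) (ga' i x) *R ga i x) = s x" .
 qed
 ultimately show ?thesis by simp
qed

lemma sat_pair:
 assumes "sfam T s t x" "sfam T s' t x" "!!ta y. ta : T ==> s ta y : F y" "!!ta y. ta : T ==> s' ta y : F y"
 shows "sat T (%ta y. pair y (s ta y) (s' ta y)) t x"
proof -
 have "sat T (%ta y. SUM i<gn. pair y (s ta y) (ga' i y) * pair y (s' ta y) (ga i y)) t x"
  by(intro sat_sum sat_mult sfamD[OF assms(1)] sfamD[OF assms(2)]) (use ga in auto)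
 thus ?thesis
 proof(rule sat_cong'[OF _ open_UNIV UNIV_I])
  fix ta y assume "ta : T"
  hence F: "s ta y : F y" "s' ta y : F y" using assms by auto
  show "(SUM i<gn. pair y (s ta y) (ga' i y) * pair y (s' ta y) (ga i y)) = pair y (s ta y) (s' ta y)"
   unfolding pair_expand[OF F]
   using pair_sym[OF F(1)] pair_sym[OF F(2)] ga by(intro sum.cong) auto
 qed
qed

lemma sfam_fixed: "s : Gam ==> sfam T (%_. s) t x"
 unfolding sfam_def using sat_pair_fixed by blast

text \<open>J is A' after the inverse of A: it is known only through a parametrised eigenbundle,
  whose points have real part \<open>A v\<close> and imaginary part \<open>- A' v\<close>.
  Invertibility at one point provides a smooth inverse nearby. This serves for L as well as for the
  graphs.\<close>

lemma sat_quotient: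
 assumes t: "t : T" and W: "open W" "p : W"
  and AF: "!!ta x v. ta : T ==> x : W ==> v : F x ==> A ta x v : F x"
  and AF': "!!ta x v. ta : T ==> x : W ==> v : F x ==> A' ta x v : F x"
  and lin: "!!ta x r v w. ta : T ==> x : W ==> v : F x ==> w : F x ==>
    A ta x (r *R v + w) = r *R A ta x v + A ta x w"
  and lin': "!!ta x r v w. ta : T ==> x : W ==> v : F x ==> w : F x ==>
    A' ta x (r *R v + w) = r *R A' ta x v + A' ta x w"
  and bij: "bij_betw (A t p) (F p) (F p)"
  and J: "!!ta x v. ta : T ==> x : W ==> v : F x ==> J ta x (A ta x v) = A' ta x v"
  and sm: "!!a b. a : Gam ==> b : Gam ==> sat T (%ta x. pair x (A ta x (a x)) (b x)) t p"
  and sm': "!!a b. a : Gam ==> b : Gam ==> sat T (%ta x. pair x (A' ta x (a x)) (b x)) t p"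
  and ab: "a : Gam" "b : Gam"
 shows "sat T (%ta x. pair x (J ta x (a x)) (b x)) t p"
proof -
 obtain B :: "'f set" where B: "onb B" using onb_exists[OF fdF] .
 obtain V al al' where V0: "open V" "p : V" "dual_frame B V al al'"
  using local_frame[OF B,of p] by blast
 note V = V0(1,2) dual_frameD[OF V0(3)]
 define k where "k x u = (SUM b:B. (u *. b) *R al b x)" for x u
 define k' where "k' x v = (SUM b:B. pair x (al' b x) v *R b)" for x v
 have kF: "k x u : F x" for x u unfolding k_def using V(3) by auto
 have klin: "k x (r *R u + w) = r *R k x u + k x w" for x r u w
  by(simp add: k_def inner_add_left scaleR_add_left sum.distrib scaleR_sum_right)
 have k'_inner: "k' x v *. c = pair x (al' c x) v" if "c : B" for x v c
 proof -
  have "k' x v *. c = (SUM b:B. pair x (al' b x) v * (b *. c))" by(simp add: k'_def inner_sum_left)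
  also have "... = (SUM b:B. if b = c then pair x (al' b x) v else 0)"
   using onbD(2)[OF B _ that] by(intro sum.cong) auto
  also have "... = pair x (al' c x) v" using onbD(1)[OF B] that by simp
  finally show ?thesis .
 qed
 have kk': "k x (k' x v) = v" if "x : V" "v : F x" for x v
  using V(6)[OF that] by(simp add: k_def k'_inner cong: sum.cong)
 have k'k: "k' x (k x u) = u" if "x : V" for x u
 proof -
  have "pair x (al' c x) (k x u) = u *. c" if c: "c : B" for c
  proof -
   have "pair x (al' c x) (k x u) = (SUM b:B. (u *. b) * pair x (al b x) (al' c x))"
    unfolding k_def using V(3,4) pair_sym[OF sectionsD[OF V(4)] sectionsD[OF V(3)]]
    by(subst pair_sum) (auto intro!: sum.cong)
   also have "... = (SUM b:B. if b = c then u *. b else 0)"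
    using V(5)[OF \<open>x : V\<close> _ c] by(intro sum.cong) auto
   also have "... = u *. c" using onbD(1)[OF B] c by simp
   finally show ?thesis .
  qed
  thus ?thesis unfolding k'_def by(simp add: onbD(3)[OF B] cong: sum.cong)
 qed
 have k'lin: "k' x (r *R v + w) = r *R k' x v + k' x w" if "v : F x" "w : F x" for x r v w
  using that V(4) by(simp add: k'_def scaleR_add_left sum.distrib scaleR_sum_right)
 \<comment> \<open>\<open>A\<close> in the local frame, an endomorphism of the model fibre, to which
   \<open>sat_inverse_family\<close> applies.\<close>
 define M where "M ta x u = k' x (A ta x (k x u))" for ta x u
 have linM: "linear (M ta x)" if "ta : T" "x : V Int W" for ta x
 proof -
  have l: "M ta x (r *R u + w) = r *R M ta x u + M ta x w" for r u w
   unfolding M_def klin using that lin AF kF by(subst lin) (auto simp: k'lin)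
  have z: "M ta x 0 = 0" using l[of 1 0 0] by simp
  show ?thesis
   by(rule linearI) (use l[of 1] l[of _ _ 0] z in auto)
 qed
 have tp: "t : T" "p : W" "p : V" using t W V by auto
 have "u = w" if "M t p u = M t p w" for u w
 proof -
  have "A t p (k p u) = A t p (k p w)"
   using kk'[OF tp(3) AF[OF tp(1,2) kF]] that unfolding M_def by metis
  hence "k p u = k p w" using bij kF by(auto simp: bij_betw_def inj_on_def)
  thus ?thesis using k'k[OF tp(3)] by metis
 qed
 hence bijM: "bij (M t p)"
  using fd_linear_inj_imp_surj[OF fdF linM] tp by(auto simp: bij_def inj_def)
 have sumA: "A2 ta x (k x u) = (SUM b:B. (u *. b) *R A2 ta x (al b x))"
  if a: "ta : T" "x : V Int W"
   and A2: "!!r v w. v : F x ==> w : F x ==> A2 ta x (r *R v + w) = r *R A2 ta x v + A2 ta x w" for A2 :: "real => 'm => 'v => 'v" and ta x u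
 proof -
  have Az: "A2 ta x 0 = 0" using A2[of 0 0 1] by simp
  have "A2 ta x (SUM b:B'. (u *. b) *R al b x) = (SUM b:B'. (u *. b) *R A2 ta x (al b x))" for B'
   by(induction B' rule: infinite_finite_induct) (use Az V(3) in "auto simp: A2")
  thus ?thesis unfolding k_def .
 qed
 have sM: "sat T (%ta x. M ta x u) t p" for u
 proof -
  have "sat T (%ta x. SUM c:B. SUM b:B. ((u *. b) * pair x (A ta x (al b x)) (al' c x)) *R c) t p"
   by(intro sat_sum sat_scaleR sat_mult sat_const sm V)
  thus ?thesis
  proof(rule sat_cong'[of _ _ _ _ "V Int W"])
   fix ta x assume a: "ta : T" "x : V Int W"
   have Ak: "A ta x (k x u) = (SUM b:B. (u *. b) *R A ta x (al b x))"
    by(rule sumA[OF a]) (use a lin in auto)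
   have AF1: "A ta x (al b x) : F x" for b using AF a V(3) by auto
   have "pair x (al' c x) (A ta x (k x u)) = (SUM b:B. (u *. b) * pair x (A ta x (al b x)) (al' c x))" for c
    unfolding Ak using V(4) AF1 pair_sym[OF AF1 sectionsD[OF V(4)]]
    by(subst pair_sum) auto
   thus "(SUM c:B. SUM b:B. ((u *. b) * pair x (A ta x (al b x)) (al' c x)) *R c) = M ta x u"
    by(simp add: M_def k'_def scaleR_sum_left)
  qed (use V W in auto)
 qed
 have VW: "open (V Int W)" "p : V Int W" using V W by auto
 obtain I X where IX: "open I" "t : I" "open X" "p : X" "X <= V Int W"
  "!!ta x. ta : T ==> ta : I ==> x : X ==> bij (M ta x)"
  "!!w. sat T (%ta x. inv (M ta x) w) t p"
  using sat_inverse_family[OF fdF sM t VW linM bijM] by metis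
 have "sat T (%ta x. SUM c:B. SUM d:B. (pair x (al' d x) (a x) * (inv (M ta x) d *. c)) * pair x (A' ta x (al c x)) (b x)) t p"
  by(intro sat_sum sat_mult sat_inner IX(7) sat_const sat_pair_fixed V sm' ab)
 thus ?thesis
 proof(rule sat_cong[OF _ IX(1,2,3,4)])
  fix ta x assume a: "ta : T" "ta : I" "x : X"
  have x: "x : V" "x : W" "x : V Int W" using a IX(5) by auto
  have b: "bij (M ta x)" by(rule IX(6)[OF a])
  have f: "M ta x (inv (M ta x) u) = u" for u using b by(simp add: bij_is_surj surj_f_inv_f)
  have g: "inv (M ta x) (M ta x u) = u" for u using b by(simp add: bij_is_inj)
  have li: "linear (inv (M ta x))" by(rule bij_linear_inv[OF linM[OF a(1) x(3)] b])
  define z where "z = inv (M ta x) (k' x (a x))"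
  have "A ta x (k x z) = k x (M ta x z)"
   using kk'[OF x(1) AF[OF a(1) x(2) kF]] by(simp add: M_def)
  also have "... = a x" using f kk'[OF x(1) sectionsD[OF ab(1)]] by(simp add: z_def)
  finally have "J ta x (a x) = A' ta x (k x z)" using J[OF a(1) x(2) kF] by metis
  also have "... = (SUM c:B. (z *. c) *R A' ta x (al c x))"
   by(rule sumA[OF a(1) x(3)]) (use a x lin' in auto)
  finally have "pair x (J ta x (a x)) (b x) = (SUM c:B. (z *. c) * pair x (A' ta x (al c x)) (b x))"
   using AF'[OF a(1) x(2)] V(3) ab by(simp add: pair_sum)
  moreover have "z = (SUM d:B. pair x (al' d x) (a x) *R inv (M ta x) d)"
   unfolding z_def k'_def by(simp add: linear_sum[OF li] linear_scale[OF li])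
  ultimately show "(SUM c:B. SUM d:B. (pair x (al' d x) (a x) * (inv (M ta x) d *. c)) * pair x (A' ta x (al c x)) (b x)) = pair x (J ta x (a x)) (b x)"
   by(simp add: inner_sum_left sum_distrib_right)
 qed
qed

end

section \<open>The Dorfman bracket\<close>

context framed_courant
begin

abbreviation Dd where "Dd == courant_D C"

definition rho :: "('m => 'v) => ('m => real) => 'm => real" where
 "rho a f = (%x. an x (a x) f)"

text \<open>The Dorfman bracket. It gives up skew-symmetry, but \<open>dorf a\<close> is a
  derivation of the products of functions and sections, of the pairing and of the bracket itself,
  without correction terms.\<close>

definition dorf :: "('m => 'v) => ('m => 'v) => 'm => 'v" where
 "dorf a b = (%x. br a b x + Dd (%y. pair y (a y) (b y)) x)"

lemma anchor_tangent: "v : F x ==> tangent_vector C x (an x v)"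
 using courant_axioms(5) by blast

lemma anchor_lin:
 assumes "u : F x" "v : F x" "sfun f"
 shows "an x (r *R u + v) f = r * an x u f + an x v f"
 using courant_axioms(6) assms by blast

lemma anchor_zero [simp]: "sfun f ==> an x 0 f = 0"
 using anchor_lin[of 0 x 0 f 1] by simp

lemma anchor_add: "u : F x ==> v : F x ==> sfun f ==> an x (u + v) f = an x u f + an x v f"
 using anchor_lin[of u x v f 1] by simp

lemma anchor_scale: "u : F x ==> sfun f ==> an x (r *R u) f = r * an x u f"
 using anchor_lin[of u x 0 f r] by simp

lemma anchor_sum:
 assumes "!!i. i : I ==> u i : F x" "sfun f"
 shows "an x (SUM i:I. r i *R u i) f = (SUM i:I. r i * an x (u i) f)"
 using assms(1)
 by(induction I rule: infinite_finite_induct) (auto simp: anchor_lin assms(2))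

lemma rho_smooth: "a : Gam ==> sfun f ==> sfun (rho a f)"
 using courant_axioms(7) unfolding anchor_sec_def rho_def by blast

text \<open>Existence behind the description operator in \<open>courant_D\<close>: the resolution of
  the identity represents the covector, and non-degeneracy gives uniqueness.\<close>

lemma Dd_spec:
 assumes f: "sfun f"
 shows "Dd f x : F x" "v : F x ==> pair x (Dd f x) v = 1/2 * an x v f"
proof -
 define w where "w = (SUM i<gn. (1/2 * an x (ga i x) f) *R ga' i x)"
 have wF: "w : F x" unfolding w_def using ga by auto
 have wp: "pair x w v = 1/2 * an x v f" if v: "v : F x" for v
 proof -
  have "pair x w v = (SUM i<gn. (1/2 * an x (ga i x) f) * pair x (ga' i x) v)"
   unfolding w_def using ga v by(subst pair_sum) auto
  also have "... = 1/2 * (SUM i<gn. pair x (ga' i x) v * an x (ga i x) f)"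
   by(simp add: sum_distrib_left mult.commute mult.left_commute)
  also have "(SUM i<gn. pair x (ga' i x) v * an x (ga i x) f) = an x (SUM i<gn. pair x (ga' i x) v *R ga i x) f"
   using ga by(subst anchor_sum[OF _ f]) auto
  also have "... = an x v f" by(simp only: frame[OF v])
  finally show ?thesis .
 qed
 have "Dd f x = w"
  unfolding courant_D_def
 proof(rule the_equality)
  show "w : F x & (ALL v:F x. pair x w v = 1 / 2 * an x v f)" using wF wp by blast
  fix w' assume "w' : F x & (ALL v:F x. pair x w' v = 1 / 2 * an x v f)"
  thus "w' = w" by(intro pair_eqI[OF _ wF]) (auto simp: wp)
 qed
 thus "Dd f x : F x" "v : F x ==> pair x (Dd f x) v = 1/2 * an x v f" using wF wp by simp_all
qed

lemma Dd_F [simp]: "sfun f ==> Dd f x : F x" by(rule Dd_spec(1))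

lemma Dd_section: "sfun f ==> Dd f : Gam"
proof(rule sectionI)
 assume f: "sfun f"
 show "Dd f x : F x" for x using f by simp
 fix a assume a: "a : Gam"
 have "(%x. pair x (Dd f x) (a x)) = (%x. 1/2 * rho a f x)"
  using a by(auto simp: Dd_spec(2)[OF f] rho_def)
 thus "sfun (%x. pair x (Dd f x) (a x))"
  by(simp only: sfun_cmult[OF rho_smooth[OF a f]])
qed

lemma Dd_eqI:
 assumes "sfun f" "w : F x" "!!v. v : F x ==> 2 * pair x w v = an x v f"
 shows "Dd f x = w"
 by(rule pair_eqI[OF Dd_F[OF assms(1)] assms(2)]) (simp add: Dd_spec(2)[OF assms(1)] assms(3)[symmetric])

lemma Dd_pair: "sfun f ==> v : F x ==> 2 * pair x (Dd f x) v = an x v f"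
 "sfun f ==> v : F x ==> 2 * pair x v (Dd f x) = an x v f"
 using Dd_spec(2)[where f = f and x = x and v = v] pair_sym[of v x "Dd f x"] by simp_all

lemma Dd_add: "sfun f ==> sfun g ==> Dd (%y. f y + g y) x = Dd f x + Dd g x"
 by(rule Dd_eqI) (auto simp: sfun_add algebra_simps Dd_pair tv_linear(1)[OF anchor_tangent])
lemma Dd_diff: "sfun f ==> sfun g ==> Dd (%y. f y - g y) x = Dd f x - Dd g x"
 by(rule Dd_eqI) (auto simp: sfun_diff algebra_simps Dd_pair tv_linear(2)[OF anchor_tangent])
lemma Dd_cmult: "sfun f ==> Dd (%y. r * f y) x = r *R Dd f x"
 by(rule Dd_eqI) (auto simp: sfun_cmult mult.left_commute[of 2] Dd_pair tv_linear(3)[OF anchor_tangent _ sfun_const])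
lemma Dd_mult: "sfun f ==> sfun g ==> Dd (%y. f y * g y) x = f x *R Dd g x + g x *R Dd f x"
 by(rule Dd_eqI) (auto simp: sfun_mult distrib_left mult.left_commute[of 2] Dd_pair tangent_vectorD(2)[OF anchor_tangent])

lemma rho_F: "rho a f x = an x (a x) f" by(simp add: rho_def)

lemma rho_lin:
 assumes "a : Gam" "sfun f" "sfun g"
 shows "rho a (%y. f y + g y) x = rho a f x + rho a g x" "rho a (%y. f y - g y) x = rho a f x - rho a g x"
  "rho a (%y. r * f y) x = r * rho a f x" "rho a (%y. f y * g y) x = f x * rho a g x + g x * rho a f x"
  "rho a (%y. - f y) x = - rho a f x"
 using tv_linear[OF anchor_tangent assms(2,3)] tangent_vectorD(2)[OF anchor_tangent assms(2,3)] assms(1)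
 by(simp_all add: rho_def)

lemma rho_const [simp]: "a : Gam ==> rho a (%_. k) x = 0"
 by(simp add: rho_def tv_const[OF anchor_tangent])

lemma bracket_section [simp]: "a : Gam ==> b : Gam ==> br a b : Gam"
 using courant_axioms(8) by blast

lemma dorf_section [simp]: "a : Gam ==> b : Gam ==> dorf a b : Gam"
 unfolding dorf_def by(intro sec_add bracket_section Dd_section pair_smooth)

lemma bracket_skew: "a : Gam ==> b : Gam ==> br a b x = - br b a x"
 using courant_axioms(9) by blast

lemma pair_sym_fun: "a : Gam ==> b : Gam ==> (%y. pair y (a y) (b y)) = (%y. pair y (b y) (a y))"
 by(rule ext) (simp add: pair_sym)

lemma dorf_skew:
 assumes "a : Gam" "b : Gam"
 shows "dorf b a x = - dorf a b x + 2 *R Dd (%y. pair y (a y) (b y)) x"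
 unfolding dorf_def bracket_skew[OF assms] pair_sym_fun[OF assms] by(simp add: scaleR_2)

lemma dorf_metric:
 assumes "a : Gam" "b : Gam" "c : Gam"
 shows "rho a (%y. pair y (b y) (c y)) x = pair x (dorf a b x) (c x) + pair x (b x) (dorf a c x)"
 using courant_axioms(15) assms unfolding dorf_def rho_def anchor_sec_def pair_sec_def by blast

lemma dorf_add_right:
 assumes "a : Gam" "b : Gam" "c : Gam"
 shows "dorf a (%y. r *R b y + c y) x = r *R dorf a b x + dorf a c x"
proof -
 have "br a (%y. r *R b y + c y) x = - br (%y. r *R b y + c y) a x"
  by(rule bracket_skew) (intro assms sec_add sec_cscale)+
 also have "br (%y. r *R b y + c y) a x = r *R br b a x + br c a x"
  using courant_axioms(10) assms by blast
 finally have 1: "br a (%y. r *R b y + c y) x = r *R br a b x + br a c x"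
  using bracket_skew[OF assms(1,2)] bracket_skew[OF assms(1,3)] by simp
 have "(%y. pair y (a y) (r *R b y + c y)) = (%y. r * pair y (a y) (b y) + pair y (a y) (c y))"
  using assms by(intro ext) simp
 hence 2: "Dd (%y. pair y (a y) (r *R b y + c y)) x = r *R Dd (%y. pair y (a y) (b y)) x + Dd (%y. pair y (a y) (c y)) x"
  using assms by(simp add: Dd_add Dd_cmult sfun_cmult pair_smooth)
 show ?thesis unfolding dorf_def 1 2 by(simp add: algebra_simps)
qed

lemma dorf_add_left:
 assumes "a : Gam" "b : Gam" "c : Gam"
 shows "dorf (%y. r *R b y + c y) a x = r *R dorf b a x + dorf c a x"
proof -
 have 1: "br (%y. r *R b y + c y) a x = r *R br b a x + br c a x"
  using courant_axioms(10) assms by blast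
 have "(%y. pair y (r *R b y + c y) (a y)) = (%y. r * pair y (b y) (a y) + pair y (c y) (a y))"
  using assms by(intro ext) simp
 hence 2: "Dd (%y. pair y (r *R b y + c y) (a y)) x = r *R Dd (%y. pair y (b y) (a y)) x + Dd (%y. pair y (c y) (a y)) x"
  using assms by(simp add: Dd_add Dd_cmult sfun_cmult pair_smooth)
 show ?thesis unfolding dorf_def 1 2 by(simp add: algebra_simps)
qed

lemma dorf_zero_right [simp]: "a : Gam ==> dorf a (%_. 0) x = 0"
 using dorf_add_right[of a "%_. 0" "%_. 0" 1 x] by simp
lemma dorf_zero_left [simp]: "a : Gam ==> dorf (%_. 0) a x = 0"
 using dorf_add_left[of a "%_. 0" "%_. 0" 1 x] by simp

lemma dorf_lin_right:
 assumes "a : Gam" "b : Gam" "c : Gam"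
 shows "dorf a (%y. b y + c y) x = dorf a b x + dorf a c x" "dorf a (%y. b y - c y) x = dorf a b x - dorf a c x"
  "dorf a (%y. - b y) x = - dorf a b x" "dorf a (%y. k *R b y) x = k *R dorf a b x"
 using dorf_add_right[OF assms(1,2,3),of 1] dorf_add_right[OF assms(1,3,2),of "-1"]
  dorf_add_right[OF assms(1,2) sec_zero,of "-1"] dorf_add_right[OF assms(1,2) sec_zero,of k] assms
 by simp_all

lemma dorf_lin_left:
 assumes "a : Gam" "b : Gam" "c : Gam"
 shows "dorf (%y. b y + c y) a x = dorf b a x + dorf c a x" "dorf (%y. b y - c y) a x = dorf b a x - dorf c a x"
  "dorf (%y. - b y) a x = - dorf b a x" "dorf (%y. k *R b y) a x = k *R dorf b a x"
 using dorf_add_left[OF assms(1,2,3),of 1] dorf_add_left[OF assms(1,3,2),of "-1"]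
  dorf_add_left[OF assms(1,2) sec_zero,of "-1"] dorf_add_left[OF assms(1,2) sec_zero,of k] assms
 by simp_all

lemma dorf_fun_right:
 assumes "a : Gam" "b : Gam" "sfun f"
 shows "dorf a (%y. f y *R b y) x = f x *R dorf a b x + rho a f x *R b x"
proof -
 have 1: "br a (%y. f y *R b y) x =
     f x *R br a b x + rho a f x *R b x - pair x (a x) (b x) *R Dd f x"
  using courant_axioms(13) assms unfolding rho_def anchor_sec_def pair_sec_def by blast
 have "(%y. pair y (a y) (f y *R b y)) = (%y. f y * pair y (a y) (b y))"
  using assms by(intro ext) simp
 hence 2: "Dd (%y. pair y (a y) (f y *R b y)) x = f x *R Dd (%y. pair y (a y) (b y)) x + pair x (a x) (b x) *R Dd f x"
  using assms by(simp add: Dd_mult pair_smooth)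
 show ?thesis unfolding dorf_def 1 2 by(simp add: algebra_simps)
qed

lemma dorf_fun_left:
 assumes "a : Gam" "b : Gam" "sfun f"
 shows "dorf (%y. f y *R a y) b x = f x *R dorf a b x - rho b f x *R a x + (2 * pair x (a x) (b x)) *R Dd f x"
proof -
 have fa: "(%y. f y *R a y) : Gam" by(rule sec_scale[OF assms(1,3)])
 have "(%y. pair y (b y) (f y *R a y)) = (%y. f y * pair y (b y) (a y))"
  using assms by(intro ext) simp
 hence 2: "Dd (%y. pair y (b y) (f y *R a y)) x = f x *R Dd (%y. pair y (b y) (a y)) x + pair x (b x) (a x) *R Dd f x"
  using assms by(simp add: Dd_mult pair_smooth)
 have s: "pair x (b x) (a x) = pair x (a x) (b x)" using assms by(simp add: pair_sym)
 show ?thesis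
  unfolding dorf_skew[OF assms(2) fa] dorf_skew[OF assms(2,1)] dorf_fun_right[OF assms(2,1,3)] 2 s
  by(simp add: scaleR_add_right scaleR_diff_right mult.commute)
qed

lemma rho_Dd: "sfun f ==> sfun g ==> an x (Dd f x) g = 0"
 using courant_axioms(14) unfolding anchor_sec_def by blast

lemma rho_dorf:
 assumes "a : Gam" "b : Gam" "sfun f"
 shows "rho (dorf a b) f x = rho a (rho b f) x - rho b (rho a f) x"
proof -
 have "rho (dorf a b) f x = an x (br a b x) f"
  using assms bracket_section[OF assms(1,2)] rho_Dd[OF pair_smooth[OF assms(1,2)] assms(3)]
  by(simp add: rho_def dorf_def anchor_add pair_smooth)
 also have "... = rho a (rho b f) x - rho b (rho a f) x"
  using courant_axioms(11) assms unfolding anchor_sec_def rho_def by blast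
 finally show ?thesis .
qed

text \<open>Test against a section c: the metric rule and compatibility with the anchor move all
  derivatives onto f.\<close>

lemma dorf_Dd_right:
 assumes "a : Gam" "sfun f"
 shows "dorf a (Dd f) x = Dd (rho a f) x"
proof(rule Dd_eqI[symmetric])
 show "sfun (rho a f)" using assms by(rule rho_smooth)
 show "dorf a (Dd f) x : F x" using assms by(simp add: Dd_section)
 fix v assume v: "v : F x"
 obtain c where c: "c : Gam" "c x = v" using section_through[OF v] by blast
 have e: "(%y. pair y (Dd f y) (c y)) = (%y. 1/2 * rho c f y)"
  using Dd_spec(2)[OF assms(2)] c by(auto simp: rho_def)
 have "rho a (%y. pair y (Dd f y) (c y)) x = 1/2 * rho a (rho c f) x"
  unfolding e by(rule rho_lin(3)[OF assms(1) rho_smooth[OF c(1) assms(2)] sfun_const[of 0]])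
 hence "1/2 * rho a (rho c f) x = pair x (dorf a (Dd f) x) (c x) + pair x (Dd f x) (dorf a c x)"
  using dorf_metric[OF assms(1) Dd_section[OF assms(2)] c(1),of x] by simp
 moreover have "2 * pair x (Dd f x) (dorf a c x) = rho (dorf a c) f x"
  using Dd_pair(1)[OF assms(2)] assms c by(simp add: rho_def)
 ultimately show "2 * pair x (dorf a (Dd f) x) v = an x v (rho a f)"
  using rho_dorf[OF assms(1) c(1) assms(2),of x] c(2) unfolding rho_F[of c "rho a f" x] by simp
qed

lemma dorf_Dd_left:
 assumes "a : Gam" "sfun f"
 shows "dorf (Dd f) a x = 0"
proof -
 have "pair y (a y) (Dd f y) = 1/2 * rho a f y" for y
  using Dd_pair(2)[OF assms(2) sectionsD[OF assms(1)],of y] unfolding rho_def by linarith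
 hence e: "(%y. pair y (a y) (Dd f y)) = (%y. 1/2 * rho a f y)" by(rule ext)
 show ?thesis
  unfolding dorf_skew[OF assms(1) Dd_section[OF assms(2)]] e dorf_Dd_right[OF assms]
   Dd_cmult[OF rho_smooth[OF assms]] by simp
qed

text \<open>The cyclic identity (ii) becomes a Leibniz identity: exact terms inside a bracket
  disappear since \<open>dorf (Dd f)\<close> is 0, and the outer exact terms cancel by a linear
  relation between the cyclic pairings, which comes from (v).\<close>

lemma dorf_jacobi:
 assumes a: "a : Gam" and b: "b : Gam" and c: "c : Gam"
 shows "dorf a (dorf b c) x = dorf (dorf a b) c x + dorf b (dorf a c) x"
proof -
 define p where "p = (%y. pair y (br a b y) (c y))"
 define q where "q = (%y. pair y (br b c y) (a y))"
 define r where "r = (%y. pair y (br c a y) (b y))"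
 have sp: "sfun p" "sfun q" "sfun r"
  unfolding p_def q_def r_def using a b c by(auto intro: pair_smooth)
 have br: "br (br u v) w x = dorf (dorf u v) w x - Dd (%y. pair y (br u v y) (w y)) x"
  if "u : Gam" "v : Gam" "w : Gam" for u v w
 proof -
  have "br u v = (%y. dorf u v y - Dd (%y. pair y (u y) (v y)) y)" by(simp add: dorf_def)
  hence "dorf (br u v) w x = dorf (dorf u v) w x"
   using dorf_lin_left(2)[OF that(3) dorf_section[OF that(1,2)] Dd_section[OF pair_smooth[OF that(1,2)]]]
    dorf_Dd_left[OF that(3) pair_smooth[OF that(1,2)]] by simp
  thus ?thesis by(simp add: eq_diff_eq dorf_def[of "br u v"])
 qed
 have "br (br a b) c x + br (br b c) a x + br (br c a) b x
   = (1/3) *R Dd (%y. p y + q y + r y) x"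
  using courant_axioms(12) a b c unfolding pair_sec_def p_def q_def r_def by blast
 \<comment> \<open>4/3 = 1/3 + 1: the right-hand side of (ii) plus the exact terms split off from
   the three outer brackets.\<close>
 hence cyc: "dorf (dorf a b) c x + dorf (dorf b c) a x + dorf (dorf c a) b x = (4/3) *R Dd (%y. p y + q y + r y) x"
  unfolding br[OF a b c] br[OF b c a] br[OF c a b] p_def[symmetric] q_def[symmetric] r_def[symmetric]
  using sp scaleR_left_distrib[of 1 "1/3" "Dd p x + Dd q x + Dd r x"]
  by(simp add: Dd_add sfun_add algebra_simps)
 have flip: "dorf u v = (%y. 2 *R Dd (%y. pair y (v y) (u y)) y - dorf v u y)" if "u : Gam" "v : Gam" for u v
  using dorf_skew[OF that(2,1)] by(auto simp: algebra_simps)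
 have ac: "dorf (dorf a c) b x = - dorf (dorf c a) b x"
  unfolding flip[OF a c]
  using a b c dorf_Dd_left[OF b pair_smooth[OF c a]]
  by(simp add: dorf_lin_left(2,4)[OF b] sec_cscale Dd_section pair_smooth)
 define f where "f = (%y. pair y (dorf b c y) (a y))"
 define g where "g = (%y. pair y (dorf a c y) (b y))"
 have sf: "sfun f" "sfun g" unfolding f_def g_def using a b c by(auto intro: pair_smooth)
 have e1: "dorf a (dorf b c) x = 2 *R Dd f x - dorf (dorf b c) a x"
  using dorf_skew[OF dorf_section[OF b c] a,of x] by(simp add: f_def)
 have e2: "dorf b (dorf a c) x = 2 *R Dd g x - dorf (dorf a c) b x"
  using dorf_skew[OF dorf_section[OF a c] b,of x] by(simp add: g_def)
 \<comment> \<open>Subtracting two instances of the metric rule eliminates G and gives 3/2 (A - B) =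
   2 p - q - r, whence the factor 2/3.\<close>
 have "f y - g y = 2/3 * (p y + q y + r y)" for y
 proof -
  have half: "pair y (Dd (%y. pair y (u y) (v y)) y) (w y) = 1/2 * rho w (%y. pair y (u y) (v y)) y"
   if "u : Gam" "v : Gam" "w : Gam" for u v w
   using Dd_spec(2)[OF pair_smooth[OF that(1,2)] sectionsD[OF that(3)]] by(simp add: rho_def)
  have dp: "pair y (dorf u v y) (w y) = pair y (br u v y) (w y) + 1/2 * rho w (%y. pair y (u y) (v y)) y"
   if "u : Gam" "v : Gam" "w : Gam" for u v w
   using half[OF that] that bracket_section[OF that(1,2)] by(simp add: dorf_def pair_smooth)
  have sk: "pair y (br u v y) (w y) = - pair y (br v u y) (w y)" if "u : Gam" "v : Gam" "w : Gam" for u v w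
   using bracket_skew[OF that(1,2),of y] that bracket_section[OF that(2,1)] by simp
  have cm: "pair y (w y) (dorf u v y) = pair y (dorf u v y) (w y)" if "u : Gam" "v : Gam" "w : Gam" for u v w
   using that by(intro pair_sym) auto
  define A where "A = rho a (%y. pair y (b y) (c y)) y"
  define B where "B = rho b (%y. pair y (c y) (a y)) y"
  define G where "G = rho c (%y. pair y (a y) (b y)) y"
  have "A = p y + 1/2 * G + (- r y + 1/2 * B)"
   using dorf_metric[OF a b c,of y] dp[OF a b c] dp[OF a c b] cm[OF a c b] sk[OF a c b] pair_sym_fun[OF a c]
   by(simp add: A_def B_def G_def p_def r_def)
  moreover have "B = q y + 1/2 * A + (- p y + 1/2 * G)"
   using dorf_metric[OF b c a,of y] dp[OF b c a] dp[OF b a c] cm[OF b a c] sk[OF b a c] pair_sym_fun[OF b a]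
   by(simp add: A_def B_def G_def p_def q_def)
  moreover have "f y = q y + 1/2 * A" using dp[OF b c a] by(simp add: f_def q_def A_def)
  moreover have "g y = - r y + 1/2 * B"
   using dp[OF a c b] sk[OF a c b] pair_sym_fun[OF a c] by(simp add: g_def r_def B_def)
  ultimately show ?thesis by(simp add: field_simps)
 qed
 hence "(%y. f y - g y) = (%y. 2/3 * (p y + q y + r y))" by(rule ext)
 hence "Dd f x - Dd g x = (2/3) *R Dd (%y. p y + q y + r y) x"
  using Dd_diff[OF sf,of x] Dd_cmult[of "%y. p y + q y + r y" "2/3" x] sp by(simp add: sfun_add)
 hence "2 *R Dd f x - 2 *R Dd g x = (4/3) *R Dd (%y. p y + q y + r y) x"
  by(simp add: scaleR_diff_right[symmetric])
 hence "2 *R Dd f x - 2 *R Dd g x = dorf (dorf a b) c x + dorf (dorf b c) a x + dorf (dorf c a) b x"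
  using cyc by simp
 thus ?thesis unfolding e1 e2 ac by(simp add: algebra_simps)
qed

lemma dorf_sum_right:
 assumes "a : Gam" "!!i. i : I ==> s i : Gam"
 shows "dorf a (%y. SUM i:I. s i y) x = (SUM i:I. dorf a (s i) x)"
 using assms(2)
 by(induction I rule: infinite_finite_induct)
  (auto simp: assms(1) dorf_lin_right(1)[OF assms(1) _ sec_sum])

text \<open>The tensor formed by \<open>ga' i\<close> and \<open>ga i\<close> is the identity of E,
  and the derivation \<open>dorf e\<close> annihilates it. This is what later makes the flow
  isometric.\<close>

lemma dorf_frame:
 assumes e: "e : Gam" and b: "b : Gam"
 shows "(SUM i<gn. pair x (dorf e (ga' i) x) (b x) *R ga i x + pair x (ga' i x) (b x) *R dorf e (ga i) x) = 0"
proof -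
 have "dorf e b x = dorf e (%y. SUM i<gn. pair y (ga' i y) (b y) *R ga i y) x"
  using frame b by simp
 also have "... = (SUM i<gn. pair x (ga' i x) (b x) *R dorf e (ga i) x + rho e (%y. pair y (ga' i y) (b y)) x *R ga i x)"
  using ga e b by(subst dorf_sum_right) (auto intro!: sec_scale pair_smooth sum.cong simp: dorf_fun_right pair_smooth)
 also have "... = (SUM i<gn. pair x (ga' i x) (b x) *R dorf e (ga i) x + pair x (dorf e (ga' i) x) (b x) *R ga i x
   + pair x (ga' i x) (dorf e b x) *R ga i x)"
  using ga e b by(intro sum.cong) (auto simp: dorf_metric algebra_simps)
 also have "... = (SUM i<gn. pair x (dorf e (ga' i) x) (b x) *R ga i x + pair x (ga' i x) (b x) *R dorf e (ga i) x)
   + (SUM i<gn. pair x (ga' i x) (dorf e b x) *R ga i x)"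
  by(simp add: sum.distrib add.commute)
 also have "(SUM i<gn. pair x (ga' i x) (dorf e b x) *R ga i x) = dorf e b x"
  using e b by(intro frame) simp
 finally show ?thesis by simp
qed

section \<open>Complexification\<close>

abbreviation cp where "cp == cpairing C"

definition FC :: "'m => ('v * 'v) set" where "FC x = F x >< F x"

definition GC :: "('m => 'v * 'v) set" where "GC = {s. fst o s : Gam & snd o s : Gam}"

definition cdorf :: "('m => 'v * 'v) => ('m => 'v * 'v) => 'm => 'v * 'v" where
 "cdorf s t = (%x. (dorf (fst o s) (fst o t) x - dorf (snd o s) (snd o t) x,
           dorf (fst o s) (snd o t) x + dorf (snd o s) (fst o t) x))"

lemma GC_cases:
 assumes "s : GC"
 obtains a b where "a : Gam" "b : Gam" "s = (%x. (a x,b x))"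
 by(rule that[of "fst o s" "snd o s"]) (use assms in "auto simp: GC_def")

lemma GC_I: "a : Gam ==> b : Gam ==> (%x. (a x,b x)) : GC"
 by(simp add: GC_def o_def)

lemma GC_FC [simp]: "s : GC ==> s x : FC x"
 by(erule GC_cases) (simp add: FC_def)

lemma cscale_simps: "cscale z (a,b) = (Re z *R a - Im z *R b,Re z *R b + Im z *R a)"
 by(simp add: cscale_def)

lemma cscale_zero_right [simp]: "cscale z 0 = 0" by(simp add: cscale_def zero_prod_def)
lemma cscale_add_right: "cscale z (u + w) = cscale z u + cscale z w"
 by(simp add: cscale_def algebra_simps)
lemma cscale_add_left: "cscale (z + z') u = cscale z u + cscale z' u"
 by(simp add: cscale_def algebra_simps)
lemma cscale_diff_left: "cscale (z - z') u = cscale z u - cscale z' u"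
 by(simp add: cscale_def algebra_simps)
lemma cscale_cscale: "cscale z (cscale z' u) = cscale (z * z') u"
 by(simp add: cscale_def algebra_simps)
lemma cscale_of_real: "cscale (of_real r) u = r *R u"
 by(simp add: cscale_def prod_eq_iff)
lemma cscale_sum_right: "cscale z (SUM i:I. g i) = (SUM i:I. cscale z (g i))"
 by(induction I rule: infinite_finite_induct) (simp_all add: cscale_add_right)
lemma FC_closed [simp,intro]:
 "0 : FC x" "u : FC x ==> w : FC x ==> u + w : FC x" "u : FC x ==> cscale z u : FC x"
 "u : FC x ==> w : FC x ==> u - w : FC x" "u : FC x ==> - u : FC x" "u : FC x ==> cconj u : FC x"
 by(auto simp: FC_def cscale_def cconj_def mem_Times_iff)

lemma FC_sum [simp,intro]: "(!!i. i : I ==> g i : FC x) ==> sum g I : FC x"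
 by(induction I rule: infinite_finite_induct) auto

lemma cp_add_left [simp]: "u : FC x ==> v : FC x ==> w : FC x ==> cp x (u + v) w = cp x u w + cp x v w"
 by(auto simp: cpairing_def FC_def complex_eq_iff)
lemma cp_diff_left [simp]: "u : FC x ==> v : FC x ==> w : FC x ==> cp x (u - v) w = cp x u w - cp x v w"
 by(auto simp: cpairing_def FC_def complex_eq_iff)
lemma cp_zero_left [simp]: "w : FC x ==> cp x 0 w = 0"
 by(auto simp: cpairing_def FC_def complex_eq_iff)
lemma cp_scale_left [simp]: "u : FC x ==> w : FC x ==> cp x (cscale z u) w = z * cp x u w"
 by(auto simp: cpairing_def FC_def complex_eq_iff cscale_def algebra_simps)
lemma cp_sym: "u : FC x ==> w : FC x ==> cp x u w = cp x w u"
 by(auto simp: cpairing_def FC_def complex_eq_iff pair_sym)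
lemma cp_add_right [simp]: "u : FC x ==> v : FC x ==> w : FC x ==> cp x w (u + v) = cp x w u + cp x w v"
 using cp_sym[of w x] by simp
lemma cp_zero_right [simp]: "w : FC x ==> cp x w 0 = 0"
 using cp_sym[of w x 0] by simp
lemma cp_scale_right [simp]: "u : FC x ==> w : FC x ==> cp x w (cscale z u) = z * cp x w u"
 using cp_sym[of w x] by simp
lemma cp_sum:
 assumes "!!i. i : I ==> g i : FC x" "w : FC x"
 shows "cp x (SUM i:I. g i) w = (SUM i:I. cp x (g i) w)" "cp x w (SUM i:I. g i) = (SUM i:I. cp x w (g i))"
 using assms by(induction I rule: infinite_finite_induct) auto
lemma cp_conj: "u : FC x ==> w : FC x ==> cp x (cconj u) (cconj w) = cnj (cp x u w)"
 by(auto simp: cpairing_def FC_def complex_eq_iff cconj_def)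

lemma cp_nondeg:
 assumes "u : FC x" "!!w. w : FC x ==> cp x u w = 0"
 shows "u = 0"
proof -
 obtain a b where u: "u = (a,b)" "a : F x" "b : F x" using assms(1) by(auto simp: FC_def)
 have "pair x a v = 0 & pair x b v = 0" if v: "v : F x" for v
  using assms(2)[of "(v,0)"] v u by(auto simp: cpairing_def FC_def complex_eq_iff)
 hence "a = 0" "b = 0" using pair_nondeg u by blast+
 thus ?thesis using u by(simp add: zero_prod_def)
qed

lemma csmooth_Re_Im: "sfun f ==> sfun (%x. Re (f x))" "sfun f ==> sfun (%x. Im (f x))"
 by(rule sfun_linear[OF bounded_linear_Re],assumption) (rule sfun_linear[OF bounded_linear_Im])

lemma csmooth_Complex:
 assumes "sfun f" "sfun g" shows "sfun (%x. Complex (f x) (g x))"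
proof -
 have "sfun (%x. complex_of_real (f x) + \<i> * complex_of_real (g x))"
  by(intro sfun_add sfun_mult sfun_const sfun_linear[OF bounded_linear_of_real] assms)
 thus ?thesis by(simp add: Complex_eq)
qed

lemma cp_smooth: "s : GC ==> t : GC ==> sfun (%x. cp x (s x) (t x))"
 unfolding cpairing_def
 by(erule GC_cases,erule GC_cases)
  (auto intro!: csmooth_Complex sfun_add sfun_diff pair_smooth)

lemma canchor_eq: "can (%x. (a x,b x)) f x = Complex (rho a (%x. Re (f x)) x - rho b (%x. Im (f x)) x)
   (rho a (%x. Im (f x)) x + rho b (%x. Re (f x)) x)"
 by(simp add: canchor_def o_def anchor_sec_def rho_def)

lemma cdorf_eq: "cdorf (%x. (a x,b x)) (%x. (c x,d x)) x = (dorf a c x - dorf b d x,dorf a d x + dorf b c x)"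
 by(simp add: cdorf_def o_def)

lemma cdorf_GC [simp]: "s : GC ==> t : GC ==> cdorf s t : GC"
 by(erule GC_cases,erule GC_cases)
  (auto simp: GC_def cdorf_def o_def intro!: sec_add sec_diff)

lemma cscale_GC: "s : GC ==> sfun f ==> (%x. cscale (f x) (s x)) : GC"
 by(erule GC_cases)
  (auto simp: GC_def o_def cscale_def intro!: sec_add sec_diff sec_scale csmooth_Re_Im)

lemma GC_add: "s : GC ==> t : GC ==> (%x. s x + t x) : GC"
 by(auto simp: GC_def o_def intro!: sec_add)
lemma GC_diff: "s : GC ==> t : GC ==> (%x. s x - t x) : GC"
 by(auto simp: GC_def o_def intro!: sec_diff)
lemma GC_zero [simp]: "(%x. 0) : GC" by(auto simp: GC_def o_def)
lemma GC_sum: "(!!i. i : I ==> s i : GC) ==> (%x. SUM i:I. s i x) : GC"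
 by(induction I rule: infinite_finite_induct) (auto intro: GC_add)
lemma GC_conj: "s : GC ==> (%x. cconj (s x)) : GC"
 by(auto simp: GC_def o_def cconj_def intro!: sec_minus)

lemma cdorf_metric:
 assumes "u : GC" "v : GC" "w : GC"
 shows "can u (%y. cp y (v y) (w y)) x = cp x (cdorf u v x) (w x) + cp x (v x) (cdorf u w x)"
proof -
 obtain u1 u2 where u: "u1 : Gam" "u2 : Gam" "u = (%x. (u1 x,u2 x))" by(rule GC_cases[OF assms(1)])
 obtain v1 v2 where v: "v1 : Gam" "v2 : Gam" "v = (%x. (v1 x,v2 x))" by(rule GC_cases[OF assms(2)])
 obtain w1 w2 where w: "w1 : Gam" "w2 : Gam" "w = (%x. (w1 x,w2 x))" by(rule GC_cases[OF assms(3)])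
 note * = u(1,2) v(1,2) w(1,2) u(3) v(3) w(3)
 show ?thesis
  unfolding *(7-9) canchor_eq cdorf_eq cpairing_def using *(1-6)
  by(simp add: complex_eq_iff rho_lin pair_smooth sfun_diff sfun_add dorf_metric)
qed

lemma cdorf_sym:
 assumes "u : GC" "v : GC" "w : GC"
 shows "cp x (cdorf u v x) (w x) + cp x (cdorf v u x) (w x) = can w (%y. cp y (u y) (v y)) x"
proof -
 obtain u1 u2 where u: "u1 : Gam" "u2 : Gam" "u = (%x. (u1 x,u2 x))" by(rule GC_cases[OF assms(1)])
 obtain v1 v2 where v: "v1 : Gam" "v2 : Gam" "v = (%x. (v1 x,v2 x))" by(rule GC_cases[OF assms(2)])
 obtain w1 w2 where w: "w1 : Gam" "w2 : Gam" "w = (%x. (w1 x,w2 x))" by(rule GC_cases[OF assms(3)])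
 note * = u(1,2) v(1,2) w(1,2) u(3) v(3) w(3)
 have s: "pair x (dorf a b x) (c x) + pair x (dorf b a x) (c x) = rho c (%y. pair y (a y) (b y)) x"
  if "a : Gam" "b : Gam" "c : Gam" for a b c
  using dorf_skew[OF that(1,2),of x] that Dd_pair(1)[OF pair_smooth[OF that(1,2)] sectionsD[OF that(3)]]
  by(simp add: rho_def pair_smooth)
 show ?thesis
  unfolding *(7-9) canchor_eq cdorf_eq cpairing_def using *(1-6)
  by(simp add: complex_eq_iff rho_lin pair_smooth sfun_diff sfun_add s[symmetric])
qed

lemma cdorf_add_right:
 assumes "u : GC" "v : GC" "w : GC"
 shows "cdorf u (%y. v y + w y) x = cdorf u v x + cdorf u w x"
  "cdorf (%y. v y + w y) u x = cdorf v u x + cdorf w u x"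
  "cdorf u (%y. v y - w y) x = cdorf u v x - cdorf u w x"
  "cdorf (%y. v y - w y) u x = cdorf v u x - cdorf w u x"
proof -
 obtain u1 u2 where u: "u1 : Gam" "u2 : Gam" "u = (%x. (u1 x,u2 x))" by(rule GC_cases[OF assms(1)])
 obtain v1 v2 where v: "v1 : Gam" "v2 : Gam" "v = (%x. (v1 x,v2 x))" by(rule GC_cases[OF assms(2)])
 obtain w1 w2 where w: "w1 : Gam" "w2 : Gam" "w = (%x. (w1 x,w2 x))" by(rule GC_cases[OF assms(3)])
 note * = u(1,2) v(1,2) w(1,2) u(3) v(3) w(3)
 show "cdorf u (%y. v y + w y) x = cdorf u v x + cdorf u w x"
  "cdorf (%y. v y + w y) u x = cdorf v u x + cdorf w u x"
  "cdorf u (%y. v y - w y) x = cdorf u v x - cdorf u w x"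
  "cdorf (%y. v y - w y) u x = cdorf v u x - cdorf w u x"
  unfolding *(7-9) using *(1-6) by(simp_all add: cdorf_eq dorf_lin_left dorf_lin_right algebra_simps)
qed

lemma cdorf_fun_right:
 assumes "u : GC" "v : GC" "sfun f"
 shows "cdorf u (%y. cscale (f y) (v y)) x = cscale (f x) (cdorf u v x) + cscale (can u f x) (v x)"
proof -
 obtain u1 u2 where u: "u1 : Gam" "u2 : Gam" "u = (%x. (u1 x,u2 x))" by(rule GC_cases[OF assms(1)])
 obtain v1 v2 where v: "v1 : Gam" "v2 : Gam" "v = (%x. (v1 x,v2 x))" by(rule GC_cases[OF assms(2)])
 note * = u(1,2) v(1,2) u(3) v(3)
 show ?thesis
  unfolding *(5,6) cscale_simps canchor_eq cdorf_eq
  using *(1-4) csmooth_Re_Im[OF assms(3)]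
  by(simp add: dorf_lin_right sec_scale dorf_fun_right algebra_simps)
qed

text \<open>Orthogonality of u and v removes the \<open>Dd f\<close> term, so f leaves the first
  slot as in a Lie algebroid.\<close>

lemma cdorf_fun_left:
 assumes "u : GC" "v : GC" "sfun f" "!!y. cp y (u y) (v y) = 0"
 shows "cdorf (%y. cscale (f y) (u y)) v x = cscale (f x) (cdorf u v x) - cscale (can v f x) (u x)"
proof -
 obtain u1 u2 where u: "u1 : Gam" "u2 : Gam" "u = (%x. (u1 x,u2 x))" by(rule GC_cases[OF assms(1)])
 obtain v1 v2 where v: "v1 : Gam" "v2 : Gam" "v = (%x. (v1 x,v2 x))" by(rule GC_cases[OF assms(2)])
 note * = u(1,2) v(1,2) u(3) v(3)
 have z: "pair x (u1 x) (v1 x) = pair x (u2 x) (v2 x)" "pair x (u1 x) (v2 x) = - pair x (u2 x) (v1 x)"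
  using assms(4)[of x] *(5,6) by(auto simp: cpairing_def complex_eq_iff)
 show ?thesis
  unfolding *(5,6) cscale_simps canchor_eq cdorf_eq
  using *(1-4) csmooth_Re_Im[OF assms(3)]
  by(simp add: dorf_lin_left sec_scale dorf_fun_left z algebra_simps)
qed

lemma canchor_lin:
 assumes "u : GC" "sfun f" "sfun g"
 shows "can u (%y. f y + g y) x = can u f x + can u g x"
  "can u (%y. f y - g y) x = can u f x - can u g x"
  "can u (%y. f y * g y) x = f x * can u g x + g x * can u f x"
  "can u (%y. - f y) x = - can u f x"
proof -
 obtain u1 u2 where *: "u1 : Gam" "u2 : Gam" "u = (%x. (u1 x,u2 x))"
  by(rule GC_cases[OF assms(1)])
 note s = csmooth_Re_Im[OF assms(2)] csmooth_Re_Im[OF assms(3)]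
 show "can u (%y. f y + g y) x = can u f x + can u g x"
  "can u (%y. f y - g y) x = can u f x - can u g x"
  "can u (%y. f y * g y) x = f x * can u g x + g x * can u f x"
  "can u (%y. - f y) x = - can u f x"
  unfolding *(3) canchor_eq using *(1,2) s
  by(simp_all add: complex_eq_iff rho_lin sfun_mult rho_lin(5)[OF _ _ sfun_const] algebra_simps)
qed

lemma canchor_const [simp]: "u : GC ==> can u (%_. k) x = 0"
 by(erule GC_cases) (simp add: canchor_eq complex_eq_iff)

lemma canchor_left:
 assumes "u : GC" "v : GC" "sfun f"
 shows "can (%y. u y + v y) f x = can u f x + can v f x"
  "can (%y. u y - v y) f x = can u f x - can v f x"
  "can (%y. cscale (g y) (u y)) f x = g x * can u f x"
proof -
 obtain u1 u2 where u: "u1 : Gam" "u2 : Gam" "u = (%x. (u1 x,u2 x))" by(rule GC_cases[OF assms(1)])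
 obtain v1 v2 where v: "v1 : Gam" "v2 : Gam" "v = (%x. (v1 x,v2 x))" by(rule GC_cases[OF assms(2)])
 note * = u(1,2) v(1,2) u(3) v(3)
 have d: "an x (a - b) h = an x a h - an x b h" if "a : F x" "b : F x" "sfun h" for a b h
  using anchor_lin[OF that(2,1,3),of "-1"] by(simp add: algebra_simps)
 note s = csmooth_Re_Im[OF assms(3)]
 show "can (%y. u y + v y) f x = can u f x + can v f x"
  "can (%y. u y - v y) f x = can u f x - can v f x"
  "can (%y. cscale (g y) (u y)) f x = g x * can u f x"
  unfolding *(5,6) using *(1-4) s
  by(simp_all add: canchor_eq cscale_simps rho_def anchor_add anchor_scale d complex_eq_iff algebra_simps)
qed

text \<open>On orthogonal sections the exact term vanishes. This links the Lie algebroids L and its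
  conjugate, defined with the Courant bracket, to the Dorfman calculus.\<close>

lemma cdorf_cbracket:
 assumes "u : GC" "v : GC" "!!y. cp y (u y) (v y) = 0"
 shows "cdorf u v = cbracket C u v"
proof
 fix x
 obtain u1 u2 where u: "u1 : Gam" "u2 : Gam" "u = (%x. (u1 x,u2 x))" by(rule GC_cases[OF assms(1)])
 obtain v1 v2 where v: "v1 : Gam" "v2 : Gam" "v = (%x. (v1 x,v2 x))" by(rule GC_cases[OF assms(2)])
 note * = u(1,2) v(1,2) u(3) v(3)
 have z: "pair y (u1 y) (v1 y) = pair y (u2 y) (v2 y)" "pair y (u1 y) (v2 y) = - pair y (u2 y) (v1 y)" for y
  using assms(3)[of y] *(5,6) by(auto simp: cpairing_def complex_eq_iff)
 have m: "Dd (%y. - pair y (u2 y) (v1 y)) x = - Dd (%y. pair y (u2 y) (v1 y)) x"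
  using Dd_cmult[OF pair_smooth[OF *(2,3)],of "-1" x] by simp
 show "cdorf u v x = cbracket C u v x"
  unfolding cdorf_def cbracket_def *(5,6) by(simp add: o_def dorf_def z m)
qed

lemma sfam_fst_snd:
 assumes "!!t x. u t x : FC x" "!!a. a : Gam ==> sat T (%t x. cp x (u t x) (a x,0)) t x"
 shows "sfam T (%t x. fst (u t x)) t x" "sfam T (%t x. snd (u t x)) t x"
proof -
 have "Re (cp y (u s y) (a y,0)) = pair y (fst (u s y)) (a y)" "Im (cp y (u s y) (a y,0)) = pair y (snd (u s y)) (a y)"
  if "a : Gam" for a s y using assms(1)[of s y] that by(auto simp: cpairing_def FC_def)
 thus "sfam T (%t x. fst (u t x)) t x" "sfam T (%t x. snd (u t x)) t x" unfolding sfam_def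
  using sat_linear[OF bounded_linear_Re assms(2)] sat_linear[OF bounded_linear_Im assms(2)] by simp_all
qed

end

section \<open>Complex polarisations and orthogonal complex structures\<close>

lemma cconj_simps [simp]: "cconj (cconj u) = u" "cconj 0 = 0" "cconj (u + w) = cconj u + cconj w"
 "cconj (u - w) = cconj u - cconj w" "cconj (- u) = - cconj u"
 "cconj (cscale z u) = cscale (cnj z) (cconj u)"
 by(simp_all add: cconj_def cscale_def zero_prod_def prod_eq_iff)

lemma cconj_eq_iff [simp]: "cconj u = cconj w <-> u = w"
 by(metis cconj_simps(1))

lemma cscale_1_left [simp]: "cscale 1 u = u" by(simp add: cscale_def)

definition csubspace :: "('v::real_vector * 'v) set => bool" where
 "csubspace N <-> 0 : N & (ALL u:N. ALL w:N. ALL z. cscale z u + w : N)"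

lemma csubspaceD:
 assumes "csubspace N"
 shows "0 : N" "u : N ==> w : N ==> u + w : N" "u : N ==> cscale z u : N"
  "u : N ==> w : N ==> u - w : N" "u : N ==> - u : N"
proof -
 have 0: "0 : N" and l: "u : N ==> w : N ==> cscale z u + w : N" for u w z
  using assms unfolding csubspace_def by blast+
 have m: "cscale (-1) u = - u" for u :: "'a * 'a" by(simp add: cscale_def prod_eq_iff)
 show "0 : N" by(rule 0)
 show "u : N ==> w : N ==> u + w : N" for u w using l[of u w 1] by simp
 show "u : N ==> cscale z u : N" for u z using l[of u 0 z] 0 by simp
 show "u : N ==> - u : N" for u using l[of u 0 "-1"] 0 m[of u] by simp
 show "u : N ==> w : N ==> u - w : N" for u w using l[of w u "-1"] m[of w] by simp
qed

lemma csubspace_sum: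
 assumes "csubspace N" "!!i. i : I ==> g i : N" shows "sum g I : N"
 using assms(2) by(induction I rule: infinite_finite_induct) (auto simp: csubspaceD[OF assms(1)])

context framed_courant
begin

text \<open>The +i-eigenspaces of orthogonal complex structures on one fibre: isotropic, meeting the
  conjugate only in 0, and such that every real vector is a sum of two conjugate vectors.\<close>

definition polar :: "'m => ('v * 'v) set => bool" where
 "polar x N <-> N <= FC x & csubspace N & (ALL u:N. ALL w:N. cp x u w = 0) &
   (ALL u:N. ALL w:N. u = cconj w --> w = 0) & (ALL v:F x. EX u:N. u + cconj u = (v,0))"

text \<open>Eigenvectors for +i have the form v - i J v, which is the pair (v, - J v); so N is the
  graph of - J.\<close>

definition Jof :: "('v * 'v) set => 'v => 'v" where
 "Jof N v = - (THE b. (v,b) : N)"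

lemma polar_ex1:
 assumes N: "polar x N" and v: "v : F x"
 shows "EX! b. (v,b) : N"
proof -
 have sub: "csubspace N" using N unfolding polar_def by(elim conjE)
 obtain u where u: "u : N" "u + cconj u = (v,0)" using N v unfolding polar_def by blast
 show ?thesis
 proof(rule ex1I[of _ "2 *R snd u"])
  have "v = 2 *R fst u" using u(2) by(auto simp: cconj_def scaleR_2 prod_eq_iff)
  hence "(v,2 *R snd u) = u + u" by(simp add: prod_eq_iff scaleR_2)
  thus in1: "(v,2 *R snd u) : N" using csubspaceD(2)[OF sub u(1) u(1)] by simp
  fix b assume "(v,b) : N"
  from csubspaceD(4)[OF sub this in1] have 0: "(0,b - 2 *R snd u) : N" by simp
  from csubspaceD(5)[OF sub 0] have 1: "(0,- (b - 2 *R snd u)) : N" by simp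
  have "ALL u:N. ALL w:N. u = cconj w --> w = 0" using N unfolding polar_def by(elim conjE)
  from this[rule_format,OF 1 0] have "(0::'v,b - 2 *R snd u) = 0" by(simp add: cconj_def)
  thus "b = 2 *R snd u" by(simp add: zero_prod_def)
 qed
qed

lemma Jof:
 assumes N: "polar x N"
 shows "(a,b) : N <-> a : F x & b = - Jof N a"
  "v : F x ==> (v,- Jof N v) : N" "v : F x ==> Jof N v : F x"
  "v : F x ==> w : F x ==> Jof N (r *R v + w) = r *R Jof N v + Jof N w"
  "v : F x ==> Jof N (Jof N v) = - v"
  "v : F x ==> w : F x ==> pair x (Jof N v) (Jof N w) = pair x v w"
  "v : F x ==> w : F x ==> pair x (Jof N v) w = - pair x v (Jof N w)"
proof -
 have sub: "csubspace N" and NF: "N <= FC x" and iso: "!!u w. u : N ==> w : N ==> cp x u w = 0"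
  using N unfolding polar_def by blast+
 show 2: "(v,- Jof N v) : N" if "v : F x" for v
  using theI'[OF polar_ex1[OF N that]] by(simp add: Jof_def)
 show 3: "Jof N v : F x" if "v : F x" for v
 proof -
  have "- Jof N v : F x" using 2[OF that] NF by(auto simp: FC_def)
  from F_closed(5)[OF this] show ?thesis by simp
 qed
 have 1: "(a,b) : N <-> a : F x & b = - Jof N a" for a b
 proof
  assume a: "(a,b) : N"
  hence aF: "a : F x" using NF by(auto simp: FC_def)
  thus "a : F x & b = - Jof N a" using polar_ex1[OF N aF] 2[OF aF] a by blast
 qed (use 2 in auto)
 thus "(a,b) : N <-> a : F x & b = - Jof N a" .
 show 4: "Jof N (r *R v + w) = r *R Jof N v + Jof N w" if "v : F x" "w : F x" for r v w
 proof -
  have "cscale (of_real r) (v,- Jof N v) + (w,- Jof N w) : N"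
   using csubspaceD(2,3)[OF sub] 2 that by blast
  hence "(r *R v + w,- (r *R Jof N v + Jof N w)) : N" by(simp add: cscale_of_real)
  hence "- (r *R Jof N v + Jof N w) = - Jof N (r *R v + w)" unfolding 1 by blast
  thus ?thesis by(simp only: neg_equal_iff_equal)
 qed
 show 5: "Jof N (Jof N v) = - v" if "v : F x" for v
 proof -
  have "cscale \<i> (v,- Jof N v) : N" using csubspaceD(3)[OF sub] 2 that by blast
  hence "(Jof N v,v) : N" by(simp add: cscale_simps)
  hence "v = - Jof N (Jof N v)" unfolding 1 by blast
  thus ?thesis by(metis minus_minus)
 qed
 have i: "cp x (v,- Jof N v) (w,- Jof N w) = 0" if "v : F x" "w : F x" for v w
  using iso 2 that by blast
 show "pair x (Jof N v) (Jof N w) = pair x v w" "pair x (Jof N v) w = - pair x v (Jof N w)" if "v : F x" "w : F x" for v w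
  using i[OF that] that 3 by(simp_all add: cpairing_def complex_eq_iff)
qed

lemma Jof_linear_simps:
 assumes N: "polar x N" and v: "v : F x" "w : F x"
 shows "Jof N (v + w) = Jof N v + Jof N w" "Jof N (v - w) = Jof N v - Jof N w"
  "Jof N (- v) = - Jof N v" "Jof N (r *R v) = r *R Jof N v" "Jof N 0 = 0"
proof -
 show z: "Jof N 0 = 0" using Jof(4)[OF N,of 0 0 "1"] by simp
 show "Jof N (v + w) = Jof N v + Jof N w" using Jof(4)[OF N v,of 1] by simp
 show "Jof N (v - w) = Jof N v - Jof N w" using Jof(4)[OF N v(2,1),of "-1"] by simp
 show "Jof N (- v) = - Jof N v" using Jof(4)[OF N v(1) F_closed(1),of "-1"] z by simp
 show "Jof N (r *R v) = r *R Jof N v" using Jof(4)[OF N v(1) F_closed(1),of r] z by simp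
qed

lemma Jof_eigenspace:
 assumes N: "polar x N"
 shows "{u : F x >< F x. (Jof N (fst u),Jof N (snd u)) = cscale \<i> u} = N"
proof(rule set_eqI)
 fix u :: "'v * 'v"
 obtain a b where u: "u = (a,b)" by fastforce
 have "u : F x >< F x & (Jof N (fst u),Jof N (snd u)) = cscale \<i> u <-> a : F x & b = - Jof N a"
  using Jof(3,5)[OF N] Jof_linear_simps(3)[OF N]
  by(auto simp: u cscale_simps)
 thus "u : {u : F x >< F x. (Jof N (fst u),Jof N (snd u)) = cscale \<i> u} <-> u : N"
  using Jof(1)[OF N,of a b] u by simp
qed

lemma eigenspace_Jof:
 assumes N: "polar x N" and E: "{u : F x >< F x. (J (fst u),J (snd u)) = cscale \<i> u} = N" and v: "v : F x"
 shows "J v = Jof N v"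
proof -
 have "(v,- Jof N v) : {u : F x >< F x. (J (fst u),J (snd u)) = cscale \<i> u}"
  unfolding E by(rule Jof(2)[OF N v])
 thus ?thesis by(simp add: cscale_simps)
qed

end

section \<open>The splitting into L and its conjugate\<close>

locale dirac_split = framed_courant C gn ga ga'
 for C :: "('m::{t2_space,second_countable_topology},'e::{real_inner,banach,heine_borel},'v::real_vector,
  'f::{real_inner,banach,heine_borel}) courant" and gn ga ga' +
 fixes L :: "'m => ('v * 'v) set"
 assumes decomposition: "conjugate_decomposition C L"
begin

abbreviation "Lb == conj_bundle L"

lemma L_lie: "isotropic_lie_subbundle C L" "isotropic_lie_subbundle C Lb"
 using decomposition unfolding conjugate_decomposition_def by simp_all

lemma complex_subbundle_csubspace:
 assumes "isotropic_lie_subbundle C N" shows "csubspace (N x)" "N x <= FC x"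
proof -
 have "ALL x. N x <= F x >< F x & 0 : N x & (ALL u:N x. ALL w:N x. ALL z. cscale z u + w : N x)"
  using assms unfolding isotropic_lie_subbundle_def complex_subbundle_def by(elim conjE)
 from spec[OF this,of x] show "csubspace (N x)" "N x <= FC x" unfolding csubspace_def FC_def by simp_all
qed

lemmas L_subspace [simp] = complex_subbundle_csubspace(1)[OF L_lie(1)] complex_subbundle_csubspace(1)[OF L_lie(2)]

lemmas L_closed [simp] = csubspaceD[OF L_subspace(1)] csubspace_sum[OF L_subspace(1)]
 csubspaceD[OF L_subspace(2)] csubspace_sum[OF L_subspace(2)]
lemmas L_sums [intro] = csubspace_sum[OF L_subspace(1)] csubspace_sum[OF L_subspace(2)]

lemmas L_FC = complex_subbundle_csubspace(2)[OF L_lie(1)] complex_subbundle_csubspace(2)[OF L_lie(2)]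

lemma L_FC' [simp]: "u : L x ==> u : FC x" "u : Lb x ==> u : FC x"
 using L_FC by blast+

lemma L_isotropic [simp]: "u : L x ==> w : L x ==> cp x u w = 0" "u : Lb x ==> w : Lb x ==> cp x u w = 0"
 using L_lie unfolding isotropic_lie_subbundle_def by blast+

lemma L_conj [simp]: "cconj u : Lb x <-> u : L x" "cconj u : L x <-> u : Lb x"
proof -
 have i: "inj (cconj :: 'v * 'v => _)" by(rule injI) simp
 show 1: "cconj u : Lb x <-> u : L x" for u unfolding conj_bundle_def by(rule inj_image_mem_iff[OF i])
 show "cconj u : L x <-> u : Lb x" using 1[of "cconj u"] by simp
qed

lemma L_decomposition: "L x Int Lb x = {0}" "{u + w |u w. u : L x & w : Lb x} = FC x"
 using decomposition unfolding conjugate_decomposition_def FC_def by simp_all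

lemma L_inter: "u : L x ==> u : Lb x ==> u = 0"
 using L_decomposition(1) by blast

lemma L_sum_ex: assumes "u : FC x" obtains v w where "v : L x" "w : Lb x" "u = v + w"
 using assms unfolding L_decomposition(2)[symmetric] by blast

lemma L_unique:
 assumes "v : L x" "w : Lb x" "v' : L x" "w' : Lb x" "v + w = v' + w'"
 shows "v = v'" "w = w'"
proof -
 have e: "v - v' = w' - w" using assms(5) by(simp add: algebra_simps)
 have "v - v' : Lb x" unfolding e using assms by simp
 moreover have "v - v' : L x" using assms by simp
 ultimately have "v - v' = 0" using L_inter by blast
 thus "v = v'" "w = w'" using e by auto
qed

lemma L_nondeg: "e : Lb x ==> (!!w. w : L x ==> cp x e w = 0) ==> e = 0"
 "e : L x ==> (!!w. w : Lb x ==> cp x e w = 0) ==> e = 0"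
proof -
 assume e: "e : Lb x" "!!w. w : L x ==> cp x e w = 0"
 show "e = 0"
 proof(rule cp_nondeg[OF L_FC'(2)[OF e(1)]])
  fix w assume "w : FC x"
  then obtain a b where "a : L x" "b : Lb x" "w = a + b" using L_sum_ex by blast
  thus "cp x e w = 0" using e by simp
 qed
next
 assume e: "e : L x" "!!w. w : Lb x ==> cp x e w = 0"
 show "e = 0"
 proof(rule cp_nondeg[OF L_FC'(1)[OF e(1)]])
  fix w assume "w : FC x"
  then obtain a b where "a : L x" "b : Lb x" "w = a + b" using L_sum_ex by blast
  thus "cp x e w = 0" using e by simp
 qed
qed

lemma L_polar [simp]: "polar x (L x)"
 unfolding polar_def
proof(intro conjI ballI impI L_FC(1) L_subspace)
 fix u w assume "u : L x" "w : L x"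
 thus "cp x u w = 0" by simp
 assume "u = cconj w"
 thus "w = 0" using L_inter[of u x] \<open>u : L x\<close> \<open>w : L x\<close> by(metis L_conj(1) cconj_simps(1,2))
next
 fix v assume v: "v : F x"
 hence "(v,0) : FC x" by(simp add: FC_def)
 then obtain a b where ab: "a : L x" "b : Lb x" "(v,0) = a + b" using L_sum_ex by blast
 have "a + b = cconj b + cconj a" unfolding ab(3)[symmetric] using arg_cong[OF ab(3),of cconj]
  by(simp add: cconj_def algebra_simps)
 hence "b = cconj a" using L_unique(2)[OF ab(1,2),of "cconj b" "cconj a"] ab by simp
 thus "EX u:L x. u + cconj u = (v,0)" using ab by metis
qed

text \<open>The complex structure of L itself, the case H = 0. It parametrises L by real
  vectors.\<close>

definition JL :: "'m => 'v => 'v" where "JL x = Jof (L x)"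

lemmas JL = Jof[OF L_polar,folded JL_def] and JL_simps = Jof_linear_simps[OF L_polar,folded JL_def]

lemma cs_iff: "s : cS L <-> s : GC & (ALL x. s x : L x)"
 "s : cS Lb <-> s : GC & (ALL x. s x : Lb x)"
 unfolding csections_on_def GC_def by blast+

text \<open>Smoothness of L is given by local complex frames only. Sections \<open>S b\<close> of L
  whose value at p has real part \<open>al b p\<close> yield an operator \<open>A\<close> that is
  the identity at p, so \<open>sat_quotient\<close> applies near p.\<close>

lemma JL_smooth:
 assumes ab: "a : Gam" "b : Gam"
 shows "sfun (%x. pair x (JL x (a x)) (b x))"
 unfolding sfun_iff
proof
 fix p
 have "ALL x. EX U n. EX s::nat => 'm => 'v * 'v. open U & x : U &
    (ALL i<n. s i : csections_on C L U) &
    (ALL y:U. bij_betw (%z. SUM i<n. cscale (z i) (s i y)) ({..<n} \<rightarrow>\<^sub>E UNIV) (L y))"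
  using L_lie(1) unfolding isotropic_lie_subbundle_def complex_subbundle_def by(elim conjE)
 from spec[OF this,of p] obtain U n and s :: "nat => 'm => 'v * 'v" where U0: "open U & p : U &
    (ALL i<n. s i : csections_on C L U) &
    (ALL y:U. bij_betw (%z. SUM i<n. cscale (z i) (s i y)) ({..<n} \<rightarrow>\<^sub>E UNIV) (L y))"
  by(elim exE)
 have U: "open U" "p : U" "!!i. i < n ==> s i : csections_on C L U"
  "!!y. y : U ==> bij_betw (%z. SUM i<n. cscale (z i) (s i y)) ({..<n} \<rightarrow>\<^sub>E UNIV) (L y)"
  using U0 by simp_all
 have "EX s' V. s' : GC & open V & p : V & V <= U & (ALL x:V. s' x = s i x)" if i: "i < n" for i
 proof -
  have s: "fst o s i : sections_on C U" "snd o s i : sections_on C U"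
   using U(3)[OF i] unfolding csections_on_def by blast+
  obtain s1 V1 where 1: "s1 : Gam" "open V1" "p : V1" "V1 <= U" "!!x. x : V1 ==> s1 x = (fst o s i) x"
   using section_extend'[OF s(1) U(1,2)] by blast
  obtain s2 V2 where 2: "s2 : Gam" "open V2" "p : V2" "V2 <= U" "!!x. x : V2 ==> s2 x = (snd o s i) x"
   using section_extend'[OF s(2) U(1,2)] by blast
  show ?thesis
   by(rule exI[of _ "%x. (s1 x,s2 x)"],rule exI[of _ "V1 Int V2"]) (use 1 2 in "auto intro: GC_I")
 qed
 then obtain s' V where s': "!!i. i < n ==> s' i : GC" "!!i. i < n ==> open (V i)" "!!i. i < n ==> p : V i"
  "!!i. i < n ==> V i <= U" "!!i x. i < n ==> x : V i ==> s' i x = s i x"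
  by metis
 have sF: "s' i x : FC x" if "i < n" for i x using s'(1)[OF that] by simp
 obtain B :: "'f set" where B: "onb B" using onb_exists[OF fdF] .
 obtain V0 al al' where V0: "open V0" "p : V0" "dual_frame B V0 al al'" using local_frame[OF B,of p] by blast
 note al = dual_frameD[OF V0(3)]
 define W where "W = (\<Inter>i<n. V i) Int V0 Int U"
 have W: "open W" "p : W" using s'(2,3) V0 U(1,2) by(auto simp: W_def intro!: open_INT open_Int)
 \<comment> \<open>Constant coefficients suffice, as only the value at p is prescribed.\<close>
 have "EX ze. (SUM i<n. cscale (ze i) (s' i p)) = (al b p,- JL p (al b p))" for b
 proof -
  have "(al b p,- JL p (al b p)) : L p" using al(1) JL(2) by simp
  hence "(al b p,- JL p (al b p)) : (%z. SUM i<n. cscale (z i) (s i p)) ` ({..<n} \<rightarrow>\<^sub>E UNIV)"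
   using U(4)[OF U(2)] unfolding bij_betw_def by blast
  then obtain z where "(al b p,- JL p (al b p)) = (SUM i<n. cscale (z i) (s i p))" by blast
  moreover have "(SUM i<n. cscale (z i) (s i p)) = (SUM i<n. cscale (z i) (s' i p))"
   using s'(3,5) by(intro sum.cong) auto
  ultimately show ?thesis by metis
 qed
 then obtain ze where ze: "!!b. (SUM i<n. cscale (ze b i) (s' i p)) = (al b p,- JL p (al b p))" by metis
 define S where "S b = (%x. SUM i<n. cscale (ze b i) (s' i x))" for b
 have SG: "S b : GC" for b unfolding S_def by(intro GC_sum cscale_GC s') auto
 have SL: "S b x : L x" if "x : W" for b x
 proof -
  have "s' i x : L x" if "i < n" for i
  proof -
   have "x : V i" "x : U" using \<open>x : W\<close> that by(auto simp: W_def)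
   thus ?thesis using s'(5)[OF that] U(3)[OF that] unfolding csections_on_def by simp
  qed
  thus ?thesis unfolding S_def by(intro L_sums) simp
 qed
 have SF: "fst (S b x) : F x" "snd (S b x) : F x" for b x using GC_FC[OF SG,of b x] by(auto simp: FC_def mem_Times_iff)
 have SGam: "(%x. fst (S b x)) : Gam" "(%x. snd (S b x)) : Gam" for b using SG[of b] by(auto simp: GC_def o_def)
 define A where "A = (%(ta::real) x v. SUM b:B. pair x (al' b x) v *R fst (S b x))"
 define A' where "A' = (%(ta::real) x v. - (SUM b:B. pair x (al' b x) v *R snd (S b x)))"
 show "sat {0} (%_ x. pair x (JL x (a x)) (b x)) 0 p"
 proof(rule sat_quotient[OF singletonI W,where A = A and A' = A' and J = "%_. JL"])
  show "A ta x v : F x" "A' ta x v : F x" for ta x v unfolding A_def A'_def using SF by auto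
  show "A ta x (r *R v + w) = r *R A ta x v + A ta x w" "A' ta x (r *R v + w) = r *R A' ta x v + A' ta x w"
   if "v : F x" "w : F x" for ta x r v w
   unfolding A_def A'_def using that al(2)
   by(simp_all add: scaleR_add_left sum.distrib scaleR_sum_right)
  have "A 0 p v = v" if "v : F p" for v
   unfolding A_def S_def ze using al(4)[OF V0(2) that] by simp
  thus "bij_betw (A 0 p) (F p) (F p)" using bij_betw_cong[of "F p" "A 0 p" id "F p"] by simp
  show "JL x (A ta x v) = A' ta x v" if x: "x : W" and v: "v : F x" for ta x v
  proof -
   have "(SUM b:B. cscale (of_real (pair x (al' b x) v)) (S b x)) : L x" using SL[OF x] by auto
   also have "(SUM b:B. cscale (of_real (pair x (al' b x) v)) (S b x)) = (A ta x v,- A' ta x v)"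
    unfolding A_def A'_def cscale_of_real by(simp add: prod_eq_iff fst_sum snd_sum)
   finally show ?thesis unfolding JL(1) by simp
  qed
  fix a b assume ab: "a : Gam" "b : Gam"
  have "sfun (%x. pair x (SUM c:B. pair x (al' c x) (a x) *R fst (S c x)) (b x))"
   by(intro pair_smooth sec_lincomb SGam ab al)
  thus "sat {0} (%ta x. pair x (A ta x (a x)) (b x)) 0 p" unfolding A_def by(rule sat_fun)
  have "sfun (%x. pair x (- (SUM c:B. pair x (al' c x) (a x) *R snd (S c x))) (b x))"
   by(intro pair_smooth sec_minus sec_lincomb SGam ab al)
  thus "sat {0} (%ta x. pair x (A' ta x (a x)) (b x)) 0 p" unfolding A'_def by(rule sat_fun)
 qed (use ab in auto)
qed

lemma JL_section: "a : Gam ==> (%x. JL x (a x)) : Gam"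
 by(rule sectionI) (auto intro: JL_smooth JL(3))

text \<open>The L-component of the real vector v, half of v - i J v.\<close>

definition pl :: "'m => 'v => 'v * 'v" where "pl x v = ((1/2) *R v,- (1/2) *R JL x v)"

lemma pl_L [simp]: "v : F x ==> pl x v : L x"
 unfolding pl_def JL(1) by(simp add: JL_simps(4)[OF _ F_closed(1)])

lemma pl_sum: "(v,0) = pl x v + cconj (pl x v)"
 by(simp add: pl_def cconj_def prod_eq_iff scaleR_left_distrib[symmetric])

definition ll :: "nat => 'm => 'v * 'v" where "ll i x = pl x (ga i x)"
definition lb :: "nat => 'm => 'v * 'v" where "lb i x = cconj (pl x (ga' i x))"

lemma pl_section: "a : Gam ==> (%x. pl x (a x)) : cS L"
 unfolding cs_iff
proof
 assume a: "a : Gam"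
 show "(%x. pl x (a x)) : GC" unfolding pl_def by(intro GC_I sec_cscale JL_section a)
 show "ALL x. pl x (a x) : L x" using a by simp
qed

lemma cs_conj: "s : cS L ==> (%x. cconj (s x)) : cS Lb"
 "s : cS Lb ==> (%x. cconj (s x)) : cS L"
 unfolding cs_iff by(auto intro: GC_conj)

lemma ll_csection [simp]: "i < gn ==> ll i : cS L" unfolding ll_def[abs_def] by(rule pl_section) (rule ga)
lemma lb_csection [simp]: "i < gn ==> lb i : cS Lb"
 unfolding lb_def[abs_def] by(rule cs_conj(1)[OF pl_section]) (rule ga)

lemma csectionsD: "s : cS L ==> s : GC" "s : cS L ==> s x : L x"
 "s : cS Lb ==> s : GC" "s : cS Lb ==> s x : Lb x"
 unfolding cs_iff by auto

lemma ll_L [simp]: "i < gn ==> ll i x : L x" "i < gn ==> lb i x : Lb x" "i < gn ==> ll i : GC" "i < gn ==> lb i : GC"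
 using csectionsD ll_csection lb_csection by blast+

text \<open>The L-component of the expansion of u in the real frame; pairing u with
  \<open>lb i\<close> equals pairing it with \<open>ga' i\<close> because L is isotropic.\<close>

lemma L_expand:
 assumes u: "u : L x" shows "(SUM i<gn. cscale (cp x (lb i x) u) (ll i x)) = u"
proof -
 obtain a b where ab: "u = (a,b)" "a : F x" "b : F x" using L_FC'(1)[OF u] by(auto simp: FC_def)
 have "(SUM i<gn. cscale (cp x (ga' i x,0) u) (ga i x,0)) = u"
  using frame[OF ab(2)] frame[OF ab(3)] ga ab
  by(simp add: ab(1) cpairing_def cscale_simps prod_eq_iff fst_sum snd_sum)
 moreover have "cp x (ga' i x,0) u = cp x (lb i x) u" if "i < gn" for i
  using that u ga(2)[OF that] pl_sum[of "ga' i x" x] by(simp add: lb_def)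
 ultimately have 1: "(SUM i<gn. cscale (cp x (lb i x) u) (ga i x,0)) = u" by simp
 have "(SUM i<gn. cscale (cp x (lb i x) u) (ga i x,0)) = (SUM i<gn. cscale (cp x (lb i x) u) (ll i x)) +
   (SUM i<gn. cscale (cp x (lb i x) u) (cconj (ll i x)))"
  by(simp add: ll_def pl_sum[symmetric] sum.distrib[symmetric] cscale_add_right[symmetric])
 hence "(SUM i<gn. cscale (cp x (lb i x) u) (ll i x)) +
   (SUM i<gn. cscale (cp x (lb i x) u) (cconj (ll i x))) = u + 0" using 1 by simp
 note e = this
 show ?thesis by(rule L_unique(1)[OF _ _ u L_closed(7) e]; intro L_sums; simp)
qed

end

section \<open>Two-forms as maps and their graphs\<close>

context dirac_split
begin

definition altform :: "'m => ('m,'v) lform => bool" where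
 "altform x H <-> (ALL u:L x. ALL w:L x. ALL v:L x. ALL z. H x [cscale z u + w,v] = z * H x [u,v] + H x [w,v] &
   H x [u,v] = - H x [v,u])"

lemma alternating_form_altform:
 assumes "alternating_form L 2 H" shows "altform x H"
proof -
 have A: "!!x vs i u w z. length vs = 2 ==> set vs <= L x ==> i < 2 ==> u : L x ==> w : L x ==>
   H x (vs[i := cscale z u + w]) = z * H x (vs[i := u]) + H x (vs[i := w])"
  and Z: "!!x vs i j. length vs = 2 ==> set vs <= L x ==> i < j ==> j < 2 ==> vs ! i = vs ! j ==> H x vs = 0"
  using assms unfolding alternating_form_def by blast+
 have l: "H x [cscale z u + w,v] = z * H x [u,v] + H x [w,v]" if "u : L x" "w : L x" "v : L x" for z u w v
  using A[of "[u,v]" x 0 u w z] that by simp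
 have r: "H x [v,u + w] = H x [v,u] + H x [v,w]" if "u : L x" "w : L x" "v : L x" for u w v
  using A[of "[v,u]" x 1 u w 1] that by simp
 have z: "H x [v,v] = 0" if "v : L x" for v using Z[of "[v,v]" x 0 1] that by simp
 have "H x [u,v] = - H x [v,u]" if uv: "u : L x" "v : L x" for u v
 proof -
  have "0 = H x [u + v,u + v]" using z uv by simp
  also have "... = H x [u,u + v] + H x [v,u + v]" using l[of u v "u + v" 1] uv by simp
  also have "... = H x [u,v] + H x [v,u]" using r uv z by simp
  finally show ?thesis by(simp add: add_eq_0_iff)
 qed
 thus ?thesis using l unfolding altform_def by blast
qed

lemma altform:
 assumes "altform x H"
 shows "u : L x ==> w : L x ==> v : L x ==> H x [u + w,v] = H x [u,v] + H x [w,v]"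
  "u : L x ==> v : L x ==> H x [cscale z u,v] = z * H x [u,v]"
  "u : L x ==> w : L x ==> v : L x ==> H x [v,u + w] = H x [v,u] + H x [v,w]"
  "u : L x ==> v : L x ==> H x [v,cscale z u] = z * H x [v,u]"
  "v : L x ==> H x [0,v] = 0" "v : L x ==> H x [v,0] = 0"
  "u : L x ==> v : L x ==> H x [v,u] = - H x [u,v]"
proof -
 have l: "H x [cscale z u + w,v] = z * H x [u,v] + H x [w,v]" "H x [u,v] = - H x [v,u]"
  if "u : L x" "w : L x" "v : L x" for z u w v
  using assms that unfolding altform_def by blast+
 have s: "H x [u,v] = - H x [v,u]" if "u : L x" "v : L x" for u v using l(2) that by blast
 show a: "H x [u + w,v] = H x [u,v] + H x [w,v]" if "u : L x" "w : L x" "v : L x" for u w v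
  using l(1)[OF that,of 1] by simp
 show z: "H x [0,v] = 0" if "v : L x" for v
  using l(1)[OF L_closed(1) L_closed(1) that,of 1] by simp
 show m: "H x [cscale z u,v] = z * H x [u,v]" if "u : L x" "v : L x" for z u v
  using l(1)[OF that(1) L_closed(1) that(2),of z] z that by simp
 show "H x [v,u + w] = H x [v,u] + H x [v,w]" if "u : L x" "w : L x" "v : L x" for u w v
  using a[OF that] s[of v u] s[of v w] s[of v "u + w"] that by simp
 show "H x [v,cscale z u] = z * H x [v,u]" if "u : L x" "v : L x" for z u v
  using m[OF that] s[of v u] s[of v "cscale z u"] that by simp
 show "H x [v,0] = 0" if "v : L x" for v using s[of v 0] z that by simp
 show "H x [v,u] = - H x [u,v]" if "u : L x" "v : L x" for u v using s that by blast
qed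

lemma altform_sum:
 assumes "altform x H" "!!i. i : I ==> g i : L x" "v : L x"
 shows "H x [SUM i:I. g i,v] = (SUM i:I. H x [g i,v])" "H x [v,SUM i:I. g i] = (SUM i:I. H x [v,g i])"
 using assms(2)
 by(induction I rule: infinite_finite_induct) (auto simp: altform(1-6)[OF assms(1)] assms(3) L_sums)

text \<open>The map H' with the description operator of \<open>form_map\<close> replaced by an
  explicit combination of the \<open>lb i\<close>, from which linearity and smoothness can be read
  off.\<close>

definition Hm :: "('m,'v) lform => 'm => 'v * 'v => 'v * 'v" where
 "Hm H x v = (SUM i<gn. cscale (H x [v,ll i x]) (lb i x))"

lemma Hm_Lb [simp]: "Hm H x v : Lb x" unfolding Hm_def by(intro L_sums) simp

lemma Hm_pair:
 assumes H: "altform x H" and "v : L x" "w : L x"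
 shows "cp x (Hm H x v) w = H x [v,w]"
proof -
 have "cp x (Hm H x v) w = (SUM i<gn. H x [v,ll i x] * cp x (lb i x) w)"
  unfolding Hm_def using assms by(subst cp_sum) auto
 also have "... = H x [v,SUM i<gn. cscale (cp x (lb i x) w) (ll i x)]"
  using assms by(subst altform_sum[OF H]) (auto simp: altform(1-6)[OF H] mult.commute)
 finally show ?thesis using L_expand[OF assms(3)] by simp
qed

lemma Lb_eqI:
 assumes "e : Lb x" "f : Lb x" "!!w. w : L x ==> cp x e w = cp x f w" shows "e = f"
proof -
 have "e - f = 0" by(rule L_nondeg(1)[of _ x]) (use assms in simp_all)
 thus ?thesis by simp
qed

lemma H_map_eq:
 assumes H: "altform x H" and v: "v : L x"
 shows "H_map C L H x v = Hm H x v"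
 unfolding form_map_def
 by(rule the_equality) (auto simp: Hm_pair[OF H v] intro: Lb_eqI)

lemma Hbar_map_eq:
 assumes H: "altform x H" and v: "v : Lb x"
 shows "Hbar_map C L H x v = cconj (Hm H x (cconj v))"
 unfolding form_map_def
proof(rule the_equality)
 have v': "cconj v : L x" using v by simp
 have c: "cp x (cconj (Hm H x (cconj v))) w = conj_form H x [v,w]" if w: "w : Lb x" for w
 proof -
  have w': "cconj w : L x" using w by simp
  have "cp x (cconj (Hm H x (cconj v))) w = cp x (cconj (Hm H x (cconj v))) (cconj (cconj w))" by simp
  also have "... = cnj (cp x (Hm H x (cconj v)) (cconj w))" using w' by(intro cp_conj) simp_all
  finally show ?thesis by(simp add: conj_form_def Hm_pair[OF H v' w'])
 qed
 show "cconj (Hm H x (cconj v)) : L x & (ALL w:Lb x. cp x (cconj (Hm H x (cconj v))) w = conj_form H x [v,w])"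
  using c by simp
 fix e assume e: "e : L x & (ALL w:Lb x. cp x e w = conj_form H x [v,w])"
 hence "e - cconj (Hm H x (cconj v)) = 0" by(intro L_nondeg(2)[of _ x]) (simp_all add: c)
 thus "e = cconj (Hm H x (cconj v))" by simp
qed

lemma Hm_add:
 assumes H: "altform x H" and "u : L x" "w : L x"
 shows "Hm H x (u + w) = Hm H x u + Hm H x w" "Hm H x (u - w) = Hm H x u - Hm H x w"
proof -
 have a: "Hm H x (u + w) = Hm H x u + Hm H x w" if "w : L x" "u : L x" for u w
  using that by(simp add: Hm_def altform(1-6)[OF H] cscale_add_left sum.distrib)
 show "Hm H x (u + w) = Hm H x u + Hm H x w" using a assms by blast
 show "Hm H x (u - w) = Hm H x u - Hm H x w" using a[of w "u - w"] assms by simp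
qed

lemma Hm_scale: "altform x H ==> u : L x ==> Hm H x (cscale z u) = cscale z (Hm H x u)"
 by(simp add: Hm_def altform(2) cscale_sum_right cscale_cscale)

lemma Hm_zero: "altform x H ==> Hm H x 0 = 0"
 using Hm_add(2)[of x H 0 0] by simp

lemmas Hm_lin = Hm_add Hm_scale Hm_zero

definition gr :: "('m,'v) lform => 'm => ('v * 'v) set" where
 "gr H x = (%v. v + Hm H x v) ` L x"

lemma graph_gr: "altform x H ==> graph C L H x = gr H x"
 unfolding graph_def gr_def by(intro image_cong refl) (simp add: H_map_eq)

definition admissible :: "'m => ('m,'v) lform => bool" where
 "admissible x H <-> altform x H &
   bij_betw (%v. cconj (Hm H x (cconj (Hm H x v))) - v) (L x) (L x)"

text \<open>Injectivity of the bijection separates the graph from its conjugate; surjectivity places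
  every real vector in their sum.\<close>

lemma gr_polar:
 assumes A: "admissible x H"
 shows "polar x (gr H x)"
proof -
 have H: "altform x H" and bij: "bij_betw (%v. cconj (Hm H x (cconj (Hm H x v))) - v) (L x) (L x)"
  using A unfolding admissible_def by blast+
 have K: "cconj (Hm H x v) : L x" for v by simp
 show ?thesis
  unfolding polar_def
 proof(intro conjI ballI impI)
  show "gr H x <= FC x" unfolding gr_def by auto
  show "csubspace (gr H x)"
   unfolding csubspace_def
  proof(intro conjI ballI allI)
   show "0 : gr H x" unfolding gr_def by(intro image_eqI[of _ _ 0]) (simp_all add: Hm_lin[OF H])
   fix a b z assume "a : gr H x" "b : gr H x"
   then obtain u w where uw: "u : L x" "w : L x" "a = u + Hm H x u" "b = w + Hm H x w" unfolding gr_def by blast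
   show "cscale z a + b : gr H x"
    unfolding gr_def
    by(intro image_eqI[of _ _ "cscale z u + w"]) (simp_all add: uw(1,2) uw(3,4) Hm_lin[OF H] cscale_add_right)
  qed
 next
  fix a b assume "a : gr H x" "b : gr H x"
  then obtain u w where uw: "u : L x" "w : L x" "a = u + Hm H x u" "b = w + Hm H x w" unfolding gr_def by blast
  have "cp x u (Hm H x w) = H x [w,u]" using Hm_pair[OF H uw(2,1)] uw(1) cp_sym[of u x "Hm H x w"] by simp
  thus "cp x a b = 0" using uw Hm_pair[OF H uw(1,2)] altform(7)[OF H uw(1,2)] by simp
 next
  fix a b assume "a : gr H x" "b : gr H x" and ab: "a = cconj b"
  then obtain u w where uw: "u : L x" "w : L x" "a = u + Hm H x u" "b = w + Hm H x w" unfolding gr_def by blast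
  have e: "u + Hm H x u = cconj (Hm H x w) + cconj w" using ab uw(3,4) by(simp add: add.commute)
  have "u = cconj (Hm H x w)" "Hm H x u = cconj w"
   using L_unique[OF uw(1) Hm_Lb _ _ e] uw by simp_all
  hence "cconj (Hm H x (cconj (Hm H x w))) - w = 0" by simp
  moreover have "cconj (Hm H x (cconj (Hm H x 0))) - 0 = 0" by(simp add: Hm_lin[OF H])
  ultimately have "w = 0" using inj_onD[OF bij_betw_imp_inj_on[OF bij],of w 0] uw(2) by simp
  thus "b = 0" using uw(4) by(simp add: Hm_lin[OF H])
 next
  fix v assume v: "v : F x"
  define l where "l = pl x v"
  have l: "l : L x" "l + cconj l = (v,0)" using v pl_sum[of v x] by(simp_all add: l_def)
  have "l : (%v. cconj (Hm H x (cconj (Hm H x v))) - v) ` L x"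
   unfolding bij_betw_imp_surj_on[OF bij] by(rule l(1))
  then obtain w where w: "cconj (Hm H x (cconj (Hm H x w))) - w = l" "w : L x" by(metis (no_types,lifting) imageE)
  \<comment> \<open>Chosen so that u plus the conjugate of H' u is l: the terms linear in H' cancel,
    and the bijection applied to w remains.\<close>
  define u where "u = cconj (Hm H x w) - w"
  have u: "u : L x" using w by(simp add: u_def)
  have "u + cconj (Hm H x u) = l" using w by(simp add: u_def Hm_lin[OF H])
  hence "(u + cconj (Hm H x u)) + (cconj u + Hm H x u) = l + cconj l" by auto
  hence e: "(u + Hm H x u) + cconj (u + Hm H x u) = (v,0)" using l(2) by(simp add: add_ac)
  have "u + Hm H x u : gr H x" unfolding gr_def using u by(rule imageI)
  with e show "EX u:gr H x. u + cconj u = (v,0)" by(rule bexI)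
 qed
qed

end

section \<open>Smooth families of graphs and their complex structures\<close>

locale admissible_family = dirac_split +
 fixes H :: "real => ('a,'c) lform"
 assumes adm: "!!t x. t : {0..1} ==> admissible x (H t)"
  and H_smooth: "!!s s' t x. s : csections C L ==> s' : csections C L ==> t : {0..1} ==>
   smooth_at C {0..1} (%t x. H t x [s x,s' x]) t x"
begin

definition J :: "real => 'a => 'c => 'c" where "J t x = Jof (gr (H t) x)"

lemmas J = Jof[OF gr_polar[OF adm],folded J_def]
lemmas J_lin = Jof_linear_simps[OF gr_polar[OF adm],folded J_def]

lemma alt: "t : {0..1} ==> altform x (H t)" using adm unfolding admissible_def by blast

text \<open>Real vectors parametrise the graph at time t: v goes to v - i JL v in L and then to the
  graph point \<open>be t x v\<close> over it. With A the real part and A' minus the imaginary part,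
  J t is A' after the inverse of A, and \<open>sat_quotient\<close> applies.\<close>

lemma J_smooth:
 assumes ab: "a : Gam" "b : Gam" and t: "t : {0..1}"
 shows "sat {0..1} (%t x. pair x (J t x (a x)) (b x)) t p"
proof -
 define be where "be t x v = (v,- JL x v) + Hm (H t) x (v,- JL x v)" for t x v
 have u: "(v,- JL x v) : L x" if "v : F x" for x v using JL(2) that by blast
 have begr: "be t x v : gr (H t) x" if "v : F x" for t x v
  unfolding gr_def be_def using u[OF that] by blast
 have beF: "be t x v : FC x" if "v : F x" for t x v
  unfolding be_def using L_FC'(1)[OF u[OF that]] L_FC'(2)[OF Hm_Lb] by blast
 have belin: "be t x (r *R v + w) = r *R be t x v + be t x w" if "t : {0..1}" "v : F x" "w : F x" for t x r v w
 proof -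
  have e: "(r *R v + w,- JL x (r *R v + w)) = cscale (of_real r) (v,- JL x v) + (w,- JL x w)"
   unfolding JL(4)[OF that(2,3)] cscale_of_real by simp
  have L': "cscale (of_real r) (v,- JL x v) : L x" "(w,- JL x w) : L x" using u that by simp_all
  show ?thesis
   unfolding be_def e Hm_lin(1)[OF alt[OF that(1)] L'] Hm_lin(3)[OF alt[OF that(1)] u[OF that(2)]]
   unfolding cscale_of_real by(simp only: scaleR_add_right add_ac)
 qed
 define A where "A t x v = fst (be t x v)" for t x v
 define A' where "A' t x v = - snd (be t x v)" for t x v
 have sm: "sfam {0..1} (%t x. fst (be t x (a x))) t p" "sfam {0..1} (%t x. snd (be t x (a x))) t p"
  if a: "a : Gam" for a
 proof -
  define s where "s = (%x. (a x,- JL x (a x)))"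
  have s: "s : cS L"
   unfolding cs_iff s_def using u a by(auto intro!: GC_I sec_minus JL_section)
  have "sat {0..1} (%t x. cp x (be t x (a x)) (b x,0)) t p" if b: "b : Gam" for b
  proof -
   have bG: "(%x. (b x,0)) : GC" using GC_I[OF b sec_zero] .
   have e: "cp x (be ta x (a x)) (b x,0) = cp x (s x) (b x,0) + (SUM i<gn. H ta x [s x,ll i x] * cp x (lb i x) (b x,0))" for ta x
   proof -
    have be: "be ta x (a x) = s x + (SUM i<gn. cscale (H ta x [s x,ll i x]) (lb i x))" by(simp add: be_def Hm_def s_def)
    have F: "(SUM i<gn. cscale (H ta x [s x,ll i x]) (lb i x)) : FC x" by(intro FC_sum) simp
    show ?thesis unfolding be using F GC_FC[OF bG,of x] GC_FC[OF csectionsD(1)[OF s],of x]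
     by(simp,subst cp_sum(1)) auto
   qed
   show ?thesis unfolding e
    by(intro sat_add sat_sum sat_mult sat_fun cp_smooth csectionsD(1)[OF s] bG H_smooth[OF s ll_csection t] ll_L) auto
  qed
  thus "sfam {0..1} (%t x. fst (be t x (a x))) t p" "sfam {0..1} (%t x. snd (be t x (a x))) t p"
   using sfam_fst_snd[of "%t x. be t x (a x)"] beF a by simp_all
 qed
 show ?thesis
 proof(rule sat_quotient[OF t open_UNIV UNIV_I,where A = A and A' = A'])
  show "A ta x v : F x" "A' ta x v : F x" if "v : F x" for ta x v
   using beF[OF that] by(auto simp: A_def A'_def FC_def mem_Times_iff)
  show "A ta x (r *R v + w) = r *R A ta x v + A ta x w" "A' ta x (r *R v + w) = r *R A' ta x v + A' ta x w"
   if "ta : {0..1}" "v : F x" "w : F x" for ta x r v w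
   unfolding A_def A'_def belin[OF that] by simp_all
  show "J ta x (A ta x v) = A' ta x v" if "ta : {0..1}" "v : F x" for ta x v
   using J(1)[OF that(1),of "A ta x v" "- A' ta x v"] begr[OF that(2),of ta] by(simp add: A_def A'_def)
  \<comment> \<open>L and the graph both project bijectively onto real parts, and L is mapped
    bijectively to the graph.\<close>
  show "bij_betw (A t p) (F p) (F p)"
   unfolding bij_betw_def
  proof
   show "inj_on (A t p) (F p)"
   proof(rule inj_onI)
    fix v w assume vw: "v : F p" "w : F p" "A t p v = A t p w"
    have "fst (be t p v) = fst (be t p w)" using vw(3) by(simp add: A_def)
    moreover have "snd (be t p v) = - J t p (fst (be t p v))" "snd (be t p w) = - J t p (fst (be t p w))"
     using J(1)[OF t,of "fst (be t p v)" "snd (be t p v)" p] J(1)[OF t,of "fst (be t p w)" "snd (be t p w)" p]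
      begr[OF vw(1),of t] begr[OF vw(2),of t] by simp_all
    ultimately have "be t p v = be t p w" by(simp add: prod_eq_iff)
    hence "(v,- JL p v) = (w,- JL p w)"
     unfolding be_def using L_unique(1)[OF u[OF vw(1)] Hm_Lb u[OF vw(2)] Hm_Lb] by blast
    thus "v = w" by simp
   qed
   show "A t p ` F p = F p"
   proof
    show "A t p ` F p <= F p" using beF by(auto simp: A_def FC_def mem_Times_iff)
    show "F p <= A t p ` F p"
    proof
     fix v assume v: "v : F p"
     obtain w where w: "w : L p" "(v,- J t p v) = w + Hm (H t) p w"
      using J(2)[OF t v] unfolding gr_def by blast
     have "w = (fst w,- JL p (fst w))" "fst w : F p" using w(1) JL(1)[of "fst w" "snd w" p] by(simp_all add: prod_eq_iff)
     hence "A t p (fst w) = v" unfolding A_def be_def using w(2) by(metis fst_conv)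
     thus "v : A t p ` F p" using \<open>fst w : F p\<close> by blast
    qed
   qed
  qed
  fix a b assume ab: "a : Gam" "b : Gam"
  have sF: "snd (be ta x (a x)) : F x" for ta x using beF[of "a x" x ta] ab by(simp add: FC_def mem_Times_iff)
  show "sat {0..1} (%ta x. pair x (A ta x (a x)) (b x)) t p" using sfamD[OF sm(1)] ab by(simp add: A_def)
  show "sat {0..1} (%ta x. pair x (A' ta x (a x)) (b x)) t p"
   using sat_minus[OF sfamD[OF sm(2)]] sF ab by(simp add: A'_def)
 qed (use ab in auto)
qed

lemma J_section: "t : {0..1} ==> a : Gam ==> (%x. J t x (a x)) : Gam"
 by(rule sectionI) (auto intro!: J(3) sat_slice_fun[where T = "{0..1}" and f = "%t x. pair x (J t x (a x)) (b x)" for b] J_smooth)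

end

section \<open>The Schouten bracket of the dual\<close>

lemma wedge_1: "wedge [al] [u] = al u"
proof -
 have "{p. p permutes {..<Suc 0}} = {id}" by(auto simp: lessThan_Suc)
 thus ?thesis by(simp add: wedge_def sign_id)
qed

lemma wedge_2: "wedge [al,be] [u,v] = al u * be v - al v * be u"
proof -
 have e: "{..<Suc (Suc 0)} = insert 0 {1}" by auto
 have "wedge [al,be] [u,v] = (\<Sum>p | p permutes insert 0 {1}. of_int (sign p) * (PROD i:insert 0 {1}. ([al,be] ! i) ([u,v] ! p i)))"
  by(simp add: wedge_def e)
 also have "... = al u * be v - al v * be u"
  by(subst sum_over_permutations_insert) (simp_all add: permutes_sing sign_swap_id sign_id transpose_def)
 finally show ?thesis .
qed

lemma wedge_3: "wedge [al,be,gm] [u,v,w] = al u * be v * gm w - al u * be w * gm v - al v * be u * gm w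
  + al v * be w * gm u + al w * be u * gm v - al w * be v * gm u"
proof -
 have e: "{..<Suc (Suc (Suc 0))} = insert 0 (insert 1 {2})" by auto
 have "wedge [al,be,gm] [u,v,w] = (\<Sum>p | p permutes insert 0 (insert 1 {2}). of_int (sign p) *
   (PROD i:insert 0 (insert 1 {2}). ([al,be,gm] ! i) ([u,v,w] ! p i)))"
  by(simp add: wedge_def e)
 also have "... = al u * be v * gm w - al u * be w * gm v - al v * be u * gm w
  + al v * be w * gm u + al w * be u * gm v - al w * be v * gm u"
  by(subst sum_over_permutations_insert,simp,simp,subst sum_over_permutations_insert,simp,simp)
   (simp add: permutes_sing sign_swap_id sign_compose permutation_swap_id sign_id transpose_def numeral_2_eq_2)
 finally show ?thesis .
qed

text \<open>The scalar core of the expansion of the Schouten bracket, isolated as a polynomial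
  identity. a, b, c, d are the values of four covectors on three sections, ac those of the bracket
  of a and c, and rac the derivatives of the values of c along the anchor of a; W is the 3 by 3
  determinant.\<close>

lemma schouten_polynomial:
 fixes a b c d ac ad bc bd rac rad rbc rbd rca rcb rda rdb :: "nat => complex"
 defines "HK == %i j k. a i * c j * bd k + a i * rbc j * d k - c j * rda i * b k
   - (a i * d j * bc k + a i * rbd j * c k - d j * rca i * b k)
   - (b i * c j * ad k + b i * rac j * d k - c j * rdb i * a k)
   + (b i * d j * ac k + b i * rad j * c k - d j * rcb i * a k)"
  and "KH == %i j k. c i * a j * (- bd k) + c i * rda j * b k - a j * rbc i * d k
   - (c i * b j * (- ad k) + c i * rdb j * a k - b j * rac i * d k)
   - (d i * a j * (- bc k) + d i * rca j * b k - a j * rbd i * c k)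
   + (d i * b j * (- ac k) + d i * rcb j * a k - b j * rad i * c k)"
  and "rH == %i j k. a i * (c j * rbd k + rbc j * d k - d j * rbc k - rbd j * c k)
    - b i * (c j * rad k + rac j * d k - d j * rac k - rad j * c k)"
  and "rK == %i j k. c i * (a j * rdb k + rda j * b k - b j * rda k - rdb j * a k)
    - d i * (a j * rcb k + rca j * b k - b j * rca k - rcb j * a k)"
  and "W == %f g h. f 1 * g 2 * h 3 - f 1 * g 3 * h 2 - f 2 * g 1 * h 3
  + f 2 * g 3 * h 1 + f 3 * g 1 * h 2 - f 3 * g 2 * (h (1::nat)::complex)"
 shows "W ac b d - W ad b c - W bc a d + W bd a c =
  HK 1 2 3 - HK 1 3 2 + HK 2 3 1 + rH 1 3 2 - rH 2 3 1 + rK 3 2 1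
  + (KH 1 2 3 - KH 1 3 2 + KH 2 3 1 + rK 1 3 2 - rK 2 3 1 + rH 3 2 1)"
 unfolding HK_def KH_def rH_def rK_def W_def by algebra

context dirac_split
begin

lemma cs_smooth [simp]:
 "s : cS L ==> e : cS Lb ==> sfun (%y. cp y (e y) (s y))"
 "s : GC ==> e : GC ==> sfun (%y. cp y (e y) (s y))"
 using cp_smooth csectionsD by blast+

lemma cs_closed:
 "e : cS Lb ==> f : cS Lb ==> (%y. e y + f y) : cS Lb"
 "e : cS Lb ==> f : cS Lb ==> (%y. e y - f y) : cS Lb"
 "e : cS Lb ==> sfun g ==> (%y. cscale (g y) (e y)) : cS Lb"
 "(!!i. i : I ==> u i : cS Lb) ==> (%y. SUM i:I. u i y) : cS Lb"
 "(%y. 0) : cS Lb"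
 unfolding cs_iff by(auto intro: GC_add GC_diff cscale_GC GC_sum intro!: L_sums)

lemma Lb_cbracket: "e : cS Lb ==> f : cS Lb ==> cbracket C e f = cdorf e f"
 "s : cS L ==> s' : cS L ==> cbracket C s s' = cdorf s s'"
 by(rule cdorf_cbracket[symmetric]; simp add: csectionsD; rule L_isotropic; simp add: csectionsD)+

lemma L_cdorf: "e : cS Lb ==> f : cS Lb ==> cdorf e f : cS Lb"
 "s : cS L ==> s' : cS L ==> cdorf s s' : cS L"
 using L_lie Lb_cbracket unfolding isotropic_lie_subbundle_def by metis+

lemma Lb_zero: "e : cS Lb ==> f : cS Lb ==> cp y (e y) (f y) = 0"
 by(rule L_isotropic(2)) (simp_all add: csectionsD)

lemma L_zero: "e : cS L ==> f : cS L ==> cp y (e y) (f y) = 0"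
 by(rule L_isotropic(1)) (simp_all add: csectionsD)

lemma cdorf_fun_both:
 assumes e: "e : cS Lb" and f: "f : cS Lb" and g: "sfun g" "sfun h"
  and w: "w : FC x"
 shows "cp x (cdorf (%y. cscale (g y) (e y)) (%y. cscale (h y) (f y)) x) w =
  g x * h x * cp x (cdorf e f x) w + g x * can e h x * cp x (f x) w - h x * can f g x * cp x (e x) w"
proof -
 have G: "e : GC" "f : GC" "(%y. cscale (g y) (e y)) : GC"
  using csectionsD(3)[OF e] csectionsD(3)[OF f] cscale_GC[OF csectionsD(3)[OF e] g(1)] by auto
 have z: "cp y (e y) (f y) = 0" for y by(rule Lb_zero[OF e f])
 have FC: "cdorf e f x : FC x" "e x : FC x" "f x : FC x" using G by auto
 show ?thesis
  unfolding cdorf_fun_right[OF G(3,2) g(2)] cdorf_fun_left[OF G(1,2) g(1) z] canchor_left(3)[OF G(1,1) g(2)]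
  using FC w by(simp add: algebra_simps)
qed

lemma cdorf_skew:
 assumes "e : cS Lb" "f : cS Lb" "w : FC x"
 shows "cp x (cdorf e f x) w = - cp x (cdorf f e x) w"
proof -
 have z: "(%y. cp y (e y) (f y)) = (%y. 0)" using Lb_zero[OF assms(1,2)] by simp
 obtain s where s: "s : GC" "s x = w"
 proof -
  obtain w1 w2 where w: "w = (w1,w2)" "w1 : F x" "w2 : F x" using assms(3) by(auto simp: FC_def)
  obtain s1 where s1: "s1 : Gam" "s1 x = w1" using section_through[OF w(2)] .
  obtain s2 where s2: "s2 : Gam" "s2 x = w2" using section_through[OF w(3)] .
  show ?thesis by(rule that[OF GC_I[OF s1(1) s2(1)]]) (simp add: s1 s2 w)
 qed
 have "cp x (cdorf e f x) w + cp x (cdorf f e x) w = 0"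
  using cdorf_sym[OF csectionsD(3)[OF assms(1)] csectionsD(3)[OF assms(2)] s(1),of x] s by(simp add: z)
 thus ?thesis by(simp add: add_eq_0_iff)
qed

text \<open>A 2-form is handled as the operator \<open>P\<close> from sections of \<open>L\<close> to sections of its conjugate.\<close>

definition Q :: "(('m => 'v * 'v) => 'm => 'v * 'v) => (('m => 'v * 'v) => 'm => 'v * 'v) =>
  ('m => 'v * 'v) => ('m => 'v * 'v) => ('m => 'v * 'v) => 'm => complex" where
 "Q P K s1 s2 s3 x = cp x (cdorf (P s1) (K s2) x) (s3 x) - cp x (cdorf (P s1) (K s3) x) (s2 x)
   + cp x (cdorf (P s2) (K s3) x) (s1 x) + can (P s1) (%y. cp y (K s3 y) (s2 y)) x
   - can (P s2) (%y. cp y (K s3 y) (s1 y)) x + can (K s3) (%y. cp y (P s2 y) (s1 y)) x"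

text \<open>The operator of the decomposable 2-form \<open>al\<close> wedge \<open>be\<close>:
  contraction with s.\<close>

definition El :: "('m => 'v * 'v) => ('m => 'v * 'v) => ('m => 'v * 'v) => 'm => 'v * 'v" where
 "El al be s = (%y. cscale (cp y (al y) (s y)) (be y) - cscale (cp y (be y) (s y)) (al y))"

lemma El_csection:
 "al : cS Lb ==> be : cS Lb ==> s : cS L ==> El al be s : cS Lb"
 unfolding El_def by(intro cs_closed cs_smooth)

lemma El_pair:
 assumes "al : cS Lb" "be : cS Lb" "w : FC y"
 shows "cp y (El al be s y) w = cp y (al y) (s y) * cp y (be y) w - cp y (be y) (s y) * cp y (al y) w"
 using assms by(simp add: El_def csectionsD)

lemma El_cdorf:
 assumes e: "al : cS Lb" "be : cS Lb" "gm : cS Lb" "dl : cS Lb"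
  and s: "s : cS L" "s' : cS L" "w : FC x"
 defines "a == %y. cp y (al y) (s y)" and "b == %y. cp y (be y) (s y)"
  and "c == %y. cp y (gm y) (s' y)" and "d == %y. cp y (dl y) (s' y)"
 shows "cp x (cdorf (El al be s) (El gm dl s') x) w =
   (a x * c x * cp x (cdorf be dl x) w + a x * can be c x * cp x (dl x) w - c x * can dl a x * cp x (be x) w)
   - (a x * d x * cp x (cdorf be gm x) w + a x * can be d x * cp x (gm x) w - d x * can gm a x * cp x (be x) w)
   - (b x * c x * cp x (cdorf al dl x) w + b x * can al c x * cp x (dl x) w - c x * can dl b x * cp x (al x) w)
   + (b x * d x * cp x (cdorf al gm x) w + b x * can al d x * cp x (gm x) w - d x * can gm b x * cp x (al x) w)"
proof -
 have sm: "sfun a" "sfun b" "sfun c" "sfun d"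
  unfolding a_def b_def c_def d_def using e s by simp_all
 have G: "(%y. cscale (a y) (be y)) : GC" "(%y. cscale (b y) (al y)) : GC"
  "(%y. cscale (c y) (dl y)) : GC" "(%y. cscale (d y) (gm y)) : GC"
  by(intro cscale_GC csectionsD(3) e sm)+
 have G': "(%y. cscale (c y) (dl y) - cscale (d y) (gm y)) : GC" by(rule GC_diff[OF G(3,4)])
 have E: "El al be s = (%y. cscale (a y) (be y) - cscale (b y) (al y))"
  "El gm dl s' = (%y. cscale (c y) (dl y) - cscale (d y) (gm y))"
  by(simp_all add: El_def a_def b_def c_def d_def)
 have FC: "cdorf (%y. cscale (a y) (be y)) (%y. cscale (c y) (dl y)) x : FC x"
  "cdorf (%y. cscale (a y) (be y)) (%y. cscale (d y) (gm y)) x : FC x"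
  "cdorf (%y. cscale (b y) (al y)) (%y. cscale (c y) (dl y)) x : FC x"
  "cdorf (%y. cscale (b y) (al y)) (%y. cscale (d y) (gm y)) x : FC x"
  using cdorf_GC G by(auto intro!: GC_FC)
 have "cp x (cdorf (El al be s) (El gm dl s') x) w =
   cp x (cdorf (%y. cscale (a y) (be y)) (%y. cscale (c y) (dl y)) x) w
   - cp x (cdorf (%y. cscale (a y) (be y)) (%y. cscale (d y) (gm y)) x) w
   - cp x (cdorf (%y. cscale (b y) (al y)) (%y. cscale (c y) (dl y)) x) w
   + cp x (cdorf (%y. cscale (b y) (al y)) (%y. cscale (d y) (gm y)) x) w"
  unfolding E cdorf_add_right(4)[OF G' G(1,2)] cdorf_add_right(3)[OF G(1,3,4)] cdorf_add_right(3)[OF G(2,3,4)]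
  using FC s(3) by simp
 also note cdorf_fun_both[OF e(2,4) sm(1,3) s(3)]
 also note cdorf_fun_both[OF e(2,3) sm(1,4) s(3)]
 also note cdorf_fun_both[OF e(1,4) sm(2,3) s(3)]
 also note cdorf_fun_both[OF e(1,3) sm(2,4) s(3)]
 finally show ?thesis .
qed

lemma El_canchor:
 assumes e: "al : cS Lb" "be : cS Lb" "gm : cS Lb" "dl : cS Lb"
  and s: "s : cS L" "s' : cS L" "s'' : cS L"
 defines "c == %s y. cp y (gm y) (s y)" and "d == %s y. cp y (dl y) (s y)"
 shows "can (El al be s) (%y. cp y (El gm dl s' y) (s'' y)) x =
   cp x (al x) (s x) * (c s' x * can be (d s'') x + can be (c s') x * d s'' x
     - d s' x * can be (c s'') x - can be (d s') x * c s'' x)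
   - cp x (be x) (s x) * (c s' x * can al (d s'') x + can al (c s') x * d s'' x
     - d s' x * can al (c s'') x - can al (d s') x * c s'' x)"
proof -
 have sm: "sfun (c s')" "sfun (d s')" "sfun (c s'')" "sfun (d s'')"
  unfolding c_def d_def using e s by simp_all
 have G: "al : GC" "be : GC" using e csectionsD by blast+
 have sa: "sfun (%y. cp y (al y) (s y))" "sfun (%y. cp y (be y) (s y))" using e s by simp_all
 have E: "(%y. cp y (El gm dl s' y) (s'' y)) = (%y. c s' y * d s'' y - d s' y * c s'' y)"
  using El_pair[OF e(3,4)] csectionsD(1)[OF s(3)] by(simp add: c_def d_def)
 have sE: "sfun (%y. c s' y * d s'' y)" "sfun (%y. d s' y * c s'' y)"
  using sm by(auto intro: sfun_mult)
 have G2: "(%y. cscale (cp y (al y) (s y)) (be y)) : GC" "(%y. cscale (cp y (be y) (s y)) (al y)) : GC"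
  by(intro cscale_GC G sa)+
 have X: "can u (%y. c s' y * d s'' y - d s' y * c s'' y) x = c s' x * can u (d s'') x + can u (c s') x * d s'' x
     - d s' x * can u (c s'') x - can u (d s') x * c s'' x" if "u : GC" for u
  unfolding canchor_lin(2)[OF that sE] canchor_lin(3)[OF that sm(1,4)] canchor_lin(3)[OF that sm(2,3)]
  by(simp add: algebra_simps)
 show ?thesis
  unfolding E unfolding El_def
  unfolding canchor_left(2)[OF G2 sfun_diff[OF sE]] canchor_left(3)[OF G(1,1) sfun_diff[OF sE]]
   canchor_left(3)[OF G(2,2) sfun_diff[OF sE]] X[OF G(1)] X[OF G(2)] ..
qed

text \<open>All anchor derivatives cancel in the symmetrised sum of \<open>Q\<close>. The right-hand
  side depends on the factors only through the operators of the two forms, which makes the bracket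
  independent of the decompositions.\<close>

lemma schouten_decomposable_22:
 assumes e: "al : cS Lb" "be : cS Lb" "gm : cS Lb" "dl : cS Lb"
  and s: "s1 : cS L" "s2 : cS L" "s3 : cS L"
 shows "schouten_decomposable C [al,be] [gm,dl] x [s1 x,s2 x,s3 x] =
  Q (El al be) (El gm dl) s1 s2 s3 x + Q (El gm dl) (El al be) s1 s2 s3 x"
proof -
 define ss where "ss i = (if i = 1 then s1 else if i = 2 then s2 else s3)" for i :: nat
 have ss: "ss i : cS L" for i using s by(simp add: ss_def)
 have s3: "s1 = ss 1" "s2 = ss 2" "s3 = ss 3" by(simp_all add: ss_def)
 have wF: "ss i x : FC x" for i using ss csectionsD(2) L_FC' by blast
 have skew: "cp x (cdorf gm al x) (ss i x) = - cp x (cdorf al gm x) (ss i x)"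
  "cp x (cdorf dl al x) (ss i x) = - cp x (cdorf al dl x) (ss i x)"
  "cp x (cdorf gm be x) (ss i x) = - cp x (cdorf be gm x) (ss i x)"
  "cp x (cdorf dl be x) (ss i x) = - cp x (cdorf be dl x) (ss i x)" for i
  using cdorf_skew e wF by blast+
 note ED = El_cdorf[OF e(1,2,3,4) ss ss wF] El_cdorf[OF e(3,4,1,2) ss ss wF]
  El_canchor[OF e(1,2,3,4) ss ss ss] El_canchor[OF e(3,4,1,2) ss ss ss]
 have lhs: "schouten_decomposable C [al,be] [gm,dl] x [s1 x,s2 x,s3 x] =
   wedge [cp x (cdorf al gm x),cp x (be x),cp x (dl x)] [s1 x,s2 x,s3 x]
   - wedge [cp x (cdorf al dl x),cp x (be x),cp x (gm x)] [s1 x,s2 x,s3 x]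
   - wedge [cp x (cdorf be gm x),cp x (al x),cp x (dl x)] [s1 x,s2 x,s3 x]
   + wedge [cp x (cdorf be dl x),cp x (al x),cp x (gm x)] [s1 x,s2 x,s3 x]"
  using e by(simp add: schouten_decomposable_def decomposable_def lessThan_Suc del_nth_def Lb_cbracket)
 show ?thesis
  unfolding lhs unfolding wedge_3 Q_def s3 unfolding ED skew
  by(rule schouten_polynomial[of
   "%i. cp x (cdorf al gm x) (ss i x)" "%i. cp x (be x) (ss i x)" "%i. cp x (dl x) (ss i x)"
   "%i. cp x (cdorf al dl x) (ss i x)" "%i. cp x (gm x) (ss i x)" "%i. cp x (cdorf be gm x) (ss i x)"
   "%i. cp x (al x) (ss i x)" "%i. cp x (cdorf be dl x) (ss i x)"
   "%i. can be (%y. cp y (gm y) (ss i y)) x" "%i. can dl (%y. cp y (al y) (ss i y)) x"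
   "%i. can be (%y. cp y (dl y) (ss i y)) x" "%i. can gm (%y. cp y (al y) (ss i y)) x"
   "%i. can al (%y. cp y (gm y) (ss i y)) x" "%i. can dl (%y. cp y (be y) (ss i y)) x"
   "%i. can al (%y. cp y (dl y) (ss i y)) x" "%i. can gm (%y. cp y (be y) (ss i y)) x"])
qed

end

section \<open>The Schouten bracket for arbitrary decompositions\<close>

context dirac_split
begin

definition good :: "(('m => 'v * 'v) => 'm => 'v * 'v) => bool" where
 "good P <-> (ALL s:cS L. P s : cS Lb)"

lemma goodD: "good P ==> s : cS L ==> P s : cS Lb" unfolding good_def by blast

lemma cp_cdorf_add:
 assumes "u : GC" "e : GC" "f : GC" "w : FC x"
 shows "cp x (cdorf u (%y. e y + f y) x) w = cp x (cdorf u e x) w + cp x (cdorf u f x) w"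
  "cp x (cdorf (%y. e y + f y) u x) w = cp x (cdorf e u x) w + cp x (cdorf f u x) w"
 unfolding cdorf_add_right(1,2)[OF assms(1,2,3)] using assms by simp_all

lemma Q_add:
 assumes P: "good P" and K: "good K" and K': "good K'" and s: "s1 : cS L" "s2 : cS L" "s3 : cS L"
 shows "Q P (%s y. K s y + K' s y) s1 s2 s3 x = Q P K s1 s2 s3 x + Q P K' s1 s2 s3 x"
  "Q (%s y. K s y + K' s y) P s1 s2 s3 x = Q K P s1 s2 s3 x + Q K' P s1 s2 s3 x"
proof -
 have G: "P s : GC" "K s : GC" "K' s : GC" "s : GC" "s x : FC x" if "s : cS L" for s
  using goodD[OF P that] goodD[OF K that] goodD[OF K' that] that by(auto intro: csectionsD GC_FC)
 note G1 = G[OF s(1)] G[OF s(2)] G[OF s(3)]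
 show "Q P (%s y. K s y + K' s y) s1 s2 s3 x = Q P K s1 s2 s3 x + Q P K' s1 s2 s3 x"
  "Q (%s y. K s y + K' s y) P s1 s2 s3 x = Q K P s1 s2 s3 x + Q K' P s1 s2 s3 x"
  unfolding Q_def using G1
  by(simp_all add: canchor_lin(1) cp_cdorf_add canchor_left(1) cp_smooth)
qed

lemma Q_zero:
 assumes P: "good P" and s: "s1 : cS L" "s2 : cS L" "s3 : cS L"
 shows "Q P (%s y. 0) s1 s2 s3 x = 0" "Q (%s y. 0) P s1 s2 s3 x = 0"
proof -
 have z: "good (%s y. 0)" unfolding good_def by(simp add: cs_closed)
 show "Q P (%s y. 0) s1 s2 s3 x = 0" "Q (%s y. 0) P s1 s2 s3 x = 0"
  using Q_add[OF P z z s,of x] by simp_all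
qed

lemma good_list:
 assumes "!!e. e : set es ==> good (g e)"
 shows "good (%s y. SUM e<-es. g e s y)"
 using assms
proof(induction es)
 case (Cons e es)
 hence "good (g e)" "good (%s y. SUM e<-es. g e s y)" by auto
 thus ?case unfolding good_def by(simp add: cs_closed)
qed (simp add: good_def cs_closed)

lemma Q_list:
 assumes P: "good P" and g: "!!e. e : set es ==> good (g e)"
  and s: "s1 : cS L" "s2 : cS L" "s3 : cS L"
 shows "Q P (%s y. SUM e<-es. g e s y) s1 s2 s3 x = (SUM e<-es. Q P (g e) s1 s2 s3 x)"
  "Q (%s y. SUM e<-es. g e s y) P s1 s2 s3 x = (SUM e<-es. Q (g e) P s1 s2 s3 x)"
 using g
proof(induction es)
 case Nil
 { case 1 show ?case by(simp add: Q_zero[OF P s]) }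
 { case 2 show ?case by(simp add: Q_zero[OF P s]) }
next
 case (Cons e es)
 { case 1
  hence g: "good (g e)" "good (%s y. SUM e<-es. g e s y)" by(auto intro: good_list)
  show ?case using Cons.IH(1) 1 Q_add(1)[OF P g s,of x] by simp }
 { case 2
  hence g: "good (g e)" "good (%s y. SUM e<-es. g e s y)" by(auto intro: good_list)
  show ?case using Cons.IH(2) 2 Q_add(2)[OF P g s,of x] by simp }
qed

definition op2 :: "('m => 'v * 'v) list => ('m => 'v * 'v) => 'm => 'v * 'v" where
 "op2 es = El (es ! 0) (es ! 1)"

definition Pf :: "('m,'v) lform => ('m => 'v * 'v) => 'm => 'v * 'v" where
 "Pf H s = (%y. Hm H y (s y))"

lemma length2: "length es = 2 ==> es = [es ! 0,es ! 1]"
 by(cases es; cases "tl es") auto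

lemma good_op2: "length es = 2 ==> set es <= cS Lb ==> good (op2 es)"
 unfolding good_def op2_def by(auto intro!: El_csection)

lemma cp_sum_list:
 assumes "!!e. e : set es ==> g e : FC x" "w : FC x"
 shows "cp x (SUM e<-es. g e) w = (SUM e<-es. cp x (g e) w) & (SUM e<-es. g e) : FC x"
 using assms(1) by(induction es) (use assms(2) in auto)

text \<open>Both sides lie in the conjugate of L, so it suffices to pair them with L.\<close>

lemma represents_2:
 assumes R: "represents C L 2 ess H" and H: "altform x H" and s: "s : cS L"
 shows "(SUM es<-ess. op2 es s x) = Hm H x (s x)"
proof(rule Lb_eqI)
 have es: "length es = 2" "set es <= cS Lb" if "es : set ess" for es
  using R that unfolding represents_def by blast+
 have g: "good (%s y. SUM es<-ess. op2 es s y)" by(rule good_list) (rule good_op2[OF es])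
 show "(SUM es<-ess. op2 es s x) : Lb x" using csectionsD(4)[OF goodD[OF g s]] by simp
 fix w assume w: "w : L x"
 have wF: "w : FC x" using w by simp
 have "H x [s x,w] = (SUM es<-ess. decomposable C es x [s x,w])"
  using R w csectionsD(2)[OF s] unfolding represents_def by simp
 also have "... = (SUM es<-ess. cp x (op2 es s x) w)"
 proof(intro arg_cong[where f = sum_list] map_cong refl)
  fix es assume e: "es : set ess"
  have e2: "es = [es ! 0,es ! 1]" "es ! 0 : cS Lb" "es ! 1 : cS Lb"
   using es[OF e] length2 by auto
  show "decomposable C es x [s x,w] = cp x (op2 es s x) w"
   using wedge_2[of "cp x ((es ! 0) x)" "cp x ((es ! 1) x)" "s x" w] El_pair[OF e2(2,3) wF,of s] arg_cong[OF e2(1),of "map (%e. cp x (e x))"]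
   unfolding decomposable_def op2_def by(simp add: mult.commute)
 qed
 also have "... = cp x (SUM es<-ess. op2 es s x) w"
 proof -
  have "op2 es s x : FC x" if "es : set ess" for es
   using csectionsD(4)[OF goodD[OF good_op2[OF es[OF that]] s]] by simp
  thus ?thesis using cp_sum_list[of ess "%es. op2 es s x" x w] wF by simp
 qed
 finally show "cp x (SUM es<-ess. op2 es s x) w = cp x (Hm H x (s x)) w"
  using Hm_pair[OF H csectionsD(2)[OF s] w] by simp
qed simp

lemma fs_alt: "H : form_sections C L 2 ==> altform x H"
 unfolding form_sections_def by(blast intro: alternating_form_altform)

lemma fs_smooth:
 assumes "H : form_sections C L 2" "s : cS L" "s' : cS L"
 shows "sfun (%x. H x [s x,s' x])"
proof -
 have "sfun (eval_form H [s,s'])"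
  using assms unfolding form_sections_def by simp
 thus ?thesis by(simp add: eval_form_def[abs_def])
qed

lemma good_Pf: "H : form_sections C L 2 ==> good (Pf H)"
 unfolding good_def Pf_def Hm_def by(auto intro!: cs_closed fs_smooth)

text \<open>Secures a candidate for the description operator in \<open>schouten\<close>: the global
  families \<open>ll\<close> and \<open>lb\<close>, available by compactness, provide a finite
  decomposition.\<close>

lemma represents_2_exists:
 assumes H: "H : form_sections C L 2"
 shows "EX ess. represents C L 2 ess H"
proof -
 define h where "h j i x = H x [ll j x,ll i x]" for j i x
 have sh: "sfun (h j i)" if "j < gn" "i < gn" for j i
  unfolding h_def using H that by(intro fs_smooth) simp_all
 \<comment> \<open>The factor 1/2 offsets summation over ordered pairs: (j,i) and (i,j) contribute
   the same wedge product.\<close>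
 define e where "e = (%(j,i). [%x. cscale (1/2 * h j i x) (lb j x),lb i])"
 define I where "I = List.product [0..<gn] [0..<gn]"
 have I: "set I = {..<gn} >< {..<gn}" "distinct I" by(auto simp: I_def intro!: distinct_product)
 show ?thesis
  unfolding represents_def
 proof(intro exI[of _ "map e I"] conjI ballI allI impI)
  fix es assume "es : set (map e I)"
  then obtain j i where "j < gn" "i < gn" "es = e (j,i)" using I by auto
  moreover from this have "sfun (%y. h j i y / 2)" using sfun_cmult[OF sh,of j i "1/2"] by simp
  ultimately show "length es = 2" "set es <= cS Lb"
   by(auto simp: e_def intro!: cs_closed)
 next
  fix x vs assume vs: "length vs = 2 & set vs <= L x"
  then obtain u v where uv: "vs = [u,v]" "u : L x" "v : L x" using length2[of vs] by(metis insert_subset list.simps(15))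
  note alt = altform(1-6)[OF fs_alt[OF H,of x]]
  have ex: "H x [u,v] = (SUM j<gn. SUM i<gn. h j i x * (cp x (lb j x) u * cp x (lb i x) v))" if "u : L x" "v : L x" for u v
  proof -
   have "H x [u,v] = H x [SUM j<gn. cscale (cp x (lb j x) u) (ll j x),v]" by(simp only: L_expand[OF that(1)])
   also have "... = (SUM j<gn. cp x (lb j x) u * H x [ll j x,v])"
    using that by(subst altform_sum[OF fs_alt[OF H]]) (auto simp: alt)
   also have "... = (SUM j<gn. SUM i<gn. h j i x * (cp x (lb j x) u * cp x (lb i x) v))"
   proof(intro sum.cong refl)
    fix j assume "j : {..<gn}"
    hence j: "ll j x : L x" by simp
    have "H x [ll j x,v] = H x [ll j x,SUM i<gn. cscale (cp x (lb i x) v) (ll i x)]" by(simp only: L_expand[OF that(2)])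
    also have "... = (SUM i<gn. cp x (lb i x) v * h j i x)"
     using that j by(subst altform_sum[OF fs_alt[OF H]]) (auto simp: alt h_def)
    finally show "cp x (lb j x) u * H x [ll j x,v] = (SUM i<gn. h j i x * (cp x (lb j x) u * cp x (lb i x) v))"
     by(simp add: sum_distrib_left ac_simps)
   qed
   finally show ?thesis .
  qed
  have "(SUM es<-map e I. decomposable C es x vs) = (SUM p:{..<gn}><{..<gn}. decomposable C (e p) x vs)"
   using sum_list_distinct_conv_sum_set[OF I(2),of "%p. decomposable C (e p) x vs"] by(simp add: o_def I(1))
  also have "... = (SUM j<gn. SUM i<gn. 1/2 * (h j i x * (cp x (lb j x) u * cp x (lb i x) v)) - 1/2 * (h j i x * (cp x (lb j x) v * cp x (lb i x) u)))"
   unfolding sum.cartesian_product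
  proof(intro sum.cong refl)
   fix p assume "p : {..<gn} >< {..<gn}"
   then obtain j i where p: "p = (j,i)" "j < gn" "i < gn" by auto
   thus "decomposable C (e p) x vs = (case p of (j,i) => 1/2 * (h j i x * (cp x (lb j x) u * cp x (lb i x) v)) - 1/2 * (h j i x * (cp x (lb j x) v * cp x (lb i x) u)))"
    using uv by(simp add: decomposable_def e_def wedge_2 mult.assoc)
  qed
  also have "... = 1/2 * H x [u,v] - 1/2 * H x [v,u]"
   unfolding ex[OF uv(2,3)] ex[OF uv(3,2)] sum_distrib_left sum_subtractf ..
  also have "... = H x [u,v]" using altform(7)[OF fs_alt[OF H] uv(2,3)] by simp
  finally show "H x vs = (SUM es<-map e I. decomposable C es x vs)" using uv by simp
 qed
qed

text \<open>Every pair of decompositions yields the same value, since \<open>Q\<close> sees only the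
  operators of H and K; so the description operator has exactly one candidate.\<close>

lemma schouten_22:
 assumes H: "H : form_sections C L 2" and K: "K : form_sections C L 2"
  and s: "s1 : cS L" "s2 : cS L" "s3 : cS L"
 shows "schouten C L 2 2 H K x [s1 x,s2 x,s3 x] = Q (Pf H) (Pf K) s1 s2 s3 x + Q (Pf K) (Pf H) s1 s2 s3 x"
proof -
 have val: "(SUM es<-ess. SUM fs<-fss. schouten_decomposable C es fs x [s1 x,s2 x,s3 x]) =
   Q (Pf H) (Pf K) s1 s2 s3 x + Q (Pf K) (Pf H) s1 s2 s3 x"
  if R: "represents C L 2 ess H" "represents C L 2 fss K" for ess fss
 proof -
  define PH where "PH = (%s y. SUM es<-ess. op2 es s y)"
  define PK where "PK = (%s y. SUM es<-fss. op2 es s y)"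
  have es: "length es = 2" "set es <= cS Lb" if "es : set ess | es : set fss" for es
   using R that unfolding represents_def by blast+
  have g: "good (op2 es)" if "es : set ess | es : set fss" for es using good_op2[OF es[OF that]] .
  have gP: "good PH" "good PK" unfolding PH_def PK_def by(rule good_list; simp add: g)+
  have eq: "PH s = Pf H s" "PK s = Pf K s" if "s : cS L" for s
   unfolding PH_def PK_def Pf_def
   using represents_2[OF R(1) fs_alt[OF H] that] represents_2[OF R(2) fs_alt[OF K] that] by auto
  have sd: "schouten_decomposable C es fs x [s1 x,s2 x,s3 x] = Q (op2 es) (op2 fs) s1 s2 s3 x + Q (op2 fs) (op2 es) s1 s2 s3 x"
   if "es : set ess" "fs : set fss" for es fs
  proof -
   have e: "es = [es ! 0,es ! 1]" "fs = [fs ! 0,fs ! 1]" using length2[OF es(1)[of es]] length2[OF es(1)[of fs]] that by simp_all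
   have m: "es ! 0 : cS Lb" "es ! 1 : cS Lb" "fs ! 0 : cS Lb" "fs ! 1 : cS Lb"
    using es[of es] es[of fs] that by auto
   show ?thesis using schouten_decomposable_22[OF m s,of x] unfolding op2_def e[symmetric] .
  qed
  have "(SUM es<-ess. SUM fs<-fss. schouten_decomposable C es fs x [s1 x,s2 x,s3 x]) =
   (SUM es<-ess. SUM fs<-fss. Q (op2 es) (op2 fs) s1 s2 s3 x + Q (op2 fs) (op2 es) s1 s2 s3 x)"
   by(intro arg_cong[where f = sum_list] map_cong refl sd)
  also have "... = (SUM es<-ess. Q (op2 es) PK s1 s2 s3 x + Q PK (op2 es) s1 s2 s3 x)"
   unfolding sum_list_addf PK_def
   by(intro arg_cong2[where f = "(+)"] arg_cong[where f = sum_list] map_cong refl Q_list[symmetric] s g) auto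
  also have "... = Q PH PK s1 s2 s3 x + Q PK PH s1 s2 s3 x"
   unfolding sum_list_addf PH_def
   by(intro arg_cong2[where f = "(+)"] Q_list[symmetric] s g gP) auto
  also have "... = Q (Pf H) (Pf K) s1 s2 s3 x + Q (Pf K) (Pf H) s1 s2 s3 x"
   unfolding Q_def eq[OF s(1)] eq[OF s(2)] eq[OF s(3)] ..
  finally show ?thesis .
 qed
 obtain ess fss where E: "represents C L 2 ess H" "represents C L 2 fss K"
  using represents_2_exists[OF H] represents_2_exists[OF K] by blast
 show ?thesis
  unfolding schouten_def
 proof(rule the_equality)
  show "EX ess fss. represents C L 2 ess H & represents C L 2 fss K &
   Q (Pf H) (Pf K) s1 s2 s3 x + Q (Pf K) (Pf H) s1 s2 s3 x =
   (SUM es<-ess. SUM fs<-fss. schouten_decomposable C es fs x [s1 x,s2 x,s3 x])"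
   using E val[OF E] by metis
 qed (use val in blast)
qed

text \<open>A 1-form is handled as the section of the conjugate bundle that represents it.\<close>

definition y1 :: "('m,'v) lform => 'm => 'v * 'v" where
 "y1 Y = (%x. SUM i<gn. cscale (Y x [ll i x]) (lb i x))"

lemma form1:
 assumes Y: "Y : form_sections C L 1"
 shows "u : L x ==> w : L x ==> Y x [cscale z u + w] = z * Y x [u] + Y x [w]"
  "s : cS L ==> sfun (%x. Y x [s x])"
proof -
 have A: "!!vs i u w z. length vs = 1 ==> set vs <= L x ==> i < 1 ==> u : L x ==> w : L x ==>
   Y x (vs[i := cscale z u + w]) = z * Y x (vs[i := u]) + Y x (vs[i := w])"
  using Y unfolding form_sections_def alternating_form_def by blast
 show "Y x [cscale z u + w] = z * Y x [u] + Y x [w]" if "u : L x" "w : L x" using A[of "[u]" 0 u w z] that by simp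
 show "sfun (%x. Y x [s x])" if "s : cS L"
 proof -
  have "sfun (eval_form Y [s])" using Y that unfolding form_sections_def by simp
  thus ?thesis by(simp add: eval_form_def[abs_def])
 qed
qed

lemma form1_sum:
 assumes Y: "Y : form_sections C L 1" and "!!i. i : I ==> g i : L x"
 shows "Y x [SUM i:I. cscale (z i) (g i)] = (SUM i:I. z i * Y x [g i])"
proof -
 have z: "Y x [0] = 0" using form1(1)[OF Y L_closed(1) L_closed(1),where z = 1] by simp
 show ?thesis using assms(2)
  by(induction I rule: infinite_finite_induct) (auto simp: z form1(1)[OF Y] L_sums)
qed

lemma y1_csection: "Y : form_sections C L 1 ==> y1 Y : cS Lb"
 unfolding y1_def by(intro cs_closed) (simp_all add: form1)

lemma y1_pair:
 assumes Y: "Y : form_sections C L 1" and w: "w : L x"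
 shows "cp x (y1 Y x) w = Y x [w]"
proof -
 have "cp x (y1 Y x) w = (SUM i<gn. cp x (lb i x) w * Y x [ll i x])"
  unfolding y1_def using w by(subst cp_sum) (auto simp: mult.commute)
 also have "... = Y x [w]"
  using form1_sum[OF Y,of "{..<gn}" "%i. ll i x" x "%i. cp x (lb i x) w"] L_expand[OF w] by simp
 finally show ?thesis .
qed

text \<open>Minus the Lie derivative along y of the 2-form with operator P, evaluated on s1 and
  s2.\<close>

definition R21 :: "(('m => 'v * 'v) => 'm => 'v * 'v) => ('m => 'v * 'v) => ('m => 'v * 'v) => ('m => 'v * 'v) => 'm => complex" where
 "R21 P y s1 s2 x = cp x (cdorf y (P s2) x) (s1 x) - cp x (cdorf y (P s1) x) (s2 x) - can y (%z. cp z (P s2 z) (s1 z)) x"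

lemma schouten_decomposable_21:
 assumes e: "al : cS Lb" "be : cS Lb" "y : cS Lb"
  and s: "s1 : cS L" "s2 : cS L"
 shows "schouten_decomposable C [al,be] [y] x [s1 x,s2 x] = R21 (El al be) y s1 s2 x"
proof -
 have F: "s1 x : FC x" "s2 x : FC x" "al x : FC x" "be x : FC x" using e s csectionsD GC_FC by blast+
 have G: "al : GC" "be : GC" "y : GC" using e csectionsD by blast+
 have lhs: "schouten_decomposable C [al,be] [y] x [s1 x,s2 x] =
   wedge [cp x (cdorf al y x),cp x (be x)] [s1 x,s2 x] - wedge [cp x (cdorf be y x),cp x (al x)] [s1 x,s2 x]"
  using e by(simp add: schouten_decomposable_def decomposable_def lessThan_Suc del_nth_def Lb_cbracket)
 have skew: "cp x (cdorf y al x) w = - cp x (cdorf al y x) w" "cp x (cdorf y be x) w = - cp x (cdorf be y x) w"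
  if "w : FC x" for w using cdorf_skew e that by blast+
 have D: "cp x (cdorf y (El al be s) x) w = - cp x (al x) (s x) * cp x (cdorf be y x) w
   + can y (%z. cp z (al z) (s z)) x * cp x (be x) w
   + cp x (be x) (s x) * cp x (cdorf al y x) w - can y (%z. cp z (be z) (s z)) x * cp x (al x) w"
  if "s : cS L" "w : FC x" for s w
 proof -
  have sm: "sfun (%z. cp z (al z) (s z))" "sfun (%z. cp z (be z) (s z))" using e that by simp_all
  have G2: "(%z. cscale (cp z (al z) (s z)) (be z)) : GC" "(%z. cscale (cp z (be z) (s z)) (al z)) : GC"
   by(intro cscale_GC G sm)+
  show ?thesis
   unfolding El_def cdorf_add_right(3)[OF G(3) G2] cdorf_fun_right[OF G(3,2) sm(1)] cdorf_fun_right[OF G(3,1) sm(2)]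
   using that(2) F G by(simp add: skew)
 qed
 have A: "can y (%z. cp z (El al be s2 z) (s1 z)) x =
   cp x (al x) (s2 x) * can y (%z. cp z (be z) (s1 z)) x + can y (%z. cp z (al z) (s2 z)) x * cp x (be x) (s1 x)
   - cp x (be x) (s2 x) * can y (%z. cp z (al z) (s1 z)) x - can y (%z. cp z (be z) (s2 z)) x * cp x (al x) (s1 x)"
 proof -
  have sm: "sfun (%z. cp z (al z) (s1 z))" "sfun (%z. cp z (be z) (s1 z))"
   "sfun (%z. cp z (al z) (s2 z))" "sfun (%z. cp z (be z) (s2 z))" using e s by simp_all
  have E: "(%z. cp z (El al be s2 z) (s1 z)) = (%z. cp z (al z) (s2 z) * cp z (be z) (s1 z) - cp z (be z) (s2 z) * cp z (al z) (s1 z))"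
   using El_pair[OF e(1,2)] csectionsD(1)[OF s(1)] by simp
  show ?thesis
   unfolding E canchor_lin(2)[OF G(3) sfun_mult[OF sm(3,2)] sfun_mult[OF sm(4,1)]]
    canchor_lin(3)[OF G(3) sm(3,2)] canchor_lin(3)[OF G(3) sm(4,1)] by(simp add: algebra_simps)
 qed
 show ?thesis unfolding lhs wedge_2 R21_def D[OF s(1) F(2)] D[OF s(2) F(1)] A by algebra
qed

lemma R21_add:
 assumes P: "good P" "good P'" and y: "y : cS Lb" "y' : cS Lb"
  and s: "s1 : cS L" "s2 : cS L"
 shows "R21 (%s z. P s z + P' s z) y s1 s2 x = R21 P y s1 s2 x + R21 P' y s1 s2 x"
  "R21 P (%z. y z + y' z) s1 s2 x = R21 P y s1 s2 x + R21 P y' s1 s2 x"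
proof -
 have G: "P s : GC" "P' s : GC" "s : GC" "s x : FC x" if "s : cS L" for s
  using goodD[OF P(1) that] goodD[OF P(2) that] that by(auto intro: csectionsD GC_FC)
 note G1 = G[OF s(1)] G[OF s(2)] csectionsD(3)[OF y(1)] csectionsD(3)[OF y(2)]
 show "R21 (%s z. P s z + P' s z) y s1 s2 x = R21 P y s1 s2 x + R21 P' y s1 s2 x"
  "R21 P (%z. y z + y' z) s1 s2 x = R21 P y s1 s2 x + R21 P y' s1 s2 x"
  unfolding R21_def using G1
  by(simp_all add: canchor_lin(1) cp_cdorf_add canchor_left(1) cp_smooth)
qed

lemma R21_zero:
 assumes P: "good P" and y: "y : cS Lb" and s: "s1 : cS L" "s2 : cS L"
 shows "R21 (%s z. 0) y s1 s2 x = 0" "R21 P (%z. 0) s1 s2 x = 0"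
proof -
 have z: "good (%s y. 0)" unfolding good_def by(simp add: cs_closed)
 show "R21 (%s z. 0) y s1 s2 x = 0" "R21 P (%z. 0) s1 s2 x = 0"
  using R21_add(1)[OF z z y y s,of x] R21_add(2)[OF P P cs_closed(5) cs_closed(5) s,of x] by simp_all
qed

lemma csection_list: "(!!e. e : set es ==> g e : cS Lb) ==> (%y. SUM e<-es. g e y) : cS Lb"
 by(induction es) (auto simp: cs_closed)

lemma R21_list:
 assumes P: "good P" and y: "y : cS Lb" and s: "s1 : cS L" "s2 : cS L"
 shows "(!!e. e : set es ==> good (g e)) ==> R21 (%s z. SUM e<-es. g e s z) y s1 s2 x = (SUM e<-es. R21 (g e) y s1 s2 x)"
  "(!!f. f : set fs ==> k f : cS Lb) ==> R21 P (%z. SUM f<-fs. k f z) s1 s2 x = (SUM f<-fs. R21 P (k f) s1 s2 x)"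
proof -
 show "R21 (%s z. SUM e<-es. g e s z) y s1 s2 x = (SUM e<-es. R21 (g e) y s1 s2 x)" if "!!e. e : set es ==> good (g e)"
  using that
 proof(induction es)
  case (Cons e es)
  hence "good (g e)" "good (%s y. SUM e<-es. g e s y)" by(auto intro: good_list)
  from R21_add(1)[OF this y y s,of x] Cons show ?case by simp
 qed (simp add: R21_zero[OF P y s])
 show "R21 P (%z. SUM f<-fs. k f z) s1 s2 x = (SUM f<-fs. R21 P (k f) s1 s2 x)" if "!!f. f : set fs ==> k f : cS Lb"
  using that
 proof(induction fs)
  case (Cons f fs)
  hence "k f : cS Lb" "(%y. SUM f<-fs. k f y) : cS Lb" by(auto intro: csection_list)
  from R21_add(2)[OF P P this s,of x] Cons show ?case by simp
 qed (simp add: R21_zero[OF P y s])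
qed

lemma length1: "length es = 1 ==> es = [es ! 0]"
 by(cases es) auto

text \<open>The scheme of degrees (2,2) again; here \<open>y1 Y\<close> alone decomposes the
  1-form.\<close>

lemma schouten_21:
 assumes H: "H : form_sections C L 2" and Y: "Y : form_sections C L 1"
  and s: "s1 : cS L" "s2 : cS L"
 shows "schouten C L 2 1 H Y x [s1 x,s2 x] = R21 (Pf H) (y1 Y) s1 s2 x"
proof -
 have val: "(SUM es<-ess. SUM fs<-fss. schouten_decomposable C es fs x [s1 x,s2 x]) = R21 (Pf H) (y1 Y) s1 s2 x"
  if R: "represents C L 2 ess H" "represents C L 1 fss Y" for ess fss
 proof -
  define PH where "PH = (%s y. SUM es<-ess. op2 es s y)"
  define y where "y = (%z. SUM fs<-fss. (fs ! 0) z)"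
  have es: "length es = 2" "set es <= cS Lb" if "es : set ess" for es
   using R that unfolding represents_def by blast+
  have fs: "length fs = 1" "set fs <= cS Lb" if "fs : set fss" for fs
   using R that unfolding represents_def by blast+
  have f0: "fs ! 0 : cS Lb" if "fs : set fss" for fs using fs[OF that] by auto
  have g: "good (op2 es)" if "es : set ess" for es using good_op2[OF es[OF that]] .
  have gP: "good PH" unfolding PH_def by(rule good_list) (rule g)
  have yc: "y : cS Lb" unfolding y_def by(rule csection_list) (rule f0)
  have eq: "PH s = Pf H s" if "s : cS L" for s
   unfolding PH_def Pf_def using represents_2[OF R(1) fs_alt[OF H] that] by auto
  have "y z = y1 Y z" for z
  proof(rule Lb_eqI)
   show "y z : Lb z" "y1 Y z : Lb z" using yc y1_csection[OF Y] by(auto intro: csectionsD)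
   fix w assume w: "w : L z"
   have "Y z [w] = (SUM es<-fss. decomposable C es z [w])" using R(2) w unfolding represents_def by simp
   also have "... = (SUM es<-fss. cp z ((es ! 0) z) w)"
   proof(intro arg_cong[where f = sum_list] map_cong refl)
    fix es assume "es : set fss"
    hence "es = [es ! 0]" using fs length1 by blast
    then obtain e where "es = [e]" by blast
    thus "decomposable C es z [w] = cp z ((es ! 0) z) w" by(simp add: decomposable_def wedge_1)
   qed
   also have "... = cp z (y z) w"
    unfolding y_def using cp_sum_list[of fss "%fs. (fs ! 0) z" z w] f0 w by(simp add: csectionsD)
   finally show "cp z (y z) w = cp z (y1 Y z) w" using y1_pair[OF Y w] by simp
  qed
  hence yeq: "y = y1 Y" by(rule ext)
  have sd: "schouten_decomposable C es fs x [s1 x,s2 x] = R21 (op2 es) (fs ! 0) s1 s2 x"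
   if "es : set ess" "fs : set fss" for es fs
  proof -
   have e: "es = [es ! 0,es ! 1]" "fs = [fs ! 0]" by(rule length2[OF es(1)[OF that(1)]],rule length1[OF fs(1)[OF that(2)]])
   have m: "es ! 0 : cS Lb" "es ! 1 : cS Lb" using es[of es] that by auto
   show ?thesis using schouten_decomposable_21[OF m f0[OF that(2)] s,of x] unfolding op2_def e[symmetric] .
  qed
  have "(SUM es<-ess. SUM fs<-fss. schouten_decomposable C es fs x [s1 x,s2 x]) =
   (SUM es<-ess. SUM fs<-fss. R21 (op2 es) (fs ! 0) s1 s2 x)"
   by(intro arg_cong[where f = sum_list] map_cong refl sd)
  also have "... = (SUM es<-ess. R21 (op2 es) y s1 s2 x)"
  proof(intro arg_cong[where f = sum_list] map_cong refl)
   fix es assume e: "es : set ess"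
   show "(SUM fs<-fss. R21 (op2 es) (fs ! 0) s1 s2 x) = R21 (op2 es) y s1 s2 x"
    unfolding y_def by(rule R21_list(2)[OF g[OF e] yc s,symmetric]) (rule f0)
  qed
  also have "... = R21 PH y s1 s2 x"
   unfolding PH_def by(rule R21_list(1)[OF gP yc s,symmetric]) (rule g)
  also have "... = R21 (Pf H) (y1 Y) s1 s2 x"
   unfolding R21_def eq[OF s(1)] eq[OF s(2)] yeq ..
  finally show ?thesis .
 qed
 have E2: "represents C L 1 [[y1 Y]] Y"
  unfolding represents_def
 proof(intro conjI ballI allI impI)
  fix x vs assume vs: "length vs = 1 & set vs <= L x"
  then obtain v where "vs = [v]" "v : L x" using length1[of vs] by(metis insert_subset list.simps(15))
  thus "Y x vs = (SUM es<-[[y1 Y]]. decomposable C es x vs)" using y1_pair[OF Y] by(simp add: decomposable_def wedge_1)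
 qed (use y1_csection[OF Y] in auto)
 obtain ess where E: "represents C L 2 ess H" using represents_2_exists[OF H] by blast
 show ?thesis
  unfolding schouten_def
 proof(rule the_equality)
  show "EX ess fss. represents C L 2 ess H & represents C L 1 fss Y &
   R21 (Pf H) (y1 Y) s1 s2 x = (SUM es<-ess. SUM fs<-fss. schouten_decomposable C es fs x [s1 x,s2 x])"
   using E E2 val[OF E E2] by metis
 qed (use val in blast)
qed

end

section \<open>Integrability and deformation of the graph\<close>

context dirac_split
begin

definition U :: "('m,'v) lform => ('m => 'v * 'v) => 'm => 'v * 'v" where
 "U H s = (%y. s y + Pf H s y)"

lemma Pf_csection: "H : form_sections C L 2 ==> s : cS L ==> Pf H s : cS Lb"
 using good_Pf goodD by blast

lemma Pf_pair:
 assumes "H : form_sections C L 2" "s : cS L" "w : L y"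
 shows "cp y (Pf H s y) w = H y [s y,w]"
 unfolding Pf_def by(rule Hm_pair) (use assms fs_alt csectionsD in auto)

lemma U_GC: "H : form_sections C L 2 ==> s : cS L ==> U H s : GC"
 unfolding U_def by(intro GC_add) (auto intro: csectionsD Pf_csection)

text \<open>Expand by the number of factors H'. Degrees 0 and 3 vanish as L and its conjugate are
  isotropic and involutive, degree 1 is \<open>d_L H\<close>, and degree 2 is \<open>Q P P\<close>,
  half of the bracket of H with itself; the sum is the Maurer-Cartan expression.\<close>

lemma graph_involutive:
 assumes H: "hamiltonian_operator C L H"
  and s: "s1 : cS L" "s2 : cS L" "s3 : cS L"
 shows "cp x (cdorf (U H s1) (U H s2) x) (U H s3 x) = 0"
proof -
 have HF: "H : form_sections C L 2" using H unfolding hamiltonian_operator_def by(elim conjE)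
 have "length [s1,s2,s3] = 3 & set [s1,s2,s3] <= cS L" using s by simp
 hence mc: "d_L C H [s1,s2,s3] x + (1/2) * eval_form (schouten C L 2 2 H H) [s1,s2,s3] x = 0"
  using H unfolding hamiltonian_operator_def by blast
 define P where "P = Pf H"
 have P: "P s : cS Lb" if "s : cS L" for s unfolding P_def by(rule Pf_csection[OF HF that])
 have G: "s1 : GC" "s2 : GC" "s3 : GC" "P s1 : GC" "P s2 : GC" "P s3 : GC"
  using s P by(auto intro: csectionsD)
 have h: "cp y (P s y) (s' y) = H y [s y,s' y]" if "s : cS L" "s' : cS L" for s s' y
  unfolding P_def using Pf_pair[OF HF that(1) csectionsD(2)[OF that(2)]] .
 have h': "cp x (P s x) w = H x [s x,w]" if "s : cS L" "w : L x" for s w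
  unfolding P_def using Pf_pair[OF HF that] .
 have br: "cdorf s s' x : L x" if "s : cS L" "s' : cS L" for s s'
  using csectionsD(2)[OF L_cdorf(2)[OF that]] .
 note alt = altform(7)[OF fs_alt[OF HF]]
 have dL: "d_L C H [s1,s2,s3] x = can s1 (%y. cp y (P s2 y) (s3 y)) x - can s2 (%y. cp y (P s1 y) (s3 y)) x
   + can s3 (%y. cp y (P s1 y) (s2 y)) x + cp x (P s3 x) (cdorf s1 s2 x) - cp x (P s2 x) (cdorf s1 s3 x)
   + cp x (P s1 x) (cdorf s2 s3 x)"
  using s alt[OF csectionsD(2)[OF s(3)] br[OF s(1,2)]] alt[OF csectionsD(2)[OF s(2)] br[OF s(1,3)]] alt[OF csectionsD(2)[OF s(1)] br[OF s(2,3)]]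
  by(simp add: d_L_def lessThan_Suc del_nth_def eval_form_def[abs_def] Lb_cbracket(2) h h' br numeral_2_eq_2)
 have q: "(1/2) * eval_form (schouten C L 2 2 H H) [s1,s2,s3] x = Q P P s1 s2 s3 x"
  using schouten_22[OF HF HF s,of x] by(simp add: eval_form_def P_def)
 note sy = cp_sym[OF GC_FC GC_FC]
 have sw: "(%y. cp y (a y) (b y)) = (%y. cp y (b y) (a y))" if "a : GC" "b : GC" for a b using sy[OF that] by auto
 have z: "cp x (cdorf s1 s2 x) (s3 x) = 0" "cp x (cdorf (P s1) (P s2) x) (P s3 x) = 0"
  using L_zero[OF L_cdorf(2)[OF s(1,2)] s(3)] Lb_zero[OF L_cdorf(1)[OF P[OF s(1)] P[OF s(2)]] P[OF s(3)]] by auto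
 have 1: "cp x (cdorf s1 (P s2) x) (s3 x) = can s1 (%y. cp y (P s2 y) (s3 y)) x - cp x (P s2 x) (cdorf s1 s3 x)"
  using cdorf_metric[OF G(1,5,3),of x] by simp
 have 2: "cp x (cdorf (P s1) s2 x) (s3 x) = can s3 (%y. cp y (P s1 y) (s2 y)) x
   - can s2 (%y. cp y (P s1 y) (s3 y)) x + cp x (P s1 x) (cdorf s2 s3 x)"
  using cdorf_sym[OF G(4,2,3),of x] cdorf_metric[OF G(2,4,3),of x] by(simp add: algebra_simps)
 have 3: "cp x (cdorf (P s1) s2 x) (P s3 x) = can (P s1) (%y. cp y (P s3 y) (s2 y)) x - cp x (cdorf (P s1) (P s3) x) (s2 x)"
  using cdorf_metric[OF G(4,2,6),of x] sw[OF G(2,6)] sy[OF G(2) cdorf_GC[OF G(4,6)]] by simp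
 have 4: "cp x (cdorf s1 (P s2) x) (P s3 x) = can (P s3) (%y. cp y (P s2 y) (s1 y)) x
   - can (P s2) (%y. cp y (P s3 y) (s1 y)) x + cp x (cdorf (P s2) (P s3) x) (s1 x)"
  using cdorf_sym[OF G(1,5,6),of x] cdorf_metric[OF G(5,1,6),of x] sw[OF G(1,6)] sw[OF G(1,5)] sy[OF G(1) cdorf_GC[OF G(5,6)]]
  by(simp add: algebra_simps)
 have FC: "cdorf s1 s2 x : FC x" "cdorf s1 (P s2) x : FC x" "cdorf (P s1) s2 x : FC x" "cdorf (P s1) (P s2) x : FC x"
  "s3 x : FC x" "P s3 x : FC x" using G by auto
 have "cdorf (U H s1) (U H s2) x = cdorf s1 s2 x + cdorf s1 (P s2) x + (cdorf (P s1) s2 x + cdorf (P s1) (P s2) x)"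
  unfolding U_def P_def[symmetric] cdorf_add_right(2)[OF GC_add[OF G(2,5)] G(1,4)]
   cdorf_add_right(1)[OF G(1,2,5)] cdorf_add_right(1)[OF G(4,2,5)] ..
 hence "cp x (cdorf (U H s1) (U H s2) x) (U H s3 x) = cp x (cdorf s1 s2 x + cdorf s1 (P s2) x + (cdorf (P s1) s2 x + cdorf (P s1) (P s2) x)) (s3 x + P s3 x)"
  by(simp add: U_def P_def)
 also have "... = d_L C H [s1,s2,s3] x + Q P P s1 s2 s3 x"
  using FC by(simp add: z 1 2 3 4 dL Q_def sy[OF cdorf_GC[OF G(1,2)] G(6)])
 also have "... = 0" using mc q by simp
 finally show ?thesis .
qed

text \<open>Up to the sign, degree 0 in H' is \<open>d_L Y\<close>, degree 1 is the Schouten bracket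
  of H and Y, and degree 2 vanishes since the conjugate of L is isotropic and involutive.\<close>

lemma deformation_rhs:
 assumes HF: "H : form_sections C L 2" and Y: "Y : form_sections C L 1"
  and s: "s1 : cS L" "s2 : cS L"
 shows "d_L C Y [s1,s2] x + eval_form (schouten C L 2 1 H Y) [s1,s2] x = - cp x (cdorf (y1 Y) (U H s1) x) (U H s2 x)"
proof -
 define P where "P = Pf H"
 define y where "y = y1 Y"
 have P: "P s : cS Lb" if "s : cS L" for s unfolding P_def by(rule Pf_csection[OF HF that])
 have y: "y : cS Lb" unfolding y_def by(rule y1_csection[OF Y])
 have G: "s1 : GC" "s2 : GC" "P s1 : GC" "P s2 : GC" "y : GC"
  using s P y by(auto intro: csectionsD)
 have yp: "cp z (y z) (s z) = Y z [s z]" if "s : cS L" for s z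
  unfolding y_def using y1_pair[OF Y csectionsD(2)[OF that]] .
 note sy = cp_sym[OF GC_FC GC_FC]
 have sw: "(%y. cp y (a y) (b y)) = (%y. cp y (b y) (a y))" if "a : GC" "b : GC" for a b using sy[OF that] by auto
 have br: "cp x (y x) (cdorf s1 s2 x) = Y x [cdorf s1 s2 x]" using yp[OF L_cdorf(2)[OF s]] .
 have dL: "d_L C Y [s1,s2] x = can s1 (%z. cp z (y z) (s2 z)) x - can s2 (%z. cp z (y z) (s1 z)) x - cp x (y x) (cdorf s1 s2 x)"
  using s by(simp add: d_L_def lessThan_Suc del_nth_def eval_form_def[abs_def] Lb_cbracket(2) yp br)
 have R: "eval_form (schouten C L 2 1 H Y) [s1,s2] x = R21 P y s1 s2 x"
  using schouten_21[OF HF Y s,of x] by(simp add: eval_form_def P_def y_def)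
 have 1: "cp x (cdorf y s1 x) (s2 x) = can s2 (%z. cp z (y z) (s1 z)) x - can s1 (%z. cp z (y z) (s2 z)) x
   + cp x (y x) (cdorf s1 s2 x)"
  using cdorf_sym[OF G(5,1,2),of x] cdorf_metric[OF G(1,5,2),of x] by(simp add: algebra_simps)
 have 2: "cp x (cdorf y s1 x) (P s2 x) = can y (%z. cp z (P s2 z) (s1 z)) x - cp x (cdorf y (P s2) x) (s1 x)"
  using cdorf_metric[OF G(5,1,4),of x] sw[OF G(1,4)] sy[OF G(1) cdorf_GC[OF G(5,4)]] by simp
 have 3: "cp x (cdorf y (P s1) x) (P s2 x) = 0"
  using Lb_zero[OF L_cdorf(1)[OF y P[OF s(1)]] P[OF s(2)]] .
 have FC: "cdorf y s1 x : FC x" "cdorf y (P s1) x : FC x" "s2 x : FC x" "P s2 x : FC x" using G by auto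
 show ?thesis
  unfolding dL R R21_def U_def P_def[symmetric] y_def[symmetric] cdorf_add_right(1)[OF G(5,1,3)]
  using FC by(simp add: 1 2 3)
qed

definition Ua :: "('m,'v) lform => ('m => 'v) => 'm => 'v * 'v" where
 "Ua H a = (%x. (a x,- Jof (gr H x) (a x)))"

text \<open>Involutivity is available for sections s + H' s with s in L; here s is the L-component
  of (a, - J a).\<close>

lemma Ua_lift:
 assumes A: "!!x. admissible x H" and a: "a : Gam" and Ja: "(%x. Jof (gr H x) (a x)) : Gam"
 obtains s where "s : cS L" "Ua H a = U H s"
proof -
 define q where "q = (%x. - Jof (gr H x) (a x))"
 have q: "q : Gam" unfolding q_def by(rule sec_minus[OF Ja])
 define s where "s = (%x. pl x (a x) + cscale \<i> (pl x (q x)))"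
 have s: "s : cS L"
  using pl_section[OF a] pl_section[OF q] cscale_GC[of "%x. pl x (q x)" "%_. \<i>"]
  unfolding cs_iff s_def by(simp add: GC_add)
 have "Ua H a x = U H s x" for x
 proof -
  have "Ua H a x : gr H x" unfolding Ua_def using Jof(2)[OF gr_polar[OF A]] a by simp
  then obtain w where w: "w : L x" "Ua H a x = w + Hm H x w" unfolding gr_def by(elim imageE)
  have "Ua H a x = (a x,0) + cscale \<i> (q x,0)" by(simp add: Ua_def q_def cscale_def)
  also have "... = s x + (cconj (pl x (a x)) + cscale \<i> (cconj (pl x (q x))))"
   unfolding pl_sum[of "a x" x] pl_sum[of "q x" x] cscale_add_right s_def by(simp add: add_ac)
  finally have e: "w + Hm H x w = s x + (cconj (pl x (a x)) + cscale \<i> (cconj (pl x (q x))))" using w(2) by simp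
  have "w = s x"
   by(rule L_unique(1)[OF w(1) Hm_Lb csectionsD(2)[OF s] _ e]) (use a q in simp)
  thus ?thesis using w(2) by(simp add: U_def Pf_def)
 qed
 thus ?thesis using that[OF s] by blast
qed

lemma Ua_involutive:
 assumes H: "hamiltonian_operator C L H" and A: "!!x. admissible x H"
  and J: "!!a. a : Gam ==> (%x. Jof (gr H x) (a x)) : Gam"
  and a: "a : Gam" "b : Gam" "c : Gam"
 shows "cp x (cdorf (Ua H a) (Ua H b) x) (Ua H c x) = 0"
proof -
 obtain sa where sa: "sa : cS L" "Ua H a = U H sa" by(rule Ua_lift[OF A a(1) J[OF a(1)]])
 obtain sb where sb: "sb : cS L" "Ua H b = U H sb" by(rule Ua_lift[OF A a(2) J[OF a(2)]])
 obtain sc where sc: "sc : cS L" "Ua H c = U H sc" by(rule Ua_lift[OF A a(3) J[OF a(3)]])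
 show ?thesis unfolding sa(2) sb(2) sc(2) by(rule graph_involutive[OF H sa(1) sb(1) sc(1)])
qed

text \<open>The bracket of a - i J a and b - i J b is p + i q. Being orthogonal to the whole
  eigenbundle, it satisfies p = J q, and this is integrability: the exact terms of the Dorfman
  bracket cancel because J is orthogonal.\<close>

lemma Jof_gcs:
 assumes H: "hamiltonian_operator C L H" and A: "!!x. admissible x H"
  and J: "!!a. a : Gam ==> (%x. Jof (gr H x) (a x)) : Gam"
 shows "associated_gcs C L H (%x. Jof (gr H x))"
proof -
 define j where "j x = Jof (gr H x)" for x
 note N = Jof[OF gr_polar[OF A],folded j_def]
 have J': "(%x. j x (a x)) : Gam" if "a : Gam" for a using J[OF that] by(simp add: j_def)
 have int: "br (%y. j y (a y)) (%y. j y (b y)) x - br a b x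
     - j x (br (%y. j y (a y)) b x + br a (%y. j y (b y)) x) = 0"
  if a: "a : Gam" and b: "b : Gam" for a b x
 proof -
  define p where "p = dorf a b x - dorf (%y. j y (a y)) (%y. j y (b y)) x"
  define q where "q = - dorf a (%y. j y (b y)) x - dorf (%y. j y (a y)) b x"
  have pF: "p : F x" "q : F x" unfolding p_def q_def using a b J' by auto
  have U: "Ua H a = (%x. (a x,- j x (a x)))" for a by(simp add: Ua_def j_def)
  have c: "cdorf (Ua H a) (Ua H b) x = (p,q)"
   unfolding U cdorf_eq p_def q_def using a b J' sec_minus[OF J']
   by(simp add: dorf_lin_right(3)[OF _ J' J'] dorf_lin_left(3)[OF _ J' J'] dorf_lin_left(3)[OF sec_minus[OF J'] J' J'])
  have "p = j x q"
  proof(rule pair_eqI[OF pF(1) N(3)[OF pF(2)]])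
   fix v assume v: "v : F x"
   obtain d where d: "d : Gam" "d x = v" using section_through[OF v] by blast
   have "cp x (p,q) (v,- j x v) = 0"
    using Ua_involutive[OF H A J a b d(1),of x] unfolding c unfolding U d(2) .
   hence "pair x p v - pair x q (- j x v) = 0" by(simp add: cpairing_def complex_eq_iff)
   thus "pair x p v = pair x (j x q) v" using N(3)[OF v] N(7)[OF pF(2) v] pF by simp
  qed
  have Jq: "j x q = - j x (- q)" using Jof_linear_simps(3)[OF gr_polar[OF A] pF(2) pF(2),folded j_def] by simp
  have jab: "pair y (j y (a y)) (j y (b y)) = pair y (a y) (b y)" "pair y (j y (a y)) (b y) = - pair y (a y) (j y (b y))" for y
   using N(6,7) a b by auto
  have Dm: "Dd (%y. - pair y (a y) (j y (b y))) x = - Dd (%y. pair y (a y) (j y (b y))) x"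
   using Dd_cmult[OF pair_smooth[OF a J'[OF b]],of "-1" x] by simp
  have "p = br a b x - br (%y. j y (a y)) (%y. j y (b y)) x"
   unfolding p_def dorf_def by(simp add: jab)
  moreover have "- q = br (%y. j y (a y)) b x + br a (%y. j y (b y)) x"
   unfolding q_def dorf_def by(simp add: jab(2) Dm)
  ultimately show ?thesis using \<open>p = j x q\<close> unfolding Jq by(simp add: algebra_simps)
 qed
 have "generalized_complex_structure C j"
  unfolding generalized_complex_structure_def bundle_endomorphism_def
  using N(3-6) J' int by(intro conjI allI ballI) simp_all
 moreover have "plus_i_eigenbundle C j = graph C L H"
 proof
  fix x
  have "altform x H" using A unfolding admissible_def by blast
  thus "plus_i_eigenbundle C j x = graph C L H x"
   unfolding graph_gr[OF \<open>altform x H\<close>] plus_i_eigenbundle_def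
   using Jof_eigenspace[OF gr_polar[OF A],of x] by(simp add: j_def)
 qed
 ultimately show ?thesis unfolding associated_gcs_def j_def[abs_def] by blast
qed

lemma associated_gcs_unique:
 assumes A: "!!x. admissible x H" and J: "associated_gcs C L H J" and v: "v : F x"
 shows "J x v = Jof (gr H x) v"
proof -
 have "altform x H" using A unfolding admissible_def by blast
 have "plus_i_eigenbundle C J x = gr H x"
  using J graph_gr[OF \<open>altform x H\<close>] unfolding associated_gcs_def by simp
 thus ?thesis
  unfolding plus_i_eigenbundle_def by(rule eigenspace_Jof[OF gr_polar[OF A] _ v])
qed

end

section \<open>The given family and its real section\<close>

locale hamiltonian_family = dirac_split C gn ga ga' L
 for C :: "('m::{t2_space,second_countable_topology},'e::{real_inner,banach,heine_borel},'v::real_vector,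
  'f::{real_inner,banach,heine_borel}) courant" and gn ga ga' L +
 fixes H Y :: "real => ('m,'v) lform"
 assumes H_family: "smooth_form_family C L 2 H"
  and H_ham: "ALL t:{0..1}. hamiltonian_operator C L (H t)"
  and H_bij: "ALL t:{0..1}. ALL x. bij_betw (%v. Hbar_map C L (H t) x (H_map C L (H t) x v) - v) (L x) (L x)"
  and Y_family: "smooth_form_family C L 1 Y"
  and evolution: "ALL t:{0..1}. ALL ss x. length ss = 2 & set ss <= csections C L -->
      ((%ta. eval_form (H ta) ss x) hvd
       d_L C (Y t) ss x + eval_form (schouten C L 2 1 (H t) (Y t)) ss x) (at t within {0..1})"
begin

lemma H_form: "t : {0..1} ==> H t : form_sections C L 2"
 using H_family unfolding smooth_form_family_def by blast

lemma Y_form: "t : {0..1} ==> Y t : form_sections C L 1"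
 using Y_family unfolding smooth_form_family_def by blast

lemma H_admissible:
 assumes t: "t : {0..1}" shows "admissible x (H t)"
proof -
 have alt: "altform x (H t)" by(rule fs_alt[OF H_form[OF t]])
 have "bij_betw (%v. Hbar_map C L (H t) x (H_map C L (H t) x v) - v) (L x) (L x)" using H_bij t by blast
 moreover have "Hbar_map C L (H t) x (H_map C L (H t) x v) - v = cconj (Hm (H t) x (cconj (Hm (H t) x v))) - v" if "v : L x" for v
  by(simp add: H_map_eq[OF alt that] Hbar_map_eq[OF alt Hm_Lb])
 ultimately show ?thesis unfolding admissible_def using alt
  by(simp cong: bij_betw_cong)
qed

lemma H_smooth_at:
 assumes "s : cS L" "s' : cS L" "t : {0..1}"
 shows "sat {0..1} (%t x. H t x [s x,s' x]) t x"
proof -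
 have "length [s,s'] = 2 & set [s,s'] <= cS L" using assms by simp
 hence "smooth_family C (%t. eval_form (H t) [s,s'])" using H_family unfolding smooth_form_family_def by blast
 hence "sat {0..1} (%t. eval_form (H t) [s,s']) t x" unfolding smooth_family_iff using assms(3) by blast
 thus ?thesis by(simp add: eval_form_def[abs_def])
qed

lemma Y_smooth_at:
 assumes "s : cS L" "t : {0..1}"
 shows "sat {0..1} (%t x. Y t x [s x]) t x"
proof -
 have "length [s] = 1 & set [s] <= cS L" using assms by simp
 hence "smooth_family C (%t. eval_form (Y t) [s])" using Y_family unfolding smooth_form_family_def by blast
 hence "sat {0..1} (%t. eval_form (Y t) [s]) t x" unfolding smooth_family_iff using assms(2) by blast
 thus ?thesis by(simp add: eval_form_def[abs_def])
qed

end

sublocale hamiltonian_family \<subseteq> admissible_family C gn ga ga' L H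
 by unfold_locales (simp_all add: H_admissible H_smooth_at)

context hamiltonian_family
begin

lemma J_associated: "t : {0..1} ==> associated_gcs C L (H t) (J t)"
 using Jof_gcs[OF _ H_admissible,of t] H_ham J_section[of t] by(simp add: J_def[abs_def])

lemma associated_J: "t : {0..1} ==> associated_gcs C L (H t) j ==> v : F x ==> j x v = J t x v"
 using associated_gcs_unique[OF H_admissible] by(simp add: J_def)

definition ya :: "real => 'm => 'v" where "ya t x = fst (y1 (Y t) x)"
definition yb :: "real => 'm => 'v" where "yb t x = snd (y1 (Y t) x)"

definition ee :: "real => 'm => 'v" where "ee t x = ya t x - J t x (yb t x)"

lemma yab_section: "t : {0..1} ==> ya t : Gam" "t : {0..1} ==> yb t : Gam"
 using csectionsD(3)[OF y1_csection[OF Y_form]] by(auto simp: GC_def ya_def[abs_def] yb_def[abs_def] o_def)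

lemma ee_section: "t : {0..1} ==> ee t : Gam"
 unfolding ee_def[abs_def] by(intro sec_diff yab_section J_section)

lemma yab_sfam:
 assumes t: "t : {0..1}" shows "sfam {0..1} ya t x" "sfam {0..1} yb t x"
proof -
 have F: "y1 (Y t) x : FC x" for t x unfolding y1_def by(intro FC_sum) simp
 have "sat {0..1} (%t x. cp x (y1 (Y t) x) (a x,0)) t x" if a: "a : Gam" for a
 proof -
  have bG: "(%x. (a x,0)) : GC" using GC_I[OF a sec_zero] .
  have e: "cp x (y1 (Y t) x) (a x,0) = (SUM i<gn. Y t x [ll i x] * cp x (lb i x) (a x,0))" for t x
   unfolding y1_def using GC_FC[OF bG,of x] by(subst cp_sum(1)) auto
  show ?thesis unfolding e
   by(intro sat_sum sat_mult sat_fun cp_smooth bG Y_smooth_at[OF ll_csection t] ll_L) auto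
 qed
 from sfam_fst_snd[of "%t. y1 (Y t)",OF F this] show "sfam {0..1} ya t x" "sfam {0..1} yb t x"
  by(simp_all add: ya_def[abs_def] yb_def[abs_def])
qed

lemma J_sfam: "t : {0..1} ==> a : Gam ==> sfam {0..1} (%ta y. J ta y (a y)) t x"
 unfolding sfam_def using J_smooth by blast

lemma ee_sfam:
 assumes t: "t : {0..1}" shows "sfam {0..1} ee t x"
 unfolding sfam_def
proof
 fix a assume a: "a : Gam"
 have "sat {0..1} (%ta y. pair y (ya ta y) (a y) + pair y (yb ta y) (J ta y (a y))) t x"
  by(intro sat_add sfamD[OF yab_sfam(1)[OF t] a] sat_pair yab_sfam(2) J_sfam t a)
   (use a yab_section J(3) in auto)
 thus "sat {0..1} (%ta y. pair y (ee ta y) (a y)) t x"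
 proof(rule sat_cong'[OF _ open_UNIV UNIV_I])
  fix ta y assume "ta : {0..1::real}"
  hence "ya ta y : F y" "yb ta y : F y" "a y : F y" using yab_section a by auto
  thus "pair y (ya ta y) (a y) + pair y (yb ta y) (J ta y (a y)) = pair y (ee ta y) (a y)"
   using J(3,7)[OF \<open>ta : {0..1}\<close>,of "yb ta y" y] by(simp add: ee_def)
 qed
qed

text \<open>The right-hand side is minus the Lie derivative of J along e, paired with b. J is not
  differentiated through its definition: orthogonality within the graph at the varying time writes
  the pairing as a constant plus products of increments of H with differentiable factors, so only
  the derivative of H at t survives.\<close>

lemma J_derivative:
 assumes t: "t : {0..1}" and a: "a : Gam" and b: "b : Gam"
 shows "((%ta. pair x (J ta x (a x)) (b x)) hvd
   pair x (a x) (dorf (ee t) (%y. J t y (b y)) x) + pair x (J t x (a x)) (dorf (ee t) b x)) (at t within {0..1})"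
proof -
 \<comment> \<open>Then (c, - J c) = (c, - b), whose pairing with (a, - J a) has real part equal to
   the pairing of a and c minus that of J a and b.\<close>
 define c where "c = (%y. - J t y (b y))"
 have c: "c : Gam" unfolding c_def by(intro sec_minus J_section t b)
 define h where "h = H t"
 have hf: "h : form_sections C L 2" and hh: "hamiltonian_operator C L h" and ha: "!!x. admissible x h"
  unfolding h_def using H_form H_ham H_admissible t by auto
 have Jh: "(%x. Jof (gr h x) (a x)) : Gam" if "a : Gam" for a
  using J_section[OF t that] by(simp add: J_def h_def)
 have Ua_eq: "Ua h a = (%y. (a y,- J t y (a y)))" for a by(simp add: Ua_def J_def h_def)
 have Jc: "J t y (c y) = b y" for y
  unfolding c_def using J(3,5)[OF t,of "b y" y] J_lin(3)[OF t J(3)[OF t],of "b y" y "b y"] b by simp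
 have Uc: "Ua h c = (%y. (c y,- b y))" by(simp add: Ua_eq Jc)
 obtain s where s: "s : cS L" "Ua h c = U h s" by(rule Ua_lift[OF ha c Jh[OF c]])
 obtain sa where sa: "sa : cS L" "Ua h a = U h sa" by(rule Ua_lift[OF ha a Jh[OF a]])
 have aF: "a x : F x" "b x : F x" "c x : F x" using a b c by auto
 have JF: "J ta x (a x) : F x" if "ta : {0..1}" for ta using J(3)[OF that aF(1)] .
 have lbF: "fst (lb i x) : F x" "snd (lb i x) : F x" if "i < gn" for i
  using L_FC'(2)[OF ll_L(2)[OF that]] by(auto simp: FC_def mem_Times_iff)
 define G where "G i ta = cp x (a x,- J ta x (a x)) (lb i x)" for i ta
 define f where "f i ta = H ta x [s x,ll i x] - H t x [s x,ll i x]" for i ta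
 \<comment> \<open>\<open>u\<close> and the graph point over \<open>s x\<close> lie in the same
   graph, at time ta, so their pairing is 0; that point differs from the one over \<open>s x\<close>
   at time t by the increments \<open>f i\<close>.\<close>
 have key: "pair x (J ta x (a x)) (b x) = pair x (a x) (c x) + Re (SUM i<gn. f i ta * G i ta)" if ta: "ta : {0..1}" for ta
 proof -
  define u where "u = (a x,- J ta x (a x))"
  have u: "u : gr (H ta) x" unfolding u_def by(rule J(2)[OF ta aF(1)])
  have uF: "u : FC x" unfolding u_def FC_def using aF JF[OF ta] by simp
  have sL: "s x : L x" using csectionsD(2)[OF s(1)] .
  have "s x + Hm (H ta) x (s x) : gr (H ta) x" unfolding gr_def using sL by blast
  hence "cp x u (s x + Hm (H ta) x (s x)) = 0"
   using u gr_polar[OF H_admissible[OF ta],of x] unfolding polar_def by blast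
  moreover have "s x + Hm (H ta) x (s x) = U h s x + (SUM i<gn. cscale (f i ta) (lb i x))"
   by(simp add: U_def Pf_def Hm_def f_def h_def cscale_diff_left sum_subtractf)
  moreover have UF: "U h s x : FC x" using U_GC[OF hf s(1)] by simp
  moreover have lF: "(SUM i<gn. cscale (f i ta) (lb i x)) : FC x" by(intro FC_sum) simp
  moreover have "cp x u (SUM i<gn. cscale (f i ta) (lb i x)) = (SUM i<gn. f i ta * G i ta)"
   using uF by(subst cp_sum) (auto simp: G_def u_def)
  ultimately have "cp x u (U h s x) + (SUM i<gn. f i ta * G i ta) = 0" using uF by simp
  hence "Re (cp x u (U h s x)) + Re (SUM i<gn. f i ta * G i ta) = 0" by(metis plus_complex.sel(1) zero_complex.sel(1))
  moreover have "Re (cp x u (U h s x)) = pair x (a x) (c x) - pair x (J ta x (a x)) (b x)"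
   unfolding s(2)[symmetric] Uc u_def using aF JF[OF ta] by(simp add: cpairing_def)
  ultimately show ?thesis by simp
 qed
 define D where "D i = - cp x (cdorf (y1 (Y t)) (U h s) x) (U h (ll i) x)" for i
 have df: "(f i hvd D i) (at t within {0..1})" if "i < gn" for i
 proof -
  have "length [s,ll i] = 2 & set [s,ll i] <= cS L" using s that by simp
  hence "((%ta. eval_form (H ta) [s,ll i] x) hvd
       d_L C (Y t) [s,ll i] x + eval_form (schouten C L 2 1 (H t) (Y t)) [s,ll i] x) (at t within {0..1})"
   using evolution t by blast
  hence "((%ta. H ta x [s x,ll i x]) hvd D i) (at t within {0..1})"
   unfolding deformation_rhs[OF H_form[OF t] Y_form[OF t] s(1) ll_csection[OF that]]
   by(simp add: eval_form_def D_def h_def)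
  hence "((%ta. H ta x [s x,ll i x] - H t x [s x,ll i x]) hvd D i - 0) (at t within {0..1})"
   by(intro has_vector_derivative_diff has_vector_derivative_const)
  thus ?thesis by(simp add: f_def[abs_def])
 qed
 have dG: "EX G'. (G i hvd G') (at t within {0..1})" if "i < gn" for i
 proof -
  have lbG: "(%x. fst (lb i x)) : Gam" "(%x. snd (lb i x)) : Gam"
   using ll_L(4)[OF that] by(auto simp: GC_def o_def)
  have "EX d. ((%ta. pair x (J ta x (a x)) (g x)) hvd d) (at t within {0..1})" if "g : Gam" for g
   using sat_time_derivative[OF J_smooth[OF a that t] t] by metis
  then obtain d1 d2 where d: "((%ta. pair x (J ta x (a x)) (fst (lb i x))) hvd d1) (at t within {0..1})"
   "((%ta. pair x (J ta x (a x)) (snd (lb i x))) hvd d2) (at t within {0..1})"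
   using lbG by metis
  have e: "G i ta = of_real (pair x (a x) (fst (lb i x))) + of_real (pair x (J ta x (a x)) (snd (lb i x)))
   + \<i> * (of_real (pair x (a x) (snd (lb i x))) - of_real (pair x (J ta x (a x)) (fst (lb i x))))" if "ta : {0..1}" for ta
   using JF[OF that] aF lbF[OF \<open>i < gn\<close>] by(simp add: G_def cpairing_def complex_eq_iff)
  have "((%ta. of_real (pair x (a x) (fst (lb i x))) + of_real (pair x (J ta x (a x)) (snd (lb i x)))
   + \<i> * (of_real (pair x (a x) (snd (lb i x))) - of_real (pair x (J ta x (a x)) (fst (lb i x))))) hvd
   0 + of_real d2 + \<i> * (0 - of_real d1)) (at t within {0..1})"
   by(intro has_vector_derivative_add has_vector_derivative_const has_vector_derivative_mult_right
    has_vector_derivative_diff has_vector_derivative_of_real d[folded hrd_hvd])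
  hence "(G i hvd 0 + of_real d2 + \<i> * (0 - of_real d1)) (at t within {0..1})"
   by(rule has_vector_derivative_transform[OF t e,rotated])
  thus ?thesis ..
 qed
 \<comment> \<open>Since \<open>f i t = 0\<close>, the product rule leaves only the term with the
   derivative of \<open>f i\<close>.\<close>
 have dfG: "((%ta. f i ta * G i ta) hvd D i * G i t) (at t within {0..1})" if i: "i < gn" for i
 proof -
  obtain G' where "(G i hvd G') (at t within {0..1})" using dG[OF i] ..
  from has_vector_derivative_mult[OF df[OF i] this] show ?thesis by(simp add: f_def)
 qed
 have "((%ta. SUM i<gn. f i ta * G i ta) hvd (SUM i<gn. D i * G i t)) (at t within {0..1})"
  using dfG by(intro has_vector_derivative_sum) simp
 from has_vector_derivative_add[OF has_vector_derivative_const[of "pair x (a x) (c x)"] bounded_linear.has_vector_derivative[OF bounded_linear_Re this]]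
 have "((%ta. pair x (a x) (c x) + Re (SUM i<gn. f i ta * G i ta)) hvd Re (SUM i<gn. D i * G i t)) (at t within {0..1})"
  by simp
 from has_vector_derivative_transform[OF t key this]
 have der: "((%ta. pair x (J ta x (a x)) (b x)) hvd Re (SUM i<gn. D i * G i t)) (at t within {0..1})" .
 have saL: "sa x : L x" using csectionsD(2)[OF sa(1)] .
 have haltf: "altform x h" by(rule fs_alt[OF hf])
 have GC: "y1 (Y t) : GC" "U h s : GC" "U h sa : GC" using csectionsD(3)[OF y1_csection[OF Y_form[OF t]]] U_GC[OF hf] s sa by auto
 have Gt: "G i t = cp x (lb i x) (sa x)" if "i < gn" for i
 proof -
  have "G i t = cp x (U h sa x) (lb i x)" unfolding G_def sa(2)[symmetric] Ua_eq ..
  also have "... = cp x (sa x) (lb i x)" using saL that by(simp add: U_def Pf_def)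
  also have "... = cp x (lb i x) (sa x)" using saL that by(intro cp_sym) simp_all
  finally show ?thesis .
 qed
 have Usum: "(SUM i<gn. cscale (cp x (lb i x) (sa x)) (U h (ll i) x)) = U h sa x"
 proof -
  have "Hm h x (SUM i:I. cscale (z i) (ll i x)) = (SUM i:I. cscale (z i) (Hm h x (ll i x)))" if "I <= {..<gn}" for z I
   using finite_subset[OF that finite_lessThan] that
  proof(induction I rule: finite_induct)
   case (insert i I)
   hence "ll i x : L x" "cscale (z i) (ll i x) : L x" by auto
   moreover have "(SUM i:I. cscale (z i) (ll i x)) : L x" by(rule L_sums) (use insert in auto)
   ultimately show ?case using insert by(simp add: Hm_lin[OF haltf])
  qed (simp add: Hm_lin[OF haltf])
  from this[OF subset_refl,of "%i. cp x (lb i x) (sa x)"] show ?thesis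
   by(simp add: U_def Pf_def cscale_add_right sum.distrib L_expand[OF saL])
 qed
 have "(SUM i<gn. D i * G i t) = - cp x (cdorf (y1 (Y t)) (U h s) x) (SUM i<gn. cscale (cp x (lb i x) (sa x)) (U h (ll i) x))"
  using U_GC[OF hf ll_csection] cdorf_GC[OF GC(1,2)]
  by(subst cp_sum(2)) (auto simp: D_def Gt sum_negf mult.commute)
 also have "... = - cp x (cdorf (y1 (Y t)) (U h s) x) (Ua h a x)" unfolding Usum sa(2) ..
 finally have sumD: "(SUM i<gn. D i * G i t) = - cp x (cdorf (y1 (Y t)) (Ua h c) x) (Ua h a x)" unfolding s(2) .
 define d where "d = (%y. - J t y (yb t y))"
 have d: "d : Gam" unfolding d_def by(intro sec_minus J_section t yab_section)
 have Jd: "J t y (d y) = yb t y" for y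
  unfolding d_def using yab_section(2)[OF t] J(3,5)[OF t,of "yb t y" y] J_lin(3)[OF t J(3)[OF t],of "yb t y" y "yb t y"] by simp
 have Ud: "Ua h d : GC" unfolding Ua_eq by(intro GC_I d sec_minus J_section t)
 have Uc': "Ua h c : GC" "Ua h a : GC" unfolding Ua_eq by(intro GC_I c a sec_minus J_section t)+
 \<comment> \<open>The real section e equals y plus a graph section, so by involutivity it may
   replace y.\<close>
 have e: "(%y. (ee t y,0)) = (%y. y1 (Y t) y + Ua h d y)"
  unfolding Ua_eq Jd by(rule ext) (simp add: ee_def ya_def yb_def d_def prod_eq_iff)
 have "cp x (cdorf (%y. (ee t y,0)) (Ua h c) x) (Ua h a x) = cp x (cdorf (y1 (Y t)) (Ua h c) x) (Ua h a x) + cp x (cdorf (Ua h d) (Ua h c) x) (Ua h a x)"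
  unfolding e using cp_cdorf_add(2)[OF Uc'(1) GC(1) Ud,of "Ua h a x" x] Uc' by simp
 also have "cp x (cdorf (Ua h d) (Ua h c) x) (Ua h a x) = 0" by(rule Ua_involutive[OF hh ha Jh d c a])
 finally have "Re (SUM i<gn. D i * G i t) = - Re (cp x (cdorf (%y. (ee t y,0)) (Ua h c) x) (Ua h a x))"
  unfolding sumD by simp
 also have "... = pair x (a x) (dorf (ee t) (%y. J t y (b y)) x) + pair x (J t x (a x)) (dorf (ee t) b x)"
 proof -
  have eG: "ee t : Gam" by(rule ee_section[OF t])
  have Jb: "(%y. J t y (b y)) : Gam" by(rule J_section[OF t b])
  have "cdorf (%y. (ee t y,0)) (Ua h c) x = (- dorf (ee t) (%y. J t y (b y)) x,- dorf (ee t) b x)"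
   unfolding Uc cdorf_eq using eG b c Jb sec_minus[OF b]
   by(simp add: c_def dorf_lin_right(3)[OF eG b b] dorf_lin_right(3)[OF eG Jb Jb])
  thus ?thesis unfolding Ua_eq using aF JF[OF t] dorf_section[OF eG b] dorf_section[OF eG Jb]
   by(simp add: cpairing_def pair_sym[of _ x])
 qed
 finally show ?thesis using der by simp
qed

end

section \<open>Flows of families of sections\<close>

text \<open>The ODE results need right-hand sides on the whole space with global bounds. After a
  cutoff the derivative is continuous and vanishes off a ball, hence it is bounded.\<close>

lemma smooth_extension:
 fixes G :: "'a::{real_inner,heine_borel} => real"
 assumes fd: "finite_dim TYPE('a)" and N: "open N" "z0 : N" and G: "son N G"
 obtains r G' K where "r > 0" "son UNIV G'" "K >= 0" "!!z. dist z0 z <= r ==> z : N & G' z = G z"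
  "!!z. \<bar>G' z\<bar> <= K" "!!z z'. \<bar>G' z - G' z'\<bar> <= K * norm (z - z')"
proof -
 obtain r0 where r0: "r0 > 0" "cball z0 r0 <= N" using N open_contains_cball by blast
 define r where "r = r0 / 3"
 have r: "r > 0" "cball z0 (3 * r) <= N" using r0 by(simp_all add: r_def)
 obtain be :: "'a => real" where be: "son UNIV be" "!!y. dist z0 y <= r ==> be y = 1" "!!y. dist z0 y >= 2 * r ==> be y = 0"
  using smooth_bump[OF r(1)] by metis
 define G' where "G' z = be z * (if z : N then G z else 0)" for z
 have out: "G' z = 0" if "dist z0 z >= 2 * r" for z using be(3)[OF that] by(simp add: G'_def)
 have oc: "open {z. dist z0 z > 2 * r}" by(intro open_Collect_less continuous_intros)
 have sm: "son UNIV G'"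
 proof(rule son_local[OF open_UNIV])
  fix z
  show "EX M. open M & z : M & son M G'"
  proof(cases "dist z0 z < 3 * r")
   case True
   have "son (ball z0 (3 * r)) (%z. be z * G z)"
    by(rule son_mult[OF son_subset[OF be(1)] son_subset[OF G]]) (use r in "auto simp: subset_eq")
   moreover have "z : N" if "z : ball z0 (3 * r)" for z using that r(2) by(auto simp: subset_eq)
   ultimately have "son (ball z0 (3 * r)) G'"
    by(intro son_cong[OF open_ball,of _ _ "%z. be z * G z" G']) (auto simp: G'_def)
   thus ?thesis using True by(intro exI[of _ "ball z0 (3 * r)"]) auto
  next
   case False
   have "son {z. dist z0 z > 2 * r} G'"
    by(rule son_cong[OF oc _ son_const[of _ 0]]) (use out in auto)
   thus ?thesis using oc False r(1) by(intro exI[of _ "{z. dist z0 z > 2 * r}"]) auto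
  qed
 qed
 obtain D where D: "!!x. (G' hfd D x) (at x)" "!!v. son UNIV (%x. D x v)"
  using son_derivative[OF sm open_UNIV] by auto
 have comp: "compact (cball z0 (2 * r))" by(rule compact_cball)
 have bnd: "EX k>=0. ALL z. \<bar>g z\<bar> <= k" if "con UNIV g" "!!z. dist z0 z > 2 * r ==> g z = 0" for g :: "'a => real"
 proof -
  have "compact (g ` cball z0 (2 * r))"
   by(rule compact_continuous_image[OF continuous_on_subset[OF that(1)] comp]) simp
  hence "bounded (g ` cball z0 (2 * r))" by(rule compact_imp_bounded)
  then obtain k where k: "k > 0" "!!z. z : cball z0 (2 * r) ==> norm (g z) <= k" unfolding bounded_pos by blast
  have "\<bar>g z\<bar> <= k" for z
   by(cases "dist z0 z <= 2 * r") (use k that(2)[of z] in auto)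
  thus ?thesis using k(1) by(intro exI[of _ k]) auto
 qed
 obtain B :: "'a set" where B: "onb B" using onb_exists[OF fd] .
 have D0: "D z b = 0" if "dist z0 z > 2 * r" for z b
 proof -
  have "(G' hfd (%_. 0)) (at z)"
   by(rule has_derivative_transform_within_open[OF has_derivative_const oc]) (use that out in auto)
  hence "D z = (%_. 0)" using has_derivative_unique[OF D(1)] by blast
  thus ?thesis by simp
 qed
 have "ALL b. EX k>=0. ALL z. \<bar>D z b\<bar> <= k"
  using bnd[OF son_continuous[OF D(2)]] D0 by blast
 then obtain k where k: "!!b. k b >= 0" "!!b z. \<bar>D z b\<bar> <= k b" by metis
 obtain k0 where k0: "k0 >= 0" "!!z. \<bar>G' z\<bar> <= k0" using bnd[OF son_continuous[OF sm]] out by(metis less_imp_le)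
 define K where "K = k0 + (SUM b:B. k b)"
 have K0: "K >= 0" "(SUM b:B. k b) <= K" "k0 <= K" using k0 k(1) by(auto simp: K_def sum_nonneg)
 have on: "onorm (D z) <= K" for z
 proof(rule onorm_bound[OF K0(1)])
  fix v
  have "D z v = (SUM b:B. (v *. b) *R D z b)"
   by(rule linear_onb_expand[OF B has_derivative_linear[OF D(1)]])
  hence "norm (D z v) <= (SUM b:B. norm ((v *. b) *R D z b))" by(simp only: norm_sum)
  also have "... <= (SUM b:B. norm v * k b)"
  proof(rule sum_mono)
   fix b assume b: "b : B"
   have "\<bar>v *. b\<bar> <= norm v" using Cauchy_Schwarz_ineq2[of v b] onb_norm_le[OF B b] by simp
   thus "norm ((v *. b) *R D z b) <= norm v * k b" using k(2)[of z b]
    by(simp add: abs_mult mult_mono)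
  qed
  also have "... <= K * norm v" using K0(2) by(simp add: sum_distrib_left[symmetric] mult.commute[of K] mult_left_mono)
  finally show "norm (D z v) <= K * norm v" .
 qed
 show ?thesis
 proof(rule that[OF r(1) sm K0(1)])
  show "z : N & G' z = G z" if "dist z0 z <= r" for z
  proof -
   have "z : cball z0 (3 * r)" using that r(1) by simp
   thus ?thesis using be(2)[OF that] r(2) by(auto simp: G'_def)
  qed
  show "\<bar>G' z\<bar> <= K" for z using k0(2)[of z] K0(3) by linarith
  show "\<bar>G' z - G' z'\<bar> <= K * norm (z - z')" for z z'
   using differentiable_bound[of UNIV G' D K z z'] D(1) on by simp
 qed
qed

lemma real_derivative_cong:
 fixes f :: "real => real"
 assumes "(f hrd D) (at t within S)" "t : S" "!!ta. ta : S ==> g ta = f ta" "D = D'"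
 shows "(g hrd D') (at t within S)"
 using has_vector_derivative_transform[of t S g f D] assms
 unfolding hrd_hvd by simp

context framed_courant
begin

lemma section_expand: "a : Gam ==> (%x. SUM i<gn. pair x (a x) (ga i x) *R ga' i x) = a"
proof
 fix x assume a: "a : Gam"
 have "(SUM i<gn. pair x (a x) (ga i x) *R ga' i x) = (SUM i<gn. pair x (ga i x) (a x) *R ga' i x)"
  using pair_sym[OF sectionsD[OF a]] ga by(intro sum.cong) auto
 thus "(SUM i<gn. pair x (a x) (ga i x) *R ga' i x) = a x" using frame'[OF sectionsD[OF a]] by simp
qed

lemma dorf_expand_right:
 assumes u: "u : Gam" and w: "w : Gam"
 shows "dorf u w x = (SUM i<gn. pair x (w x) (ga i x) *R dorf u (ga' i) x + rho u (%y. pair y (w y) (ga i y)) x *R ga' i x)"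
proof -
 have "dorf u w x = dorf u (%y. SUM i<gn. pair y (w y) (ga i y) *R ga' i y) x" by(simp only: section_expand[OF w])
 also have "... = (SUM i<gn. dorf u (%y. pair y (w y) (ga i y) *R ga' i y) x)"
  by(rule dorf_sum_right[OF u]) (use ga w in "auto intro!: sec_scale pair_smooth")
 also have "... = (SUM i<gn. pair x (w x) (ga i x) *R dorf u (ga' i) x + rho u (%y. pair y (w y) (ga i y)) x *R ga' i x)"
  using dorf_fun_right[OF u ga(2) pair_smooth[OF w ga(1)]] by(intro sum.cong) auto
 finally show ?thesis .
qed

text \<open>All dependence on u and w is put into pairings with fixed sections and anchor
  derivatives of such pairings, so smoothness and time derivatives of the bracket of two families
  reduce to those of functions.\<close>

lemma dorf_expand:
 assumes u: "u : Gam" and w: "w : Gam" and c: "c : Gam"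
 shows "pair x (dorf u w x) (c x) = (SUM i<gn. pair x (w x) (ga i x) *
    (rho c (%y. pair y (u y) (ga' i y)) x - rho (ga' i) (%y. pair y (u y) (c y)) x + pair x (u x) (dorf (ga' i) c x))
   + (SUM j<gn. pair x (u x) (ga j x) * rho (ga' j) (%y. pair y (w y) (ga i y)) x) * pair x (ga' i x) (c x))"
proof -
 have 1: "pair x (dorf u a x) (c x) = rho c (%y. pair y (u y) (a y)) x - rho a (%y. pair y (u y) (c y)) x
   + pair x (u x) (dorf a c x)" if a: "a : Gam" for a
  unfolding dorf_skew[OF a u] using dorf_metric[OF a u c,of x] Dd_pair(1)[OF pair_smooth[OF a u] sectionsD[OF c],of x]
   pair_sym_fun[OF a u] a u c by(simp add: pair_smooth rho_def)
 have 2: "rho u f x = (SUM j<gn. pair x (u x) (ga j x) * rho (ga' j) f x)" if f: "sfun f" for f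
  unfolding rho_def using anchor_sum[OF _ f,of "{..<gn}" "%j. ga' j x" x "%j. pair x (u x) (ga j x)"] ga
   fun_cong[OF section_expand[OF u],of x] by simp
 show ?thesis
  unfolding dorf_expand_right[OF u w] using u c ga
  by(subst pair_sum) (auto intro!: sum.cong simp: 1 2[OF pair_smooth[OF w ga(1)]])
qed

lemma dorf_smooth_at:
 assumes u: "!!ta. ta : T ==> u ta : Gam" and w: "!!ta. ta : T ==> w ta : Gam" and c: "c : Gam"
  and su: "sfam T u t x" and sw: "sfam T w t x"
 shows "sat T (%ta y. pair y (dorf (u ta) (w ta) y) (c y)) t x"
proof -
 have R: "sat T (%ta y. rho a (%z. pair z (v ta z) (b z)) y) t x"
  if "a : Gam" "b : Gam" "!!ta. ta : T ==> v ta : Gam" "sfam T v t x" for a b v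
  unfolding rho_def
  by(rule sat_tangent[where X = "%y. an y (a y)", OF _ _ _ sfamD[OF that(4,2)]])
   (use that rho_smooth[OF that(1)] in "auto simp: rho_def anchor_tangent intro!: pair_smooth")
 have "sat T (%ta x. SUM i<gn. pair x (w ta x) (ga i x) *
    (rho c (%y. pair y (u ta y) (ga' i y)) x - rho (ga' i) (%y. pair y (u ta y) (c y)) x + pair x (u ta x) (dorf (ga' i) c x))
   + (SUM j<gn. pair x (u ta x) (ga j x) * rho (ga' j) (%y. pair y (w ta y) (ga i y)) x) * pair x (ga' i x) (c x)) t x"
  by(intro sat_sum sat_add sat_diff sat_mult R sfamD[OF su] sfamD[OF sw]
    sat_pair_fixed dorf_section u w c su sw ga) simp_all
 thus ?thesis
  by(rule sat_cong'[OF _ open_UNIV UNIV_I]) (simp add: dorf_expand[OF u w c])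
qed

lemma dorf_time_derivative:
 assumes t: "t : T" "t islimpt T"
  and u: "!!ta. ta : T ==> u ta : Gam" and w: "!!ta. ta : T ==> w ta : Gam"
  and su: "sfam T u t x" and sw: "sfam T w t x"
  and ud: "ud : Gam" and wd: "wd : Gam" and c: "c : Gam"
  and du: "!!a y. a : Gam ==> ((%ta. pair y (u ta y) (a y)) hrd pair y (ud y) (a y)) (at t within T)"
  and dw: "!!a y. a : Gam ==> ((%ta. pair y (w ta y) (a y)) hrd pair y (wd y) (a y)) (at t within T)"
 shows "((%ta. pair x (dorf (u ta) (w ta) x) (c x)) hrd
  pair x (dorf ud (w t) x) (c x) + pair x (dorf (u t) wd x) (c x)) (at t within T)"
proof -
 have dr: "((%ta. rho b (%y. pair y (z ta y) (a y)) x) hrd rho b (%y. pair y (zd y) (a y)) x) (at t within T)"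
  if z: "!!ta. ta : T ==> z ta : Gam" and sz: "sfam T z t x" and zd: "zd : Gam"
  and dz: "!!a y. a : Gam ==> ((%ta. pair y (z ta y) (a y)) hrd pair y (zd y) (a y)) (at t within T)"
  and a: "a : Gam" and b: "b : Gam" for z zd a b
  unfolding rho_def hrd_hvd
  by(rule tangent_time_derivative[OF anchor_tangent[OF sectionsD[OF b]] pair_smooth[OF z a] sfamD[OF sz a] t])
   (use dz[OF a] pair_smooth[OF zd a] in "auto simp: hrd_hvd")
 have dru: "((%ta. rho b (%y. pair y (u ta y) (a y)) x) hrd rho b (%y. pair y (ud y) (a y)) x) (at t within T)"
  if "a : Gam" "b : Gam" for a b
  by(rule dr[of u ud]) (fact u su ud du that)+
 have drw: "((%ta. rho b (%y. pair y (w ta y) (a y)) x) hrd rho b (%y. pair y (wd y) (a y)) x) (at t within T)"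
  if "a : Gam" "b : Gam" for a b
  by(rule dr[of w wd]) (fact w sw wd dw that)+
 let ?f = "%u w i. pair x (w x) (ga i x) * (rho c (%y. pair y (u y) (ga' i y)) x - rho (ga' i) (%y. pair y (u y) (c y)) x
    + pair x (u x) (dorf (ga' i) c x)) + (SUM j<gn. pair x (u x) (ga j x) * rho (ga' j) (%y. pair y (w y) (ga i y)) x) * pair x (ga' i x) (c x)"
 have "((%ta. SUM i<gn. ?f (u ta) (w ta) i) hrd (SUM i<gn. ?f ud (w t) i + ?f (u t) wd i)) (at t within T)"
 proof(rule DERIV_sum)
  fix i assume "i : {..<gn}"
  hence i: "i < gn" by simp
  show "((%ta. ?f (u ta) (w ta) i) hrd ?f ud (w t) i + ?f (u t) wd i) (at t within T)"
   by(rule DERIV_cong,(rule DERIV_add DERIV_diff DERIV_mult DERIV_sum dw du dru drw DERIV_const dorf_section ga c i | simp; fail)+)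
    (simp add: sum.distrib sum_distrib_right algebra_simps)
 qed
 thus ?thesis
  by(rule real_derivative_cong[OF _ t(1)])
   (simp_all add: dorf_expand[OF u w c] dorf_expand[OF ud w[OF t(1)] c] dorf_expand[OF u[OF t(1)] wd c] sum.distrib[symmetric])
qed

end

section \<open>Integral curves of a time-dependent section\<close>

locale section_flow = framed_courant C gn ga ga'
 for C :: "('m::{t2_space,second_countable_topology},'e::{real_inner,banach,heine_borel},'v::real_vector,
  'f::{real_inner,banach,heine_borel}) courant" and gn ga ga' +
 fixes e :: "real => 'm => 'v"
 assumes e_section [simp]: "!!t. t : {0..1} ==> e t : sections C"
  and e_sfam: "!!t x. t : {0..1} ==> sfam {0..1} e t x"
begin

lemma rho_e_smooth:
 assumes f: "sfun f" and t: "t : {0..1}"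
 shows "sat {0..1} (%ta y. rho (e ta) f y) t x"
proof -
 have "sat {0..1} (%ta y. 2 * pair y (e ta y) (Dd f y)) t x"
  by(intro sat_mult sat_const sfamD[OF e_sfam[OF t]] Dd_section f)
 thus ?thesis
  by(rule sat_cong'[OF _ open_UNIV UNIV_I]) (simp add: Dd_pair(2)[OF f] rho_def)
qed

lemma dorf_e_smooth:
 assumes a: "a : Gam" and b: "b : Gam" and t: "t : {0..1}"
 shows "sat {0..1} (%ta y. pair y (dorf (e ta) a y) (b y)) t x"
 by(rule dorf_smooth_at[OF _ _ b e_sfam[OF t] sfam_fixed[OF a]]) (simp_all add: a)

lemma icurve_const_on:
 assumes "is_interval S" "s : S" "t : S"
  "!!ta. ta : S ==> (f hrd 0) (at ta within S)"
 shows "f s = (f t :: real)"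
 using has_field_derivative_zero_constant[of S f] assms unfolding is_interval_convex_1 by metis

text \<open>A curve in M with a vector over it, both moved by e and tested against functions and
  sections. The clause for w says that w is dragged along by the derivation
  \<open>dorf (e t)\<close>. Derivatives are taken within S, so that the end points of [0,1] are
  included.\<close>

definition icurve :: "real set => (real => 'm) => (real => 'v) => bool" where
 "icurve S gm w <-> S <= {0..1} & con S gm & (ALL t:S. w t : F (gm t) &
   (ALL f. sfun f --> ((%ta. f (gm ta)) hrd rho (e t) f (gm t)) (at t within S)) &
   (ALL a:Gam. ((%ta. pair (gm ta) (a (gm ta)) (w ta)) hrd
    pair (gm t) (dorf (e t) a (gm t)) (w t)) (at t within S)))"

lemma icurveD:
 assumes "icurve S gm w"
 shows "S <= {0..1}" "con S gm" "t : S ==> w t : F (gm t)"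
  "t : S ==> sfun f ==> ((%ta. f (gm ta)) hrd rho (e t) f (gm t)) (at t within S)"
  "t : S ==> a : Gam ==> ((%ta. pair (gm ta) (a (gm ta)) (w ta)) hrd
    pair (gm t) (dorf (e t) a (gm t)) (w t)) (at t within S)"
 using assms unfolding icurve_def by blast+

lemma icurve_subset:
 assumes "icurve S gm w" "S' <= S" shows "icurve S' gm w"
 unfolding icurve_def
proof(intro conjI ballI allI impI)
 note I = icurveD[OF assms(1)]
 show "S' <= {0..1}" "con S' gm" using I(1,2) assms(2) continuous_on_subset by blast+
 fix t assume t: "t : S'"
 hence tS: "t : S" using assms(2) by blast
 show "w t : F (gm t)" by(rule I(3)[OF tS])
 show "((%ta. f (gm ta)) hrd rho (e t) f (gm t)) (at t within S')" if "sfun f" for f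
  by(rule DERIV_subset[OF I(4)[OF tS that] assms(2)])
 show "((%ta. pair (gm ta) (a (gm ta)) (w ta)) hrd pair (gm t) (dorf (e t) a (gm t)) (w t)) (at t within S')"
  if "a : Gam" for a
  by(rule DERIV_subset[OF I(5)[OF tS that] assms(2)])
qed

text \<open>Local coefficients of the two ODEs near time s0: G is the velocity of the base point in
  the chart, \<open>Gy\<close> the matrix of \<open>dorf (e t)\<close> in the frame
  \<open>al\<close>, both extended to the whole model space with global bounds.\<close>

definition local_model where
 "local_model s0 r U c V B ey G D al al' Gy K <-> (U,c) : charts C & onb (B::'e set) & onb (D::'f set) &
   open V & V <= U & (r::real) > 0 & (K::real) >= 0 &
   (ALL b. sfun (ey b) & (ALL x:V. ey b x = c x *. b)) &
   son UNIV (G :: real * 'e => 'e) & (ALL t y y'. norm (G (t,y) - G (t,y')) <= K * norm (y - y')) &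
   (ALL b:D. ALL d:D. son UNIV (Gy b d :: real * 'e => real) & (ALL z. \<bar>Gy b d z\<bar> <= K)) &
   dual_frame D V al al' &
   (ALL t:{0..1}. \<bar>t - s0\<bar> < r --> (ALL x:V. (ALL b:B. rho (e t) (ey b) x = G (t,c x) *. b) &
    (ALL b:D. ALL d:D. pair x (dorf (e t) (al b) x) (al' d x) = Gy b d (t,c x))))"

lemma extend_at:
 assumes g: "sat T g s0 p" and U: "(U,c) : charts C" "p : U"
 obtains r G K where "r > 0" "son UNIV (G :: real * 'e => real)" "K >= 0" "!!z. \<bar>G z\<bar> <= K" "!!z z'. \<bar>G z - G z'\<bar> <= K * norm (z - z')"
  "!!t x. t : T ==> x : U ==> \<bar>t - s0\<bar> < r ==> dist (c p) (c x) < r ==> g t x = G (t,c x)"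
proof -
 obtain N G0 where N: "open N" "(s0,c p) : N" "N <= UNIV >< c ` U" "son N G0"
  "!!ta y. (ta,y) : N ==> ta : T ==> G0 (ta,y) = g ta (iv U c y)"
  using sat_chartE[OF g U] by metis
 obtain r G K where G: "r > 0" "son UNIV G" "K >= 0" "!!z. dist (s0,c p) z <= r ==> z : N & G z = G0 z"
  "!!z. \<bar>G z\<bar> <= K" "!!z z'. \<bar>G z - G z'\<bar> <= K * norm (z - z')"
  using smooth_extension[OF fdRE N(1,2,4)] by metis
 show ?thesis
 proof(rule that[OF _ G(2,3,5,6)])
  \<comment> \<open>Half, because the distance in the product is bounded by the sum of the two
    distances.\<close>
  show "r / 2 > 0" using G(1) by simp
  fix t x assume a: "t : T" "x : U" "\<bar>t - s0\<bar> < r / 2" "dist (c p) (c x) < r / 2"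
  have "dist (s0,c p) (t,c x) <= dist s0 t + dist (c p) (c x)"
   by(simp add: dist_Pair_Pair sqrt_sum_squares_le_sum)
  also have "... <= r" using a(3,4) by(simp add: dist_real_def abs_minus_commute)
  finally have "(t,c x) : N" "G (t,c x) = G0 (t,c x)" using G(4) by auto
  thus "g t x = G (t,c x)" using N(5)[of t "c x"] a(1) chart(5)[OF U(1) a(2)] by simp
 qed
qed

lemma local_model_exists:
 assumes s0: "s0 : {0..1}"
 shows "EX r U c V B ey G D al al' Gy K. p : V & local_model s0 r U c V B ey G D al al' Gy K"
proof -
 obtain U c where U: "(U,c) : charts C" "p : U" using ex_chart by blast
 obtain V1 ey where V1: "open V1" "p : V1" "V1 <= U" "!!b::'e. sfun (ey b)" "!!b x. x : V1 ==> ey b x = c x *. b"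
  using coordinate_functions[OF U] by blast
 obtain B :: "'e set" where B: "onb B" using onb_exists[OF fdE] .
 obtain D :: "'f set" where D: "onb D" using onb_exists[OF fdF] .
 obtain V2 al al' where V2: "open V2" "p : V2" "dual_frame D V2 al al'" using local_frame[OF D,of p] by blast
 note al = dual_frameD[OF V2(3)]
 have "EX r (G :: real * 'e => real) K. r > 0 & son UNIV G & K >= 0 & (ALL z z'. \<bar>G z - G z'\<bar> <= K * norm (z - z')) &
  (ALL t x. t : {0..1} --> x : U --> \<bar>t - s0\<bar> < r --> dist (c p) (c x) < r --> rho (e t) (ey b) x = G (t,c x))" for b
  using extend_at[OF rho_e_smooth[OF V1(4) s0] U] by(metis (no_types,lifting))
 then obtain r1 K1 and G1 :: "'e => real * 'e => real" where G1: "!!b. r1 b > 0" "!!b. son UNIV (G1 b)" "!!b. K1 b >= 0"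
  "!!b z z'. \<bar>G1 b z - G1 b z'\<bar> <= K1 b * norm (z - z')"
  "!!b t x. t : {0..1} ==> x : U ==> \<bar>t - s0\<bar> < r1 b ==> dist (c p) (c x) < r1 b ==> rho (e t) (ey b) x = G1 b (t,c x)"
  by(metis (no_types,lifting))
 have "EX r (G :: real * 'e => real) K. r > 0 & son UNIV G & K >= 0 & (ALL z. \<bar>G z\<bar> <= K) &
  (ALL t x. t : {0..1} --> x : U --> \<bar>t - s0\<bar> < r --> dist (c p) (c x) < r --> pair x (dorf (e t) (al b) x) (al' d x) = G (t,c x))" for b d
  using extend_at[OF dorf_e_smooth[OF al(1,2) s0] U] by(metis (no_types,lifting))
 then obtain r2 K2 and Gy :: "'f => 'f => real * 'e => real" where G2: "!!b d. r2 b d > 0" "!!b d. son UNIV (Gy b d)" "!!b d. K2 b d >= 0"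
  "!!b d z. \<bar>Gy b d z\<bar> <= K2 b d"
  "!!b d t x. t : {0..1} ==> x : U ==> \<bar>t - s0\<bar> < r2 b d ==> dist (c p) (c x) < r2 b d ==> pair x (dorf (e t) (al b) x) (al' d x) = Gy b d (t,c x)"
  by(metis (no_types,lifting))
 define R where "R = insert 1 (r1 ` B Un (%(b,d). r2 b d) ` (D >< D))"
 have R: "finite R" "R ~= {}" "!!r. r : R ==> r > 0" using onbD(1)[OF B] onbD(1)[OF D] G1(1) G2(1) by(auto simp: R_def)
 define r where "r = Min R"
 have r: "r > 0" unfolding r_def using Min_in[OF R(1,2)] R(3) by blast
 have rle: "r <= r1 b" if "b : B" for b unfolding r_def by(rule Min_le[OF R(1)]) (use that in "auto simp: R_def")
 have rle2: "r <= r2 b d" if "b : D" "d : D" for b d unfolding r_def by(rule Min_le[OF R(1)]) (use that in "auto simp: R_def")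
 define K where "K = (SUM b:B. K1 b) + (SUM b:D. SUM d:D. K2 b d)"
 have Ks: "(SUM b:B. K1 b) >= 0" "(SUM b:D. SUM d:D. K2 b d) >= 0" using G1(3) G2(3) by(auto intro!: sum_nonneg)
 have K0: "K >= 0" using Ks by(simp add: K_def)
 have K2: "K2 b d <= K" if "b : D" "d : D" for b d
 proof -
  have "K2 b d <= (SUM d:D. K2 b d)" by(rule member_le_sum) (use that G2(3) onbD(1)[OF D] in auto)
  also have "... <= (SUM b:D. SUM d:D. K2 b d)" by(rule member_le_sum) (use that G2(3) onbD(1)[OF D] in "auto intro!: sum_nonneg")
  finally show ?thesis using Ks by(simp add: K_def)
 qed
 define G where "G = (%z. SUM b:B. G1 b z *R b)"
 have sG: "son UNIV G" unfolding G_def by(intro son_sum son_scaleR G1 son_const)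
 have Gb: "G z *. b = G1 b z" if "b : B" for b z
 proof -
  have "G z *. b = (SUM b':B. G1 b' z * (b' *. b))" by(simp add: G_def inner_sum_left)
  also have "... = (SUM b':B. if b' = b then G1 b z else 0)" using onbD(2)[OF B _ that] by(intro sum.cong) auto
  finally show ?thesis using onbD(1)[OF B] that by simp
 qed
 have LG: "norm (G (t,y) - G (t,y')) <= K * norm (y - y')" for t y y'
 proof -
  have "G (t,y) - G (t,y') = (SUM b:B. (G1 b (t,y) - G1 b (t,y')) *R b)"
   by(simp add: G_def sum_subtractf scaleR_diff_left)
  also have "norm ... <= (SUM b:B. norm ((G1 b (t,y) - G1 b (t,y')) *R b))" by(rule norm_sum)
  also have "... <= (SUM b:B. K1 b * norm (y - y'))"
  proof(rule sum_mono)
   fix b assume b: "b : B"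
   show "norm ((G1 b (t,y) - G1 b (t,y')) *R b) <= K1 b * norm (y - y')"
    using G1(4)[of b "(t,y)" "(t,y')"] onb_norm_le[OF B b] by(simp add: norm_Pair)
  qed
  also have "... <= K * norm (y - y')" using Ks by(simp add: K_def sum_distrib_right[symmetric] mult_right_mono)
  finally show ?thesis .
 qed
 define V where "V = V1 Int V2 Int {x : U. c x : ball (c p) r}"
 have V: "open V" "p : V" "V <= U" "V <= V1" "V <= V2"
  using V1 V2 U r chart_preimage_open[OF U(1) open_ball] by(auto simp: V_def)
 have dF: "dual_frame D V al al'" using V2(3) V(5) unfolding dual_frame_def by blast
 have "local_model s0 r U c V B ey G D al al' Gy K"
  unfolding local_model_def
 proof(intro conjI allI ballI impI)
  show "onb B" "onb D" "open V" "V <= U" "dual_frame D V al al'" by fact+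
  show "\<bar>Gy b d z\<bar> <= K" if "b : D" "d : D" for b d z using G2(4)[of b d z] K2[OF that] by linarith
  show "ey b x = c x *. b" if "x : V" for b x using V1(5) V(4) that by blast
  fix t x assume t: "t : {0..1}" "\<bar>t - s0\<bar> < r" "x : V"
  hence x: "x : U" "dist (c p) (c x) < r" by(auto simp: V_def)
  show "rho (e t) (ey b) x = G (t,c x) *. b" if "b : B" for b
   unfolding Gb[OF that] by(rule G1(5)[OF t(1) x(1)]) (use t x rle[OF that] in auto)
  show "pair x (dorf (e t) (al b) x) (al' d x) = Gy b d (t,c x)" if "b : D" "d : D" for b d
   by(rule G2(5)[OF t(1) x(1)]) (use t x rle2[OF that] in auto)
 qed (use U r K0 V1(4) sG LG G2(2) in auto)
 thus ?thesis using V(2) by(intro exI conjI) assumption+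
qed

end

context section_flow
begin

lemma local_modelD:
 assumes "local_model s0 r U c V B ey G D al al' Gy K"
 shows "(U,c) : charts C" "onb B" "onb D" "open V" "V <= U" "r > 0" "K >= 0"
  "sfun (ey b)" "x : V ==> ey b x = c x *. b" "son UNIV G"
  "norm (G (t,y) - G (t,y')) <= K * norm (y - y')"
  "b1 : D ==> d : D ==> son UNIV (Gy b1 d)" "b1 : D ==> d : D ==> \<bar>Gy b1 d z\<bar> <= K"
  "dual_frame D V al al'"
  "t : {0..1} ==> \<bar>t - s0\<bar> < r ==> x : V ==> b : B ==> rho (e t) (ey b) x = G (t,c x) *. b"
  "t : {0..1} ==> \<bar>t - s0\<bar> < r ==> x : V ==> b1 : D ==> d : D ==>
    pair x (dorf (e t) (al b1) x) (al' d x) = Gy b1 d (t,c x)"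
 using assms unfolding local_model_def by(simp_all del: split_paired_All)

lemma icurve_base_ode:
 assumes L: "local_model s0 r U c V B ey G D al al' Gy K" and I: "icurve S gm w"
  and S: "!!t. t : S ==> \<bar>t - s0\<bar> < r & gm t : V" and t: "t : S"
 shows "((%ta. c (gm ta)) hvd G (t,c (gm t))) (at t within S)"
proof -
 note L = local_modelD[OF L]
 have t01: "t : {0..1}" using icurveD(1)[OF I] t by blast
 have "((%ta. SUM b:B. ey b (gm ta) *R b) hvd (SUM b:B. rho (e t) (ey b) (gm t) *R b)) (at t within S)"
 proof(rule has_vector_derivative_sum)
  fix b
  have "((%ta. ey b (gm ta)) hrd rho (e t) (ey b) (gm t)) (at t within S)"
   by(rule icurveD(4)[OF I t L(8)])
  from has_vector_derivative_scaleR[OF this has_vector_derivative_const]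
  show "((%ta. ey b (gm ta) *R b) hvd rho (e t) (ey b) (gm t) *R b) (at t within S)" by simp
 qed
 moreover have "(SUM b:B. rho (e t) (ey b) (gm t) *R b) = G (t,c (gm t))"
  using L(15)[OF t01] S[OF t] onbD(3)[OF L(2)] by(simp cong: sum.cong)
 moreover have "(SUM b:B. ey b (gm ta) *R b) = c (gm ta)" if "ta : S" for ta
  using L(9) S[OF that] onbD(3)[OF L(2)] by simp
 ultimately show ?thesis by(metis (no_types,lifting) has_vector_derivative_transform t)
qed

text \<open>The times at which the base curves agree form a set that is closed by the Hausdorff
  property and open by uniqueness for the ODE of a local model.\<close>

lemma icurve_unique_base:
 assumes S: "is_interval S" "s : S" "t : S" and I: "icurve S gm w" "icurve S gm' w'" and eq: "gm s = gm' s"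
 shows "gm t = gm' t"
proof -
 have con: "connected S" using S(1) is_interval_connected by blast
 have "eventually (%b. (gm a = gm' a) = (gm b = gm' b)) (at a within S)" if a: "a : S" for a
 proof(cases "gm a = gm' a")
  case False
  obtain O1 O2 where O: "open O1" "open O2" "gm a : O1" "gm' a : O2" "O1 Int O2 = {}"
   using hausdorff[OF False] by blast
  have "eventually (%b. gm b : O1) (at a within S)" "eventually (%b. gm' b : O2) (at a within S)"
   using icurveD(2)[OF I(1)] icurveD(2)[OF I(2)] a O unfolding continuous_on_def by(blast intro: topological_tendstoD)+
  thus ?thesis
   by(rule eventually_elim2) (use False O(5) in auto)
 next
  case True
  have a01: "a : {0..1}" using icurveD(1)[OF I(1)] a by blast
  obtain r U c V B ey G D al al' Gy K where V: "gm a : V" and L: "local_model a r U c V B ey G D al al' Gy K"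
   using local_model_exists[OF a01,of "gm a"] by(elim exE conjE)
  note L' = local_modelD[OF L]
  have "eventually (%b. gm b : V) (at a within S)" "eventually (%b. gm' b : V) (at a within S)"
   using icurveD(2)[OF I(1)] icurveD(2)[OF I(2)] a L'(4) V True unfolding continuous_on_def by(auto intro: topological_tendstoD)
  hence "eventually (%b. gm b : V & gm' b : V) (at a within S)" by(rule eventually_conj)
  then obtain d where d: "d > 0" "!!b. b : S ==> b ~= a ==> dist b a < d ==> gm b : V & gm' b : V"
   unfolding eventually_at by blast
  define ep where "ep = min d r"
  define S' where "S' = S Int ball a ep"
  have ep: "ep > 0" using d L'(6) by(simp add: ep_def)
  have S': "is_interval S'" "S' <= S" "a : S'"
   using S(1) a ep by(auto simp: S'_def is_interval_convex_1 convex_Int)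
  have loc: "\<bar>b - a\<bar> < r & gm b : V" "\<bar>b - a\<bar> < r & gm' b : V" if "b : S'" for b
   using that d(2)[of b] V True by(cases "b = a"; auto simp: S'_def ep_def dist_real_def abs_minus_commute)+
  have "gm b = gm' b" if b: "b : S'" for b
  proof -
   have "c (gm b) = c (gm' b)"
   proof(rule ode_unique[where G = "%t z. G (t,z)", OF S'(1) S'(3) b])
    show "norm (G (t,z) - G (t,z')) <= K * norm (z - z')" for t z z' by(rule L'(11))
    show "((%ta. c (gm ta)) hvd G (t,c (gm t))) (at t within S')" if "t : S'" for t
     by(rule icurve_base_ode[OF L icurve_subset[OF I(1) S'(2)] loc(1) that])
    show "((%ta. c (gm' ta)) hvd G (t,c (gm' t))) (at t within S')" if "t : S'" for t
     by(rule icurve_base_ode[OF L icurve_subset[OF I(2) S'(2)] loc(2) that])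
   qed (simp add: True)
   thus ?thesis using chart(5)[OF L'(1)] loc[OF b] L'(5) by(metis subsetD)
  qed
  hence "(gm a = gm' a) = (gm b = gm' b)" if "b : S" "dist b a < ep" for b
   using True that by(simp add: S'_def dist_commute)
  thus ?thesis unfolding eventually_at using ep by blast
 qed
 hence "(gm s = gm' s) = (gm t = gm' t)"
  using connected_local_const[OF con S(2,3),of "%t. gm t = gm' t"] by blast
 thus ?thesis using eq by simp
qed

lemma icurve_cong:
 assumes "icurve S gm w" "!!ta. ta : S ==> gm' ta = gm ta" shows "icurve S gm' w"
 unfolding icurve_def
proof(intro conjI ballI allI impI)
 note I = icurveD[OF assms(1)]
 show "S <= {0..1}" by(rule I(1))
 show "con S gm'" using I(2) assms(2) by(simp cong: continuous_on_cong)
 fix t assume t: "t : S"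
 show "w t : F (gm' t)" using I(3)[OF t] assms(2)[OF t] by simp
 show "((%ta. f (gm' ta)) hrd rho (e t) f (gm' t)) (at t within S)" if "sfun f" for f
  by(rule real_derivative_cong[OF I(4)[OF t that] t]) (use assms(2) t in simp_all)
 show "((%ta. pair (gm' ta) (a (gm' ta)) (w ta)) hrd pair (gm' t) (dorf (e t) a (gm' t)) (w t)) (at t within S)"
  if "a : Gam" for a by(rule real_derivative_cong[OF I(5)[OF t that] t]) (use assms(2) t in simp_all)
qed

lemma icurve_lincomb:
 assumes "icurve S gm w" "icurve S gm w'" shows "icurve S gm (%t. r *R w t + w' t)"
 unfolding icurve_def
proof(intro conjI ballI allI impI)
 note I = icurveD[OF assms(1)] and I' = icurveD[OF assms(2)]
 show "S <= {0..1}" "con S gm" by(rule I)+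
 fix t assume t: "t : S"
 show "r *R w t + w' t : F (gm t)" using I(3) I'(3) t by blast
 show "((%ta. f (gm ta)) hrd rho (e t) f (gm t)) (at t within S)" if "sfun f" for f
  by(rule I(4)[OF t that])
 fix a assume a: "a : Gam"
 have "e t : Gam" using I(1) t by auto
 thus "((%ta. pair (gm ta) (a (gm ta)) (r *R w ta + w' ta)) hrd
   pair (gm t) (dorf (e t) a (gm t)) (r *R w t + w' t)) (at t within S)"
  by(intro real_derivative_cong[OF DERIV_add[OF DERIV_cmult[OF I(5)[OF t a],of r] I'(5)[OF t a]] t])
   (use I(3) I'(3) t a in simp_all)
qed

text \<open>Expand the pairing in the global frame; the product rule then produces the expression of
  \<open>dorf_frame\<close>, which is zero.\<close>

lemma icurve_pair:
 assumes S: "is_interval S" "s : S" "t : S" and I1: "icurve S gm w1" and I2: "icurve S gm w2"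
 shows "pair (gm s) (w1 s) (w2 s) = pair (gm t) (w1 t) (w2 t)"
proof(rule icurve_const_on[OF S])
 fix t assume t: "t : S"
 have et: "e t : Gam" using icurveD(1)[OF I1] t by auto
 obtain b where b: "b : Gam" "b (gm t) = w1 t" using section_through[OF icurveD(3)[OF I1 t]] by blast
 have w2: "w2 t : F (gm t)" by(rule icurveD(3)[OF I2 t])
 have "((%ta. SUM i<gn. pair (gm ta) (ga' i (gm ta)) (w1 ta) * pair (gm ta) (ga i (gm ta)) (w2 ta)) hrd
  (SUM i<gn. pair (gm t) (dorf (e t) (ga' i) (gm t)) (w1 t) * pair (gm t) (ga i (gm t)) (w2 t)
    + pair (gm t) (dorf (e t) (ga i) (gm t)) (w2 t) * pair (gm t) (ga' i (gm t)) (w1 t))) (at t within S)" (is "(_ hrd ?D) _")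
  by(intro DERIV_sum DERIV_mult icurveD(5)[OF I1 t] icurveD(5)[OF I2 t] ga) simp_all
 moreover have "?D = pair (gm t) (SUM i<gn. pair (gm t) (dorf (e t) (ga' i) (gm t)) (w1 t) *R ga i (gm t)
    + pair (gm t) (ga' i (gm t)) (w1 t) *R dorf (e t) (ga i) (gm t)) (w2 t)"
  using ga et w2 by(subst pair_sum) (auto simp: mult.commute)
 ultimately show "((%ta. pair (gm ta) (w1 ta) (w2 ta)) hrd 0) (at t within S)"
  using dorf_frame[OF et b(1),of "gm t"] b(2) w2
  by(elim real_derivative_cong[OF _ t]) (simp_all add: pair_expand[OF icurveD(3)[OF I1] icurveD(3)[OF I2]])
qed

text \<open>The solutions \<open>Ph v\<close> are isometric, hence their values at time \<open>t\<close> span the fibre, and the pairing of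
 \<open>w\<close> with each of them is constant.\<close>

lemma icurve_unique_fibre:
 assumes S: "is_interval S" "s : S" "t : S" and w: "icurve S gm w"
  and Ph: "!!v. v : F (gm s) ==> icurve S gm (Ph v)" "!!v. v : F (gm s) ==> Ph v s = v"
 shows "w t = Ph (w s) t"
proof -
 obtain B :: "'f set" where B: "onb B" using onb_exists[OF fdF] .
 obtain U ph where U: "(U,ph) : trivs C" "gm s : U" using ex_triv by blast
 obtain V py where V: "(V,py) : trivs C" "gm t : V" using ex_triv by blast
 define a where "a b = tinv ph (gm s) b" for b
 define u where "u b = Ph (a b) t" for b
 have aF: "a b : F (gm s)" for b unfolding a_def by(rule tinv(1)[OF U])
 have a_sum: "tinv ph (gm s) y = (SUM b:B. (y *. b) *R a b)" for y
  using tinv_sum[OF U,of "%b. y *. b" "%b. b" B] onbD(3)[OF B] by(simp add: a_def)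
 have uF: "u b : F (gm t)" for b unfolding u_def by(rule icurveD(3)[OF Ph(1)[OF aF] S(3)])
 have gram: "pair (gm t) (w' t) (u b) = pair (gm s) (w' s) (a b)" if "icurve S gm w'" for w' b
  using icurve_pair[OF S that Ph(1)[OF aF]] Ph(2)[OF aF] by(simp add: u_def)
 define A where "A y = (SUM b:B. (y *. b) *R py (gm t) (u b))" for y
 have A: "tinv py (gm t) (A y) = (SUM b:B. (y *. b) *R u b)" for y
  unfolding A_def tinv_sum[OF V] tinv(3)[OF V uF] ..
 have lin: "linear A" unfolding A_def
  by(rule linearI) (simp_all add: inner_add_left scaleR_add_left sum.distrib scaleR_sum_right)
 have "inj A"
  unfolding linear_injective_0[OF lin]
 proof(intro allI impI)
  fix y assume "A y = 0"
  hence z: "(SUM b:B. (y *. b) *R u b) = 0" using A[of y] tinv(5)[OF V] by simp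
  have 0: "pair (gm s) (tinv ph (gm s) y) (a c) = 0" for c
  proof -
   have "pair (gm s) (tinv ph (gm s) y) (a c) = (SUM b:B. (y *. b) * pair (gm s) (a b) (a c))"
    unfolding a_sum using aF by(subst pair_sum) auto
   also have "... = (SUM b:B. (y *. b) * pair (gm t) (u b) (u c))"
    using gram[OF Ph(1)[OF aF]] Ph(2)[OF aF] by(simp add: u_def)
   also have "... = pair (gm t) (SUM b:B. (y *. b) *R u b) (u c)" using uF by(subst pair_sum) auto
   finally show ?thesis using z uF by simp
  qed
  have "tinv ph (gm s) y = 0"
  proof(rule pair_nondeg[OF tinv(1)[OF U]])
   fix v assume v: "v : F (gm s)"
   have "v = (SUM b:B. (ph (gm s) v *. b) *R a b)" using a_sum[of "ph (gm s) v"] tinv(3)[OF U v] by simp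
   hence "pair (gm s) (tinv ph (gm s) y) v = pair (gm s) (tinv ph (gm s) y) (SUM b:B. (ph (gm s) v *. b) *R a b)" by simp
   also have "... = 0" using 0 aF tinv(1)[OF U] by(subst pair_sum) auto
   finally show "pair (gm s) (tinv ph (gm s) y) v = 0" .
  qed
  thus "y = 0" using tinv(2,5)[OF U] by metis
 qed
 hence surj: "surj A" by(rule fd_linear_inj_imp_surj[OF fdF lin])
 have ws: "w s : F (gm s)" by(rule icurveD(3)[OF w S(2)])
 show ?thesis
 proof(rule pair_eqI)
  show F: "w t : F (gm t)" "Ph (w s) t : F (gm t)" using icurveD(3)[OF w S(3)] icurveD(3)[OF Ph(1)[OF ws] S(3)] by auto
  fix v assume v: "v : F (gm t)"
  obtain y where y: "py (gm t) v = A y" using surj by(rule surjE)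
  have ve: "v = (SUM b:B. (y *. b) *R u b)" using A[of y] tinv(3)[OF V v] y by simp
  show "pair (gm t) (w t) v = pair (gm t) (Ph (w s) t) v"
   unfolding ve using uF F gram[OF w] gram[OF Ph(1)[OF ws]] Ph(2)[OF ws] by(simp add: pair_sum)
 qed
qed

definition near :: "real => real => real set" where
 "near s d = {t : {0..1}. \<bar>t - s\<bar> < d}"

lemma near_eq: "near s d = {0..1} Int {s - d<..<s + d}" by(auto simp: near_def)

lemma near_interval: "is_interval (near s d)"
 unfolding near_eq is_interval_convex_1 by(intro convex_Int) simp_all

text \<open>Excludes isolated times, so that derivatives within the interval are unique also at the
  ends of [0,1].\<close>

lemma near_islimpt:
 assumes "s : {0..1}" "d > 0" "t : near s d" shows "t islimpt near s d"
proof(rule connected_imp_perfect)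
 show "connected (near s d)" using near_interval is_interval_connected by blast
 define t' where "t' = (if s <= 1/2 then s + min (d/2) (1/4) else s - min (d/2) (1/4))"
 have "s : near s d" "t' : near s d" "s ~= t'" using assms by(auto simp: near_def t'_def)
 thus "near s d ~= {a}" for a by auto
qed (rule assms(3))

text \<open>\<open>h s t\<close> and \<open>Ps s t\<close> move the points of \<open>W\<close> and the fibres over them from time \<open>s\<close> to time \<open>t\<close>;
 they depend smoothly on \<open>t\<close> as well as on the starting time \<open>s\<close>.\<close>

definition local_flow :: "'m set => real set => real => (real => real => 'm => 'm) => (real => real => 'm => 'v => 'v) => bool" where
 "local_flow W S d h Ps <-> (ALL x:W. ALL s:S. h s s x = x &
   (ALL v:F x. Ps s s x v = v & icurve (near s d) (%t. h s t x) (%t. Ps s t x v)) &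
   (ALL t:near s d. (ALL f::'m => real. sfun f -->
     sat {0..1} (%t x. f (h s t x)) t x & sat {0..1} (%s x. f (h s t x)) s x) &
    (ALL a:Gam. ALL b:Gam. sat {0..1} (%t x. pair (h s t x) (a (h s t x)) (Ps s t x (b x))) t x &
     sat {0..1} (%s x. pair (h s t x) (a (h s t x)) (Ps s t x (b x))) s x)))"

lemma local_flowD:
 assumes "local_flow W S d h Ps" "x : W"
 shows "s : S ==> h s s x = x" "s : S ==> v : F x ==> Ps s s x v = v"
  "s : S ==> v : F x ==> icurve (near s d) (%t. h s t x) (%t. Ps s t x v)"
  "s : S ==> t : near s d ==> sfun f ==> sat {0..1} (%t x. f (h s t x) :: real) t x"
  "s : S ==> t : near s d ==> sfun f ==> sat {0..1} (%s x. f (h s t x) :: real) s x"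
  "s : S ==> t : near s d ==> a : Gam ==> b : Gam ==> sat {0..1} (%t x. pair (h s t x) (a (h s t x)) (Ps s t x (b x))) t x"
  "s : S ==> t : near s d ==> a : Gam ==> b : Gam ==> sat {0..1} (%s x. pair (h s t x) (a (h s t x)) (Ps s t x (b x))) s x"
 using assms unfolding local_flow_def by blast+

end

section \<open>Local existence of the flow\<close>

lemma (in mfd) sfun_chart:
 assumes "smooth_fun M f" "(U,c) : charts M"
 shows "son (c ` U) (%y. f (iv U c y))"
 using assms unfolding smooth_fun_on_def by(auto simp: o_def)

lemma has_vector_derivative_shift_time:
 fixes u :: "real => 'z::real_normed_vector"
 assumes "(u hvd D) (at (t - s))"
 shows "((%ta. u (ta - s)) hvd D) (at t within S)"
proof -
 have "((%ta. ta - s) hvd 1 - 0) (at t)"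
  by(intro has_vector_derivative_diff has_vector_derivative_id has_vector_derivative_const)
 from vector_diff_chain_at[OF this assms] show ?thesis
  by(simp add: o_def has_vector_derivative_at_within)
qed

context section_flow
begin

lemma onb_inner_sum: "onb B ==> b' : B ==> (SUM b:B. k b *R b) *. b' = k b'"
 using onbD(1,2)[of B] by(simp add: inner_sum_left if_distrib[of "(*) _"] sum.delta' cong: sum.cong if_cong)

lemma model_rho:
 assumes L: "local_model s0 r U c V B ey G D al al' Gy K"
  and t: "t : {0..1}" "\<bar>t - s0\<bar> < r" and x: "x : V" and f: "sfun f"
  and Df: "((%y. f (iv U c y)) hfd Df) (at (c x))"
 shows "rho (e t) f x = Df (G (t,c x))"
proof -
 note L' = local_modelD[OF L]
 have "an x (e t x) f = (SUM b:B. Df b * an x (e t x) (ey b))"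
  by(rule tv_coords[OF anchor_tangent L'(1,4,5) x L'(8,9,2) f Df])
   (use t in auto)
 also have "... = (SUM b:B. (G (t,c x) *. b) *R Df b)"
  using L'(15)[OF t x] by(intro sum.cong) (auto simp: rho_def mult.commute)
 also have "... = Df (G (t,c x))"
  by(rule linear_onb_expand[OF L'(2) has_derivative_linear[OF Df],symmetric])
 finally show ?thesis by(simp add: rho_def)
qed

text \<open>The pairings of \<open>al\<close> with \<open>al'\<close> are constant on V, so
  \<open>dorf (e t)\<close> acts on \<open>al'\<close> by minus the transposed matrix. This fixes
  the sign and the order of the indices in the fibre equation.\<close>

lemma model_frame:
 assumes L: "local_model s0 r U c V B ey G D al al' Gy K"
  and t: "t : {0..1}" "\<bar>t - s0\<bar> < r" and x: "x : V" and a: "a : Gam" and d: "d : D"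
 shows "(SUM b:D. Gy b d (t,c x) * pair x (a x) (al' b x)) = - pair x (a x) (dorf (e t) (al' d) x)"
proof -
 note L' = local_modelD[OF L]
 note al = dual_frameD[OF L'(14)]
 have et: "e t : Gam" using t by simp
 have G: "Gy b d (t,c x) = - pair x (al b x) (dorf (e t) (al' d) x)" if b: "b : D" for b
 proof -
  have "rho (e t) (%y. pair y (al b y) (al' d y)) x = an x (e t x) (%_. if b = d then 1 else 0)"
   unfolding rho_def
   by(rule tv_local[OF anchor_tangent _ _ L'(4) x])
    (use al et b d in "auto intro: pair_smooth")
  also have "... = 0" by(rule tv_const[OF anchor_tangent]) (use et in simp)
  finally have "pair x (dorf (e t) (al b) x) (al' d x) + pair x (al b x) (dorf (e t) (al' d) x) = 0"
   using dorf_metric[OF et al(1,2),of b d x] by simp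
  thus ?thesis using L'(16)[OF t x b d] by linarith
 qed
 have "(SUM b:D. Gy b d (t,c x) * pair x (a x) (al' b x)) = - (SUM b:D. pair x (al' b x) (a x) * pair x (al b x) (dorf (e t) (al' d) x))"
  unfolding sum_negf[symmetric] using G pair_sym[OF sectionsD[OF a] sectionsD[OF al(2)]]
  by(intro sum.cong) auto
 also have "(SUM b:D. pair x (al' b x) (a x) * pair x (al b x) (dorf (e t) (al' d) x)) =
   pair x (SUM b:D. pair x (al' b x) (a x) *R al b x) (dorf (e t) (al' d) x)"
  using al(1,2) et by(subst pair_sum) auto
 also have "... = pair x (a x) (dorf (e t) (al' d) x)" using al(4)[OF x sectionsD[OF a]] by simp
 finally show ?thesis .
qed

text \<open>The base ODE is solved in the chart, then a linear ODE along its solution for the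
  components of the fibre vector in \<open>al'\<close>. Starting time and starting point are
  parameters of both, so \<open>ode_smooth\<close> yields smoothness in them.\<close>

lemma local_flow_exists:
 assumes s0: "s0 : {0..1}"
 shows "EX d W h Ps. d > 0 & open W & p : W & local_flow W (near s0 d) d h Ps"
proof -
 obtain r U c V B ey G D al al' Gy K where pV: "p : V" and L: "local_model s0 r U c V B ey G D al al' Gy K"
  using local_model_exists[OF s0,of p] by(elim exE conjE)
 note L' = local_modelD[OF L]
 note al = dual_frameD[OF L'(14)]
 have U: "(U,c) : charts C" and VU: "V <= U" and oV: "open V" by(rule L')+
 note fds = fd_prod fd_real fdE fdF
 have ocV: "open (c ` V)" using chart_image_open[OF U oV] VU by(simp add: Int_absorb1)
 define n where "n = real (card D)"
 \<comment> \<open>One constant for both equations: K for the base, n^2 K for an n by n matrix with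
   entries bounded by K.\<close>
 define K' where "K' = (1 + n * n) * K"
 \<comment> \<open>The bound r / 2 keeps s and t both within r of s0; the other one ensures
   \<open>K' * d <= 1/2\<close>.\<close>
 define d where "d = min (r / 2) (1 / (2 * (K' + 1)))"
 have n: "n >= 0" "K >= 0" using L'(7) by(simp_all add: n_def)
 hence K': "K' >= 0" "K <= K'" "n * n * K <= K'" by(simp_all add: K'_def distrib_right)
 have d: "d > 0" "d <= r / 2" using L'(6) K' by(auto simp: d_def)
 have "K' * d <= K' * (1 / (2 * (K' + 1)))" using K' by(intro mult_left_mono) (simp_all add: d_def)
 also have "... <= 1/2" using K' by(simp add: field_simps)
 finally have Kd: "K' * d <= 1/2" .
 \<comment> \<open>Time is counted from the starting time s, which becomes a parameter, so the
   initial condition always sits at 0.\<close>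
 define G1 :: "real * (real * 'e) * 'e => 'e" where "G1 q = G (fst (fst (snd q)) + fst q,snd (snd q))" for q
 have sG1: "son (cyl d) G1"
  unfolding G1_def[abs_def]
  by(rule son_compose[OF fdRE L'(10)])
   (auto intro!: son_Pair son_add son_fst son_snd)
 have LG1: "norm (G1 (t,q,z) - G1 (t,q,z')) <= K' * norm (z - z')" for t q z z'
  unfolding G1_def using order_trans[OF L'(11) mult_right_mono[OF K'(2) norm_ge_zero]] by simp
 obtain u where u: "son (cyl d) u" "!!q. u (0,q) = snd q"
  "!!t q. t : {-d<..<d} ==> ((%t. u (t,q)) hvd G1 (t,q,u (t,q))) (at t)"
  using ode_smooth[OF fdRE fdE d(1) K'(1) Kd sG1 LG1 bounded_linear_snd] by metis
 define k where "k b b' t q = Gy b b' (fst q + t,u (t,(fst q,fst (snd q))))" for b b' t and q :: "real * 'e * 'f"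
 define G2 :: "real * (real * 'e * 'f) * 'f => 'f" where
  "G2 q = (SUM b:D. (SUM b':D. k b b' (fst q) (fst (snd q)) * (snd (snd q) *. b')) *R b)" for q
 have sG2: "son (cyl d) G2"
  unfolding G2_def[abs_def] k_def
  by(intro son_sum son_scaleR son_mult son_const son_inner son_snd son_id
    son_compose[OF fdRE L'(12)] son_Pair son_add son_fst son_compose[OF _ u(1)] fds) auto
 have LG2: "norm (G2 (t,q,z) - G2 (t,q,z')) <= K' * norm (z - z')" for t q z z'
 proof -
  have "G2 (t,q,z) - G2 (t,q,z') = (SUM b:D. (SUM b':D. k b b' t q * ((z - z') *. b')) *R b)"
   by(simp add: G2_def inner_diff_left right_diff_distrib sum_subtractf scaleR_diff_left)
  also have "norm ... <= (SUM b:D. SUM b':D. K * norm (z - z'))"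
  proof(intro sum_norm_le)
   fix b assume b: "b : D"
   have "norm (SUM b':D. k b b' t q * ((z - z') *. b')) <= (SUM b':D. K * norm (z - z'))"
   proof(intro sum_norm_le)
    fix b' assume b': "b' : D"
    have "\<bar>(z - z') *. b'\<bar> <= norm (z - z')"
     using Cauchy_Schwarz_ineq2[of "z - z'" b'] onb_norm_le[OF L'(3) b'] by simp
    thus "norm (k b b' t q * ((z - z') *. b')) <= K * norm (z - z')"
     unfolding real_norm_def abs_mult k_def using L'(13)[OF b b'] n by(intro mult_mono) auto
   qed
   thus "norm ((SUM b':D. k b b' t q * ((z - z') *. b')) *R b) <= (SUM b':D. K * norm (z - z'))"
    using onb_norm_le[OF L'(3) b] by simp
  qed
  also have "... <= K' * norm (z - z')" using mult_right_mono[OF K'(3) norm_ge_zero] by(simp add: n_def mult.assoc)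
  finally show ?thesis .
 qed
 have bl: "bounded_linear (%q::real * 'e * 'f. snd (snd q))"
  by(intro bounded_linear_snd_comp bounded_linear_snd)
 have fP: "finite_dim TYPE(real * 'e * 'f)" by(intro fds)
 obtain xi where xi: "son (cyl d) xi" "!!q. xi (0,q) = snd (snd q)"
  "!!t q. t : {-d<..<d} ==> ((%t. xi (t,q)) hvd G2 (t,q,xi (t,q))) (at t)"
  using ode_smooth[OF fP fdF d(1) K'(1) Kd sG2 LG2 bl] by metis
 define Q where "Q = (cyl d) Int u -` (c ` V)"
 have Q: "open Q" unfolding Q_def
  by(rule continuous_open_preimage[OF son_continuous[OF u(1)] _ ocV]) (intro open_Times open_greaterThanLessThan open_UNIV)
 have "(0,(s0,c p)) : Q" using d(1) pV by(simp add: Q_def u(2))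
 then obtain ep where ep: "ep > 0" "ball (0,(s0,c p)) ep <= Q" using Q open_contains_ball by blast
 \<comment> \<open>A third of \<open>ep\<close> each for t - s, s - s0 and the displacement of the
   starting point.\<close>
 define dl where "dl = min d (ep / 3)"
 have dl: "dl > 0" "dl <= d" "dl <= ep / 3" using d ep by(auto simp: dl_def)
 define W where "W = V Int {x : U. c x : ball (c p) dl}"
 have W: "open W" "p : W" "W <= V" using oV chart_preimage_open[OF U open_ball] pV VU dl(1) by(auto simp: W_def)
 have WX: "c x : ball (c p) dl" "x : V" "x : U" if "x : W" for x using that by(auto simp: W_def)
 define h where "h s t x = iv U c (u (t - s,(s,c x)))" for s t x
 define xi0 where "xi0 x v = (SUM b:D. pair x (al b x) v *R b)" for x v
 define Xi where "Xi s t x v = xi (t - s,(s,c x,xi0 x v))" for s t x v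
 define Ps where "Ps s t x v = (SUM b:D. (Xi s t x v *. b) *R al' b (h s t x))" for s t x v
 have uV: "u (t - s,(s,y)) : c ` V" if "\<bar>t - s\<bar> < dl" "\<bar>s - s0\<bar> < dl" "y : ball (c p) dl" for s t y
 proof -
  have "dist (0,(s0,c p)) (t - s,(s,y)) <= \<bar>t - s\<bar> + (\<bar>s0 - s\<bar> + dist (c p) y)"
   unfolding dist_Pair_Pair using sqrt_sum_squares_le_sum
   by(intro order_trans[OF sqrt_sum_squares_le_sum] add_mono sqrt_sum_squares_le_sum) (simp_all add: dist_real_def)
  also have "... < ep" using that dl(3) by simp
  finally show ?thesis using ep(2) by(auto simp: Q_def)
 qed
 have hV: "h s t x : V" "c (h s t x) = u (t - s,(s,c x))" if tx: "\<bar>t - s\<bar> < dl" "\<bar>s - s0\<bar> < dl" "x : W" for s t x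
 proof -
  obtain x' where x': "x' : V" "u (t - s,(s,c x)) = c x'" using uV[OF tx(1,2) WX(1)[OF tx(3)]] by blast
  have "h s t x = x'" unfolding h_def x'(2) using chart(5)[OF U] x'(1) VU by blast
  thus "h s t x : V" "c (h s t x) = u (t - s,(s,c x))" using x' by simp_all
 qed
 have pair_Psi: "pair (h s t x) (a (h s t x)) (Ps s t x v) = (SUM b:D. (Xi s t x v *. b) * pair (h s t x) (a (h s t x)) (al' b (h s t x)))"
  if "a : Gam" for a s t x v
  unfolding Ps_def using that al(2) by(subst pair_sum) auto
 \<comment> \<open>Starting and final time are smooth functions mu and nu of one variable; holding
   one constant and letting the other vary gives both smoothness clauses of
   \<open>local_flow\<close>.\<close>
 have sm: "sfun f ==> sat {0..1} (%ta x. f (h (mu ta) (nu ta) x)) t x"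
  "a : Gam ==> b : Gam ==> sat {0..1} (%ta x. pair (h (mu ta) (nu ta) x) (a (h (mu ta) (nu ta) x)) (Ps (mu ta) (nu ta) x (b x))) t x"
  if m: "son UNIV mu" "son UNIV nu" and t: "\<bar>nu t - mu t\<bar> < dl" "\<bar>mu t - s0\<bar> < dl" and x: "x : W"
  for mu nu :: "real => real" and t x a b and f :: "'m => real"
 proof -
  define N where "N = {ta. \<bar>nu ta - mu ta\<bar> < dl & \<bar>mu ta - s0\<bar> < dl} >< (ball (c p) dl Int c ` V)"
  have "con UNIV mu" "con UNIV nu" using m son_continuous by blast+
  hence N: "open N" "(t,c x) : N"
   unfolding N_def using ocV t WX[OF x] by(auto intro!: open_Times open_Collect_conj open_Collect_less continuous_intros)
  have Nz: "\<bar>nu (fst z) - mu (fst z)\<bar> < dl" "\<bar>mu (fst z) - s0\<bar> < dl" "snd z : ball (c p) dl" "snd z : c ` V" "nu (fst z) - mu (fst z) : {-d<..<d}"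
   if "z : N" for z using that dl(2) by(auto simp: N_def)
  have smu: "son N (%z. mu (fst z))" "son N (%z. nu (fst z))"
   by(rule son_compose[OF fd_real m(1)] son_compose[OF fd_real m(2)],simp_all add: son_fst)+
  let ?u = "%z. u (nu (fst z) - mu (fst z),(mu (fst z),snd z))"
  have su: "son N ?u"
   by(rule son_compose[OF _ u(1)])
    (use Nz(5) in "auto intro!: son_Pair son_snd son_diff smu fds")
  have uN: "?u ` N <= c ` U" using uV[OF Nz(1,2,3)] VU by blast
  have sf: "son N (%z. f (iv U c (?u z)))" if "sfun f" for f :: "'m => real"
   by(rule son_compose[OF fdE sfun_chart[OF that U] su uN])
  have cinv: "c (iv U c y) = y" if "y : c ` V" for y
   using that VU chart(6)[OF U] by auto
  show "sat {0..1} (%ta x. f (h (mu ta) (nu ta) x)) t x" if "sfun f"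
   by(rule satI[OF U WX(3)[OF x] N sf[OF that]]) (use cinv in "auto simp: N_def h_def")
  assume ab: "a : Gam" "b : Gam"
  have "son N (%z. pair (iv U c (snd z)) (al b' (iv U c (snd z))) (b (iv U c (snd z))))" for b'
   by(rule son_compose[OF fdE sfun_chart[OF pair_smooth[OF al(1) ab(2)] U] son_snd[OF son_id]])
    (use Nz(4) VU in blast)
  hence s0': "son N (%z. xi0 (iv U c (snd z)) (b (iv U c (snd z))))"
   unfolding xi0_def by(intro son_sum son_scaleR son_const)
  let ?xi = "%z. xi (nu (fst z) - mu (fst z),(mu (fst z),snd z,xi0 (iv U c (snd z)) (b (iv U c (snd z)))))"
  have sxi: "son N ?xi"
   by(rule son_compose[OF _ xi(1)])
    (use Nz(5) in "auto intro!: son_Pair son_snd son_diff smu s0' fds")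
  have sp: "son N (%z. SUM b':D. (?xi z *. b') * (%y. pair y (a y) (al' b' y)) (iv U c (?u z)))"
   by(intro son_sum son_mult son_inner sxi son_const sf pair_smooth ab al)
  show "sat {0..1} (%ta x. pair (h (mu ta) (nu ta) x) (a (h (mu ta) (nu ta) x)) (Ps (mu ta) (nu ta) x (b x))) t x"
   unfolding pair_Psi[OF ab(1)]
   by(rule satI[OF U WX(3)[OF x] N sp]) (use cinv in "auto simp: N_def h_def Xi_def")
 qed
 have "local_flow W (near s0 dl) dl h Ps"
  unfolding local_flow_def
 proof(intro ballI conjI allI impI)
  fix x s assume x: "x : W" and "s : near s0 dl"
  hence s: "\<bar>s - s0\<bar> < dl" by(simp add: near_def)
  have t: "t : {0..1}" "\<bar>t - s\<bar> < dl" "t - s : {-d<..<d}" "\<bar>t - s0\<bar> < r" if "t : near s dl" for t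
   using that s dl(2) d(2) by(auto simp: near_def)
  show "sat {0..1} (%t x. f (h s t x)) t x" "sat {0..1} (%s x. f (h s t x)) s x"
   if "t : near s dl" "sfun f" for t and f :: "'m => real"
   using sm(1)[of "%_. s" "%t. t" t x f] sm(1)[of "%s. s" "%_. t" s x f] that x s t(2) by simp_all
  show "sat {0..1} (%t x. pair (h s t x) (a (h s t x)) (Ps s t x (b x))) t x"
   "sat {0..1} (%s x. pair (h s t x) (a (h s t x)) (Ps s t x (b x))) s x"
   if "t : near s dl" "a : Gam" "b : Gam" for t a b
   using sm(2)[of "%_. s" "%t. t" t x a b] sm(2)[of "%s. s" "%_. t" s x a b] that x s t(2) by simp_all
  show hs: "h s s x = x" unfolding h_def using u(2) chart(5)[OF U WX(3)[OF x]] by simp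
  fix v assume v: "v : F x"
  show "Ps s s x v = v"
   unfolding Ps_def Xi_def hs using xi(2) al(5)[OF WX(2)[OF x] v] by(simp add: xi0_def onb_inner_sum[OF L'(3)] cong: sum.cong)
  have du: "((%ta. u (ta - s,(s,c x))) hvd G (t,c (h s t x))) (at t within near s dl)"
   if tn: "t : near s dl" for t
   using u(3)[OF t(3)[OF tn],of "(s,c x)"] hV(2)[OF t(2)[OF tn] s x]
   by(intro has_vector_derivative_shift_time) (simp add: G1_def)
  show "icurve (near s dl) (%t. h s t x) (%t. Ps s t x v)"
   unfolding icurve_def
  proof(intro conjI ballI allI impI)
   show "near s dl <= {0..1}" by(auto simp: near_def)
   have cu: "con (near s dl) (%t. u (t - s,(s,c x)))"
    unfolding continuous_on_eq_continuous_within using du has_vector_derivative_continuous by blast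
   show "con (near s dl) (%t. h s t x)"
    unfolding h_def
    by(rule continuous_on_compose2[OF chart(4)[OF U] cu])
     (use uV[OF t(2) s WX(1)[OF x]] VU in auto)
   fix t assume tn: "t : near s dl"
   note t = t[OF tn]
   define y where "y = h s t x"
   have y: "y : V" "c y = u (t - s,(s,c x))" unfolding y_def using hV[OF t(2) s x] by auto
   show "Ps s t x v : F (h s t x)" unfolding Ps_def using al(2) by auto
   show df: "((%ta. f (h s ta x)) hrd rho (e t) f (h s t x)) (at t within near s dl)"
    if f: "sfun f" for f
   proof -
    obtain f' where f': "!!y. y : c ` U ==> ((%y. f (iv U c y)) hfd f' y) (at y)"
     using son_derivative[OF sfun_chart[OF f U] chart(2)[OF U]] by metis
    have yU: "c y : c ` U" using y(1) VU by blast
    have "(((%y. f (iv U c y)) o (%ta. u (ta - s,(s,c x)))) hvd f' (c y) (G (t,c y))) (at t within near s dl)"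
     using vector_derivative_diff_chain_within[OF du[OF tn] has_derivative_at_withinI[OF f']] yU by(simp add: y(2) y_def[symmetric])
    thus ?thesis
     unfolding hrd_hvd y_def[symmetric] model_rho[OF L t(1,4) y(1) f f'[OF yU]]
     by(simp add: o_def h_def)
   qed
   fix a assume a: "a : Gam"
   have et: "e t : Gam" using t(1) by simp
   define k' where "k' b = Xi s t x v *. b" for b
   have dXi: "((%ta. Xi s ta x v *. b) hrd (SUM b':D. Gy b b' (t,c y) * k' b')) (at t within near s dl)"
    if b: "b : D" for b
   proof -
    have "((%ta. Xi s ta x v) hvd G2 (t - s,(s,c x,xi0 x v),Xi s t x v)) (at t within near s dl)"
     unfolding Xi_def by(rule has_vector_derivative_shift_time[OF xi(3)[OF t(3)]])
    from bounded_linear.has_vector_derivative[OF bounded_linear_inner_left this,of b]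
    show ?thesis unfolding hrd_hvd
     by(simp add: G2_def k_def onb_inner_sum[OF L'(3) b] y(2) k'_def)
   qed
   have "((%ta. SUM b:D. (Xi s ta x v *. b) * pair (h s ta x) (a (h s ta x)) (al' b (h s ta x))) hrd
     (SUM b:D. (SUM b':D. Gy b b' (t,c y) * k' b') * pair y (a y) (al' b y) + rho (e t) (%y. pair y (a y) (al' b y)) y * k' b)) (at t within near s dl)"
    using DERIV_mult[OF dXi df[OF pair_smooth[OF a al(2)]]] by(intro DERIV_sum) (simp add: k'_def y_def)
   moreover have "(SUM b:D. (SUM b':D. Gy b b' (t,c y) * k' b') * pair y (a y) (al' b y)) = (SUM b:D. k' b * - pair y (a y) (dorf (e t) (al' b) y))"
   proof -
    have "(SUM b:D. (SUM b':D. Gy b b' (t,c y) * k' b') * pair y (a y) (al' b y)) =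
     (SUM b':D. k' b' * (SUM b:D. Gy b b' (t,c y) * pair y (a y) (al' b y)))"
     unfolding sum_distrib_right sum_distrib_left by(subst sum.swap) (simp add: ac_simps)
    thus ?thesis using model_frame[OF L t(1,4) y(1) a] by(simp cong: sum.cong)
   qed
   moreover have "pair y (dorf (e t) a y) (Ps s t x v) = (SUM b:D. k' b * - pair y (a y) (dorf (e t) (al' b) y) + rho (e t) (%y. pair y (a y) (al' b y)) y * k' b)"
    unfolding Ps_def k'_def[symmetric] y_def[symmetric] dorf_metric[OF et a al(2)] using et a al(2)
    by(subst pair_sum) (auto intro!: sum.cong simp: algebra_simps)
   ultimately show "((%ta. pair (h s ta x) (a (h s ta x)) (Ps s ta x v)) hrd
     pair (h s t x) (dorf (e t) a (h s t x)) (Ps s t x v)) (at t within near s dl)"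
    unfolding pair_Psi[OF a] y_def[symmetric] by(simp only: sum.distrib)
  qed
 qed
 thus ?thesis using dl(1) W(1,2) by blast
qed

end

section \<open>Uniform flow time and time derivatives along integral curves\<close>

context section_flow
begin

lemma local_flow_unique:
 assumes L: "local_flow W S d h Ps" "local_flow W' S' d' h' Ps'" and x: "x : W" "x : W'" and s: "s : S" "s : S'"
  and T: "is_interval T" "T <= near s d" "T <= near s d'" "s : T" "t : T"
 shows "h s t x = h' s t x" "v : F x ==> Ps s t x v = Ps' s t x v"
proof -
 note l = local_flowD[OF L(1) x(1)] and l' = local_flowD[OF L(2) x(2)]
 have I: "icurve T (%t. h s t x) (%t. Ps s t x v)" "icurve T (%t. h' s t x) (%t. Ps' s t x v)" if "v : F x" for v
  using icurve_subset[OF l(3)[OF s(1) that] T(2)] icurve_subset[OF l'(3)[OF s(2) that] T(3)] .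
 have base: "h s t x = h' s t x" if "t : T" for t
  by(rule icurve_unique_base[OF T(1,4) that I(1)[OF F_closed(1)] I(2)[OF F_closed(1)]]) (simp add: l(1)[OF s(1)] l'(1)[OF s(2)])
 show "h s t x = h' s t x" by(rule base[OF T(5)])
 show "Ps s t x v = Ps' s t x v" if v: "v : F x"
  using icurve_unique_fibre[OF T(1,4,5) icurve_cong[OF I(2)[OF v] base],of "%v t. Ps s t x v"] I(1) l(1,2)[OF s(1)] l'(2)[OF s(2) v]
  by simp
qed

lemma near_self: "s : {0..1} ==> d > 0 ==> s : near s d" by(simp add: near_def)

lemma near_mono: "d <= d' ==> near s d <= near s d'" by(auto simp: near_def)

text \<open>Compactness of [0,1] times M gives one flow time for all points. Each starting time and
  point picks one of finitely many local flows; by uniqueness the picked flows agree where they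
  overlap, so the glued flow is smooth.\<close>

lemma global_flow_exists: "EX dl>0. EX h Ps. local_flow UNIV {0..1} dl h Ps"
proof -
 let ?P = "%z (d,W,h,Ps). d > 0 & open W & snd z : W & local_flow W (near (fst z) d) d h Ps"
 have "ALL z:{0..1} >< UNIV. EX q. ?P z q"
 proof
  fix z :: "real * 'm" assume "z : {0..1} >< UNIV"
  then obtain d W h Ps where "d > 0" "open W" "snd z : W" "local_flow W (near (fst z) d) d h Ps"
   using local_flow_exists[of "fst z" "snd z"] by(auto simp: mem_Times_iff)
  thus "EX q. ?P z q" by(intro exI[of _ "(d,W,h,Ps)"]) simp
 qed
 from bchoice[OF this] obtain q where q: "ALL z:{0..1} >< UNIV. ?P z (q z)" by(elim exE)
 define d W h Ps where defs: "d z = fst (q z)" "W z = fst (snd (q z))" "h z = fst (snd (snd (q z)))" "Ps z = snd (snd (snd (q z)))" for z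
 have *: "d z > 0" "open (W z)" "snd z : W z" "local_flow (W z) (near (fst z) (d z)) (d z) (h z) (Ps z)" if "z : {0..1} >< UNIV" for z
  using bspec[OF q that] by(simp_all add: defs split_beta)
 define A where "A z = {fst z - d z<..<fst z + d z} >< W z" for z
 have comp: "compact ({0..1::real} >< (UNIV :: 'm set))" by(intro compact_Times compact_M compact_Icc)
 have oA: "open (A z)" "z : A z" if "z : {0..1} >< UNIV" for z
  unfolding A_def using *[OF that] by(auto simp: mem_Times_iff open_Times)
 have cov: "{0..1::real} >< (UNIV :: 'm set) <= (UN z:{0..1}><UNIV. A z)" using oA(2) by(intro subsetI UN_I)
 obtain P where P: "P <= {0..1} >< UNIV" "finite P" "{0..1} >< UNIV <= (UN z:P. A z)"
  by(rule compactE_image[OF comp oA(1) cov])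
 define dl where "dl = Min (insert 1 (d ` P))"
 have "dl : insert 1 (d ` P)" unfolding dl_def by(rule Min_in) (use P in auto)
 hence dl: "dl > 0" using *(1) P(1) by auto
 have "ALL y. EX z. fst y : {0..1} --> z : P & fst y : near (fst z) (d z) & snd y : W z"
 proof
  fix y :: "real * 'm"
  have "EX z:P. y : A z" if "fst y : {0..1}" using subsetD[OF P(3),of y] that by(simp add: mem_Times_iff)
  thus "EX z. fst y : {0..1} --> z : P & fst y : near (fst z) (d z) & snd y : W z"
   by(fastforce simp: A_def near_def mem_Times_iff)
 qed
 from choice[OF this] obtain ze where ze: "!!s x. s : {0..1} ==> ze (s,x) : P"
  "!!s x. s : {0..1} ==> s : near (fst (ze (s,x))) (d (ze (s,x)))" "!!s x. s : {0..1} ==> x : W (ze (s,x))"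
  by fastforce
 define h' where "h' s t x = h (ze (s,x)) s t x" for s t x
 define Ps' where "Ps' s t x v = Ps (ze (s,x)) s t x v" for s t x v
 have sub: "near s dl <= near s (d z)" if "z : P" for s z
  using P(2) that by(intro near_mono) (simp add: dl_def)
 have lf: "local_flow (W z) (near (fst z) (d z)) (d z) (h z) (Ps z)" "open (W z)" if "z : P" for z using *[of z] P(1) that by auto
 have agree: "h' s t y = h z s t y" "v : F y ==> Ps' s t y v = Ps z s t y v"
  if z: "z : P" "s : near (fst z) (d z)" "y : W z" and t: "t : near s dl" for s t z y v
 proof -
  have s: "s : {0..1}" using z(2) by(simp add: near_def)
  note u = local_flow_unique[OF lf(1)[OF ze(1)[OF s]] lf(1)[OF z(1)] ze(3)[OF s] z(3) ze(2)[OF s] z(2) near_interval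
    sub[OF ze(1)[OF s]] sub[OF z(1)] near_self[OF s dl] t]
  show "h' s t y = h z s t y" "v : F y ==> Ps' s t y v = Ps z s t y v" unfolding h'_def Ps'_def by(rule u; assumption)+
 qed
 have "local_flow UNIV {0..1} dl h' Ps'"
  unfolding local_flow_def
 proof(intro ballI conjI allI impI)
  fix x s assume s: "s : {0..1::real}"
  define z where "z = ze (s,x)"
  have z: "z : P" "s : near (fst z) (d z)" "x : W z" unfolding z_def by(rule ze[OF s])+
  note l = local_flowD[OF lf(1)[OF z(1)] z(3)] and ag = agree[OF z(1)]
  show "h' s s x = x" unfolding h'_def z_def[symmetric] by(rule l(1)[OF z(2)])
  show "Ps' s s x v = v" "icurve (near s dl) (%t. h' s t x) (%t. Ps' s t x v)" if "v : F x" for v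
   unfolding h'_def Ps'_def z_def[symmetric] using l(2)[OF z(2) that] icurve_subset[OF l(3)[OF z(2) that] sub[OF z(1)]] .
  fix t assume t: "t : near s dl"
  hence t': "t : near s (d z)" using sub[OF z(1)] by blast
  define I where "I = {fst z - d z<..<fst z + d z} Int {t - dl<..<t + dl}"
  have I: "open I" "s : I" "!!si. si : {0..1} ==> si : I ==> si : near (fst z) (d z)" "!!si. si : I ==> t : near si dl"
   using t z(2) by(auto simp: I_def near_def)
  define I' where "I' = {s - dl<..<s + dl}"
  have I': "open I'" "t : I'" "!!ta. ta : {0..1} ==> ta : I' ==> ta : near s dl" using t by(auto simp: I'_def near_def)
  show "sat {0..1} (%t x. f (h' s t x)) t x" if "sfun f" for f :: "'m => real"
   by(rule sat_cong[OF l(4)[OF z(2) t' that] I'(1,2) lf(2)[OF z(1)] z(3)]) (simp add: ag(1)[OF z(2)] I'(3))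
  show "sat {0..1} (%s x. f (h' s t x)) s x" if "sfun f" for f :: "'m => real"
   by(rule sat_cong[OF l(5)[OF z(2) t' that] I(1,2) lf(2)[OF z(1)] z(3)]) (simp add: ag(1)[OF I(3) _ I(4)])
  show "sat {0..1} (%t x. pair (h' s t x) (a (h' s t x)) (Ps' s t x (b x))) t x" if "a : Gam" "b : Gam" for a b
   by(rule sat_cong[OF l(6)[OF z(2) t' that] I'(1,2) lf(2)[OF z(1)] z(3)]) (simp add: ag[OF z(2)] I'(3) that)
  show "sat {0..1} (%s x. pair (h' s t x) (a (h' s t x)) (Ps' s t x (b x))) s x" if "a : Gam" "b : Gam" for a b
   by(rule sat_cong[OF l(7)[OF z(2) t' that] I(1,2) lf(2)[OF z(1)] z(3)]) (simp add: ag[OF I(3) _ I(4)] that)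
 qed
 thus ?thesis using dl by blast
qed

text \<open>Total derivative along an integral curve: partial time derivative plus derivative along
  the anchor of e. As t is a limit point of S, \<open>gd\<close> must be the time derivative of a
  local representative.\<close>

lemma icurve_chain:
 assumes I: "icurve S gm w" and t: "t : S" and g: "sat S g t (gm t)" and gt: "sfun (g t)"
  and gd: "((%ta. g ta (gm t)) hrd gd) (at t within S)" and lim: "t islimpt S"
 shows "((%ta. g ta (gm ta)) hrd gd + rho (e t) (g t) (gm t)) (at t within S)"
proof -
 define p where "p = gm t"
 have t01: "t : {0..1}" using icurveD(1)[OF I] t by blast
 obtain U c where U: "(U,c) : charts C" "p : U" using ex_chart by blast
 obtain V ey where V: "open V" "p : V" "V <= U" "!!b::'e. sfun (ey b)" "!!b x. x : V ==> ey b x = c x *. b"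
  using coordinate_functions[OF U] by blast
 obtain B :: "'e set" where B: "onb B" using onb_exists[OF fdE] .
 obtain r and G :: "real * 'e => real" and K where G: "r > 0" "son UNIV G"
  "!!t' x. t' : S ==> x : U ==> \<bar>t' - t\<bar> < r ==> dist (c p) (c x) < r ==> g t' x = G (t',c x)"
  using extend_at[OF g[folded p_def] U] by metis
 obtain G' where G': "!!z. (G hfd G' z) (at z)"
  by(rule son_derivative[OF G(2) open_UNIV]) blast
 define A where "A = V Int {x : U. c x : ball (c p) r}"
 have A: "open A" "p : A" "A <= V" "A <= U"
  using V U G(1) chart_preimage_open[OF U(1) open_ball] by(auto simp: A_def)
 have gG: "g t' x = G (t',c x)" if "t' : S" "\<bar>t' - t\<bar> < r" "x : A" for t' x
  by(rule G(3)) (use that in "auto simp: A_def")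
 define vel where "vel = (SUM b:B. rho (e t) (ey b) p *R b)"
 define y where "y ta = (SUM b:B. ey b (gm ta) *R b)" for ta
 have yc: "y ta = c (gm ta)" if "gm ta : A" for ta
  unfolding y_def using V(5) onbD(3)[OF B] that A(3) by(simp add: subset_eq)
 have dy: "(y hvd vel) (at t within S)"
  unfolding y_def[abs_def] vel_def
 proof(rule has_vector_derivative_sum)
  fix b
  from has_vector_derivative_scaleR[OF icurveD(4)[OF I t V(4)[of b]] has_vector_derivative_const[of b]]
  show "((%ta. ey b (gm ta) *R b) hvd rho (e t) (ey b) p *R b) (at t within S)" by(simp add: p_def)
 qed
 have "((%ta. (ta,y ta)) hvd (1,vel)) (at t within S)"
  by(intro has_vector_derivative_Pair has_vector_derivative_id dy)
 from vector_derivative_diff_chain_within[OF this has_derivative_at_withinI[OF G']]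
 have 1: "((%ta. G (ta,y ta)) hvd G' (t,y t) (1,vel)) (at t within S)" by(simp add: o_def)
 have "eventually (%ta. gm ta : A) (at t within S)"
  using icurveD(2)[OF I] t A unfolding continuous_on_def p_def by(blast intro: topological_tendstoD)
 then obtain d where d: "d > 0" "!!ta. ta : S ==> ta ~= t ==> dist ta t < d ==> gm ta : A"
  unfolding eventually_at by blast
 have 2: "((%ta. g ta (gm ta)) hvd G' (t,y t) (1,vel)) (at t within S)"
 proof(rule has_vector_derivative_transform_within[OF 1,of "min d r"])
  fix ta assume ta: "ta : S" "dist ta t < min d r"
  have a: "gm ta : A" using d(2)[OF ta(1)] ta(2) A(2) by(cases "ta = t") (auto simp: p_def)
  show "G (ta,y ta) = g ta (gm ta)" using gG[OF ta(1) _ a] ta(2) yc[OF a] by(simp add: dist_real_def)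
 qed (use d G(1) t in auto)
 have yt: "y t = c p" using yc[of t] A(2) by(simp add: p_def)
 have lin: "linear (G' (t,c p))" using has_derivative_linear[OF G'] .
 have "G' (t,c p) (1,vel) = G' (t,c p) ((1,0) + (0,vel))" by simp
 also have "... = G' (t,c p) (1,0) + G' (t,c p) (0,vel)" by(rule linear_add[OF lin])
 also have "G' (t,c p) (1,0) = gd"
 proof(rule vector_derivative_unique_within)
  show "at t within S ~= bot" using lim by(simp add: trivial_limit_within)
  show "((%ta. g ta p) hvd gd) (at t within S)"
   using gd by(simp add: p_def hrd_hvd)
  show "((%ta. g ta p) hvd G' (t,c p) (1,0)) (at t within S)"
   by(rule has_vector_derivative_transform_within[OF has_derivative_time_slice[OF G'] G(1) t])
    (use gG[OF _ _ A(2)] in "auto simp: dist_real_def")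
 qed
 also have "G' (t,c p) (0,vel) = rho (e t) (g t) p"
 proof -
  have oA: "open (c ` A)" using chart_image_open[OF U(1) A(1)] A(4) by(simp add: Int_absorb1)
  have "((%y. (t,y)) hfd (%v. (0,v))) (at (c p))"
   by(intro has_derivative_Pair has_derivative_const has_derivative_ident)
  from has_derivative_compose[OF this G'] have "((%y. G (t,y)) hfd (%v. G' (t,c p) (0,v))) (at (c p))" .
  hence D: "((%y. g t (iv U c y)) hfd (%v. G' (t,c p) (0,v))) (at (c p))"
  proof(rule has_derivative_transform_within_open[OF _ oA])
   show "c p : c ` A" using A(2) by blast
   fix z assume "z : c ` A"
   then obtain x where x: "x : A" "z = c x" by blast
   have "iv U c z = x" unfolding x(2) by(rule chart(5)[OF U(1)]) (use x A in blast)
   thus "G (t,z) = g t (iv U c z)" using gG[OF t _ x(1)] G(1) x(2) by simp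
  qed
  have "an p (e t p) (g t) = (SUM b:B. G' (t,c p) (0,b) * an p (e t p) (ey b))"
   by(rule tv_coords[OF anchor_tangent U(1) V(1,3,2,4,5) B gt D]) (use t01 in auto)
  also have "... = G' (t,c p) (SUM b:B. an p (e t p) (ey b) *R (0,b))"
   by(simp add: linear_sum[OF lin] linear_scale[OF lin] mult.commute del: scaleR_Pair)
  also have "(SUM b:B. an p (e t p) (ey b) *R (0::real,b)) = (0,vel)"
   by(simp add: vel_def rho_def prod_eq_iff fst_sum snd_sum)
  finally show ?thesis by(simp add: rho_def)
 qed
 finally have "G' (t,y t) (1,vel) = gd + rho (e t) (g t) (gm t)" by(simp add: yt p_def)
 thus ?thesis using 2 by(simp add: hrd_hvd)
qed

text \<open>The counterpart of \<open>icurve_chain\<close> for sections. Invariance of anchor,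
  bracket and complex structures under the flow all come from comparing its two terms.\<close>

lemma icurve_family_pair:
 assumes I: "icurve S gm w" and t: "t : S" "t islimpt S" and a: "!!ta. ta : S ==> a ta : Gam" and sa: "sfam S a t (gm t)"
  and adF: "ad : F (gm t)"
  and ad: "!!b. b : Gam ==> ((%ta. pair (gm t) (a ta (gm t)) (b (gm t))) hrd pair (gm t) ad (b (gm t))) (at t within S)"
 shows "((%ta. pair (gm ta) (a ta (gm ta)) (w ta)) hrd
   pair (gm t) ad (w t) + pair (gm t) (dorf (e t) (a t) (gm t)) (w t)) (at t within S)"
proof -
 define y where "y = gm t"
 have S01: "S <= {0..1}" by(rule icurveD(1)[OF I])
 have t01: "t : {0..1}" using S01 t(1) by blast
 have et: "e t : Gam" using t01 by simp
 have at: "a t : Gam" by(rule a[OF t(1)])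
 have wF: "w ta : F (gm ta)" if "ta : S" for ta by(rule icurveD(3)[OF I that])
 define g where "g i = (%ta x. pair x (a ta x) (ga i x))" for i
 have sg: "sfun (g i t)" if "i < gn" for i unfolding g_def using at ga(1)[OF that] by(intro pair_smooth)
 have dg: "((%ta. g i ta (gm ta)) hrd pair y ad (ga i y) + rho (e t) (g i t) y) (at t within S)" if i: "i < gn" for i
  unfolding y_def
  using sfamD[OF sa ga(1)[OF i]] ad[OF ga(1)[OF i]] sg[OF i]
  by(intro icurve_chain[where g = "g i" and w = w,OF I t(1) _ _ _ t(2)]) (simp_all add: g_def)
 have "((%ta. SUM i<gn. g i ta (gm ta) * pair (gm ta) (ga' i (gm ta)) (w ta)) hrd
   (SUM i<gn. (pair y ad (ga i y) + rho (e t) (g i t) y) * pair y (ga' i y) (w t)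
    + pair y (dorf (e t) (ga' i) y) (w t) * g i t y)) (at t within S)"
  unfolding y_def
  by(intro DERIV_sum DERIV_mult icurveD(5)[OF I t(1)] dg[unfolded y_def] ga(2)) simp_all
 thus ?thesis
 proof(rule real_derivative_cong[OF _ t(1)])
  show "pair (gm ta) (a ta (gm ta)) (w ta) = (SUM i<gn. g i ta (gm ta) * pair (gm ta) (ga' i (gm ta)) (w ta))" if ta: "ta : S" for ta
  proof -
   have aF: "a ta (gm ta) : F (gm ta)" by(rule sectionsD[OF a[OF ta]])
   have "pair (gm ta) (a ta (gm ta)) (w ta) = pair (gm ta) (SUM i<gn. pair (gm ta) (ga i (gm ta)) (a ta (gm ta)) *R ga' i (gm ta)) (w ta)"
    by(simp only: frame'[OF aF])
   also have "... = (SUM i<gn. g i ta (gm ta) * pair (gm ta) (ga' i (gm ta)) (w ta))"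
    using wF[OF ta] ga pair_sym[OF aF] by(subst pair_sum) (auto simp: g_def)
   finally show ?thesis .
  qed
  have de: "dorf (e t) (a t) y = (SUM i<gn. g i t y *R dorf (e t) (ga' i) y + rho (e t) (g i t) y *R ga' i y)"
   unfolding g_def by(rule dorf_expand_right[OF et at])
  have wt: "w t : F y" using wF[OF t(1)] by(simp add: y_def)
  have F2: "g i t y *R dorf (e t) (ga' i) y + rho (e t) (g i t) y *R ga' i y : F y" if "i : {..<gn}" for i
   using that ga et by(intro F_closed(2) F_closed(3) sectionsD dorf_section) auto
  have "pair y (dorf (e t) (a t) y) (w t) = (SUM i<gn. pair y (g i t y *R dorf (e t) (ga' i) y + rho (e t) (g i t) y *R ga' i y) (w t))"
   unfolding de by(rule pair_sum(1)) (use F2 wt in auto)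
  also have "... = (SUM i<gn. rho (e t) (g i t) y * pair y (ga' i y) (w t) + pair y (dorf (e t) (ga' i) y) (w t) * g i t y)"
   by(rule sum.cong) (use wt ga et in auto)
  finally have 1: "pair y (dorf (e t) (a t) y) (w t) = ..." .
  have adF': "ad : F y" using adF by(simp add: y_def)
  have "pair y ad (w t) = pair y (SUM i<gn. pair y (ga i y) ad *R ga' i y) (w t)" by(simp only: frame'[OF adF'])
  also have "... = (SUM i<gn. pair y ad (ga i y) * pair y (ga' i y) (w t))"
   using wt ga pair_sym[OF adF'] by(subst pair_sum) auto
  finally have 2: "pair y ad (w t) = ..." .
  show "(SUM i<gn. (pair y ad (ga i y) + rho (e t) (g i t) y) * pair y (ga' i y) (w t)
    + pair y (dorf (e t) (ga' i) y) (w t) * g i t y) =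
   pair (gm t) ad (w t) + pair (gm t) (dorf (e t) (a t) (gm t)) (w t)"
   unfolding y_def[symmetric] 1 2 by(simp add: sum.distrib distrib_right)
 qed
qed

end

section \<open>The flow over short times\<close>

locale global_flow = section_flow C gn ga ga' e
 for C :: "('m::{t2_space,second_countable_topology},'e::{real_inner,banach,heine_borel},'v::real_vector,
  'f::{real_inner,banach,heine_borel}) courant" and gn ga ga' e +
 fixes dl :: real and h :: "real => real => 'm => 'm" and Ps :: "real => real => 'm => 'v => 'v"
 assumes delta: "dl > 0" and flow: "local_flow UNIV {0..1} dl h Ps"
begin

definition close :: "real => real => bool" where "close s t <-> s : {0..1} & t : near s dl"

lemma closeD: "close s t ==> s : {0..1}" "close s t ==> t : near s dl" "close s t ==> t : {0..1}" "close s t ==> s : near s dl"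
 "close s t ==> close t s"
 using delta by(auto simp: close_def near_def)

lemmas fl = local_flowD[OF flow UNIV_I]

lemmas fl_curve = fl(3)

lemma Psi_F [simp]: "close s t ==> v : F x ==> Ps s t x v : F (h s t x)"
 using icurveD(3)[OF fl_curve] closeD by blast

text \<open>Uniqueness on the common part of the two time intervals, which is again an
  interval.\<close>

lemma flow_cocycle:
 assumes s: "close s si" and t: "close s t" "close si t"
 shows "h si t (h s si x) = h s t x" "v : F x ==> Ps si t (h s si x) (Ps s si x v) = Ps s t x v"
proof -
 note c = closeD[OF s]
 define T where "T = near s dl Int near si dl"
 have T: "is_interval T" "si : T" "t : T" "T <= near s dl" "T <= near si dl"
  using near_interval c closeD[OF c(5)] t closeD by(auto simp: T_def is_interval_convex_1 intro: convex_Int)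
 have I: "icurve T (%ta. h si ta (h s si x)) (%ta. Ps si ta (h s si x) v)" if "v : F (h s si x)" for v
  by(rule icurve_subset[OF fl_curve[OF c(3) that] T(5)])
 have I': "icurve T (%ta. h s ta x) (%ta. Ps s ta x v)" if "v : F x" for v by(rule icurve_subset[OF fl_curve[OF c(1) that] T(4)])
 have base: "h s ta x = h si ta (h s si x)" if "ta : T" for ta
  by(rule icurve_unique_base[OF T(1,2) that I'[OF F_closed(1)] I[OF F_closed(1)]]) (simp add: fl(1)[OF c(3)])
 show "h si t (h s si x) = h s t x" using base[OF T(3)] by simp
 show "Ps si t (h s si x) (Ps s si x v) = Ps s t x v" if "v : F x"
  using icurve_unique_fibre[OF T(1,2,3) I'[OF that],of "%v ta. Ps si ta (h s si x) v"] icurve_cong[OF I base] fl(2)[OF c(3)] by simp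
qed

lemma flow_inverse:
 assumes st: "close s t"
 shows "h t s (h s t x) = x" "v : F x ==> Ps t s (h s t x) (Ps s t x v) = v"
proof -
 note c = closeD[OF st]
 have s: "close s s" using delta c(1) by(simp add: close_def near_def)
 show "h t s (h s t x) = x" "v : F x ==> Ps t s (h s t x) (Ps s t x v) = v"
  using flow_cocycle[OF st s c(5)] fl(1,2)[OF c(1)] by simp_all
qed

lemma Psi_linear:
 assumes st: "close s t" and v: "v : F x" "w : F x"
 shows "Ps s t x (r *R v + w) = r *R Ps s t x v + Ps s t x w"
proof -
 note c = closeD[OF st]
 show ?thesis
  using icurve_unique_fibre[OF near_interval c(4,2) icurve_lincomb[OF fl_curve[OF c(1) v(1)] fl_curve[OF c(1) v(2)],of r],of "%v t. Ps s t x v"]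
   fl(1,2)[OF c(1)] fl_curve[OF c(1)] v by simp
qed

lemma Psi_pair:
 assumes st: "close s t" and v: "v : F x" "w : F x"
 shows "pair (h s t x) (Ps s t x v) (Ps s t x w) = pair x v w"
proof -
 note c = closeD[OF st]
 show ?thesis
  using icurve_pair[OF near_interval c(4,2) fl_curve[OF c(1) v(1)] fl_curve[OF c(1) v(2)]] fl(1,2)[OF c(1)] v by simp
qed

lemma Psi_bij:
 assumes st: "close s t" shows "bij_betw (Ps s t x) (F x) (F (h s t x))"
proof(rule bij_betwI[where g = "Ps t s (h s t x)"])
 note c = closeD(5)[OF st]
 show "Ps s t x : F x \<rightarrow> F (h s t x)" using st by simp
 show "Ps t s (h s t x) : F (h s t x) \<rightarrow> F x" using Psi_F[OF c,of _ "h s t x"] flow_inverse(1)[OF st] by auto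
 show "Ps t s (h s t x) (Ps s t x v) = v" if "v : F x" for v using flow_inverse(2)[OF st that] .
 show "Ps s t x (Ps t s (h s t x) v) = v" if "v : F (h s t x)" for v
  using flow_inverse(2)[OF c that] flow_inverse(1)[OF st] by simp
qed

lemma h_smooth: "close s t ==> sfun f ==> sfun (%x. f (h s t x) :: real)"
 by(rule sat_slice_fun[where T = "{0..1}" and f = "%t x. f (h s t x)"])
  (use fl(4) closeD in blast)+

lemma h_bij: "close s t ==> bij (h s t)" "close s t ==> inv (h s t) = h t s"
proof -
 assume st: "close s t"
 have 1: "h t s (h s t x) = x" "h s t (h t s x) = x" for x
  using flow_inverse(1)[OF st] flow_inverse(1)[OF closeD(5)[OF st]] by auto
 thus "bij (h s t)" by(intro bij_betw_byWitness[where f' = "h t s"]) auto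
 show "inv (h s t) = h t s" by(rule inv_equality) (use 1 in auto)
qed

text \<open>Bump functions give continuity, and cut-off coordinates give the chart expressions. So
  charts need not be followed through the flow and its compositions.\<close>

lemma smooth_mapI:
 assumes k: "!!f :: 'm => real. sfun f ==> sfun (%x. f (k x))"
 shows "smooth_map C k"
 unfolding smooth_map_def
proof(intro conjI)
 show cont: "con UNIV k"
  unfolding continuous_on_open_vimage[OF open_UNIV]
 proof(intro allI impI)
  fix A :: "'m set" assume A: "open A"
  have "EX T. open T & x : T & T <= k -` A" if x: "x : k -` A" for x
  proof -
   obtain ze V S where ze: "sfun ze" "open V" "k x : V" "V <= A" "!!x. x : V ==> ze x = (1::real)"
    "!!x. 0 <= ze x" "closed S" "S <= A" "!!x. x ~: S ==> ze x = 0"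
    using bump[OF A,of "k x"] x by(metis vimage_eq)
   have "con UNIV (%x. ze (k x))" by(rule sfun_continuous[OF k[OF ze(1)]])
   hence "open ((%x. ze (k x)) -` {1/2<..})" unfolding continuous_on_open_vimage[OF open_UNIV] by(metis open_greaterThan Int_UNIV_right)
   moreover have "k y : A" if "ze (k y) > 1/2" for y
    using ze(8,9) that by(cases "k y : S") auto
   moreover have "ze (k x) = 1" using ze(3,5) by blast
   ultimately show ?thesis by(intro exI[of _ "(%x. ze (k x)) -` {1/2<..}"]) auto
  qed
  thus "open (k -` A Int UNIV)" unfolding Int_UNIV_right by(subst open_subopen) blast
 qed
 show "ALL (U,c):charts C. ALL (V,d):charts C. son (c ` (U Int k -` V)) (d o k o iv U c)"
 proof(clarify)
  fix U c V d assume U: "(U,c) : charts C" and V: "(V,d) : charts C"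
  obtain B :: "'e set" where B: "onb B" using onb_exists[OF fdE] .
  have okV: "open (k -` V)" using cont chart(1)[OF V] unfolding continuous_on_open_vimage[OF open_UNIV] by(metis Int_UNIV_right)
  have oc: "open (c ` (U Int k -` V))" by(rule chart_image_open[OF U okV])
  show "son (c ` (U Int k -` V)) (d o k o iv U c)"
  proof(rule son_local[OF oc])
   fix y assume "y : c ` (U Int k -` V)"
   then obtain x where x: "x : U" "k x : V" "y = c x" by auto
   obtain V' ey where V': "open V'" "k x : V'" "V' <= V" "!!b::'e. sfun (ey b)" "!!b z. z : V' ==> ey b z = d z *. b"
    using coordinate_functions[OF V x(2)] by blast
   have okV': "open (k -` V')" using cont V'(1) unfolding continuous_on_open_vimage[OF open_UNIV] by(metis Int_UNIV_right)
   define N where "N = c ` (U Int k -` V')"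
   have N: "open N" "y : N" unfolding N_def using chart_image_open[OF U okV'] x V'(2) by auto
   have NU: "N <= c ` U" by(auto simp: N_def)
   have "son N (%y. SUM b:B. ey b (k (iv U c y)) *R b)"
    by(intro son_sum son_scaleR son_const son_subset[OF sfun_chart[OF k[OF V'(4)] U] NU])
   moreover have "(SUM b:B. ey b (k (iv U c z)) *R b) = (d o k o iv U c) z" if "z : N" for z
   proof -
    have "k (iv U c z) : V'" using that chart(5)[OF U] by(auto simp: N_def)
    thus ?thesis using V'(5) onbD(3)[OF B] by simp
   qed
   ultimately have "son N (d o k o iv U c)" by(rule son_cong[OF N(1),rotated])
   thus "EX N. open N & y : N & son N (d o k o iv U c)" using N by blast
  qed
 qed
qed

lemma h_diffeomorphism: "close s t ==> diffeomorphism C (h s t)"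
 unfolding diffeomorphism_def using h_bij h_smooth closeD(5) by(auto intro!: smooth_mapI)

definition pull :: "real => real => ('m => 'v) => 'm => 'v" where
 "pull s t a = (%x. Ps t s (h s t x) (a (h s t x)))"

lemma pull_F:
 assumes st: "close s t" and a: "a (h s t x) : F (h s t x)" shows "pull s t a x : F x"
 using Psi_F[OF closeD(5)[OF st] a] flow_inverse(1)[OF st] by(simp add: pull_def)

lemma pull_pair:
 assumes st: "close s t" and a: "a (h s t x) : F (h s t x)" and v: "v : F x"
 shows "pair x (pull s t a x) v = pair (h s t x) (a (h s t x)) (Ps s t x v)"
proof -
 have "pair (h t s (h s t x)) (Ps t s (h s t x) (a (h s t x))) (Ps t s (h s t x) (Ps s t x v)) = pair (h s t x) (a (h s t x)) (Ps s t x v)"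
  by(rule Psi_pair[OF closeD(5)[OF st] a]) (use st v in simp)
 thus ?thesis using flow_inverse[OF st] v by(simp add: pull_def)
qed

lemma Psi_pull:
 assumes st: "close s t" and a: "a (h s t x) : F (h s t x)" shows "Ps s t x (pull s t a x) = a (h s t x)"
 using flow_inverse(2)[OF closeD(5)[OF st] a] flow_inverse(1)[OF st] by(simp add: pull_def)

lemma pull_section:
 assumes st: "close s t" and a: "a : Gam" shows "pull s t a : Gam"
proof(rule sectionI)
 show "pull s t a x : F x" for x using st a by(simp add: pull_F)
 fix b assume b: "b : Gam"
 have "sfun (%x. pair (h s t x) (a (h s t x)) (Ps s t x (b x)))"
  by(rule sat_slice_fun[where T = "{0..1}" and f = "%t x. pair (h s t x) (a (h s t x)) (Ps s t x (b x))"])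
   (use fl(6)[OF _ _ a b] closeD[OF st] in blast)+
 thus "sfun (%x. pair x (pull s t a x) (b x))" using st a b by(simp add: pull_pair)
qed

lemma pushforward_eq: "close s t ==> pushforward (h s t) (Ps s t) a = pull t s a"
 unfolding pushforward_def pull_def by(simp add: h_bij(2))

lemma pull_pull:
 assumes st: "close s t" and a: "!!x. a x : F x" shows "pull s t (pull t s a) = a"
proof
 fix x
 have ts: "close t s" by(rule closeD(5)[OF st])
 have "pull s t (pull t s a) x = Ps t s (h s t x) (pull t s a (h s t x))" by(simp add: pull_def)
 also have "... = a (h t s (h s t x))" by(rule Psi_pull[OF ts]) (rule a)
 finally show "pull s t (pull t s a) x = a x" using flow_inverse(1)[OF st] by simp
qed

lemma flow_bundle_automorphism:
 assumes st: "close s t" shows "bundle_automorphism C (h s t) (Ps s t)"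
 unfolding bundle_automorphism_def
proof(intro conjI allI ballI impI)
 fix a assume a: "ALL x. a x : F x"
 show "(a : Gam) = (pushforward (h s t) (Ps s t) a : Gam)"
  unfolding pushforward_eq[OF st]
  using pull_section[OF closeD(5)[OF st],of a] pull_section[OF st,of "pull t s a"] pull_pull[OF st,of a] a by auto
qed (use h_diffeomorphism[OF st] Psi_bij[OF st] Psi_linear[OF st] in auto)

end

section \<open>Invariance of anchor and bracket under the flow\<close>

lemma real_derivative_unique:
 assumes "t islimpt S" "(f hrd A) (at t within S)" "(f hrd B) (at t within S)"
 shows "A = B"
 using vector_derivative_unique_within[of t S f A B] assms
 by(simp add: hrd_hvd trivial_limit_within)

context global_flow
begin

text \<open>The intermediate times si for which both the flow from s to si and the one from si to t
  are available.\<close>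

definition common :: "real => real => real set" where "common s t = near s dl Int near t dl"

lemma common:
 assumes st: "close s t"
 shows "is_interval (common s t)" "s : common s t" "t : common s t" "common s t <= near s dl" "common s t <= {0..1}"
  "si : common s t ==> close s si" "si : common s t ==> close si t" "si : common s t ==> si islimpt common s t"
proof -
 note c = closeD[OF st]
 show I: "is_interval (common s t)" using near_interval by(auto simp: common_def is_interval_convex_1 intro: convex_Int)
 show st': "s : common s t" "t : common s t" using c delta by(auto simp: common_def near_def)
 show "si islimpt common s t" if "si : common s t"
 proof(cases "s = t")
  case True
  thus ?thesis using near_islimpt[OF c(1) delta] that by(simp add: common_def)
 next
  case False
  hence "common s t ~= {x}" for x using st' by(metis singletonD)
  thus ?thesis by(rule connected_imp_perfect[OF is_interval_connected[OF I] that])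
 qed
qed (use st in "auto simp: common_def close_def near_def abs_minus_commute")

lemma curve_common: "close s t ==> v : F x ==> icurve (common s t) (%si. h s si x) (%si. Ps s si x v)"
 by(rule icurve_subset[OF fl_curve[OF closeD(1)] common(4)])

lemma h_self [simp]: "s : {0..1} ==> h s s x = x" by(rule fl(1))

lemma pull_self: "s : {0..1} ==> a : Gam ==> pull s s a = a" by(auto simp: pull_def fl(2))

text \<open>Differentiating the constant function \<open>si \<mapsto> f (h si t (h s si y))\<close> at \<open>s\<close> yields the backward equation.\<close>

lemma flow_back_function:
 assumes st: "close s t" and f: "sfun f"
 shows "((%si. f (h si t y)) hrd - rho (e s) (%z. f (h s t z)) y) (at s within {0..1})"
proof -
 note c = closeD[OF st] and S = common[OF st]
 have sm: "sat {0..1} (%si x. f (h si t x)) s y" by(rule fl(5)[OF c(1,2) f])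
 obtain D where D: "((%si. f (h si t y)) hrd D) (at s within {0..1})"
  using sat_time_derivative[OF sm c(1)] unfolding hrd_hvd by blast
 have "((%si. f (h si t (h s si y))) hrd D + rho (e s) (%z. f (h s t z)) (h s s y)) (at s within common s t)"
  by(rule icurve_chain[where g = "%si z. f (h si t z)", OF curve_common[OF st F_closed(1)] S(2) _ h_smooth[OF st f] _ S(8)[OF S(2)]])
   (use sat_mono[OF sm S(5)] DERIV_subset[OF D S(5)] c(1) in simp_all)
 hence "((%si. f (h s t y)) hrd D + rho (e s) (%z. f (h s t z)) (h s s y)) (at s within common s t)"
  by(rule real_derivative_cong[OF _ S(2)]) (simp_all add: flow_cocycle(1)[OF S(6) st S(7)])
 from real_derivative_unique[OF S(8)[OF S(2)] this DERIV_const] show ?thesis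
  using D c(1) by(simp add: eq_neg_iff_add_eq_0[symmetric])
qed

lemma pull_sfam:
 assumes st: "close s t" and a: "a : Gam" and si: "si : common s t"
 shows "sfam (common s t) (%ta. pull ta t a) si y"
 unfolding sfam_def
proof
 fix b assume b: "b : Gam"
 note S = common[OF st]
 have "sat (common s t) (%ta y. pair (h ta t y) (a (h ta t y)) (Ps ta t y (b y))) si y"
  by(rule sat_mono[OF fl(7)[OF _ _ a b] S(5)]) (use closeD[OF S(7)[OF si]] in auto)
 thus "sat (common s t) (%ta y. pair y (pull ta t a y) (b y)) si y"
  by(rule sat_cong'[OF _ open_UNIV UNIV_I]) (use pull_pair[OF S(7)] a b in simp)
qed

text \<open>The backward equation for pulled-back sections. Derivatives \<open>D b\<close> exist by
  smoothness in the starting time; their value follows because the corresponding pairing is constant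
  along the integral curve that starts at time si.\<close>

lemma flow_back_pull:
 assumes st: "close s t" and a: "a : Gam" and b: "b : Gam" and si: "si : common s t"
 shows "((%ta. pair y (pull ta t a y) (b y)) hrd - pair y (dorf (e si) (pull si t a) y) (b y)) (at si within common s t)"
proof -
 have sit: "close si t" by(rule common(7)[OF st si])
 note c = closeD[OF sit] and S = common[OF sit]
 let ?p = "%b ta. pair (h ta t y) (a (h ta t y)) (Ps ta t y (b y))"
 have pp: "pair y (pull ta t a y) (b y) = ?p b ta" if "close ta t" "b : Gam" for ta b using pull_pair[OF that(1),of a y "b y"] a that by simp
 have "ALL b:Gam. EX D. (?p b hrd D) (at si within {0..1})"
  using sat_time_derivative[OF fl(7)[OF c(1,2) a] c(1)] unfolding hrd_hvd by blast
 from bchoice[OF this] obtain D where D': "ALL b:Gam. (?p b hrd D b) (at si within {0..1})" by(elim exE)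
 note D = bspec[OF D']
 \<comment> \<open>The vector represented by the numbers \<open>D b\<close>; it combines the
   separate derivatives into one time derivative of the section.\<close>
 define ad where "ad = (SUM i<gn. D (ga' i) *R ga i y)"
 have adF: "ad : F y" unfolding ad_def using ga by auto
 have dS: "((%ta. pair y (pull ta t a y) (b y)) hrd D b) (at si within common si t)" if "b : Gam" for b
  by(rule real_derivative_cong[OF DERIV_subset[OF D[OF that] S(5)] S(2)]) (simp_all add: pp[OF S(7) that])
 have dad: "((%ta. pair y (pull ta t a y) (b y)) hrd pair y ad (b y)) (at si within common si t)" if b: "b : Gam" for b
 proof(rule real_derivative_cong[OF _ S(2)])
  show "((%ta. SUM i<gn. pair y (pull ta t a y) (ga' i y) * pair y (ga i y) (b y)) hrd (SUM i<gn. D (ga' i) * pair y (ga i y) (b y))) (at si within common si t)"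
   by(intro DERIV_sum DERIV_cmult_right dS ga) simp
  show "pair y (pull ta t a y) (b y) = (SUM i<gn. pair y (pull ta t a y) (ga' i y) * pair y (ga i y) (b y))" if "ta : common si t" for ta
   using pair_expand[of "pull ta t a y" y "b y"] pull_F[OF S(7)[OF that],of a y] a b ga pair_sym[of "pull ta t a y" y] by(auto intro!: sum.cong)
  show "(SUM i<gn. D (ga' i) * pair y (ga i y) (b y)) = pair y ad (b y)" unfolding ad_def using ga b by(subst pair_sum) auto
 qed
 have "((%ta. pair (h si ta y) (pull ta t a (h si ta y)) (Ps si ta y (b y))) hrd
   pair (h si si y) ad (Ps si si y (b y)) + pair (h si si y) (dorf (e si) (pull si t a) (h si si y)) (Ps si si y (b y))) (at si within common si t)"
  by(rule icurve_family_pair[OF curve_common[OF sit sectionsD[OF b]] S(2) S(8)[OF S(2)] pull_section[OF S(7) a]])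
   (use c(1) adF dad pull_sfam[OF sit a S(2)] in simp_all)
 hence "((%ta. ?p b si) hrd pair y ad (b y) + pair y (dorf (e si) (pull si t a) y) (b y)) (at si within common si t)"
 proof(rule real_derivative_cong[OF _ S(2)])
  fix ta assume ta: "ta : common si t"
  show "?p b si = pair (h si ta y) (pull ta t a (h si ta y)) (Ps si ta y (b y))"
   using pull_pair[OF S(7)[OF ta],of a "h si ta y" "Ps si ta y (b y)"] Psi_F[OF S(6)[OF ta]] flow_cocycle[OF S(6)[OF ta] sit S(7)[OF ta]] a b by simp
 qed (use c(1) b fl(2) in simp)
 from real_derivative_unique[OF S(8)[OF S(2)] this DERIV_const]
 have Db: "D b = - pair y (dorf (e si) (pull si t a) y) (b y)"
  using real_derivative_unique[OF S(8)[OF S(2)] dS[OF b] dad[OF b]] by simp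
 show ?thesis
  by(rule real_derivative_cong[OF DERIV_subset[OF D[OF b] common(5)[OF st]] si pp[OF common(7)[OF st] b] Db])
qed

text \<open>Let u be f after the flow from si to t. The pairing of \<open>Dd u\<close> with the
  transported v is constant in si: the backward equation contributes minus \<open>Dd\<close> of
  \<open>rho (e si) u\<close>, the motion along the curve contributes
  \<open>dorf (e si) (Dd u)\<close>, and these cancel by \<open>dorf_Dd_right\<close>. The claim
  compares si = s with si = t.\<close>

lemma flow_anchor:
 assumes st: "close s t" and v: "v : F x" and f: "sfun f"
 shows "an (h s t x) (Ps s t x v) f = an x v (%y. f (h s t y))"
proof -
 note c = closeD[OF st] and S = common[OF st]
 define u where "u ta = (%y. f (h ta t y))" for ta
 have su: "sfun (u ta)" if "ta : common s t" for ta unfolding u_def by(rule h_smooth[OF S(7)[OF that] f])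
 have "pair (h s s x) (Dd (u s) (h s s x)) (Ps s s x v) = pair (h s t x) (Dd (u t) (h s t x)) (Ps s t x v)"
 proof(rule icurve_const_on[OF S(1-3)])
  fix si assume si: "si : common s t"
  note I = curve_common[OF st v]
  define y where "y = h s si x"
  have esi: "e si : Gam" using S(5) si by auto
  have r: "sfun (rho (e si) (u si))" by(rule rho_smooth[OF esi su[OF si]])
  have mr: "sfun (%z. - rho (e si) (u si) z)" using sfun_cmult[OF r,of "-1"] by simp
  have ssi: "sat (common s t) u si y"
   unfolding u_def using sat_mono[OF fl(5)[OF _ _ f] S(5)] closeD[OF S(7)[OF si]] by blast
  have "((%ta. pair (h s ta x) (Dd (u ta) (h s ta x)) (Ps s ta x v)) hrd
    pair y (- Dd (rho (e si) (u si)) y) (Ps s si x v) + pair y (dorf (e si) (Dd (u si)) y) (Ps s si x v)) (at si within common s t)"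
   unfolding y_def
  proof(rule icurve_family_pair[OF I si S(8)[OF si] Dd_section[OF su]],unfold y_def[symmetric])
   show "sfam (common s t) (%ta. Dd (u ta)) si y"
    unfolding sfam_def
   proof
    fix b assume b: "b : Gam"
    have "sat (common s t) (%ta z. 1/2 * an z (b z) (u ta)) si y"
     by(intro sat_mult sat_const sat_tangent[where X = "%z. an z (b z)"] ssi su anchor_tangent)
      (use b rho_smooth[OF b] in "simp_all add: rho_def")
    thus "sat (common s t) (%ta z. pair z (Dd (u ta) z) (b z)) si y"
     by(rule sat_cong'[OF _ open_UNIV UNIV_I]) (simp add: Dd_spec(2)[OF su] b)
   qed
   show "- Dd (rho (e si) (u si)) y : F y" using r by simp
   fix b assume b: "b : Gam"
   have "((%ta. an y (b y) (u ta)) hvd an y (b y) (%z. - rho (e si) (u si) z)) (at si within common s t)"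
    by(rule tangent_time_derivative[OF anchor_tangent[OF sectionsD[OF b]] su ssi si S(8)[OF si] _ mr])
     (use DERIV_subset[OF flow_back_function[OF S(7)[OF si] f] S(5)] in "simp_all add: u_def hrd_hvd[symmetric]")
   hence "((%ta. 1/2 * an y (b y) (u ta)) hrd 1/2 * an y (b y) (%z. - rho (e si) (u si) z)) (at si within common s t)"
    unfolding hrd_hvd[symmetric] by(rule DERIV_cmult)
   thus "((%ta. pair y (Dd (u ta) y) (b y)) hrd pair y (- Dd (rho (e si) (u si)) y) (b y)) (at si within common s t)"
    by(rule real_derivative_cong[OF _ si])
     (use rho_lin(5)[OF b r r,of y,unfolded rho_F[of b]] b r in "simp_all add: Dd_spec(2)[OF su] Dd_spec(2)[OF r]")
  qed
  thus "((%ta. pair (h s ta x) (Dd (u ta) (h s ta x)) (Ps s ta x v)) hrd 0) (at si within common s t)"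
   using Psi_F[OF S(6)[OF si] v] r by(simp add: dorf_Dd_right[OF esi su[OF si]] y_def)
 qed
 thus ?thesis
  using Dd_pair(1)[OF su[OF S(2)] v] Dd_pair(1)[OF f Psi_F[OF st v]] c fl(2)[OF c(1) v] by(simp add: u_def)
qed

text \<open>The argument of \<open>flow_anchor\<close> for the bracket of two pulled-back sections;
  the terms now cancel by the Leibniz identity \<open>dorf_jacobi\<close>.\<close>

lemma pull_dorf:
 assumes st: "close s t" and G: "a : Gam" "b : Gam"
 shows "dorf (pull s t a) (pull s t b) x = pull s t (dorf a b) x"
proof -
 note c = closeD[OF st] and S = common[OF st]
 note P = pull_section[OF S(7) G(1)] pull_section[OF S(7) G(2)]
 have PF: "dorf (pull s t a) (pull s t b) x : F x" "pull s t (dorf a b) x : F x" using P[OF S(2)] pull_F[OF st] G by auto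
 show ?thesis
 proof(rule pair_eqI[OF PF])
  fix v assume v: "v : F x"
  have "pair (h s s x) (dorf (pull s t a) (pull s t b) (h s s x)) (Ps s s x v) =
   pair (h s t x) (dorf (pull t t a) (pull t t b) (h s t x)) (Ps s t x v)"
  proof(rule icurve_const_on[OF S(1-3)])
   fix si assume si: "si : common s t"
   define A where "A = pull si t a"
   define B where "B = pull si t b"
   define y where "y = h s si x"
   have esi: "e si : Gam" using S(5) si by auto
   have AB: "A : Gam" "B : Gam" using P[OF si] by(simp_all add: A_def B_def)
   note sf = pull_sfam[OF st G(1) si] pull_sfam[OF st G(2) si]
   have "((%ta. pair (h s ta x) (dorf (pull ta t a) (pull ta t b) (h s ta x)) (Ps s ta x v)) hrd
     pair y (- dorf (e si) (dorf A B) y) (Ps s si x v) + pair y (dorf (e si) (dorf A B) y) (Ps s si x v)) (at si within common s t)"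
    unfolding y_def A_def B_def
   proof(rule icurve_family_pair[OF curve_common[OF st v] si S(8)[OF si] dorf_section[OF P]],unfold y_def[symmetric] A_def[symmetric] B_def[symmetric])
    show "sfam (common s t) (%ta. dorf (pull ta t a) (pull ta t b)) si y"
     unfolding sfam_def by(intro ballI dorf_smooth_at P sf)
    show "- dorf (e si) (dorf A B) y : F y" using esi AB by simp
    fix z assume z: "z : Gam"
    let ?d = "%a y. - dorf (e si) a y"
    have d: "?d A : Gam" "?d B : Gam" using esi AB by(auto intro: sec_minus)
    have "((%ta. pair y (dorf (pull ta t a) (pull ta t b) y) (z y)) hrd
     pair y (dorf (?d A) (pull si t b) y) (z y) + pair y (dorf (pull si t a) (?d B) y) (z y)) (at si within common s t)"
     by(rule dorf_time_derivative[OF si S(8)[OF si] P sf d z])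
      (use flow_back_pull[OF st G(1) _ si] flow_back_pull[OF st G(2) _ si] esi AB in "simp_all add: A_def[symmetric] B_def[symmetric]")
    thus "((%ta. pair y (dorf (pull ta t a) (pull ta t b) y) (z y)) hrd pair y (?d (dorf A B) y) (z y)) (at si within common s t)"
     unfolding A_def[symmetric] B_def[symmetric] dorf_jacobi[OF esi AB] using esi AB z
      dorf_lin_left(3)[OF AB(2) dorf_section[OF esi AB(1)] AB(1)] dorf_lin_right(3)[OF AB(1) dorf_section[OF esi AB(2)] AB(2)] by simp
   qed
   thus "((%ta. pair (h s ta x) (dorf (pull ta t a) (pull ta t b) (h s ta x)) (Ps s ta x v)) hrd 0) (at si within common s t)"
    using Psi_F[OF S(6)[OF si] v] esi AB by(simp add: y_def)
  qed
  thus "pair x (dorf (pull s t a) (pull s t b) x) v = pair x (pull s t (dorf a b) x) v"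
   using pull_pair[OF st _ v,of "dorf a b"] G c fl(2)[OF c(1) v] by(simp add: pull_self)
 qed
qed

lemma pull_Dd:
 assumes st: "close s t" and f: "sfun f"
 shows "pull s t (Dd f) x = Dd (%y. f (h s t y)) x"
proof(rule Dd_eqI[symmetric])
 show "sfun (%y. f (h s t y))" by(rule h_smooth[OF st f])
 show "pull s t (Dd f) x : F x" using st f by(simp add: pull_F)
 fix v assume v: "v : F x"
 show "2 * pair x (pull s t (Dd f) x) v = an x v (%y. f (h s t y))"
  using pull_pair[OF st,of "Dd f" x v] Dd_pair(1)[OF f Psi_F[OF st v]] flow_anchor[OF st v f] f v by simp
qed

text \<open>The Courant bracket is the Dorfman bracket minus \<open>Dd\<close> of the pairing, and
  both parts are compatible with the pullback.\<close>

lemma pull_bracket: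
 assumes st: "close s t" and G: "a : Gam" "b : Gam"
 shows "br (pull s t a) (pull s t b) x = pull s t (br a b) x"
proof -
 define p where "p = (%y. pair y (a y) (b y))"
 have p: "sfun p" unfolding p_def by(rule pair_smooth[OF G])
 have "br a b = (%y. (-1) *R Dd p y + dorf a b y)" by(auto simp: dorf_def p_def)
 hence "pull s t (br a b) x = pull s t (dorf a b) x - pull s t (Dd p) x"
  using Psi_linear[OF closeD(5)[OF st],of "Dd p (h s t x)" "h s t x" "dorf a b (h s t x)" "-1"] G p by(simp add: pull_def)
 also have "... = dorf (pull s t a) (pull s t b) x - Dd (%y. pair y (pull s t a y) (pull s t b y)) x"
  using pull_pair[OF st,of a _ "pull s t b _"] pull_F[OF st,of b] Psi_pull[OF st,of b] G
  unfolding pull_Dd[OF st p] pull_dorf[OF st G] by(simp add: p_def)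
 also have "... = br (pull s t a) (pull s t b) x" by(simp add: dorf_def)
 finally show ?thesis by simp
qed

lemma flow_courant_automorphism:
 assumes st: "close s t" shows "courant_automorphism C (h s t) (Ps s t)"
 unfolding courant_automorphism_def
proof(intro conjI allI ballI impI)
 show "bundle_automorphism C (h s t) (Ps s t)" by(rule flow_bundle_automorphism[OF st])
 show "br (pushforward (h s t) (Ps s t) a) (pushforward (h s t) (Ps s t) b) x = pushforward (h s t) (Ps s t) (br a b) x"
  if "a : Gam" "b : Gam" for a b x
  unfolding pushforward_eq[OF st] by(rule pull_bracket[OF closeD(5)[OF st] that])
qed (use Psi_pair[OF st] flow_anchor[OF st] in "auto simp: o_def")

end

section \<open>Transport of the complex structures\<close>

context section_flow
begin

lemma sfam_mono: "sfam T s t x ==> T' <= T ==> sfam T' s t x"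
 unfolding sfam_def using sat_mono by blast

text \<open>What the transport has to know of J. The last clause says weakly that the time
  derivative of J is minus its Lie derivative along e.\<close>

definition parallel :: "(real => 'm => 'v => 'v) => bool" where
 "parallel J <-> (ALL t:{0..1}. (ALL x. ALL v:F x. J t x v : F x) &
   (ALL x. ALL v:F x. ALL w:F x. pair x (J t x v) w = - pair x v (J t x w)) &
   (ALL a:Gam. (%x. J t x (a x)) : Gam & (ALL x. sfam {0..1} (%ta y. J ta y (a y)) t x)) &
   (ALL a:Gam. ALL b:Gam. ALL x. ((%ta. pair x (J ta x (a x)) (b x)) hvd
    pair x (a x) (dorf (e t) (%y. J t y (b y)) x) + pair x (J t x (a x)) (dorf (e t) b x)) (at t within {0..1})))"

text \<open>By skewness J moves to the test section, where \<open>icurve_family_pair\<close>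
  differentiates it; the evolution of J turns the outcome into the equation of an integral curve for
  J w.\<close>

lemma parallel_icurve:
 assumes J: "parallel J" and I: "icurve S gm w" and lim: "!!t. t : S ==> t islimpt S"
 shows "icurve S gm (%t. J t (gm t) (w t))"
 unfolding icurve_def
proof(intro conjI ballI allI impI)
 note I' = icurveD[OF I]
 show "S <= {0..1}" "con S gm" by(rule I')+
 fix t assume t: "t : S"
 have t01: "ta : {0..1}" if "ta : S" for ta using I'(1) that by blast
 note tt = t01[OF t]
 have JF: "J ta x v : F x" if "ta : {0..1}" "v : F x" for ta x v using J that unfolding parallel_def by blast
 have Jskew: "pair x (J ta x v) w = - pair x v (J ta x w)" if "ta : {0..1}" "v : F x" "w : F x" for ta x v w
  using J that unfolding parallel_def by blast
 have Jsec: "(%x. J ta x (a x)) : Gam" if "ta : {0..1}" "a : Gam" for ta a using J that unfolding parallel_def by blast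
 have Jsf: "sfam {0..1} (%ta y. J ta y (a y)) ta x" if "ta : {0..1}" "a : Gam" for ta a x using J that unfolding parallel_def by blast
 show "J t (gm t) (w t) : F (gm t)" by(rule JF[OF tt I'(3)[OF t]])
 show "((%ta. f (gm ta)) hrd rho (e t) f (gm t)) (at t within S)" if "sfun f" for f
  by(rule I'(4)[OF t that])
 fix a assume a: "a : Gam"
 define x where "x = gm t"
 have et: "e t : Gam" using tt by simp
 have wt: "w t : F x" using I'(3)[OF t] by(simp add: x_def)
 have ea: "dorf (e t) a : Gam" using et a by simp
 \<comment> \<open>The time derivative of J a at t as a vector, minus the Lie derivative of J along
   e applied to a.\<close>
 define ad where "ad = J t x (dorf (e t) a x) - dorf (e t) (%y. J t y (a y)) x"
 have F: "J t x (dorf (e t) a x) : F x" "dorf (e t) (%y. J t y (a y)) x : F x"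
  using JF[OF tt sectionsD[OF ea]] dorf_section[OF et Jsec[OF tt a]] by auto
 have adF: "ad : F (gm t)" unfolding ad_def x_def[symmetric] using F by simp
 have "((%ta. pair (gm ta) (J ta (gm ta) (a (gm ta))) (w ta)) hrd
   pair (gm t) ad (w t) + pair (gm t) (dorf (e t) (%y. J t y (a y)) (gm t)) (w t)) (at t within S)"
 proof(rule icurve_family_pair[OF I t lim[OF t] Jsec[OF t01 a] sfam_mono[OF Jsf[OF tt a] I'(1)] adF])
  fix b assume b: "b : Gam"
  have Jb: "(%y. J t y (b y)) : Gam" and Ja: "(%y. J t y (a y)) : Gam" using Jsec tt a b by auto
  have m: "rho (e t) (%y. pair y (a y) (J t y (b y))) x = - rho (e t) (%y. pair y (J t y (a y)) (b y)) x"
  proof -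
   have "(%y. pair y (a y) (J t y (b y))) = (%y. - pair y (J t y (a y)) (b y))"
    using Jskew[OF tt] a b by auto
   thus ?thesis using rho_lin(5)[OF et pair_smooth[OF Ja b] pair_smooth[OF Ja b]] by simp
  qed
  have "pair x ad (b x) = pair x (a x) (dorf (e t) (%y. J t y (b y)) x) + pair x (J t x (a x)) (dorf (e t) b x)"
   using dorf_metric[OF et a Jb,of x] dorf_metric[OF et Ja b,of x] m
    Jskew[OF tt sectionsD[OF ea,of x] sectionsD[OF b,of x]] F b by(simp add: ad_def)
  moreover have "((%ta. pair x (J ta x (a x)) (b x)) hvd
    pair x (a x) (dorf (e t) (%y. J t y (b y)) x) + pair x (J t x (a x)) (dorf (e t) b x)) (at t within {0..1})"
   using J tt a b unfolding parallel_def by blast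
  ultimately show "((%ta. pair (gm t) (J ta (gm t) (a (gm t))) (b (gm t))) hrd pair (gm t) ad (b (gm t))) (at t within S)"
   unfolding x_def[symmetric] hrd_hvd
   by(intro has_vector_derivative_within_subset[OF _ I'(1)]) simp
 qed
 from DERIV_minus[OF this]
 show "((%ta. pair (gm ta) (a (gm ta)) (J ta (gm ta) (w ta))) hrd
   pair (gm t) (dorf (e t) a (gm t)) (J t (gm t) (w t))) (at t within S)"
 proof(rule real_derivative_cong[OF _ t])
  show "pair (gm ta) (a (gm ta)) (J ta (gm ta) (w ta)) = - pair (gm ta) (J ta (gm ta) (a (gm ta))) (w ta)" if "ta : S" for ta
   using Jskew[OF t01[OF that] sectionsD[OF a] I'(3)[OF that]] by simp
  have "- (pair x ad (w t) + pair x (dorf (e t) (%y. J t y (a y)) x) (w t)) = - pair x (J t x (dorf (e t) a x)) (w t)"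
   using F wt by(simp add: ad_def)
  thus "- (pair (gm t) ad (w t) + pair (gm t) (dorf (e t) (%y. J t y (a y)) (gm t)) (w t)) =
    pair (gm t) (dorf (e t) a (gm t)) (J t (gm t) (w t))"
   using Jskew[OF tt sectionsD[OF ea] wt] by(simp add: x_def)
 qed
qed

end

section \<open>Composition of short flows\<close>

context global_flow
begin

text \<open>Both sides are integral curves over the same base curve with the same value at time
  s.\<close>

lemma flow_parallel:
 assumes J: "parallel J" and st: "close s t" and v: "v : F x"
 shows "J t (h s t x) (Ps s t x v) = Ps s t x (J s x v)"
proof -
 note c = closeD[OF st]
 have Jv: "J s x v : F x" using J c(1) v unfolding parallel_def by blast
 show ?thesis
  using icurve_unique_fibre[OF near_interval c(4,2) parallel_icurve[OF J fl_curve[OF c(1) v] near_islimpt[OF c(1) delta]],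
    of "%v t. Ps s t x v"] fl(1,2)[OF c(1)] fl_curve[OF c(1)] v Jv by simp
qed

text \<open>Smoothness of k and its inverse is also recorded through pulled-back functions; in this
  form it passes to compositions, and \<open>smooth_mapI\<close> returns it to charts.\<close>

definition carries :: "(real => 'm => 'v => 'v) => real => real => bool" where
 "carries J s t <-> (EX k Ph. courant_automorphism C k Ph &
   (ALL f :: 'm => real. sfun f --> sfun (%x. f (k x)) & sfun (%x. f (inv k x))) &
   (ALL x. ALL v:F x. J t (k x) (Ph x v) = Ph x (J s x v)))"

lemma carries_close: "parallel J ==> close s t ==> carries J s t"
 unfolding carries_def
 by(intro exI[of _ "h s t"] exI[of _ "Ps s t"])
  (auto simp: flow_courant_automorphism h_smooth h_bij(2) closeD(5) flow_parallel)

lemma carries_trans: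
 assumes J: "parallel J" and st: "carries J s t" and tr: "carries J t r" and s: "s : {0..1}"
 shows "carries J s r"
proof -
 obtain k Ph where k: "courant_automorphism C k Ph"
  "!!f :: 'm => real. sfun f ==> sfun (%x. f (k x))" "!!f :: 'm => real. sfun f ==> sfun (%x. f (inv k x))"
  "!!x v. v : F x ==> J t (k x) (Ph x v) = Ph x (J s x v)"
  using st unfolding carries_def by blast
 obtain l Th where l: "courant_automorphism C l Th"
  "!!f :: 'm => real. sfun f ==> sfun (%x. f (l x))" "!!f :: 'm => real. sfun f ==> sfun (%x. f (inv l x))"
  "!!x v. v : F x ==> J r (l x) (Th x v) = Th x (J t x v)"
  using tr unfolding carries_def by blast
 have ka: "bij k" "!!x. bij_betw (Ph x) (F x) (F (k x))"
  "!!x v w r. v : F x ==> w : F x ==> Ph x (r *R v + w) = r *R Ph x v + Ph x w"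
  "!!a. (!!x. a x : F x) ==> a : Gam <-> pushforward k Ph a : Gam"
  "!!x u v. u : F x ==> v : F x ==> pair (k x) (Ph x u) (Ph x v) = pair x u v"
  "!!a b x. a : Gam ==> b : Gam ==> br (pushforward k Ph a) (pushforward k Ph b) x = pushforward k Ph (br a b) x"
  "!!x v f. v : F x ==> sfun f ==> an (k x) (Ph x v) f = an x v (f o k)"
  using k(1) unfolding courant_automorphism_def bundle_automorphism_def diffeomorphism_def by blast+
 have la: "bij l" "!!x. bij_betw (Th x) (F x) (F (l x))"
  "!!x v w r. v : F x ==> w : F x ==> Th x (r *R v + w) = r *R Th x v + Th x w"
  "!!a. (!!x. a x : F x) ==> a : Gam <-> pushforward l Th a : Gam"
  "!!x u v. u : F x ==> v : F x ==> pair (l x) (Th x u) (Th x v) = pair x u v"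
  "!!a b x. a : Gam ==> b : Gam ==> br (pushforward l Th a) (pushforward l Th b) x = pushforward l Th (br a b) x"
  "!!x v f. v : F x ==> sfun f ==> an (l x) (Th x v) f = an x v (f o l)"
  using l(1) unfolding courant_automorphism_def bundle_automorphism_def diffeomorphism_def by blast+
 have PhF: "Ph x v : F (k x)" if "v : F x" for x v using ka(2)[of x] that unfolding bij_betw_def by blast
 have ThF: "Th x v : F (l x)" if "v : F x" for x v using la(2)[of x] that unfolding bij_betw_def by blast
 define m where "m = l o k"
 define Om where "Om x v = Th (k x) (Ph x v)" for x v
 have im: "inv m y = inv k (inv l y)" for y unfolding m_def using o_inv_distrib[OF la(1) ka(1)] by simp
 have kk: "k (inv k y) = y" for y using ka(1) by(simp add: bij_is_surj surj_f_inv_f)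
 have push: "pushforward m Om a = pushforward l Th (pushforward k Ph a)" for a
  unfolding pushforward_def Om_def im kk ..
 have pF: "pushforward k Ph a x : F x" if "!!x. a x : F x" for a x
  unfolding pushforward_def using PhF[OF that,of "inv k x"] kk by simp
 have "courant_automorphism C m Om"
  unfolding courant_automorphism_def bundle_automorphism_def diffeomorphism_def
 proof(intro conjI allI ballI impI)
  show "bij m" unfolding m_def using ka(1) la(1) by(rule bij_comp)
  show "smooth_map C m" using k(2)[OF l(2)] by(intro smooth_mapI) (simp add: m_def)
  show "smooth_map C (inv m)" using l(3)[OF k(3)] by(intro smooth_mapI) (simp add: im)
  show "bij_betw (Om x) (F x) (F (m x))" for x
   using bij_betw_trans[OF ka(2)[of x] la(2)[of "k x"]] by(simp add: m_def Om_def[abs_def] o_def)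
  show "Om x (q *R v + w) = q *R Om x v + Om x w" if "v : F x" "w : F x" for x v w q
   unfolding Om_def ka(3)[OF that] by(rule la(3)) (use PhF that in auto)
  show "(a : Gam) = (pushforward m Om a : Gam)" if "ALL x. a x : F x" for a
   unfolding push using ka(4)[of a] la(4)[of "pushforward k Ph a"] pF[of a] that by auto
  show "pair (m x) (Om x u) (Om x v) = pair x u v" if "u : F x" "v : F x" for x u v
   unfolding m_def Om_def o_def using la(5) ka(5) PhF that by simp
  show "br (pushforward m Om a) (pushforward m Om b) x = pushforward m Om (br a b) x" if "a : Gam" "b : Gam" for a b x
  proof -
   have "pushforward k Ph a : Gam" "pushforward k Ph b : Gam" using ka(4)[of a] ka(4)[of b] that by simp_all
   moreover have "br (pushforward k Ph a) (pushforward k Ph b) = pushforward k Ph (br a b)"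
    using ka(6)[OF that] by(rule ext)
   ultimately show ?thesis unfolding push using la(6) by simp
  qed
  show "an (m x) (Om x v) f = an x v (f o m)" if v: "v : F x" and f: "sfun f" for x v f
  proof -
   have "sfun (f o l)" using l(2)[OF f] by(simp add: o_def)
   thus ?thesis unfolding m_def Om_def using la(7)[OF PhF[OF v] f] ka(7)[OF v] by(simp add: o_assoc)
  qed
 qed
 moreover have "sfun (%x. f (m x)) & sfun (%x. f (inv m x))" if "sfun f" for f :: "'m => real"
  using k(2)[OF l(2)[OF that]] l(3)[OF k(3)[OF that]] unfolding im by(simp add: m_def)
 moreover have "J r (m x) (Om x v) = Om x (J s x v)" if "v : F x" for x v
  unfolding m_def Om_def o_def using l(4)[OF PhF[OF that]] k(4)[OF that] by simp
 ultimately show ?thesis unfolding carries_def by blast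
qed

lemma carries_01:
 assumes J: "parallel J" shows "carries J 0 1"
proof -
 \<comment> \<open>n steps of length 1/n, each shorter than the flow time.\<close>
 obtain n :: nat where n: "n > 0" "inverse (real n) < dl" using ex_inverse_of_nat_less[OF delta] by auto
 have cl: "close (real k / real n) (real (Suc k) / real n)" if "Suc k <= n" for k
 proof -
  have "real (Suc k) / real n - real k / real n = inverse (real n)" by(simp add: diff_divide_distrib[symmetric] inverse_eq_divide)
  moreover have "real (Suc k) / real n <= 1" "real k / real n <= 1" using that n(1) by(simp_all add: field_simps)
  ultimately show ?thesis using n by(simp add: close_def near_def)
 qed
 have "carries J 0 (real k / real n)" if "k <= n" for k
  using that
 proof(induction k)
  case 0
  have "close 0 0" using delta by(simp add: close_def near_def)
  thus ?case using carries_close[OF J] by simp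
 next
  case (Suc k)
  show ?case by(rule carries_trans[OF J Suc.IH carries_close[OF J cl]]) (use Suc.prems in auto)
 qed
 from this[OF order_refl] show ?thesis using n(1) by simp
qed

end

context hamiltonian_family
begin

lemma J_isomorphic: "isomorphic_gcs C (J 0) (J 1)"
proof -
 interpret section_flow C gn ga ga' ee
  by unfold_locales (simp_all add: ee_section ee_sfam)
 obtain dl h Ps where "dl > 0" "local_flow UNIV {0..1} dl h Ps"
  using global_flow_exists by blast
 then interpret global_flow C gn ga ga' ee dl h Ps
  by unfold_locales (auto simp del: split_paired_All)
 have "parallel J"
  unfolding parallel_def by(intro ballI conjI allI J(3) J(7) J_section J_sfam J_derivative)
 hence "carries J 0 1" by(rule carries_01)
 then obtain k Ph where k: "courant_automorphism C k Ph" "!!x v. v : F x ==> J 1 (k x) (Ph x v) = Ph x (J 0 x v)"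
  unfolding carries_def by blast
 have "bij_betw (Ph x) (F x) (F (k x))" for x
  using k(1) unfolding courant_automorphism_def bundle_automorphism_def by blast
 hence "inv_into (F x) (Ph x) (J 1 (k x) (Ph x v)) = J 0 x v" if "v : F x" for x v
  unfolding k(2)[OF that] using J(3)[of 0 v x] that by(intro inv_into_f_f) (auto simp: bij_betw_def)
 thus ?thesis unfolding isomorphic_gcs_def using k(1) by blast
qed

end

theorem theorem6p4:
  fixes C :: "('m::{t2_space,second_countable_topology}, 'e::{real_inner,banach,heine_borel},
                'v::real_vector, 'f::{real_inner,banach,heine_borel}) courant"
    and L :: "'m \<Rightarrow> ('v \<times> 'v) set"
    and H Y :: "real \<Rightarrow> ('m, 'v) lform"
  assumes "courant_algebroid C"
    and "compact (UNIV :: 'm set)"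
    and "conjugate_decomposition C L"
    and "smooth_form_family C L 2 H"
    and "\<forall>t\<in>{0..1}. hamiltonian_operator C L (H t)"
    and "\<forall>t\<in>{0..1}. \<forall>x. bij_betw (\<lambda>v. Hbar_map C L (H t) x (H_map C L (H t) x v) - v) (L x) (L x)"
    and "smooth_form_family C L 1 Y"
    and "\<forall>t\<in>{0..1}. \<forall>ss x. length ss = 2 \<and> set ss \<subseteq> csections C L \<longrightarrow>
           ((\<lambda>\<tau>. eval_form (H \<tau>) ss x) has_vector_derivative
              d_L C (Y t) ss x + eval_form (schouten C L 2 1 (H t) (Y t)) ss x) (at t within {0..1})"
  shows "(\<exists>J. associated_gcs C L (H 0) J) \<and>
         (\<exists>J. associated_gcs C L (H 1) J) \<and>
         (\<forall>J\<^sub>0 J\<^sub>1. associated_gcs C L (H 0) J\<^sub>0 \<and> associated_gcs C L (H 1) J\<^sub>1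
                   \<longrightarrow> isomorphic_gcs C J\<^sub>0 J\<^sub>1)"
proof -
 interpret courant C by unfold_locales (rule assms(1))
 obtain n :: nat and a a' where a: "ALL i<n. a i : sections C & a' i : sections C"
  "ALL x. ALL v:F x. (SUM i<n. pair x (a' i x) v *R a i x) = v"
  using global_frame_exists[OF assms(2)] by blast
 interpret hamiltonian_family C n a a' L H Y
  by unfold_locales (use assms a in blast)+
 have "isomorphic_gcs C J\<^sub>0 J\<^sub>1" if J0: "associated_gcs C L (H 0) J\<^sub>0" and J1: "associated_gcs C L (H 1) J\<^sub>1" for J\<^sub>0 J\<^sub>1
 proof -
  obtain k Ph where k: "courant_automorphism C k Ph"
   "ALL x. ALL v:F x. inv_into (F x) (Ph x) (J 1 (k x) (Ph x v)) = J 0 x v"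
   using J_isomorphic unfolding isomorphic_gcs_def by(elim exE conjE)
  have b: "bij_betw (Ph x) (F x) (F (k x))" for x
   using k(1) unfolding courant_automorphism_def bundle_automorphism_def by blast
  \<comment> \<open>An associated structure is determined on the fibres only, so the replacement by
    \<open>J 0\<close> and \<open>J 1\<close> is made at vectors of the fibres.\<close>
  have "inv_into (F x) (Ph x) (J\<^sub>1 (k x) (Ph x v)) = J\<^sub>0 x v" if v: "v : F x" for x v
  proof -
   have "Ph x v : F (k x)" using b[of x] v unfolding bij_betw_def by blast
   hence "J\<^sub>1 (k x) (Ph x v) = J 1 (k x) (Ph x v)" using associated_J[OF _ J1] by simp
   moreover have "J\<^sub>0 x v = J 0 x v" using associated_J[OF _ J0 v] by simp
   ultimately show ?thesis using k(2) v by simp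
  qed
  thus ?thesis unfolding isomorphic_gcs_def using k(1) by blast
 qed
 moreover have "associated_gcs C L (H 0) (J 0)" "associated_gcs C L (H 1) (J 1)"
  using J_associated[of 0] J_associated[of 1] by simp_all
 ultimately show ?thesis by blast
qed

end
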